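(* There exists a family $(G_d)_{d\in D}$ of finitely generated, recursively presented, torsion-free, 3-step solvable, conjugacy separable groups such that: (i) for each $d\in D$ there is an integer $\delta$ with $\mathrm{Rf}_{G_d}\prec \exp(n^\delta)$; (ii) for each $d\in D$, $\mathrm{Cl}_{G_d}$ is at most polynomial (bounded above by a polynomial function); (iii) for each $d\in D$, the conjugacy problem in $G_d$ is solvable in polynomial time; (iv) for every computable function $\Phi:\mathbb N\to\mathbb N$ there exists $d\in D$ such that $\mathrm{Conj}_{G_d}\succ\Phi$.
   Context: For a group $G$ with finite generating set $S$, $\|g\|_S$ is the word norm: the least $k$ such that $g$ is a product of $k$ elements of $S\cup S^{-1}$. A group is residually finite if every non-trivial element has non-trivial image in some finite quotient, and conjugacy separable if any two non-conjugate elements have non-conjugate images in some finite quotient. Write $g_1\sim g_2$ for conjugacy. For $n\ge 1$ define $$\mathrm{Rf}_{G,S}(n)=\max_{g\in G\setminus\{1\},\ \|g\|_S\le n}\ \min\{|Q| : \varphi:G\to Q \text{ a homomorphism to a finite group},\ \varphi(g)\ne 1\}$$ (for $G$ residually finite), $$\mathrm{Conj}_{G,S}(n)=\max_{\|g_1\|_S,\|g_2\|_S\le n,\ g_1\not\sim g_2}\ \min\{|Q| : \varphi:G\twoheadrightarrow Q \text{ a finite quotient},\ \varphi(g_1)\not\sim\varphi(g_2)\}$$ (for $G$ conjugacy separable), and $$\mathrm{Cl}_{G,S}(n)=\max_{\|g_1\|_S,\|g_2\|_S\le n,\ g_1\sim g_2}\ \min\{\|h\|_S : h\in G,\ hg_1h^{-1}=g_2\}.$$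 A maximum over an empty set is $0$. For functions $f,g$ on the positive integers with non-negative real values, $f\prec g$ (equivalently $g\succ f$) means there is an integer $C\ge1$ with $f(n)\le C\,g(Cn)$ for all $n\ge 1$; $f\simeq g$ means $f\prec g$ and $g\prec f$. Up to $\simeq$ the three functions do not depend on $S$, so $S$ is dropped from the notation. Polynomial-time solvability of the conjugacy problem means: there is an algorithm that, given two words in a fixed finite generating set and inverses, decides in time polynomial in the total length whether they represent conjugate elements. Recursively presented means having a presentation with finitely many (or a computable set of) generators and a recursively enumerable set of relators. 3-step solvable means solvable of derived length 3. *)

theory Defs
  imports
    "HOL-Computational_Algebra.Polynomial"
    "HOL-Algebra.Generated_Groups"
begin

section \<open>Turing machines\<close>

text \<open>
  Deterministic multi-tape machines. Tape symbols and states are natural numbers, and 0 is the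
  blank symbol. A tape is a function on the integers which is kept centred at the head: the
  scanned cell is always cell 0, and a head movement shifts the tape.
\<close>

type_synonym tape = "int \<Rightarrow> nat"

datatype move = Move_Left | Stay | Move_Right

primrec shift_tape :: "move \<Rightarrow> tape \<Rightarrow> tape" where
  "shift_tape Move_Left t = (\<lambda>i. t (i - 1))"
| "shift_tape Stay t = t"
| "shift_tape Move_Right t = (\<lambda>i. t (i + 1))"

text \<open>
  A rule \<open>(q, [(a\<^sub>0, b\<^sub>0, m\<^sub>0), \<dots>, (a\<^sub>k, b\<^sub>k, m\<^sub>k)], q')\<close> applies in state \<open>q\<close> when head \<open>i\<close> scans
  \<open>a\<^sub>i\<close> for every \<open>i \<le> k\<close>; it writes \<open>b\<^sub>i\<close>, moves head \<open>i\<close> by \<open>m\<^sub>i\<close> and passes to state \<open>q'\<close>.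
  The program is a finite list of rules, so that only finitely many states and symbols are used.
  The first applicable rule is executed, and the machine halts when there is none.
  A machine has one tape for input and output and \<open>work_tapes\<close> further tapes.
\<close>

type_synonym rule = "nat \<times> (nat \<times> nat \<times> move) list \<times> nat"

datatype tm = TM (work_tapes: nat) (rules: "rule list")

type_synonym config = "nat \<times> tape list"

definition applicable :: "config \<Rightarrow> rule \<Rightarrow> bool" where
  "applicable c r \<longleftrightarrow> fst r = fst c \<and> map fst (fst (snd r)) = map (\<lambda>t. t 0) (snd c)"

definition tm_step :: "tm \<Rightarrow> config \<Rightarrow> config option" where
  "tm_step M c =
     (case find (applicable c) (rules M) of
        None \<Rightarrow> None
      | Some (_, acts, q) \<Rightarrow>
          Some (q, map2 (\<lambda>(_, b, m) t. shift_tape m (t(0 := b))) acts (snd c)))"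

definition word_tape :: "nat list \<Rightarrow> tape" where
  "word_tape w = (\<lambda>i. if 0 \<le> i \<and> i < int (length w) then w ! nat i else 0)"

text \<open>The initial state is 0.\<close>

definition init_config :: "tm \<Rightarrow> nat list \<Rightarrow> config" where
  "init_config M w = (0, word_tape w # replicate (work_tapes M) (word_tape []))"

definition halts_in :: "tm \<Rightarrow> nat list \<Rightarrow> nat \<Rightarrow> config \<Rightarrow> bool" where
  "halts_in M w t c \<longleftrightarrow>
     (init_config M w, c) \<in> {(c1, c2). tm_step M c1 = Some c2} ^^ t \<and> tm_step M c = None"

text \<open>A machine accepts its input by halting in state 1.\<close>

definition accepting :: "config \<Rightarrow> bool" where
  "accepting c \<longleftrightarrow> fst c = 1"

text \<open>Arguments and values of numerical functions are written in unary, with the symbol 1.\<close>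

definition computable :: "(nat \<Rightarrow> nat) \<Rightarrow> bool" where
  "computable \<Phi> \<longleftrightarrow>
     (\<exists>M. \<forall>n. \<exists>t c. halts_in M (replicate n 1) t c \<and>
                    hd (snd c) = word_tape (replicate (\<Phi> n) 1))"


section \<open>Words and group presentations\<close>

text \<open>The letter \<open>(i, True)\<close> is the \<open>i\<close>-th generator and \<open>(i, False)\<close> is its formal inverse.\<close>

type_synonym word = "(nat \<times> bool) list"

definition words :: "nat \<Rightarrow> word set" where
  "words k = lists ({..<k} \<times> UNIV)"

text \<open>
  On tapes, the symbols from 2 onwards encode letters; 0 is the blank and 1 will serve as a
  separator.
\<close>

definition encode :: "word \<Rightarrow> nat list" where
  "encode = map (\<lambda>(i, b). 2 + 2 * i + of_bool b)"

definition recursively_enumerable :: "nat \<Rightarrow> word set \<Rightarrow> bool" where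
  "recursively_enumerable k R \<longleftrightarrow>
     R \<subseteq> words k \<and> (\<exists>M. \<forall>w\<in>words k. w \<in> R \<longleftrightarrow> (\<exists>t c. halts_in M (encode w) t c))"

text \<open>Equality of two words in the group with generators \<open>0, \<dots>, k - 1\<close> and relators \<open>R\<close>.\<close>

inductive_set pres_eq :: "nat \<Rightarrow> word set \<Rightarrow> (word \<times> word) set"
  for k :: nat and R :: "word set" where
  refl: "u \<in> words k \<Longrightarrow> (u, u) \<in> pres_eq k R"
| sym: "(u, v) \<in> pres_eq k R \<Longrightarrow> (v, u) \<in> pres_eq k R"
| trans: "(u, v) \<in> pres_eq k R \<Longrightarrow> (v, w) \<in> pres_eq k R \<Longrightarrow> (u, w) \<in> pres_eq k R"
| cancel: "u \<in> words k \<Longrightarrow> v \<in> words k \<Longrightarrow> i < k \<Longrightarrow>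
    (u @ [(i, b), (i, \<not> b)] @ v, u @ v) \<in> pres_eq k R"
| relator: "u \<in> words k \<Longrightarrow> v \<in> words k \<Longrightarrow> r \<in> R \<Longrightarrow> r \<in> words k \<Longrightarrow>
    (u @ r @ v, u @ v) \<in> pres_eq k R"

definition presented_group :: "nat \<Rightarrow> word set \<Rightarrow> word set monoid" where
  "presented_group k R =
     \<lparr> carrier = words k // pres_eq k R,
       monoid.mult = (\<lambda>A B. \<Union>u\<in>A. \<Union>v\<in>B. pres_eq k R `` {u @ v}),
       one = pres_eq k R `` {[]} \<rparr>"

definition recursively_presented :: "('a, 'b) monoid_scheme \<Rightarrow> bool" where
  "recursively_presented G \<longleftrightarrow>
     (\<exists>k R. recursively_enumerable k R \<and> G \<cong> presented_group k R)"


section \<open>Group-theoretic notions\<close>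

definition finite_gen_set :: "('a, 'b) monoid_scheme \<Rightarrow> 'a set \<Rightarrow> bool" where
  "finite_gen_set G S \<longleftrightarrow> finite S \<and> S \<subseteq> carrier G \<and> generate G S = carrier G"

definition finitely_generated :: "('a, 'b) monoid_scheme \<Rightarrow> bool" where
  "finitely_generated G \<longleftrightarrow> (\<exists>S. finite_gen_set G S)"

definition torsion_free :: "('a, 'b) monoid_scheme \<Rightarrow> bool" where
  "torsion_free G \<longleftrightarrow>
     (\<forall>g\<in>carrier G. \<forall>n::nat. g \<noteq> \<one>\<^bsub>G\<^esub> \<and> n > 0 \<longrightarrow> g [^]\<^bsub>G\<^esub> n \<noteq> \<one>\<^bsub>G\<^esub>)"

definition has_derived_length :: "('a, 'b) monoid_scheme \<Rightarrow> nat \<Rightarrow> bool" where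
  "has_derived_length G l \<longleftrightarrow>
     (derived G ^^ l) (carrier G) = {\<one>\<^bsub>G\<^esub>} \<and>
     (\<forall>j<l. (derived G ^^ j) (carrier G) \<noteq> {\<one>\<^bsub>G\<^esub>})"

definition conjugate :: "('a, 'b) monoid_scheme \<Rightarrow> 'a \<Rightarrow> 'a \<Rightarrow> bool" where
  "conjugate G g1 g2 \<longleftrightarrow> (\<exists>h\<in>carrier G. h \<otimes>\<^bsub>G\<^esub> g1 \<otimes>\<^bsub>G\<^esub> inv\<^bsub>G\<^esub> h = g2)"

definition word_norm :: "('a, 'b) monoid_scheme \<Rightarrow> 'a set \<Rightarrow> 'a \<Rightarrow> nat" where
  "word_norm G S g =
     (LEAST k. \<exists>xs. length xs = k \<and> set xs \<subseteq> S \<union> (m_inv G ` S) \<and>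
                    foldr (\<otimes>\<^bsub>G\<^esub>) xs \<one>\<^bsub>G\<^esub> = g)"

text \<open>
  Finite quotients are represented by groups with carrier in \<^typ>\<open>nat\<close>: every finite
  group is isomorphic to one of these.
\<close>

definition conjugacy_separable :: "('a, 'b) monoid_scheme \<Rightarrow> bool" where
  "conjugacy_separable G \<longleftrightarrow>
     (\<forall>g1\<in>carrier G. \<forall>g2\<in>carrier G. \<not> conjugate G g1 g2 \<longrightarrow>
        (\<exists>(Q :: nat monoid) \<phi>. group Q \<and> finite (carrier Q) \<and> \<phi> \<in> epi G Q \<and>
                               \<not> conjugate Q (\<phi> g1) (\<phi> g2)))"


section \<open>The functions Rf, Conj and Cl\<close>

text \<open>
  On \<^typ>\<open>nat\<close>, \<open>Inf\<close> of a nonempty set is its minimum, \<open>Sup\<close> of a nonempty finite set is its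
  maximum, and \<open>Sup {} = 0\<close>. The suprema below range over finite sets when \<open>S\<close> is a finite
  generating set. The inner set in \<open>Rf\<close> (in \<open>Conj\<close>) is nonempty when \<open>G\<close> is residually
  finite (conjugacy separable); conjugacy separable groups are residually finite.
\<close>

definition Rf :: "('a, 'b) monoid_scheme \<Rightarrow> 'a set \<Rightarrow> nat \<Rightarrow> nat" where
  "Rf G S n =
     (SUP g\<in>{g \<in> carrier G. g \<noteq> \<one>\<^bsub>G\<^esub> \<and> word_norm G S g \<le> n}.
        Inf {order Q | (Q :: nat monoid) \<phi>.
               group Q \<and> finite (carrier Q) \<and> \<phi> \<in> hom G Q \<and> \<phi> g \<noteq> \<one>\<^bsub>Q\<^esub>})"

definition Conj :: "('a, 'b) monoid_scheme \<Rightarrow> 'a set \<Rightarrow> nat \<Rightarrow> nat" where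
  "Conj G S n =
     (SUP (g1, g2)\<in>{(g1, g2). g1 \<in> carrier G \<and> g2 \<in> carrier G \<and>
                       word_norm G S g1 \<le> n \<and> word_norm G S g2 \<le> n \<and> \<not> conjugate G g1 g2}.
        Inf {order Q | (Q :: nat monoid) \<phi>.
               group Q \<and> finite (carrier Q) \<and> \<phi> \<in> epi G Q \<and> \<not> conjugate Q (\<phi> g1) (\<phi> g2)})"

definition Cl :: "('a, 'b) monoid_scheme \<Rightarrow> 'a set \<Rightarrow> nat \<Rightarrow> nat" where
  "Cl G S n =
     (SUP (g1, g2)\<in>{(g1, g2). g1 \<in> carrier G \<and> g2 \<in> carrier G \<and>
                       word_norm G S g1 \<le> n \<and> word_norm G S g2 \<le> n \<and> conjugate G g1 g2}.
        Inf {word_norm G S h | h. h \<in> carrier G \<and> h \<otimes>\<^bsub>G\<^esub> g1 \<otimes>\<^bsub>G\<^esub> inv\<^bsub>G\<^esub> h = g2})"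

text \<open>The comparison concerns functions on the positive integers; values at 0 are ignored.\<close>

definition dominated :: "(nat \<Rightarrow> real) \<Rightarrow> (nat \<Rightarrow> real) \<Rightarrow> bool" (infix \<open>\<prec>\<close> 50) where
  "f \<prec> g \<longleftrightarrow> (\<exists>C::nat. C \<ge> 1 \<and> (\<forall>n\<ge>1. f n \<le> real C * g (C * n)))"

definition polynomially_bounded :: "(nat \<Rightarrow> real) \<Rightarrow> bool" where
  "polynomially_bounded f \<longleftrightarrow> (\<exists>p::real poly. \<forall>n\<ge>1. f n \<le> poly p (real n))"


section \<open>The conjugacy problem\<close>

definition eval_word :: "('a, 'b) monoid_scheme \<Rightarrow> 'a list \<Rightarrow> word \<Rightarrow> 'a" where
  "eval_word G gs w =
     foldr (\<lambda>(i, b) x. (if b then gs ! i else inv\<^bsub>G\<^esub> (gs ! i)) \<otimes>\<^bsub>G\<^esub> x) w \<one>\<^bsub>G\<^esub>"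

definition poly_time_conjugacy_wrt :: "('a, 'b) monoid_scheme \<Rightarrow> 'a list \<Rightarrow> bool" where
  "poly_time_conjugacy_wrt G gs \<longleftrightarrow>
     (\<exists>M (p :: nat poly). \<forall>u\<in>words (length gs). \<forall>v\<in>words (length gs).
        \<exists>t c. halts_in M (encode u @ [1] @ encode v) t c \<and>
              t \<le> poly p (length u + length v) \<and>
              (accepting c \<longleftrightarrow> conjugate G (eval_word G gs u) (eval_word G gs v)))"

text \<open>
  Whether this holds does not depend on the generating tuple, so all of them are admitted; the
  notion is only meaningful for finitely generated groups.
\<close>

definition poly_time_conjugacy :: "('a, 'b) monoid_scheme \<Rightarrow> bool" where
  "poly_time_conjugacy G \<longleftrightarrow>
     (\<forall>gs. finite_gen_set G (set gs) \<longrightarrow> poly_time_conjugacy_wrt G gs)"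

end

theory Submission
  imports Defs "HOL-Library.Countable" "HOL-Library.Nat_Bijection" "HOL-Number_Theory.Cong"
    "HOL-Algebra.Multiplicative_Group"
begin

text \<open>
  The groups. Start from the free class-two nilpotent group on generators \<open>a_i\<close>, \<open>c_i\<close> with \<open>i\<close> an
  integer, impose \<open>[c_i, c_j] = ([a_i, c_j] [a_j, c_i]\<inverse>) ^ D (i - j)\<close> where \<open>D k = D (- k)\<close> is
  a power of 2, and let \<open>t\<close> shift all indices by 1. The result is generated by \<open>t\<close>, \<open>a_0\<close>
  and \<open>c_0\<close> and is an extension of a torsion-free class-two group by the integers. Here \<open>D k = 2 ^ X r\<close>, where \<open>r\<close> is the least number
  whose factorial does not divide \<open>k\<close>; so \<open>D\<close> is periodic modulo \<open>R!\<close> away from the multiples of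
  \<open>R!\<close>, and the same definition with indices modulo \<open>R!\<close> and values modulo \<open>l\<close> gives finite
  quotients. Elements are handled through integer coordinates: the exponent of \<open>t\<close>, the exponents
  of the \<open>a_i\<close> and \<open>c_i\<close>, and the central coordinates. The group is words modulo equality of
  coordinates.

  Large quotients (\<open>Conj_ge\<close>). Let \<open>k = (r - 1)!\<close>, so that \<open>D k = 2 ^ X r\<close>. At the pair \<open>(0, k)\<close>
  conjugation changes \<open>c_0\<^sup>2\<close> by even powers of \<open>[c_0, c_k]\<close> only, so \<open>c_0\<^sup>2\<close> and \<open>c_0\<^sup>2 [c_0, c_k]\<close> are not conjugate.
  But \<open>[c_0, c_k]\<close> is a power with exponent \<open>2 ^ X r\<close>, hence of odd order in each quotient with fewer
  than \<open>2 ^ X r\<close> elements, and there it is an even power of itself: the images are conjugate. The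
  words have length \<open>O((r - 1)!)\<close>, so suitable exponents force the function Conj above any
  prescribed function. For a machine that halts on all unary inputs, \<open>X r\<close> is a time that
  suffices on all inputs shorter than \<open>r!\<close>; its output is not longer than its input and its
  running time together.

  Everything else is insensitive to \<open>D\<close>, because \<open>D\<close> enters each equation linearly. An equation
  \<open>a + D q = 0\<close> with \<open>|a| < 2 ^ c\<close> has the same solutions when \<open>D\<close> is replaced by
  \<open>min D (2 ^ c)\<close>; for large \<open>D\<close> it says that \<open>a = q = 0\<close>. Therefore conjugacy of two words of
  length \<open>L\<close> is a condition on integers that are polynomial in \<open>L\<close> (\<open>conj_crit\<close>), with the
  following two cases. For exponent 0 of \<open>t\<close>, a conjugator solves \<open>x = 2 (u \<and> v)\<close> for the vector
  \<open>v\<close> of the given elements; one value of \<open>u\<close> determines the others, and it can be reduced modulo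
  \<open>v\<close>. For exponent \<open>k \<noteq> 0\<close>, a conjugator is found by summing differences along orbits of the shift
  by \<open>k\<close>, and the obstruction consists of finitely many orbit sums. Both cases produce conjugators
  of polynomial length (\<open>Cl_polynomial\<close>), and both obstructions persist in a finite quotient
  (\<open>separate_words\<close>), since subgroups of finitely generated free
  abelian groups are closed in the profinite topology
  and orbit sums are preserved by folding indices modulo \<open>R!\<close>. A non-trivial coordinate of a word of
  length \<open>n\<close> is \<open>a + D q\<close> with \<open>a\<close> and \<open>q\<close> quadratic in \<open>n\<close>; it is non-zero modulo some
  \<open>l \<le> exp(O(n\<^sup>2))\<close>, and with \<open>R!\<close> at most quadratic in \<open>n\<close> this gives the bound \<open>exp(n\<^sup>6)\<close> for Rf
  (\<open>Rf_exponential\<close>).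

  Complexity (\<open>machine_group_poly_time\<close>). To decide the criterion it suffices to know
  \<open>min (2 ^ X r) (2 ^ c)\<close> with \<open>c\<close> logarithmic in \<open>L\<close>, which takes only \<open>c\<close> steps of a simulation
  of the given machine. Since all numbers are polynomial in \<open>L\<close>, they may be kept in unary: a class
  of functions computed by programs with counters in polynomial time is closed under recursion with
  polynomially bounded values, contains the criterion, and its programs run on Turing machines. The
  word problem is the case of conjugacy to the empty word, so the words that represent 1 are a
  recursively enumerable set of relators.
\<close>

section \<open>Groups of words modulo a congruence\<close>

definition invw :: "word => word" where
 "invw w = rev (map (%(i, b). (i, ~ b)) w)"

lemma invw_simps [simp]: "invw [] = []" "invw (u @ w) = invw w @ invw u"
  "invw (x # w) = invw w @ [(fst x, ~ snd x)]" "invw (invw w) = w" "length (invw w) = length w"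
 by (auto simp: invw_def rev_map case_prod_beta comp_def split_def)

text \<open>A canonical natural number for each class, so that the group and its quotients have carriers in \<^typ>\<open>nat\<close>.\<close>

definition class_code :: "(word => word => bool) => word => nat" where
 "class_code E w = (LEAST n. EX u. E w u & to_nat u = n)"

definition word_group :: "(word => word => bool) => nat monoid" where
 "word_group E = \<lparr>carrier = range (class_code E),
  monoid.mult = (%x y. class_code E (from_nat x @ from_nat y)), one = class_code E []\<rparr>"

locale word_congruence =
 fixes E :: "word => word => bool"
 assumes equiv: "equivp E"
  and append: "E u u' ==> E w w' ==> E (u @ w) (u' @ w')"
  and inverse: "E (w @ invw w) []"
begin

abbreviation "\<kappa> \<equiv> class_code E"
abbreviation "G \<equiv> word_group E"

lemma refl [simp]: "E w w" and sym: "E u w ==> E w u" and trans: "E u v ==> E v w ==> E u w"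
 using equiv by (auto elim: equivpE dest: reflpD sympD transpD)

lemma code_eq_iff: "\<kappa> u = \<kappa> w \<longleftrightarrow> E u w"
proof
 assume "E u w"
 hence "E u = E w" using equiv by (simp add: equivp_def)
 thus "\<kappa> u = \<kappa> w" by (simp add: class_code_def)
next
 have "EX v. E u v & to_nat v = \<kappa> u" for u
  unfolding class_code_def by (rule LeastI_ex) (auto intro: exI[of _ u])
 then obtain v v' where "E u v" "to_nat v = \<kappa> u" "E w v'" "to_nat v' = \<kappa> w" by meson
 moreover assume "\<kappa> u = \<kappa> w"
 ultimately show "E u w" by (metis injD inj_to_nat sym trans)
qed

lemma from_code: "E w (from_nat (\<kappa> w))"
proof -
 have "EX v. E w v & to_nat v = \<kappa> w"
  unfolding class_code_def by (rule LeastI_ex) (auto intro: exI[of _ w])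
 thus ?thesis by (metis from_nat_to_nat)
qed

lemma mult_code [simp]: "\<kappa> u \<otimes>\<^bsub>G\<^esub> \<kappa> w = \<kappa> (u @ w)"
 by (simp add: word_group_def code_eq_iff) (meson append from_code sym)

lemma one_code: "\<one>\<^bsub>G\<^esub> = \<kappa> []" by (simp add: word_group_def)

lemma carrier_code: "carrier G = range \<kappa>" by (simp add: word_group_def)

lemma code_carrier [simp]: "\<kappa> w : carrier G" by (simp add: carrier_code)

lemma group: "group G"
proof (rule groupI)
 fix x assume "x : carrier G"
 then obtain w where x: "x = \<kappa> w" by (auto simp: carrier_code)
 show "EX y:carrier G. y \<otimes>\<^bsub>G\<^esub> x = \<one>\<^bsub>G\<^esub>"
  using inverse[of "invw w"] by (intro bexI[of _ "\<kappa> (invw w)"]) (auto simp: x one_code code_eq_iff)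
qed (auto simp: carrier_code one_code)

lemma inv_code [simp]: "inv\<^bsub>G\<^esub> \<kappa> w = \<kappa> (invw w)"
proof -
 interpret group G by (rule group)
 show ?thesis
  by (rule inv_equality) (use inverse[of "invw w"] in \<open>auto simp: one_code code_eq_iff\<close>)
qed

lemma conjugate_code: "conjugate G (\<kappa> u) (\<kappa> w) \<longleftrightarrow> (EX h. E (h @ u) (w @ h))"
proof -
 interpret group G by (rule group)
 have "E (h @ u @ invw h) w \<longleftrightarrow> E (h @ u) (w @ h)" for h
 proof -
  have "\<kappa> h \<otimes>\<^bsub>G\<^esub> \<kappa> u \<otimes>\<^bsub>G\<^esub> inv\<^bsub>G\<^esub> \<kappa> h = \<kappa> w \<longleftrightarrow> \<kappa> h \<otimes>\<^bsub>G\<^esub> \<kappa> u = \<kappa> w \<otimes>\<^bsub>G\<^esub> \<kappa> h"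
   by (metis code_carrier inv_solve_right m_closed)
  thus ?thesis by (simp add: code_eq_iff)
 qed
 thus ?thesis by (auto simp: conjugate_def carrier_code code_eq_iff)
qed

lemma pow_code: "\<kappa> w [^]\<^bsub>G\<^esub> (n::nat) = \<kappa> (concat (replicate n w))"
proof (induction n)
 case 0
 thus ?case by (simp add: one_code nat_pow_def)
next
 case (Suc n)
 interpret group G by (rule group)
 have "concat (replicate n w) @ w = w @ concat (replicate n w)" by (induction n) auto
 with Suc show ?case by (simp)
qed

lemma order_le:
 assumes "!!u w. f u = f w ==> E u w" "range f <= X" "finite X"
 shows "finite (carrier G) & order G <= card X"
proof -
 have "carrier G <= (%x. \<kappa> (SOME w. f w = x)) ` X"
 proof
  fix y assume "y : carrier G"
  then obtain w where y: "y = \<kappa> w" by (auto simp: carrier_code)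
  have "f (SOME w'. f w' = f w) = f w" by (rule someI) simp
  hence "y = \<kappa> (SOME w'. f w' = f w)" using assms(1) y by (metis code_eq_iff)
  thus "y : (%x. \<kappa> (SOME w. f w = x)) ` X" using assms(2) by auto
 qed
 thus ?thesis unfolding order_def
  by (meson assms(3) card_image_le card_mono finite_imageI le_trans finite_subset)
qed

end

lemma word_group_epi:
 assumes "word_congruence E" "word_congruence F" "!!u w. E u w ==> F u w"
 obtains \<phi> where "\<phi> : epi (word_group E) (word_group F)"
  "!!w. \<phi> (class_code E w) = class_code F w"
proof -
 interpret E: word_congruence E by fact
 interpret F: word_congruence F by fact
 define \<phi> where "\<phi> x = class_code F (from_nat x)" for x
 have \<phi>: "\<phi> (class_code E w) = class_code F w" for w
  unfolding \<phi>_def F.code_eq_iff using E.from_code assms(3) F.sym by blast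
 have "\<phi> : epi (word_group E) (word_group F)"
  unfolding epi_def hom_def using \<phi> by (auto simp: E.carrier_code F.carrier_code) (metis \<phi> image_eqI rangeI)
 with \<phi> that show thesis by blast
qed

section \<open>Coordinates of words\<close>

definition sgb :: "bool => int" where "sgb b = (if b then 1 else - 1)"

definition dt :: "nat \<times> bool => int" where "dt x = (if fst x = 0 then sgb (snd x) else 0)"

text \<open>The exponent sum of the generator 0, which is \<open>t\<close>.\<close>

definition ht :: "word => int" where "ht w = sum_list (map dt w)"

text \<open>A letter \<open>a\<close> or \<open>c\<close> at position \<open>p\<close>, read after a prefix of \<open>t\<close>-exponent \<open>i\<close>, contributes to the conjugate
\<open>a_i\<close> or \<open>c_i\<close> (\<open>c_i\<close> for the Boolean True). Indices are taken modulo \<open>m\<close>; \<open>m = 0\<close> is the infinite group.\<close>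

definition ut :: "int => word => bool => int => nat => int" where
 "ut m w c i p = (if fst (w ! p) = (if c then 2 else 1) & m dvd i - ht (take p w)
  then sgb (snd (w ! p)) else 0)"

definition cv :: "int => word => bool => int => int" where
 "cv m w c i = (\<Sum>p<length w. ut m w c i p)"

text \<open>The class-two part of the word, antisymmetrised: a pair of occurrences counts 1 or -1 according to its order, up to the signs of the letters. On \<open>[x, y]\<close> this gives 2; the
normalisation avoids choosing an order of the generators.\<close>

definition cP :: "int => word => bool => bool => int => int => int" where
 "cP m w c c' i j = (\<Sum>p'<length w. \<Sum>p<p'. ut m w c i p * ut m w c' j p' - ut m w c' j p * ut m w c i p')"

lemma ht_simps [simp]: "ht [] = 0" "ht (u @ w) = ht u + ht w" "ht (x # w) = dt x + ht w"
 by (simp_all add: ht_def)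

lemma sum_lessThan_add: "(\<Sum>p<a + b. f p) = (\<Sum>p<a. f p) + (\<Sum>p<b. f (a + p))" for f :: "nat => int"
 by (induction b) (auto simp: add.assoc)

lemma ut_append:
 "p < length u ==> ut m (u @ w) c i p = ut m u c i p"
 "ut m (u @ w) c i (length u + p) = ut m w c (i - ht u) p"
 by (auto simp: ut_def nth_append diff_diff_eq)

lemma cv_Nil [simp]: "cv m [] c i = 0" and cP_Nil [simp]: "cP m [] c c' i j = 0"
 by (simp_all add: cv_def cP_def)

lemma cv_append [simp]: "cv m (u @ w) c i = cv m u c i + cv m w c (i - ht u)"
 by (simp add: cv_def sum_lessThan_add ut_append)

text \<open>Collecting a product in a class-two group: the two central parts add up, corrected by the commutator form of the two vectors of exponents, the second one shifted by the height of the first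
word.\<close>

lemma cP_append: "cP m (u @ w) c c' i j = cP m u c c' i j + cP m w c c' (i - ht u) (j - ht u)
  + cv m u c i * cv m w c' (j - ht u) - cv m u c' j * cv m w c (i - ht u)"
proof -
 let ?a = "ut m u c" and ?a' = "ut m u c'" and ?b = "ut m w c" and ?b' = "ut m w c'"
 have 1: "(\<Sum>p'<length w. \<Sum>p<length u. ?a i p * ?b' (j - ht u) p' - ?a' j p * ?b (i - ht u) p') =
   cv m u c i * cv m w c' (j - ht u) - cv m u c' j * cv m w c (i - ht u)"
  by (simp add: cv_def sum_subtractf sum_product sum.swap[of _ "{..<length w}" "{..<length u}"])
 show ?thesis
  by (simp add: cP_def sum_lessThan_add ut_append sum.distrib 1)
qed

lemma cP_antisym: "cP m w c c' i j = - cP m w c' c j i"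
 by (simp add: cP_def sum_negf[symmetric] algebra_simps)

lemma cv_mod: "m dvd i - i' ==> cv m w c i = cv m w c i'"
 and cP_mod: "m dvd i - i' ==> m dvd j - j' ==> cP m w c c' i j = cP m w c c' i' j'"
proof -
 have *: "ut m w c i p = ut m w c i' p" if "m dvd i - i'" for i i' c p
 proof -
  have "m dvd i - x \<longleftrightarrow> m dvd i' - x" for x
   using dvd_add_right_iff[OF that, of "i' - x"] by simp
  thus ?thesis by (simp add: ut_def)
 qed
 show "m dvd i - i' ==> cv m w c i = cv m w c i'" by (auto simp: cv_def intro!: sum.cong *)
 show "m dvd i - i' ==> m dvd j - j' ==> cP m w c c' i j = cP m w c c' i' j'"
  by (auto simp: cP_def * cong: sum.cong)
qed

subsection \<open>Sizes\<close>

lemma abs_dt: "\<bar>dt x\<bar> <= 1" by (simp add: dt_def sgb_def)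

lemma ht_le: "\<bar>ht w\<bar> <= int (length w)"
proof (induction w)
 case (Cons x w) thus ?case using abs_dt[of x] by (simp add: abs_if split: if_splits)
qed simp

lemma ht_take_le: "p <= length w ==> \<bar>ht (take p w)\<bar> <= int p"
 using ht_le[of "take p w"] by simp

lemma abs_ut: "\<bar>ut m w c i p\<bar> <= 1" by (simp add: ut_def sgb_def)

lemma ut_supp: "p < length w ==> \<bar>i\<bar> >= int (length w) ==> ut 0 w c i p = 0"
 using ht_take_le[of p w] by (auto simp: ut_def)

lemma cv_supp: "\<bar>i\<bar> >= int (length w) ==> cv 0 w c i = 0"
 by (simp add: cv_def ut_supp)

lemma cP_supp: "\<bar>i\<bar> >= int (length w) \<or> \<bar>j\<bar> >= int (length w) ==> cP 0 w c c' i j = 0"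
 by (auto simp: cP_def ut_supp intro!: sum.neutral)

lemma abs_sum_le: "(!!p. p : A ==> \<bar>f p\<bar> <= (b::int)) ==> \<bar>sum f A\<bar> <= int (card A) * b"
 using order_trans[OF sum_abs sum_bounded_above[of A "%p. \<bar>f p\<bar>" b]] by simp

lemma abs_cv: "\<bar>cv m w c i\<bar> <= int (length w)"
 unfolding cv_def using abs_sum_le[of "{..<length w}" "ut m w c i" 1] abs_ut by simp

lemma abs_cP: "\<bar>cP m w c c' i j\<bar> <= 2 * int (length w) ^ 2"
proof -
 have 1: "\<bar>ut m w c i p * ut m w c' j p' - ut m w c' j p * ut m w c i p'\<bar> <= 2" for p p'
 proof -
  have "\<bar>x * y\<bar> <= 1" if "\<bar>x\<bar> <= 1" "\<bar>y\<bar> <= 1" for x y :: int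
   using that by (simp add: abs_mult mult_le_one)
  from this[OF abs_ut abs_ut, of m w c i p m w c' j p'] this[OF abs_ut abs_ut, of m w c' j p m w c i p']
  show ?thesis by linarith
 qed
 have "\<bar>\<Sum>p<p'. ut m w c i p * ut m w c' j p' - ut m w c' j p * ut m w c i p'\<bar> <= int (length w) * 2"
  if "p' < length w" for p'
 proof -
  have "\<bar>\<Sum>p<p'. ut m w c i p * ut m w c' j p' - ut m w c' j p * ut m w c i p'\<bar> <= int (card {..<p'}) * 2"
   by (rule abs_sum_le) (rule 1)
  thus ?thesis using that by simp
 qed
 hence "\<bar>cP m w c c' i j\<bar> <= int (card {..<length w}) * (int (length w) * 2)"
  unfolding cP_def by (intro abs_sum_le) auto
 thus ?thesis by (simp add: power2_eq_square)
qed

subsection \<open>Parity\<close>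

text \<open>Modulo 2 both numbers count the pairs formed by an occurrence of the first letter and one of the second. Hence elements with equal exponents differ by even central coordinates.\<close>

lemma cP_parity:
 assumes "(c, i) ~= (c', j)"
 shows "even (cP 0 w c c' i j - cv 0 w c i * cv 0 w c' j)"
proof (induction w rule: rev_induct)
 case (snoc x w)
 have "cv 0 [x] c (i - ht w) * cv 0 [x] c' (j - ht w) = 0"
  using assms by (auto simp: cv_def ut_def)
 moreover have "cP 0 [x] c c' (i - ht w) (j - ht w) = 0" by (simp add: cP_def)
 ultimately have "cP 0 (w @ [x]) c c' i j - cv 0 (w @ [x]) c i * cv 0 (w @ [x]) c' j =
  (cP 0 w c c' i j - cv 0 w c i * cv 0 w c' j) - 2 * (cv 0 w c' j * cv 0 [x] c (i - ht w))"
  by (simp add: cP_append algebra_simps)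
 thus ?case using snoc by simp
qed simp

subsection \<open>Folding\<close>

text \<open>Reducing indices modulo \<open>m\<close> collects the values in each residue class; a window that contains the support makes the sum finite. The lemmas below transport this to the
coordinates: each coordinate in a quotient is a linear function of the coordinates in the infinite group.\<close>

lemma ut_fold:
 assumes "p < length w" "int (length w) <= N"
 shows "ut m w c i p = (SUM i':{-N..N}. of_bool (m dvd i - i') * ut 0 w c i' p)"
proof -
 have *: "of_bool (m dvd i - i') * ut 0 w c i' p = (if i' = ht (take p w) then ut m w c i p else 0)" for i'
  by (auto simp: ut_def)
 have "ht (take p w) : {-N..N}" using ht_take_le[of p w] assms by auto
 thus ?thesis unfolding * by simp
qed

lemma cv_fold:
 assumes "int (length w) <= N"
 shows "cv m w c i = (SUM i':{-N..N}. of_bool (m dvd i - i') * cv 0 w c i')"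
proof -
 have "cv m w c i = (\<Sum>p<length w. SUM i':{-N..N}. of_bool (m dvd i - i') * ut 0 w c i' p)"
  unfolding cv_def using assms by (intro sum.cong refl ut_fold) auto
 thus ?thesis
  by (subst (asm) sum.swap) (simp add: cv_def sum_distrib_left del: sum_of_bool_mult_eq)
qed

lemma cP_fold:
 assumes "int (length w) <= N"
 shows "cP m w c c' i j =
  (SUM i':{-N..N}. SUM j':{-N..N}. of_bool (m dvd i - i') * of_bool (m dvd j - j') * cP 0 w c c' i' j')"
proof -
 define f where "f = (%p p' i' j'. of_bool (m dvd i - i') * of_bool (m dvd j - j') *
  (ut 0 w c i' p * ut 0 w c' j' p' - ut 0 w c' j' p * ut 0 w c i' p'))"
 have *: "ut m w c i p * ut m w c' j p' - ut m w c' j p * ut m w c i p' =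
  (SUM i':{-N..N}. SUM j':{-N..N}. f p p' i' j')" if "p < length w" "p' < length w" for p p'
 proof -
  have 1: "ut m w c i p * ut m w c' j p' = (SUM i':{-N..N}. SUM j':{-N..N}.
    of_bool (m dvd i - i') * of_bool (m dvd j - j') * (ut 0 w c i' p * ut 0 w c' j' p'))"
   unfolding ut_fold[OF that(1) assms, of m c i] ut_fold[OF that(2) assms, of m c' j]
   by (simp add: sum_product mult_ac del: sum_of_bool_mult_eq sum_mult_of_bool_eq)
  have 2: "ut m w c' j p * ut m w c i p' = (SUM i':{-N..N}. SUM j':{-N..N}.
    of_bool (m dvd i - i') * of_bool (m dvd j - j') * (ut 0 w c' j' p * ut 0 w c i' p'))"
   unfolding ut_fold[OF that(1) assms, of m c' j] ut_fold[OF that(2) assms, of m c i]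
   by (simp add: sum_product mult_ac del: sum_of_bool_mult_eq sum_mult_of_bool_eq)
  show ?thesis unfolding 1 2 f_def by (simp add: sum_subtractf right_diff_distrib)
 qed
 have "cP m w c c' i j = (\<Sum>p'<length w. \<Sum>p<p'. SUM x:{-N..N}\<times>{-N..N}. f p p' (fst x) (snd x))"
  unfolding cP_def
 proof (rule sum.cong[OF HOL.refl], rule sum.cong[OF HOL.refl])
  fix p' p assume "p' : {..<length w}" "p : {..<p'}"
  thus "ut m w c i p * ut m w c' j p' - ut m w c' j p * ut m w c i p' =
   (SUM x:{-N..N}\<times>{-N..N}. f p p' (fst x) (snd x))"
   by (simp add: sum.cartesian_product' *[of p p'])
 qed
 also have "... = (SUM x:{-N..N}\<times>{-N..N}. \<Sum>p'<length w. \<Sum>p<p'. f p p' (fst x) (snd x))"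
  by (simp only: sum.swap[of _ _ "{-N..N}\<times>{-N..N}"])
 also have "... = (SUM i':{-N..N}. SUM j':{-N..N}. \<Sum>p'<length w. \<Sum>p<p'. f p p' i' j')"
  by (simp only: sum.cartesian_product' fst_conv snd_conv)
 finally show ?thesis
  by (simp only: f_def cP_def sum_distrib_left)
qed

section \<open>The twisted groups\<close>

text \<open>The value at 0 is immaterial: twists at equal indices are set to 0 below.\<close>

definition rk :: "int => nat" where "rk k = (LEAST r. ~ fact r dvd k)"

lemma not_fact_dvd: "k ~= 0 ==> \<bar>k\<bar> < int r ==> ~ (fact r :: int) dvd k"
proof
 assume a: "k ~= 0" "\<bar>k\<bar> < int r" "(fact r :: int) dvd k"
 hence "(fact r :: int) <= \<bar>k\<bar>" using dvd_imp_le_int[of k "fact r"] by simp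
 moreover have "int r <= fact r"
  using fact_ge_self[of r] by (metis of_nat_fact of_nat_le_iff)
 ultimately show False using a by linarith
qed

lemma rk_minus: "rk (- k) = rk k" by (simp add: rk_def)

lemma rk_le: "~ fact R dvd k ==> rk k <= R"
 unfolding rk_def by (rule Least_le)

text \<open>Factorials divide each other, so the least one that fails to divide \<open>k\<close> is seen modulo \<open>R!\<close> as soon as \<open>R!\<close> fails to divide \<open>k\<close>. This is
the reason for a definition through factorials: the twisting exponents pass to quotients with indices modulo \<open>R!\<close>.\<close>

lemma rk_period:
 assumes "~ fact R dvd k" "fact R dvd k - k'"
 shows "rk k' = rk k"
proof -
 have *: "(fact r :: int) dvd k' \<longleftrightarrow> fact r dvd k" if "r <= R" for r
 proof -
  have "(fact r :: int) dvd k - k'" using that fact_dvd[of r R] assms(2) dvd_trans by blast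
  thus ?thesis using dvd_add_right_iff[of "fact r" "k - k'" k'] by simp
 qed
 show ?thesis unfolding rk_def[of k']
 proof (rule Least_equality)
  have "~ fact (rk k) dvd k" unfolding rk_def using assms(1) by (rule LeastI)
  thus "~ fact (rk k) dvd k'" using * rk_le[OF assms(1)] by blast
 next
  fix r assume r: "~ (fact r :: int) dvd k'"
  show "rk k <= r"
  proof (cases "r <= R")
   case True thus ?thesis using r * by (auto intro: rk_le)
  next
   case False thus ?thesis using rk_le[OF assms(1)] by simp
  qed
 qed
qed

text \<open>Rank \<open>r\<close> forces \<open>(r - 1)!\<close> to divide the number, so this is the shortest distance at which it occurs. It determines the length of the words in the lower
bound.\<close>

lemma rk_fact: "r >= 2 ==> rk (fact (r - 1)) = r"
 unfolding rk_def
proof (rule Least_equality)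
 assume r: "r >= 2"
 thus "~ (fact r :: int) dvd fact (r - 1)"
  using zdvd_imp_le[of "fact r" "fact (r - 1) :: int"] fact_less_mono[of "r - 1" r, where 'a = int]
  by auto
 show "r <= y" if "~ (fact y :: int) dvd fact (r - 1)" for y
 proof (rule ccontr)
  assume "~ r <= y"
  hence "(fact y :: int) dvd fact (r - 1)" by (intro fact_dvd) simp
  with that show False by simp
 qed
qed

text \<open>The moduli for which the twisting exponents are well defined on index classes.\<close>

definition fold_mod :: "int => bool" where "fold_mod m \<longleftrightarrow> m = 0 \<or> (EX R. m = fact R)"

lemma fold_mod_simps [simp]: "fold_mod 0" "fold_mod (fact R)" by (auto simp: fold_mod_def)

lemma cv_single: "cv m [x] c i = (if fst x = (if c then 2 else 1) & m dvd i then sgb (snd x) else 0)"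
 by (simp add: cv_def ut_def)

lemma cP_single [simp]: "cP m [x] c c' i j = 0" by (simp add: cP_def)

lemma sgb_not: "sgb (~ b) = - sgb b" by (simp add: sgb_def)

lemma word_inverse: "ht (w @ invw w) = 0" "cv m (w @ invw w) c i = 0" "cP m (w @ invw w) c c' i j = 0"
proof -
 have *: "ht (w @ invw w) = 0 & (ALL c i. cv m (w @ invw w) c i = 0) & (ALL c c' i j. cP m (w @ invw w) c c' i j = 0)"
 proof (induction w)
  case (Cons x w)
  define v y where "v = w @ invw w" and "y = [(fst x, ~ snd x)]"
  have eq: "(x # w) @ invw (x # w) = [x] @ v @ y" by (simp add: v_def y_def)
  have y: "cv m y c (i - dt x) = - cv m [x] c i" for c i
   by (auto simp: y_def cv_single dt_def sgb_not)
  have v: "ht v = 0" "cv m v c i = 0" "cP m v c c' i j = 0" for c c' i j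
   using Cons by (auto simp: v_def)
  have 1: "ht ([x] @ v @ y) = 0" using v by (simp add: y_def dt_def sgb_not)
  have "cv m ([x] @ v @ y) c i = 0" for c i unfolding cv_append using v y by simp
  moreover have "cP m ([x] @ v @ y) c c' i j = 0" for c c' i j
   unfolding cP_append cv_append using v y by (simp add: y_def)
  ultimately show ?case using 1 unfolding eq by blast
 qed simp
 thus "ht (w @ invw w) = 0" "cv m (w @ invw w) c i = 0" "cP m (w @ invw w) c c' i j = 0" by blast+
qed

lemma ht_invw [simp]: "ht (invw w) = - ht w"
 using word_inverse(1)[of w] by simp

lemma cv_invw: "cv m (invw w) c i = - cv m w c (i + ht w)"
 using word_inverse(2)[of m w c "i + ht w"] by simp

lemma cP_invw: "ht w = 0 ==> cP m (invw w) c c' i j = - cP m w c c' i j"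
 using word_inverse(3)[of m w c c' i j] by (simp add: cP_append cv_invw)

text \<open>The construction works for arbitrary positive exponents; computability of \<open>X\<close> enters only in the algorithm.\<close>

locale exponents =
 fixes X :: "nat => nat"
 assumes X_pos: "X r >= 1"
begin

definition D :: "int => int" where "D k = 2 ^ X (rk k)"

text \<open>On the diagonal of the index group the commutators vanish, and the relation imposes nothing.\<close>

definition dm :: "int => int => int" where "dm m k = (if m dvd k then 0 else D k)"

text \<open>The commutator form of the twisted group: the coordinate with \<open>b\<close> False belongs to \<open>[a_i, a_j]\<close>, and the one with \<open>b\<close> True to \<open>[a_i,
c_j]\<close>, into which \<open>[c_i, c_j]\<close> has been absorbed with factor \<open>D (i - j)\<close>.\<close>

definition om :: "int => (bool => int => int) => (bool => int => int) => bool => int => int => int" where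
 "om m u v b i j = (if b
  then u False i * v True j - v False i * u True j + dm m (i - j) * (u True i * v True j - v True i * u True j)
  else u False i * v False j - v False i * u False j)"

text \<open>The central coordinates, which follow the same substitution as the form above.\<close>

definition zz :: "int => word => bool => int => int => int" where
 "zz m w b i j = (if b then cP m w False True i j + dm m (i - j) * cP m w True True i j
  else cP m w False False i j)"

text \<open>Equality in the quotient with heights and indices modulo \<open>m\<close> and the other coordinates modulo \<open>l\<close>; for \<open>m = l = 0\<close> this is equality in the group
itself.\<close>

definition eqm :: "int => int => word => word => bool" where
 "eqm m l u w \<longleftrightarrow> [ht u = ht w] (mod m) & (ALL c i. [cv m u c i = cv m w c i] (mod l)) \<and>
  (ALL b i j. [zz m u b i j = zz m w b i j] (mod l))"

lemma D_ge2: "D k >= 2"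
 using power_increasing[OF X_pos, of "2::int" "rk k"] by (simp add: D_def)

lemma D_minus: "D (- k) = D k" by (simp add: D_def rk_minus)


lemma dm_minus: "dm m (- k) = dm m k" by (simp add: dm_def D_minus)

lemma dm_mod: "fold_mod m ==> m dvd k - k' ==> dm m k = dm m k'"
 using dvd_add_right_iff[of m "k - k'" k'] rk_period[of _ k k']
 by (auto simp: dm_def D_def fold_mod_def)

lemma zz_Nil [simp]: "zz m [] b i j = 0" by (simp add: zz_def)

lemma zz_mod: "fold_mod m ==> m dvd i - i' ==> m dvd j - j' ==> zz m w b i j = zz m w b i' j'"
proof -
 assume a: "fold_mod m" "m dvd i - i'" "m dvd j - j'"
 have "m dvd (i - j) - (i' - j')" using dvd_diff[OF a(2,3)] by (simp add: algebra_simps)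
 thus ?thesis using a by (simp add: zz_def dm_mod[of m "i - j" "i' - j'"] cP_mod[of m i i' j j'])
qed

lemma zz_append: "zz m (u @ w) b i j = zz m u b i j + zz m w b (i - ht u) (j - ht u)
  + om m (cv m u) (%c i. cv m w c (i - ht u)) b i j"
 by (simp add: zz_def om_def cP_append algebra_simps)

lemma om_add_left: "om m (%c i. u c i + u' c i) v b i j = om m u v b i j + om m u' v b i j"
 and om_add_right: "om m u (%c i. v c i + v' c i) b i j = om m u v b i j + om m u v' b i j"
 and om_swap: "om m v u b i j = - om m u v b i j"
 and om_self: "om m u u b i j = 0"
 and om_smult: "om m (%c i. a * u c i) v b i j = a * om m u v b i j"
 and om_smult_right: "om m u (%c i. a * v c i) b i j = a * om m u v b i j"
 and om_zero [simp]: "om m (%c i. 0) v b i j = 0" "om m u (%c i. 0) b i j = 0"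
 by (simp_all add: om_def algebra_simps)

lemma om_cong:
 assumes "!!c. [u c i = u' c i] (mod l)" "!!c. [u c j = u' c j] (mod l)"
  "!!c. [v c i = v' c i] (mod l)" "!!c. [v c j = v' c j] (mod l)"
 shows "[om m u v b i j = om m u' v' b i j] (mod l)"
 using assms by (cases b) (auto simp: om_def intro!: cong_add cong_diff cong_mult)

lemma cong_cv_shift: "[s = s'] (mod m) ==> cv m w c (i - s) = cv m w c (i - s')"
 by (rule cv_mod) (auto simp: cong_iff_dvd_diff dvd_diff_commute)

lemma cong_zz_shift: "fold_mod m ==> [s = s'] (mod m) ==> zz m w b (i - s) (j - s) = zz m w b (i - s') (j - s')"
 by (rule zz_mod) (auto simp: cong_iff_dvd_diff dvd_diff_commute)

text \<open>Shifts of indices are compatible with the folded coordinates, because \<open>dm m\<close> depends only on residues. The product formulas then show that equality of coordinates is a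
congruence.\<close>

lemma word_congruence_eqm:
 assumes "fold_mod m"
 shows "word_congruence (eqm m l)"
proof
 show "equivp (eqm m l)"
 proof (rule equivpI)
  show "reflp (eqm m l)" by (simp add: reflp_def eqm_def)
  show "symp (eqm m l)" by (auto simp: symp_def eqm_def cong_sym_eq)
  show "transp (eqm m l)" unfolding transp_def eqm_def by (blast intro: cong_trans)
 qed
 show "eqm m l (w @ invw w) []" for w
  using word_inverse[where w = w] by (simp add: eqm_def zz_def)
next
 fix u u' w w' assume a: "eqm m l u u'" "eqm m l w w'"
 have h: "[ht u = ht u'] (mod m)" using a by (simp add: eqm_def)
 have c: "[cv m w c (i - ht u) = cv m w' c (i - ht u')] (mod l)" for c i
  using a(2) cong_cv_shift[OF h, of w' c i] by (metis eqm_def)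
 have "[zz m w b (i - ht u) (j - ht u) = zz m w' b (i - ht u') (j - ht u')] (mod l)" for b i j
  using a(2) cong_zz_shift[OF assms h, of w' b i j] by (metis eqm_def)
 thus "eqm m l (u @ w) (u' @ w')"
  using a c h unfolding eqm_def zz_append cv_append ht_simps
  by (auto intro!: cong_add om_cong)
qed

abbreviation "E \<equiv> eqm 0 0"

lemma E_iff: "E u w \<longleftrightarrow> ht u = ht w & (ALL c i. cv 0 u c i = cv 0 w c i) & (ALL b i j. zz 0 u b i j = zz 0 w b i j)"
 by (simp add: eqm_def)

sublocale word_congruence E by (rule word_congruence_eqm) simp

text \<open>Off the diagonal, pairs of indices that are folded together have the same twist, because \<open>D\<close> is periodic there. Pairs folded onto the diagonal cancel by antisymmetry.\<close>

lemma zz_fold: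
 assumes "int (length w) <= N" "fold_mod m"
 shows "zz m w b i j =
  (SUM i':{-N..N}. SUM j':{-N..N}. of_bool (m dvd i - i') * of_bool (m dvd j - j') * zz 0 w b i' j')"
proof (cases b)
 case False
 thus ?thesis by (simp add: zz_def cP_fold[OF assms(1), of m])
next
 case True
 define g where "g i' j' = of_bool (m dvd i - i') * of_bool (m dvd j - j') * (dm 0 (i' - j') * cP 0 w True True i' j')" for i' j'
 have "(SUM i':{-N..N}. SUM j':{-N..N}. g i' j') = dm m (i - j) * cP m w True True i j"
 proof (cases "m dvd i - j")
  case True
  have "m dvd j - x \<longleftrightarrow> m dvd i - x" for x
   using dvd_add_right_iff[OF True, of "j - x"] by simp
  hence *: "g j' i' = - g i' j'" for i' j'
   using dm_minus[of 0 "i' - j'"] cP_antisym[of 0 w True True j' i'] by (simp add: g_def)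
  have "(SUM i':{-N..N}. SUM j':{-N..N}. g i' j') = (SUM j':{-N..N}. SUM i':{-N..N}. g i' j')"
   by (rule sum.swap)
  also have "... = - (SUM j':{-N..N}. SUM i':{-N..N}. g j' i')" unfolding sum_negf[symmetric] by (intro sum.cong HOL.refl *)
  finally show ?thesis using True by (simp add: dm_def)
 next
  case False
  have "g i' j' = dm m (i - j) * (of_bool (m dvd i - i') * of_bool (m dvd j - j') * cP 0 w True True i' j')" for i' j'
  proof (cases "m dvd i - i' & m dvd j - j'")
   case True
   hence "m dvd (i - j) - (i' - j')" using dvd_diff[of m "i - i'" "j - j'"] by (simp add: algebra_simps)
   hence "dm m (i - j) = dm m (i' - j')" "~ m dvd i' - j'"
    using dm_mod[OF assms(2)] False dvd_add_right_iff[of m "(i - j) - (i' - j')" "i' - j'"] by auto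
   moreover hence "i' ~= j'" by auto
   ultimately show ?thesis by (auto simp: g_def dm_def)
  qed (auto simp: g_def)
  thus ?thesis by (simp add: sum_distrib_left cP_fold[OF assms(1), of m] del: sum_of_bool_mult_eq sum_mult_of_bool_eq)
 qed
 thus ?thesis
  using True cP_fold[OF assms(1), of m False True i j]
  by (simp only: zz_def if_True distrib_left sum.distrib g_def)
qed

text \<open>Folded coordinates are sums of the exact ones, so equality in the group passes to the quotients.\<close>

lemma E_imp_eqm:
 assumes "E u w" "fold_mod m"
 shows "eqm m l u w"
proof -
 define N where "N = int (max (length u) (length w))"
 have N: "int (length u) <= N" "int (length w) <= N" by (auto simp: N_def)
 have e: "ht u = ht w" "cv 0 u c i = cv 0 w c i" "zz 0 u b i j = zz 0 w b i j" for c b i j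
  using assms(1) by (auto simp: E_iff)
 have "cv m u c i = cv m w c i" for c i
  by (simp only: cv_fold[OF N(1), of m] cv_fold[OF N(2), of m] e)
 moreover have "zz m u b i j = zz m w b i j" for b i j
  by (simp only: zz_fold[OF N(1) assms(2)] zz_fold[OF N(2) assms(2)] e)
 ultimately show ?thesis by (simp add: eqm_def e)
qed

end

section \<open>Words with prescribed coordinates\<close>

definition pw :: "nat => int => word" where "pw x n = replicate (nat \<bar>n\<bar>) (x, n >= 0)"

lemma length_pw [simp]: "length (pw x n) = nat \<bar>n\<bar>" by (simp add: pw_def)

lemma sum_list_replicate_int: "sum_list (replicate n (a::int)) = int n * a"
 by (induction n) (auto simp: algebra_simps)

lemma ht_pw: "ht (pw x n) = (if x = 0 then n else 0)"
 by (auto simp: pw_def ht_def dt_def sgb_def sum_list_replicate_int)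

lemma cv_pw: "cv m (pw x n) c i = (if x = (if c then 2 else 1) & m dvd i then n else 0)"
proof -
 have "ut m (pw x n) c i p = (if x = (if c then 2 else 1) & m dvd i then sgb (n >= 0) else 0)"
  if "p < nat \<bar>n\<bar>" for p
 proof (cases "x = 0")
  case True thus ?thesis using that by (simp add: ut_def pw_def)
 next
  case False
  hence "ht (take p (pw x n)) = 0" using that by (simp add: pw_def ht_def dt_def sum_list_replicate_int)
  thus ?thesis using that by (simp add: ut_def pw_def)
 qed
 thus ?thesis by (auto simp: cv_def sgb_def)
qed

lemma cP_pw [simp]: "cP m (pw x n) c c' i j = 0"
proof (cases "x = 0")
 case True
 thus ?thesis by (simp add: cP_def ut_def pw_def)
next
 case False
 have "ut m (pw x n) c i p = (if x = (if c then 2 else 1) & m dvd i then sgb (n >= 0) else 0)"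
  if "p < nat \<bar>n\<bar>" for p c i
 proof -
  have "ht (take p (pw x n)) = 0" using that False by (simp add: pw_def ht_def dt_def sum_list_replicate_int)
  thus ?thesis using that by (simp add: ut_def pw_def)
 qed
 thus ?thesis unfolding cP_def
  by (intro sum.neutral ballI) (simp add: mult.commute)
qed

text \<open>The word for the power \<open>e\<close> of a generator at height \<open>i\<close>.\<close>

definition lw :: "bool => int => int => word" where
 "lw c i e = pw 0 i @ pw (if c then 2 else 1) e @ pw 0 (- i)"

lemma ht_lw [simp]: "ht (lw c i e) = 0" by (simp add: lw_def ht_pw)

lemma cv_lw: "cv m (lw c i e) c' i' = (if c' = c & m dvd i' - i then e else 0)"
 by (auto simp: lw_def cv_pw ht_pw)

lemma length_lw: "int (length (lw c i e)) = 2 * \<bar>i\<bar> + \<bar>e\<bar>"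
 by (simp add: lw_def)

definition linw :: "(bool => int => int) => int list => word" where
 "linw u is = concat (map (%i. lw False i (u False i) @ lw True i (u True i)) is)"

lemma ht_linw [simp]: "ht (linw u is) = 0"
 by (induction "is") (auto simp: linw_def)

lemma cv_linw: "distinct is ==> cv 0 (linw u is) c i = (if i : set is then u c i else 0)"
proof (induction "is")
 case (Cons j "is")
 have "linw u (j # is) = lw False j (u False j) @ lw True j (u True j) @ linw u is" by (simp add: linw_def)
 thus ?case using Cons by (auto simp: cv_lw)
qed (simp add: linw_def)

lemma length_linw:
 assumes "!!i. i : set is ==> \<bar>i\<bar> <= N" "!!c i. \<bar>u c i\<bar> <= B"
 shows "int (length (linw u is)) <= int (length is) * (4 * N + 2 * B)"
 using assms(1)
proof (induction "is")
 case (Cons j "is")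
 have "linw u (j # is) = lw False j (u False j) @ lw True j (u True j) @ linw u is" by (simp add: linw_def)
 hence "int (length (linw u (j # is))) = 4 * \<bar>j\<bar> + \<bar>u False j\<bar> + \<bar>u True j\<bar> + int (length (linw u is))"
  using length_lw[of False j "u False j"] length_lw[of True j "u True j"] by simp
 moreover have "\<bar>j\<bar> <= N" and "int (length (linw u is)) <= int (length is) * (4 * N + 2 * B)"
  using Cons by auto
 ultimately show ?case using assms(2)[of False j] assms(2)[of True j]
  by (simp add: algebra_simps)
qed (simp add: linw_def)

text \<open>Conjugators are assembled from these words, so their length must be polynomial in the support and in the values.\<close>

lemma word_of_vector:
 assumes "!!c i. \<bar>i\<bar> > N ==> u c i = 0" "!!c i. \<bar>u c i\<bar> <= B" "N >= 0"
 obtains h where "ht h = 0" "!!c i. cv 0 h c i = u c i" "int (length h) <= (2 * N + 1) * (4 * N + 2 * B)"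
proof
 have "cv 0 (linw u [-N..N]) c i = (if i : set [-N..N] then u c i else 0)" for c i
  by (rule cv_linw) simp
 thus "cv 0 (linw u [-N..N]) c i = u c i" for c i using assms(1)[of i c] by auto
 have "int (length (linw u [-N..N])) <= int (length [-N..N]) * (4 * N + 2 * B)"
  using assms(2) by (intro length_linw) auto
 thus "int (length (linw u [-N..N])) <= (2 * N + 1) * (4 * N + 2 * B)" using assms(3) by simp
qed simp

definition comw :: "word => word => word" where "comw u v = u @ v @ invw u @ invw v"

lemma ht_comw [simp]: "ht (comw u v) = 0" by (simp add: comw_def)

lemma cv_comw: "ht u = 0 ==> ht v = 0 ==> cv m (comw u v) c i = 0"
 by (simp add: comw_def cv_invw)

lemma cP_comw: "ht u = 0 ==> ht v = 0 ==>
  cP m (comw u v) c c' i j = 2 * (cv m u c i * cv m v c' j - cv m v c i * cv m u c' j)"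
 by (simp add: comw_def cP_append cv_invw cP_invw algebra_simps)

context exponents
begin

lemma zz_comw: "ht u = 0 ==> ht v = 0 ==> zz m (comw u v) b i j = 2 * om m (cv m u) (cv m v) b i j"
 by (simp add: zz_def om_def cP_comw algebra_simps)

text \<open>Products of commutators of generators give all even central coordinates; odd ones do not occur, by the parity of pair counts. The three integral matrices are kept apart so that the length
bound does not involve \<open>D\<close>.\<close>

lemma word_of_central:
 fixes aa ac cc :: "int => int => int"
 assumes anti: "!!i j. aa j i = - aa i j" "!!i j. cc j i = - cc i j"
  and supp: "!!i j. \<bar>i\<bar> > N \<or> \<bar>j\<bar> > N ==> aa i j = 0 & ac i j = 0 & cc i j = 0"
  and bound: "!!i j. \<bar>aa i j\<bar> <= B & \<bar>ac i j\<bar> <= B & \<bar>cc i j\<bar> <= B" and "N >= 0"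
 obtains h where "ht h = 0" "!!c i. cv 0 h c i = 0"
  "!!i j. zz 0 h False i j = 2 * aa i j" "!!i j. zz 0 h True i j = 2 * (ac i j + dm 0 (i - j) * cc i j)"
  "int (length h) <= (2 * N + 1)\<^sup>2 * (24 * N + 6 * B + 6)"
proof -
 define W where "W = (%(i, j). comw (lw False i (if i < j then aa i j else 0)) (lw False j 1)
  @ comw (lw False i (ac i j)) (lw True j 1) @ comw (lw True i (if i < j then cc i j else 0)) (lw True j 1))"
 have htW: "ht (W p) = 0" and cvW: "cv 0 (W p) c i = 0" for p c i
  by (auto simp: W_def split_def cv_comw)
 have zW: "zz 0 (W p) b i j = (if b then
   2 * (of_bool (p = (i, j)) * ac i j + dm 0 (i - j) * (of_bool (i < j & p = (i, j)) * cc i j - of_bool (j < i & p = (j, i)) * cc j i))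
   else 2 * (of_bool (i < j & p = (i, j)) * aa i j - of_bool (j < i & p = (j, i)) * aa j i))" for p b i j
 proof -
  obtain a b' where p: "p = (a, b')" by fastforce
  have 1: "zz 0 (comw (lw False a e) (lw False b' 1)) b i j =
    (if b then 0 else 2 * (of_bool (p = (i, j)) * e - of_bool (p = (j, i)) * e))" for e
   by (auto simp: zz_comw om_def cv_lw p)
  have 2: "zz 0 (comw (lw False a e) (lw True b' 1)) b i j = (if b then 2 * (of_bool (p = (i, j)) * e) else 0)" for e
   by (auto simp: zz_comw om_def cv_lw p)
  have 3: "zz 0 (comw (lw True a e) (lw True b' 1)) b i j =
    (if b then 2 * (dm 0 (i - j) * (of_bool (p = (i, j)) * e - of_bool (p = (j, i)) * e)) else 0)" for e
   by (auto simp: zz_comw om_def cv_lw p)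
  have "zz 0 (W p) b i j = zz 0 (comw (lw False a (if a < b' then aa a b' else 0)) (lw False b' 1)) b i j
   + zz 0 (comw (lw False a (ac a b')) (lw True b' 1)) b i j
   + zz 0 (comw (lw True a (if a < b' then cc a b' else 0)) (lw True b' 1)) b i j"
   by (simp add: W_def p zz_append cv_comw)
  thus ?thesis unfolding 1 2 3 by (auto simp: p)
 qed
 have lW: "int (length (W p)) <= 24 * N + 6 * B + 6" if "p : {-N..N} \<times> {-N..N}" for p
 proof -
  obtain i j where p: "p = (i, j)" by fastforce
  have lc: "int (length (comw u v)) = 2 * int (length u) + 2 * int (length v)" for u v
   by (simp add: comw_def)
  have ij: "\<bar>i\<bar> <= N" "\<bar>j\<bar> <= N" using that p by auto
  have B: "\<bar>aa i j\<bar> <= B" "\<bar>ac i j\<bar> <= B" "\<bar>cc i j\<bar> <= B" "B >= 0" using bound[of i j] by auto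
  have "int (length (W p)) = int (length (comw (lw False i (if i < j then aa i j else 0)) (lw False j 1)))
  + int (length (comw (lw False i (ac i j)) (lw True j 1))) + int (length (comw (lw True i (if i < j then cc i j else 0)) (lw True j 1)))"
   by (simp add: W_def p)
  thus ?thesis unfolding lc length_lw using B ij by auto
 qed
 define L where "L = List.product [-N..N] [-N..N]"
 define V where "V ps = concat (map W ps)" for ps
 have V: "ht (V ps) = 0 & (ALL c i. cv 0 (V ps) c i = 0)" for ps
  by (induction ps) (auto simp: V_def htW cvW)
 have zV: "zz 0 (V ps) b i j = (\<Sum>p\<leftarrow>ps. zz 0 (W p) b i j)" for ps b i j
  by (induction ps) (use V htW cvW in \<open>auto simp: V_def zz_append\<close>)
 have sumL: "(\<Sum>p\<leftarrow>L. of_bool (P & p = q) * x) = of_bool P * x" if "q \<notin> {-N..N} \<times> {-N..N} ==> x = 0" for P q and x :: int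
 proof -
  have dL: "distinct L" and sL: "set L = {-N..N} \<times> {-N..N}"
   by (auto simp: L_def distinct_product)
  have "(\<Sum>p\<leftarrow>L. of_bool (P & p = q) * x) = (SUM p:set L. of_bool (P & p = q) * x)"
   by (rule sum_list_distinct_conv_sum_set[OF dL])
  also have "... = (SUM p:set L. if p = q then of_bool P * x else 0)"
   by (intro sum.cong) auto
  finally show ?thesis unfolding sL using that by (auto simp add: sum.delta[of "{-N..N} \<times> {-N..N}"])
 qed
 have out: "aa i j = 0" "ac i j = 0" "cc i j = 0" if "(i, j) \<notin> {-N..N} \<times> {-N..N}" for i j
 proof -
  have "\<bar>i\<bar> > N \<or> \<bar>j\<bar> > N" using that by auto
  thus "aa i j = 0" "ac i j = 0" "cc i j = 0" using supp by blast+
 qed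
 have sums: "(\<Sum>p\<leftarrow>L. of_bool (P & p = (i, j)) * aa i j) = of_bool P * aa i j"
  "(\<Sum>p\<leftarrow>L. of_bool (P & p = (i, j)) * ac i j) = of_bool P * ac i j"
  "(\<Sum>p\<leftarrow>L. of_bool (P & p = (i, j)) * cc i j) = of_bool P * cc i j" for P i j
  by (rule sumL, erule out)+
 have zF: "zz 0 (V L) False i j = 2 * aa i j" for i j
 proof -
  have "zz 0 (V L) False i j = 2 * ((\<Sum>p\<leftarrow>L. of_bool (i < j & p = (i, j)) * aa i j)
    - (\<Sum>p\<leftarrow>L. of_bool (j < i & p = (j, i)) * aa j i))"
   by (simp add: zV zW sum_list_const_mult sum_list_subtractf)
  also have "... = 2 * (of_bool (i < j) * aa i j - of_bool (j < i) * aa j i)" by (simp only: sums)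
  finally show ?thesis using anti(1)[of i j] anti(1)[of i i] by (cases i j rule: linorder_cases) auto
 qed
 have zT: "zz 0 (V L) True i j = 2 * (ac i j + dm 0 (i - j) * cc i j)" for i j
 proof -
  have "zz 0 (V L) True i j = 2 * ((\<Sum>p\<leftarrow>L. of_bool (True & p = (i, j)) * ac i j) + dm 0 (i - j) * ((\<Sum>p\<leftarrow>L. of_bool (i < j & p = (i, j)) * cc i j)
    - (\<Sum>p\<leftarrow>L. of_bool (j < i & p = (j, i)) * cc j i)))"
   by (simp add: zV zW sum_list_const_mult sum_list_subtractf sum_list_addf)
  also have "... = 2 * (of_bool True * ac i j + dm 0 (i - j) * (of_bool (i < j) * cc i j - of_bool (j < i) * cc j i))" by (simp only: sums)
  finally show ?thesis using anti(2)[of i j] anti(2)[of i i] by (cases i j rule: linorder_cases) auto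
 qed
 have lV: "set ps <= {-N..N} \<times> {-N..N} ==> int (length (V ps)) <= int (length ps) * (24 * N + 6 * B + 6)" for ps
 proof (induction ps)
  case (Cons p ps)
  thus ?case using lW[of p] by (simp add: V_def algebra_simps)
 qed (simp add: V_def)
 have "set L <= {-N..N} \<times> {-N..N}" by (auto simp: L_def)
 hence "int (length (V L)) <= int (length L) * (24 * N + 6 * B + 6)" by (rule lV)
 moreover have "int (length L) = (2 * N + 1)\<^sup>2" using \<open>N >= 0\<close> by (simp add: L_def power2_eq_square)
 ultimately show thesis using that[of "V L"] V[of L] zF zT by metis
qed

section \<open>Finite generation, torsion and derived length\<close>

definition std_gens :: "nat list" where "std_gens = [\<kappa> [(0, True)], \<kappa> [(1, True)], \<kappa> [(2, True)]]"

lemma code_Cons: "\<kappa> (x # w) = \<kappa> [x] \<otimes>\<^bsub>G\<^esub> \<kappa> w" by simp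

text \<open>Letters other than 0, 1, 2 are allowed and represent 1, which gives the type of words a supply of padding letters.\<close>

lemma code_letter:
 "\<kappa> [(i, b)] = (if i < 3 then (if b then std_gens ! i else inv\<^bsub>G\<^esub> (std_gens ! i)) else \<one>\<^bsub>G\<^esub>)"
proof (cases "i < 3")
 case True
 hence "i = 0 \<or> i = 1 \<or> i = 2" by auto
 thus ?thesis by (cases b) (auto simp: std_gens_def)
next
 case False
 hence "E [(i, b)] []" by (auto simp: E_iff cv_single zz_def dt_def)
 thus ?thesis using False by (simp add: one_code code_eq_iff)
qed

lemma finite_gen_std: "finite_gen_set G (set std_gens)"
proof -
 interpret group G by (rule group)
 have S: "set std_gens <= carrier G" by (auto simp: std_gens_def)
 have "\<kappa> w : generate G (set std_gens)" for w
 proof (induction w)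
  case (Cons x w)
  have "\<kappa> [x] : generate G (set std_gens)"
  proof (cases "fst x < 3")
   case True
   hence "std_gens ! fst x : set std_gens" by (intro nth_mem) (simp add: std_gens_def)
   thus ?thesis using True code_letter[of "fst x" "snd x"] by (auto intro: generate.incl generate.inv)
  next
   case False
   thus ?thesis using code_letter[of "fst x" "snd x"] by (auto intro: generate.one)
  qed
  thus ?case using Cons code_Cons generate.eng by metis
 qed (simp add: one_code[symmetric] generate.one)
 moreover have "generate G (set std_gens) <= carrier G" using S by (rule generate_incl)
 ultimately show ?thesis using S by (auto simp: finite_gen_set_def carrier_code)
qed

lemma power_coords:
 assumes "ht w = 0"
 shows "ht (concat (replicate n w)) = 0 & cv m (concat (replicate n w)) c i = int n * cv m w c i \<and>
  zz m (concat (replicate n w)) b i j = int n * zz m w b i j"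
proof -
 have "ht (concat (replicate n w)) = 0 & (ALL c i. cv m (concat (replicate n w)) c i = int n * cv m w c i) \<and>
  (ALL b i j. zz m (concat (replicate n w)) b i j = int n * zz m w b i j)"
 proof (induction n)
  case (Suc n)
  thus ?case using assms
   by (auto simp: zz_append om_smult_right[of m _ "int n"] om_self algebra_simps)
 qed simp
 thus ?thesis by blast
qed

lemma ht_power: "ht (concat (replicate n w)) = int n * ht w"
 by (induction n) (auto simp: algebra_simps)

text \<open>Powers multiply a coordinate by \<open>n\<close>: first the height, then the exponents, then the central values.\<close>

lemma torsion_free: "torsion_free G"
 unfolding torsion_free_def
proof (intro ballI allI impI notI)
 fix g n assume g: "g : carrier G" "g ~= \<one>\<^bsub>G\<^esub> & (n::nat) > 0" "g [^]\<^bsub>G\<^esub> n = \<one>\<^bsub>G\<^esub>"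
 obtain w where w: "g = \<kappa> w" using g by (auto simp: carrier_code)
 have e: "E (concat (replicate n w)) []" using g w by (simp add: pow_code one_code code_eq_iff)
 hence h: "ht w = 0" using g ht_power[of n w] by (simp add: E_iff)
 have "E w []" using e g power_coords[OF h, of n 0] by (simp add: E_iff h)
 thus False using g w by (simp add: one_code code_eq_iff)
qed

text \<open>Modulo the kernel of the height the group is cyclic, the kernel is nilpotent of class two, and its centre contains the elements without exponents: so the third derived group is trivial. It
is not metabelian, because two commutators \<open>[t, a]\<close> and \<open>[t\<^sup>2, a]\<close> do not commute.\<close>

lemma derived_length: "has_derived_length G 3"
proof -
 interpret group G by (rule group)
 define A1 A2 where "A1 = \<kappa> ` {w. ht w = 0}" and "A2 = \<kappa> ` {w. ht w = 0 & (ALL c i. cv 0 w c i = 0)}"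
 have com: "\<kappa> u \<otimes>\<^bsub>G\<^esub> \<kappa> v \<otimes>\<^bsub>G\<^esub> inv\<^bsub>G\<^esub> \<kappa> u \<otimes>\<^bsub>G\<^esub> inv\<^bsub>G\<^esub> \<kappa> v = \<kappa> (comw u v)" for u v
  by (simp add: comw_def)
 have "\<kappa> [] : A1" "\<kappa> [] : A2" by (auto simp: A1_def A2_def)
 hence "A1 ~= {}" "A2 ~= {}" by auto
 hence sg: "subgroup A1 G" "subgroup A2 G"
  unfolding A1_def A2_def
  by (intro subgroupI; fastforce simp: cv_invw)+
 have d: "derived G H <= A"
  if dA: "subgroup A G" "!!u v. \<kappa> u : H ==> \<kappa> v : H ==> \<kappa> (comw u v) : A" "H <= carrier G" for H A
  unfolding derived_def
 proof (intro generate_subgroup_incl subsetI)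
  fix x assume "x : derived_set G H"
  then obtain y z where yz: "y : H" "z : H" "x = y \<otimes>\<^bsub>G\<^esub> z \<otimes>\<^bsub>G\<^esub> inv\<^bsub>G\<^esub> y \<otimes>\<^bsub>G\<^esub> inv\<^bsub>G\<^esub> z" by auto
  moreover obtain u v where uv: "y = \<kappa> u" "z = \<kappa> v"
   using yz dA(3) unfolding carrier_code by blast
  ultimately show "x : A" using dA(2)[of u v] com[of u v] by metis
 qed (rule dA(1))
 have d1: "derived G (carrier G) <= A1" by (rule d) (use sg in \<open>auto simp: A1_def\<close>)
 have A1D: "ht w = 0" if "\<kappa> w : A1" for w using that by (auto simp: A1_def code_eq_iff E_iff)
 have A2D: "ht w = 0 & (ALL c i. cv 0 w c i = 0)" if "\<kappa> w : A2" for w using that by (auto simp: A2_def code_eq_iff E_iff)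
 have d2: "derived G A1 <= A2"
 proof (rule d)
  fix u v assume "\<kappa> u : A1" "\<kappa> v : A1"
  hence "ht u = 0" "ht v = 0" using A1D by auto
  thus "\<kappa> (comw u v) : A2" by (auto simp: A2_def cv_comw)
 qed (use sg in \<open>auto simp: A1_def\<close>)
 have d3: "derived G A2 <= {\<one>\<^bsub>G\<^esub>}"
 proof (rule d)
  fix u v assume "\<kappa> u : A2" "\<kappa> v : A2"
  hence a: "ht u = 0" "ht v = 0" "!!c i. cv 0 u c i = 0" using A2D by auto
  have "cv 0 u = (%c i. 0)" using a by auto
  hence "E (comw u v) []" using a by (simp add: E_iff cv_comw zz_comw om_def)
  thus "\<kappa> (comw u v) : {\<one>\<^bsub>G\<^esub>}" by (simp add: one_code code_eq_iff)
 qed (use sg triv_subgroup in \<open>auto simp: A2_def\<close>)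
 have c1: "derived G (carrier G) <= carrier G" by (simp add: derived_in_carrier)
 have A: "A1 <= carrier G" "A2 <= carrier G" by (auto simp: A1_def A2_def)
 have e2: "(derived G ^^ 2) (carrier G) <= A2"
  using mono_derived[OF d1] d2 by (simp add: numeral_2_eq_2)
 have e3: "(derived G ^^ 3) (carrier G) <= {\<one>\<^bsub>G\<^esub>}"
  using mono_derived[OF e2] d3 by (simp add: numeral_3_eq_3 numeral_2_eq_2)
 have one: "\<one>\<^bsub>G\<^esub> : derived G H" for H by (simp add: derived_def generate.one)
 have three: "(derived G ^^ 3) (carrier G) = {\<one>\<^bsub>G\<^esub>}" using e3 one by (auto simp: numeral_3_eq_3)
 have dI: "\<kappa> (comw u v) : derived G H" if "\<kappa> u : H" "\<kappa> v : H" for u v H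
  unfolding derived_def com[symmetric] using that by (intro generate.incl UN_I[of "\<kappa> u"] UN_I[of "\<kappa> v"]) auto
 \<comment> \<open>\<open>u1 = a_1 a_0\<inverse>\<close> and \<open>u2 = a_2 a_0\<inverse>\<close>; \<open>[u1, u2]\<close> has the coordinate of \<open>[a_1, a_2]\<close>.\<close>
 define u1 u2 where "u1 = comw (pw 0 1) (pw 1 1)" and "u2 = comw (pw 0 2) (pw 1 1)"
 have cvu: "cv 0 u1 c i = (if c then 0 else of_bool (i = 1) - of_bool (i = 0))"
  "cv 0 u2 c i = (if c then 0 else of_bool (i = 2) - of_bool (i = 0))" for c i
  by (auto simp: u1_def u2_def comw_def cv_pw ht_pw cv_invw)
 have "\<kappa> u1 : derived G (carrier G)" "\<kappa> u2 : derived G (carrier G)"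
  unfolding u1_def u2_def by (auto intro!: dI)
 hence "\<kappa> (comw u1 u2) : (derived G ^^ 2) (carrier G)"
  by (auto simp: numeral_2_eq_2 intro: dI)
 moreover have "~ E (comw u1 u2) []"
 proof
  assume "E (comw u1 u2) []"
  hence "zz 0 (comw u1 u2) False 1 2 = 0" by (simp add: E_iff)
  moreover have "ht u1 = 0" "ht u2 = 0" by (simp_all add: u1_def u2_def)
  ultimately show False by (simp add: zz_comw om_def cvu)
 qed
 ultimately have two: "(derived G ^^ 2) (carrier G) ~= {\<one>\<^bsub>G\<^esub>}" by (auto simp: one_code code_eq_iff)
 have triv: "derived G {\<one>\<^bsub>G\<^esub>} = {\<one>\<^bsub>G\<^esub>}"
 proof
  show "derived G {\<one>\<^bsub>G\<^esub>} <= {\<one>\<^bsub>G\<^esub>}"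
   unfolding derived_def by (rule generate_subgroup_incl) (use triv_subgroup in auto)
 qed (use one in auto)
 have "(derived G ^^ j) (carrier G) ~= {\<one>\<^bsub>G\<^esub>}" if "j < 3" for j
 proof
  assume a: "(derived G ^^ j) (carrier G) = {\<one>\<^bsub>G\<^esub>}"
  have t: "(derived G ^^ n) {\<one>\<^bsub>G\<^esub>} = {\<one>\<^bsub>G\<^esub>}" for n by (induction n) (auto simp: triv)
  have "2 = (2 - j) + j" using that by simp
  hence "(derived G ^^ 2) (carrier G) = (derived G ^^ (2 - j)) ((derived G ^^ j) (carrier G))"
   by (metis comp_apply funpow_add)
  thus False using two a t by simp
 qed
 thus ?thesis using three by (simp add: has_derived_length_def)
qed

end

abbreviation class_sum :: "int => int => int => (int => int) => int" where
 "class_sum N k t f \<equiv> SUM i:{-N..N}. of_bool (k dvd i - t) * f i"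

section \<open>Telescoping sums\<close>

text \<open>Summing \<open>f\<close> along each orbit of the shift by \<open>k\<close>, from its far end up to \<open>i\<close>. The solution has finite support exactly because the total over each
orbit vanishes.\<close>

lemma telescope_solution:
 fixes f :: "int => int"
 assumes k: "k ~= 0" and supp: "!!i. \<bar>i\<bar> > N ==> f i = 0" and N: "N >= 0"
  and sum0: "!!ii. class_sum N k ii f = 0"
  and B: "!!i. \<bar>f i\<bar> <= B"
 defines "g \<equiv> %i. SUM i':{-N..N}. of_bool (k dvd i - i' & (i - i') * k >= 0) * f i'"
 shows "g i - g (i - k) = f i" "\<bar>i\<bar> > N ==> g i = 0" "\<bar>g i\<bar> <= (2 * N + 1) * B"
proof -
 have *: "of_bool (k dvd i - i' & (i - i') * k >= 0) * f i' - of_bool (k dvd i - k - i' & (i - k - i') * k >= 0) * f i'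
   = (if i' = i then f i' else 0)" for i'
 proof (cases "k dvd i - i'")
  case True
  then obtain n where "i - i' = k * n" by (elim dvdE)
  hence n: "i = i' + k * n" by simp
  have kk: "k * k > 0" using k by (simp add: zero_less_mult_iff linorder_neq_iff) (linarith)
  have 1: "(i - i') * k = (k * k) * n" "(i - k - i') * k = (k * k) * (n - 1)"
   unfolding n by (simp_all add: algebra_simps)
  have 2: "k dvd i - k - i'" by (simp add: n)
  have 3: "i' = i \<longleftrightarrow> n = 0" using n k by auto
  show ?thesis unfolding 1 using True 2 kk by (auto simp: 3 zero_le_mult_iff)
 next
  case False
  hence "i' ~= i" "~ k dvd i - k - i'"
   using dvd_add_right_iff[of k k "i - k - i'"] by (auto simp: algebra_simps)
  thus ?thesis using False by simp
 qed
 have "g i - g (i - k) = (SUM i':{-N..N}. if i' = i then f i' else 0)"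
  unfolding g_def sum_subtractf[symmetric] * ..
 thus "g i - g (i - k) = f i" using supp[of i] by auto
 have N2: "int (card {-N..N}) = 2 * N + 1" using N by simp
 have B0: "B >= 0" using B[of 0] by simp
 have "\<bar>of_bool (k dvd i - i' & (i - i') * k >= 0) * f i'\<bar> <= B" for i'
  using B[of i'] B0 by (simp add: of_bool_def)
 hence "\<bar>g i\<bar> <= int (card {-N..N}) * B" unfolding g_def by (intro abs_sum_le)
 thus "\<bar>g i\<bar> <= (2 * N + 1) * B" by (simp only: N2)
 assume i: "\<bar>i\<bar> > N"
 show "g i = 0"
 proof (cases "i * k > 0")
  case True
  have "(i - i') * k >= 0" if "i' : {-N..N}" for i'
   using True i that by (auto simp: zero_less_mult_iff zero_le_mult_iff)
  hence "g i = (SUM i':{-N..N}. of_bool (k dvd i' - i) * f i')"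
   unfolding g_def by (intro sum.cong) (auto simp: dvd_diff_commute)
  thus ?thesis by (simp only: sum0)
 next
  case False
  hence "i * k < 0" using i k N by (auto simp: not_less mult_le_0_iff mult_less_0_iff)
  hence "~ (i - i') * k >= 0" if "i' : {-N..N}" for i'
   using i that by (auto simp: mult_less_0_iff zero_le_mult_iff)
  thus ?thesis unfolding g_def by (intro sum.neutral) auto
 qed
qed

lemma sum_window:
 fixes f :: "int => int"
 assumes "!!i. \<bar>i\<bar> > N ==> f i = 0" "N <= M"
 shows "(SUM i:{-M..M}. f i) = (SUM i:{-N..N}. f i)"
 by (rule sum.mono_neutral_right) (use assms in auto)

lemma sum_window_shift:
 fixes f :: "int => int"
 assumes "!!i. \<bar>i\<bar> > N ==> f i = 0"
 shows "(SUM i:{-(N + \<bar>s\<bar>)..N + \<bar>s\<bar>}. f (i - s)) = (SUM i:{-N..N}. f i)"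
proof -
 have "(SUM i:{-(N + \<bar>s\<bar>)..N + \<bar>s\<bar>}. f (i - s)) = (SUM i:{-(N + \<bar>s\<bar>) - s..N + \<bar>s\<bar> - s}. f i)"
  by (rule sum.reindex_bij_witness[of _ "%i. i + s" "%i. i - s"]) auto
 also have "... = (SUM i:{-N..N}. f i)"
  by (rule sum.mono_neutral_right) (use assms in auto)
 finally show ?thesis .
qed

text \<open>The converse: a finitely supported difference has vanishing sum over each orbit.\<close>

lemma telescope_sum:
 fixes f g :: "int => int"
 assumes eq: "!!i. f i = g i - g (i - k)"
  and supp: "!!i. \<bar>i\<bar> > N ==> f i = 0" "!!i. \<bar>i\<bar> > M ==> g i = 0"
 shows "class_sum N k ii f = 0"
proof -
 define L where "L = max N M"
 define G where "G i = of_bool (k dvd i - ii) * g i" for i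
 have G: "G i = 0" if "\<bar>i\<bar> > L" for i using that supp(2) by (simp add: L_def G_def)
 have "k dvd i - k - ii \<longleftrightarrow> k dvd i - ii" for i
  using dvd_add_right_iff[of k "- k" "i - ii"] by (simp add: algebra_simps)
 hence *: "of_bool (k dvd i - ii) * f i = G i - G (i - k)" for i
  by (simp add: G_def eq algebra_simps)
 have "class_sum N k ii f =
   class_sum (L + \<bar>k\<bar>) k ii f"
  by (rule sum_window[symmetric]) (use supp(1) in \<open>auto simp: L_def\<close>)
 also have "... = (SUM i:{-(L + \<bar>k\<bar>)..L + \<bar>k\<bar>}. G i) - (SUM i:{-(L + \<bar>k\<bar>)..L + \<bar>k\<bar>}. G (i - k))"
  unfolding * sum_subtractf ..
 also have "... = 0"
  using sum_window[of L G "L + \<bar>k\<bar>"] sum_window_shift[of L G k] G by simp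
 finally show ?thesis .
qed

text \<open>Used for uniqueness of solutions: two of them differ by a periodic function.\<close>

lemma periodic_finite_support:
 fixes d :: "int => 'a"
 assumes "k ~= 0" "!!i. d i = d (i - k)" "!!i. \<bar>i\<bar> > M ==> d i = z"
 shows "d i = z"
proof -
 have *: "d i = d (i - int n * k)" for n
 proof (induction n)
  case (Suc n) thus ?case using assms(2)[of "i - int n * k"] by (simp add: algebra_simps)
 qed simp
 define n where "n = nat (\<bar>i\<bar> + \<bar>M\<bar> + 1)"
 have "int n * 1 <= int n * \<bar>k\<bar>" using assms(1) by (intro mult_left_mono) auto
 hence "\<bar>int n * k\<bar> >= \<bar>i\<bar> + \<bar>M\<bar> + 1" by (simp add: abs_mult n_def)
 thus ?thesis using *[of n] assms(3)[of "i - int n * k"] by (auto simp: abs_if split: if_splits)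
qed

section \<open>Conjugacy with a prescribed shift\<close>

context exponents
begin

text \<open>Conjugators are sorted by their height \<open>s\<close>; for fixed \<open>s\<close> the conditions on the other coordinates are linear.\<close>

definition conj_shift :: "int => word => word => bool" where
 "conj_shift s w w' \<longleftrightarrow> (EX h. ht h = s & E (h @ w) (w' @ h))"

lemma conj_shift_iff: "(EX s. conj_shift s w w') \<longleftrightarrow> conjugate G (\<kappa> w) (\<kappa> w')"
 by (auto simp: conj_shift_def conjugate_code)

lemma conj_shift_ht: "conj_shift s w w' ==> ht w = ht w'"
 by (auto simp: conj_shift_def E_iff)

lemma zz_supp: "\<bar>i\<bar> >= int (length w) \<or> \<bar>j\<bar> >= int (length w) ==> zz 0 w b i j = 0"
 using cP_supp[of w i j] by (simp add: zz_def)

lemma E_appendI: "E u u' ==> E (v @ u) (v @ u')" "E u u' ==> E (u @ v) (u' @ v)"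
 using append by auto

lemma E_insert: "E (u @ invw w @ w @ v) (u @ v)" "E (u @ w @ invw w @ v) (u @ v)"
proof -
 have 1: "E (u @ w @ invw w @ v) (u @ v)" for u w v
 proof -
  have "E (w @ invw w @ v) ([] @ v)" using E_appendI(2)[OF inverse[of w], of v] by simp
  thus ?thesis using E_appendI(1) by fastforce
 qed
 show "E (u @ w @ invw w @ v) (u @ v)" by (rule 1)
 show "E (u @ invw w @ w @ v) (u @ v)" using 1[of u "invw w" v] by simp
qed

text \<open>A conjugator may be multiplied by \<open>w\<close> itself, which changes its height by \<open>ht w\<close>.\<close>

lemma conj_shift_step:
 assumes "conj_shift s w w'"
 shows "conj_shift (s + ht w) w w'" "conj_shift (s - ht w) w w'"
proof -
 obtain h where h: "ht h = s" "E (h @ w) (w' @ h)" using assms by (auto simp: conj_shift_def)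
 have "E ((h @ w) @ w) (w' @ (h @ w))" using E_appendI(2)[OF h(2), of w] by simp
 thus "conj_shift (s + ht w) w w'" unfolding conj_shift_def using h(1) by (intro exI[of _ "h @ w"]) auto
 have "E ((h @ invw w) @ w) (h @ [])" using E_insert(1)[of h w "[]"] by simp
 moreover have "E (h @ []) (h @ w @ invw w)" using E_insert(2)[of h w "[]"] sym by simp
 moreover have "E (h @ w @ invw w) (w' @ (h @ invw w))" using E_appendI(2)[OF h(2), of "invw w"] by simp
 ultimately have "E ((h @ invw w) @ w) (w' @ (h @ invw w))" by (blast intro: trans)
 thus "conj_shift (s - ht w) w w'" unfolding conj_shift_def using h(1) by (intro exI[of _ "h @ invw w"]) auto
qed

lemma conj_shift_mult: "conj_shift s w w' ==> conj_shift (s + n * ht w) w w'"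
proof (induction n rule: int_induct[of _ 0])
 case base thus ?case by simp
next
 case (step1 n) thus ?case using conj_shift_step(1)[of "s + n * ht w" w w'] by (simp add: algebra_simps)
next
 case (step2 n) thus ?case using conj_shift_step(2)[of "s + n * ht w" w w'] by (simp add: algebra_simps)
qed

text \<open>The coordinates of \<open>h w = w' h\<close>. The exponents of \<open>h\<close> satisfy a difference equation with step \<open>ht w\<close>, and so do its central coordinates once the
exponents are known.\<close>

lemma conj_eqs:
 assumes "E (h @ w) (w' @ h)"
 shows "ht w = ht w'" "cv 0 h c i + cv 0 w c (i - ht h) = cv 0 w' c i + cv 0 h c (i - ht w')"
  "zz 0 h b i j + zz 0 w b (i - ht h) (j - ht h) + om 0 (cv 0 h) (%c i. cv 0 w c (i - ht h)) b i j =
  zz 0 w' b i j + zz 0 h b (i - ht w') (j - ht w') + om 0 (cv 0 w') (%c i. cv 0 h c (i - ht w')) b i j"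
 using assms by (auto simp: E_iff zz_append)

text \<open>If \<open>ht w\<close> is not 0, reduce the height modulo it. Otherwise the exponents of \<open>w'\<close> are those of \<open>w\<close> shifted by \<open>s\<close>, and if there are none,
the same holds for the central coordinates. Supports are no larger than the length, so \<open>s\<close> is small unless both words are trivial, and then \<open>s = 0\<close> works.\<close>

lemma conj_shift_bounded:
 assumes "conj_shift s w w'"
 obtains s' where "\<bar>s'\<bar> <= int (length w) + int (length w')" "conj_shift s' w w'"
proof (cases "ht w = 0")
 case False
 have "\<bar>s mod ht w\<bar> <= \<bar>ht w\<bar>" using abs_mod_less[OF False, of s] by simp
 moreover have "conj_shift (s mod ht w) w w'"
  using conj_shift_mult[OF assms, of "- (s div ht w)"] by (simp add: minus_mult_div_eq_mod[symmetric] mult.commute)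
 ultimately show thesis using that[of "s mod ht w"] ht_le[of w] by linarith
next
 case True
 obtain h where h: "ht h = s" "E (h @ w) (w' @ h)" using assms by (auto simp: conj_shift_def)
 have w': "ht w' = 0" using conj_shift_ht[OF assms] True by simp
 have cv: "cv 0 w' c i = cv 0 w c (i - s)" for c i using conj_eqs(2)[OF h(2), of c i] h(1) w' by simp
 note outer = that
 have fin: thesis if "\<bar>i\<bar> < int (length w)" "\<bar>i + s\<bar> < int (length w')" for i
 proof -
  have "\<bar>s\<bar> <= int (length w) + int (length w')" using that by linarith
  thus thesis using outer assms by blast
 qed
 show thesis
 proof (cases "ALL c i. cv 0 w c i = 0")
  case False
  then obtain c i where ci: "cv 0 w c i ~= 0" by auto
  hence "cv 0 w' c (i + s) ~= 0" using cv[of c "i + s"] by simp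
  thus thesis using fin[of i] ci cv_supp[of w i c] cv_supp[of w' "i + s" c] by force
 next
  case True
  hence 0: "cv 0 w = (%c i. 0)" "cv 0 w' = (%c i. 0)" using cv by (auto intro!: ext)
  have zz: "zz 0 w' b i j = zz 0 w b (i - s) (j - s)" for b i j
   using conj_eqs(3)[OF h(2), of b i j] h(1) w' 0 by simp
  show thesis
  proof (cases "ALL b i j. zz 0 w b i j = 0")
   case False
   then obtain b i j where z: "zz 0 w b i j ~= 0" by auto
   hence "zz 0 w' b (i + s) (j + s) ~= 0" using zz[of b "i + s" "j + s"] by simp
   thus thesis using fin[of i] z zz_supp[of w i j b] zz_supp[of w' "i + s" "j + s" b] by force
  next
   case True
   hence "E w w'" using zz 0 w' \<open>ht w = 0\<close> by (simp add: E_iff)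
   hence "conj_shift 0 w w'" unfolding conj_shift_def by (intro exI[of _ "[]"]) auto
   thus thesis using that[of 0] by simp
  qed
 qed
qed

lemma zz_pw0 [simp]: "zz m (pw x n) b i j = 0" by (simp add: zz_def)

lemma cv_pw0 [simp]: "cv m (pw 0 n) = (%c i. 0)" by (intro ext) (simp add: cv_pw)

subsection \<open>Elements of height zero\<close>

text \<open>For words of height 0 the central coordinates of the conjugator cancel and its exponents \<open>u\<close> enter through the commutator form alone. Each finitely supported \<open>u\<close>
comes from a word.\<close>

lemma conj_shift_height0:
 assumes "ht w = 0" "ht w' = 0"
 shows "conj_shift s w w' \<longleftrightarrow> (ALL c i. cv 0 w' c i = cv 0 w c (i - s)) \<and>
  (EX u N. (ALL c i. \<bar>i\<bar> > N --> u c i = 0) \<and>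
   (ALL b i j. zz 0 w' b i j - zz 0 w b (i - s) (j - s) = 2 * om 0 u (cv 0 w') b i j))"
proof
 assume "conj_shift s w w'"
 then obtain h where h: "ht h = s" "E (h @ w) (w' @ h)" by (auto simp: conj_shift_def)
 have cv: "cv 0 w' c i = cv 0 w c (i - s)" for c i using conj_eqs(2)[OF h(2), of c i] h(1) assms by simp
 have "zz 0 w' b i j - zz 0 w b (i - s) (j - s) = 2 * om 0 (cv 0 h) (cv 0 w') b i j" for b i j
  using conj_eqs(3)[OF h(2), of b i j] h(1) assms om_swap[of 0 "cv 0 w'" "cv 0 h" b i j]
  by (simp add: cv[symmetric])
 thus "(ALL c i. cv 0 w' c i = cv 0 w c (i - s)) \<and>
  (EX u N. (ALL c i. \<bar>i\<bar> > N --> u c i = 0) \<and>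
   (ALL b i j. zz 0 w' b i j - zz 0 w b (i - s) (j - s) = 2 * om 0 u (cv 0 w') b i j))"
  using cv cv_supp[of h] by (intro conjI allI exI[of _ "cv 0 h"] exI[of _ "int (length h)"]) auto
next
 assume a: "(ALL c i. cv 0 w' c i = cv 0 w c (i - s)) \<and>
  (EX u N. (ALL c i. \<bar>i\<bar> > N --> u c i = 0) \<and>
   (ALL b i j. zz 0 w' b i j - zz 0 w b (i - s) (j - s) = 2 * om 0 u (cv 0 w') b i j))"
 then obtain u N where u: "!!c i. \<bar>i\<bar> > N ==> u c i = 0"
  "!!b i j. zz 0 w' b i j - zz 0 w b (i - s) (j - s) = 2 * om 0 u (cv 0 w') b i j" by blast
 define M where "M = Max ((%(c, i). \<bar>u c i\<bar>) ` (UNIV \<times> {-\<bar>N\<bar>..\<bar>N\<bar>}))"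
 have M: "\<bar>u c i\<bar> <= max M 0" for c i
 proof (cases "\<bar>i\<bar> > N")
  case False
  hence "\<bar>u c i\<bar> <= M" unfolding M_def by (intro Max_ge image_eqI[of _ _ "(c, i)"]) auto
  thus ?thesis by simp
 qed (simp add: u)
 obtain h where h: "ht h = 0" "!!c i. cv 0 h c i = u c i"
  using word_of_vector[of "\<bar>N\<bar>" u "max M 0"] u(1) M by (metis abs_ge_zero abs_of_nonneg less_le_trans linorder_not_less order_less_le_trans abs_ge_self)
 show "conj_shift s w w'" unfolding conj_shift_def
 proof (intro exI conjI)
  show "ht (h @ pw 0 s) = s" using h by (simp add: ht_pw)
  have cvh: "cv 0 h = u" using h(2) by auto
  have cvw: "cv 0 w c (i - s) = cv 0 w' c i" for c i using a by simp
  show "E ((h @ pw 0 s) @ w) (w' @ h @ pw 0 s)"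
   using u(2) om_swap[of 0 "cv 0 w'" u]
   by (auto simp: E_iff zz_append assms h(1) ht_pw cvh cvw algebra_simps)
 qed
qed

end

section \<open>Pivots\<close>

text \<open>A position where \<open>v\<close> does not vanish, taken among the \<open>a\<close>-exponents when these are not all 0. Through it \<open>u \<and> v\<close> determines \<open>u\<close> up
to multiples of \<open>v\<close>.\<close>

definition pivot :: "(bool => int => int) => int => bool" where
 "pivot v i0 \<longleftrightarrow> v False i0 ~= 0 \<or> (ALL i. v False i = 0) & v True i0 ~= 0"

lemma pivot_exists: "v c i ~= 0 ==> EX i0. pivot v i0"
 by (cases c) (auto simp: pivot_def)

text \<open>The commutator form at one pair of indices, as a function of the four pairs of values involved. In this form it can be evaluated on guessed values.\<close>

definition omp :: "int => (bool => int) => (bool => int) => (bool => int) => (bool => int) => bool => int" where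
 "omp d p q v v' b = (if b then p False * v' True - v False * q True + d * (p True * v' True - v True * q True)
  else p False * v' False - v False * q False)"

lemma abs_le_mult: "y ~= 0 ==> \<bar>x\<bar> <= \<bar>x * y\<bar>" for x y :: int
proof -
 assume "y ~= 0"
 hence "1 <= \<bar>y\<bar>" by simp
 from mult_left_mono[OF this, of "\<bar>x\<bar>"] show ?thesis by (simp only: abs_mult mult_1_right abs_ge_zero)
qed

lemma abs_mult_le: "\<bar>x\<bar> <= a ==> \<bar>y\<bar> <= b ==> \<bar>x * y\<bar> <= a * b" for x y :: int
 by (simp add: abs_mult mult_mono)

lemma tri: "\<bar>2 * (a - b) - c\<bar> <= \<bar>d - 2 * e\<bar> ==> \<bar>a\<bar> <= \<bar>b\<bar> + \<bar>c\<bar> + \<bar>d\<bar> + \<bar>e\<bar>" for a b c d e :: int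
 by (smt (verit))

context exponents
begin

lemma dm0: "dm 0 0 = 0" "k ~= 0 ==> dm 0 k >= 2" "dm 0 k >= 0"
 using D_ge2[of k] by (auto simp: dm_def)

lemma om_omp: "om m u v b i j = omp (dm m (i - j)) (%c. u c i) (%c. u c j) (%c. v c i) (%c. v c j) b"
 by (simp add: om_def omp_def)

text \<open>Adding multiples of \<open>v\<close> to \<open>u\<close> does not change \<open>u \<and> v\<close>, so one value of \<open>u\<close> at the pivot can be reduced modulo the value of
\<open>v\<close> there.\<close>

lemma pivot_normalise:
 assumes "pivot v i0"
 obtains u' where "!!b i j. om 0 u' v b i j = om 0 u v b i j"
  "v False i0 ~= 0 ==> \<bar>u' False i0\<bar> <= \<bar>v False i0\<bar>"
  "v False i0 = 0 ==> \<bar>u' True i0\<bar> <= \<bar>v True i0\<bar>"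
proof -
 define n where "n = (if v False i0 ~= 0 then u False i0 div v False i0 else u True i0 div v True i0)"
 define u' where "u' c i = u c i + (- n) * v c i" for c i
 have om: "om 0 u' v b i j = om 0 u v b i j" for b i j
  unfolding u'_def om_add_left om_smult by (simp add: om_self)
 have "v False i0 ~= 0 ==> u' False i0 = u False i0 mod v False i0"
  "v False i0 = 0 ==> u' True i0 = u True i0 mod v True i0"
  by (auto simp: u'_def n_def minus_div_mult_eq_mod)
 thus thesis using that[of u'] om assms abs_mod_less[of "v False i0" "u False i0"]
   abs_mod_less[of "v True i0" "u True i0"] by (auto simp: pivot_def)
qed

text \<open>A solution bounded independently of \<open>D\<close>. The sum of the entries at \<open>(i, j)\<close> and \<open>(j, i)\<close> is free of \<open>D\<close>, because the
\<open>D\<close>-parts are antisymmetric; together with the \<open>a\<close>-block it bounds the values of \<open>u\<close> in terms of the value at the pivot. If all \<open>a\<close>-exponents of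
\<open>v\<close> vanish, this bounds only half of the values; then \<open>D\<close> times a bracket equals a bounded number, and since \<open>D\<close> is a non-zero integer the bracket is bounded as
well.\<close>

lemma pivot_bound:
 assumes x: "!!b i j. x b i j = 2 * om 0 u v b i j"
  and xF: "!!i j. x False i j = aa i j" and xT: "!!i j. x True i j = ac i j + dm 0 (i - j) * cc i j"
  and anti: "!!i j. cc j i = - cc i j"
  and vs: "!!c i. \<bar>i\<bar> >= L ==> v c i = 0"
  and xs: "!!i j. \<bar>i\<bar> >= L \<or> \<bar>j\<bar> >= L ==> aa i j = 0 & ac i j = 0 & cc i j = 0"
  and B: "!!c i. \<bar>v c i\<bar> <= B" "!!i j. \<bar>aa i j\<bar> <= B & \<bar>ac i j\<bar> <= B & \<bar>cc i j\<bar> <= B" "B >= 1"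
  and piv: "pivot v i0"
 obtains u' where "!!b i j. x b i j = 2 * om 0 u' v b i j" "!!c i. \<bar>i\<bar> >= L ==> u' c i = 0"
  "!!c i. \<bar>u' c i\<bar> <= 6 * B ^ 3"
proof -
 obtain u' where u': "!!b i j. om 0 u' v b i j = om 0 u v b i j"
  "v False i0 ~= 0 ==> \<bar>u' False i0\<bar> <= \<bar>v False i0\<bar>"
  "v False i0 = 0 ==> \<bar>u' True i0\<bar> <= \<bar>v True i0\<bar>"
  using pivot_normalise[OF piv] by blast
 define al ga f ph where "al = u' False" and "ga = u' True" and "f = v False" and "ph = v True"
 note defs = al_def[symmetric] ga_def[symmetric] f_def[symmetric] ph_def[symmetric]
 have e: "x b i j = 2 * om 0 u' v b i j" for b i j using x u' by simp
 have eF: "aa i j = 2 * (al i * f j - f i * al j)" for i j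
  using e[of False i j] by (simp add: xF om_def defs)
 have eT: "ac i j + dm 0 (i - j) * cc i j =
   2 * (al i * ph j - f i * ga j + dm 0 (i - j) * (ga i * ph j - ph i * ga j))" for i j
  using e[of True i j] by (simp add: xT om_def defs)
 have dmc: "dm 0 (j - i) = dm 0 (i - j)" for i j using dm_minus[of 0 "i - j"] by simp
 \<comment> \<open>the symmetric part of the block does not involve the twist\<close>
 have sy: "ac i j + ac j i = 2 * (al i * ph j - f i * ga j + al j * ph i - f j * ga i)" for i j
  using eT[of i j] eT[of j i] by (simp add: dmc[of i j] anti[of j i] algebra_simps)
 have ac0: "ac i i = 2 * (al i * ph i - f i * ga i)" for i using sy[of i i] by simp
 have Bf: "\<bar>f i\<bar> <= B" "\<bar>ph i\<bar> <= B" "\<bar>aa i j\<bar> <= B" "\<bar>ac i j\<bar> <= B" "\<bar>cc i j\<bar> <= B" for i j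
  using B by (auto simp: f_def ph_def)
 have BB: "B <= B * B" "B * B <= B * B * B" "B >= 0" "B * B >= 0" using B(3) by (auto simp: mult_left_mono[of 1 B, simplified])
 have B3: "B ^ 3 = B * B * B" by (simp add: power3_eq_cube)
 have outf: "\<bar>i\<bar> >= L ==> f i = 0 & ph i = 0" for i using vs by (simp add: f_def ph_def)
 have res: "(\<bar>al i\<bar> <= 6 * B ^ 3 & \<bar>ga i\<bar> <= 6 * B ^ 3) & (\<bar>i\<bar> >= L --> al i = 0 & ga i = 0)" for i
 proof (cases "f i0 = 0")
  case False
  have a0: "\<bar>al i0\<bar> <= B" using u'(2) False Bf(1)[of i0] by (simp add: defs)
  have a1: "2 * (al i * f i0) = aa i i0 + 2 * (f i * al i0)" for i using eF[of i i0] by simp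
  have a: "\<bar>al i\<bar> <= B + B * B" for i
   using a1[of i] abs_mult_le[OF Bf(1)[of i] a0] abs_le_mult[OF False, of "al i"] Bf(3)[of i i0] by linarith
  have g1: "2 * (ga i0 * f i0) = 2 * (al i0 * ph i0) - ac i0 i0" using ac0[of i0] by (simp add: mult.commute)
  have g0: "\<bar>ga i0\<bar> <= B + B * B"
   using g1 abs_mult_le[OF a0 Bf(2)[of i0]] abs_le_mult[OF False, of "ga i0"] Bf(4)[of i0 i0] by linarith
  have g2: "2 * (ga i * f i0) = 2 * (al i * ph i0) - 2 * (f i * ga i0) + 2 * (al i0 * ph i) - (ac i i0 + ac i0 i)" for i
   using sy[of i i0] by (simp add: algebra_simps)
  have g: "\<bar>ga i\<bar> <= (B + B * B) * B + B * (B + B * B) + B * B + B" for i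
   using g2[of i] abs_mult_le[OF a[of i] Bf(2)[of i0]] abs_mult_le[OF Bf(1)[of i] g0]
    abs_mult_le[OF a0 Bf(2)[of i]] abs_le_mult[OF False, of "ga i"] Bf(4)[of i i0] Bf(4)[of i0 i] by linarith
  have "\<bar>i\<bar> >= L ==> al i = 0" for i using a1[of i] False xs[of i i0] outf[of i] by simp
  moreover have "\<bar>i\<bar> >= L ==> ga i = 0" for i
   using g2[of i] False xs[of i i0] xs[of i0 i] outf[of i] calculation by simp
  moreover have "(B + B * B) * B + B * (B + B * B) + B * B + B <= 6 * (B * B * B)"
   using BB by (simp add: algebra_simps)
  ultimately show ?thesis using a[of i] g[of i] BB unfolding B3 by (smt (verit))
 next
  case True
  hence f0: "f i = 0" for i using piv by (auto simp: pivot_def f_def)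
  have p0: "ph i0 ~= 0" using True piv by (auto simp: pivot_def f_def ph_def)
  have g0: "\<bar>ga i0\<bar> <= B" using u'(3) True Bf(2)[of i0] by (simp add: defs)
  have a0: "\<bar>al i0\<bar> <= B"
   using ac0[of i0] f0 abs_le_mult[OF p0, of "al i0"] Bf(4)[of i0 i0] by simp
  have a1: "2 * (al i * ph i0) = ac i i0 + ac i0 i - 2 * (al i0 * ph i)" for i
   using sy[of i i0] f0 by (simp add: algebra_simps)
  have a: "\<bar>al i\<bar> <= B + B * B" for i
   using a1[of i] abs_mult_le[OF a0 Bf(2)[of i]] abs_le_mult[OF p0, of "al i"] Bf(4)[of i i0] Bf(4)[of i0 i] by linarith
  have g1: "dm 0 (i - i0) * (2 * (ga i * ph i0 - ph i * ga i0) - cc i i0) = ac i i0 - 2 * (al i * ph i0)" for i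
   using eT[of i i0] f0 by (simp add: algebra_simps)
  have g: "\<bar>ga i\<bar> <= B * B + B + B + (B + B * B) * B" for i
  proof (cases "i = i0")
   case False
   hence "dm 0 (i - i0) ~= 0" using dm0(2)[of "i - i0"] by simp
   hence "\<bar>2 * (ga i * ph i0 - ph i * ga i0) - cc i i0\<bar> <= \<bar>ac i i0 - 2 * (al i * ph i0)\<bar>"
    using abs_le_mult g1[of i] by (metis mult.commute)
   hence "\<bar>ga i * ph i0\<bar> <= \<bar>ph i * ga i0\<bar> + \<bar>cc i i0\<bar> + \<bar>ac i i0\<bar> + \<bar>al i * ph i0\<bar>"
    by (rule tri)
   thus ?thesis using abs_mult_le[OF Bf(2)[of i] g0] abs_mult_le[OF a[of i] Bf(2)[of i0]]
     abs_le_mult[OF p0, of "ga i"] Bf(4)[of i i0] Bf(5)[of i i0] BB by linarith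
  next
   case True
   have "0 <= (B + B * B) * B" using BB by simp
   thus ?thesis unfolding True using g0 BB by linarith
  qed
  have ao: "\<bar>i\<bar> >= L ==> al i = 0" for i using a1[of i] p0 xs[of i i0] xs[of i0 i] outf[of i] by simp
  moreover have "\<bar>i\<bar> >= L ==> ga i = 0" for i
  proof -
   assume i: "\<bar>i\<bar> >= L"
   hence "i ~= i0" using outf[of i0] p0 by auto
   hence "dm 0 (i - i0) ~= 0" using dm0(2)[of "i - i0"] by simp
   thus "ga i = 0" using g1[of i] xs[of i i0] i outf[of i] ao[of i] p0 by simp
  qed
  moreover have "B * B + B + B + (B + B * B) * B <= 6 * (B * B * B)"
   using BB by (simp add: algebra_simps)
  ultimately show ?thesis using a[of i] g[of i] BB unfolding B3 by (smt (verit))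
 qed
 show thesis
 proof (rule that[of u'])
  show "\<bar>u' c i\<bar> <= 6 * B ^ 3" for c i using res[of i] by (cases c) (auto simp: al_def ga_def)
  show "\<bar>i\<bar> >= L ==> u' c i = 0" for c i using res[of i] by (cases c) (auto simp: al_def ga_def)
 qed (rule e)
qed

text \<open>The difference of two solutions satisfies a homogeneous system with entries \<open>v False i0\<close> and \<open>D (i - i0) * v True i0\<close>, which at a pivot has only the trivial
solution.\<close>

lemma pivot_unique:
 assumes piv: "pivot v i0" and "i ~= i0"
  and "!!b. x b i i0 = 2 * omp (dm 0 (i - i0)) p p0 (%c. v c i) (%c. v c i0) b"
   "!!b. x b i0 i = 2 * omp (dm 0 (i0 - i)) p0 p (%c. v c i0) (%c. v c i) b"
   "!!b. x b i i0 = 2 * omp (dm 0 (i - i0)) q p0 (%c. v c i) (%c. v c i0) b"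
   "!!b. x b i0 i = 2 * omp (dm 0 (i0 - i)) p0 q (%c. v c i0) (%c. v c i) b"
 shows "p = q"
proof -
 define r where "r c = p c - q c" for c
 have d: "dm 0 (i0 - i) = dm 0 (i - i0)" using dm_minus[of 0 "i - i0"] by simp
 have d0: "dm 0 (i - i0) ~= 0" using dm0(2)[of "i - i0"] assms(2) by simp
 have "2 * (r False * v False i0) = 0"
  using assms(3)[of False] assms(5)[of False] unfolding omp_def r_def if_False left_diff_distrib right_diff_distrib by linarith
 hence F: "r False * v False i0 = 0" by simp
 have "2 * (r False * v True i0 + dm 0 (i - i0) * (r True * v True i0)) = 0"
  using assms(3)[of True] assms(5)[of True]
  unfolding omp_def r_def if_True left_diff_distrib right_diff_distrib distrib_left by linarith
 hence T1: "r False * v True i0 + dm 0 (i - i0) * (r True * v True i0) = 0" by simp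
 have "2 * (v False i0 * r True + dm 0 (i - i0) * (v True i0 * r True)) = 0"
  using assms(4)[of True] assms(6)[of True]
  unfolding omp_def r_def if_True d left_diff_distrib right_diff_distrib distrib_left by linarith
 hence T2: "v False i0 * r True + dm 0 (i - i0) * (v True i0 * r True) = 0" by simp
 have "r False = 0 & r True = 0"
 proof (cases "v False i0 = 0")
  case False
  hence r0: "r False = 0" using F by simp
  hence z: "dm 0 (i - i0) * (v True i0 * r True) = 0" using T1 by (simp add: mult.commute)
  have "v False i0 * r True = 0" using T2 unfolding z by simp
  thus ?thesis using r0 False by simp
 next
  case True
  hence "v True i0 ~= 0" using piv by (simp add: pivot_def)
  hence "r True = 0" using T2 True d0 by simp
  thus ?thesis using T1 \<open>v True i0 ~= 0\<close> by simp
 qed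
 thus "p = q" by (auto simp: r_def fun_eq_iff) (metis (full_types))
qed

text \<open>A local form of solvability that can be checked in polynomial time: instead of a solution on the whole window, only its values at three indices are guessed, the pivot and two
others.\<close>

definition pivot_eqs where
 "pivot_eqs x v L B i0 p0 \<longleftrightarrow> (ALL i j. \<bar>i\<bar> < L --> \<bar>j\<bar> < L --> (\<exists>p q :: bool => int. (ALL c. \<bar>p c\<bar> <= B & \<bar>q c\<bar> <= B) \<and>
  (i = i0 --> p = p0) & (j = i0 --> q = p0) \<and>
  (ALL b. x b i i0 = 2 * omp (dm 0 (i - i0)) p p0 (%c. v c i) (%c. v c i0) b \<and>
     x b i0 i = 2 * omp (dm 0 (i0 - i)) p0 p (%c. v c i0) (%c. v c i) b \<and>
     x b j i0 = 2 * omp (dm 0 (j - i0)) q p0 (%c. v c j) (%c. v c i0) b \<and>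
     x b i0 j = 2 * omp (dm 0 (i0 - j)) p0 q (%c. v c i0) (%c. v c j) b \<and>
     x b i j = 2 * omp (dm 0 (i - j)) p q (%c. v c i) (%c. v c j) b)))"

text \<open>Local solutions agree on overlaps because the value at the pivot determines all others, so they fit together to one solution.\<close>

lemma pivot_eqs_solvable:
 assumes piv: "pivot v i0" and i0: "\<bar>i0\<bar> < L" and eqs: "pivot_eqs x v L B i0 p0"
  and vs: "!!c i. \<bar>i\<bar> >= L ==> v c i = 0"
  and xs: "!!b i j. \<bar>i\<bar> >= L \<or> \<bar>j\<bar> >= L ==> x b i j = 0"
 shows "EX u. (ALL c i. \<bar>i\<bar> >= L --> u c i = 0) & (ALL b i j. x b i j = 2 * om 0 u v b i j)"
proof -
 define good where "good i p \<longleftrightarrow> (i = i0 --> p = p0) \<and>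
  (ALL b. x b i i0 = 2 * omp (dm 0 (i - i0)) p p0 (%c. v c i) (%c. v c i0) b \<and>
     x b i0 i = 2 * omp (dm 0 (i0 - i)) p0 p (%c. v c i0) (%c. v c i) b)" for i p
 have uniq: "p = q" if "good i p" "good i q" for i p q
 proof (cases "i = i0")
  case True thus ?thesis using that by (simp add: good_def)
 next
  case False
  show ?thesis by (rule pivot_unique[OF piv False, of x p p0 q]) (use that in \<open>unfold good_def, blast+\<close>)
 qed
 have ex: "EX p q. good i p & good j q & (ALL b. x b i j = 2 * omp (dm 0 (i - j)) p q (%c. v c i) (%c. v c j) b)"
  if ij: "\<bar>i\<bar> < L" "\<bar>j\<bar> < L" for i j
 proof -
  obtain p q where pq: "(ALL c. \<bar>p c\<bar> <= B & \<bar>q c\<bar> <= B) \<and>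
  (i = i0 --> p = p0) & (j = i0 --> q = p0) \<and>
  (ALL b. x b i i0 = 2 * omp (dm 0 (i - i0)) p p0 (%c. v c i) (%c. v c i0) b \<and>
     x b i0 i = 2 * omp (dm 0 (i0 - i)) p0 p (%c. v c i0) (%c. v c i) b \<and>
     x b j i0 = 2 * omp (dm 0 (j - i0)) q p0 (%c. v c j) (%c. v c i0) b \<and>
     x b i0 j = 2 * omp (dm 0 (i0 - j)) p0 q (%c. v c i0) (%c. v c j) b \<and>
     x b i j = 2 * omp (dm 0 (i - j)) p q (%c. v c i) (%c. v c j) b)"
   using eqs[unfolded pivot_eqs_def, THEN spec, THEN spec, THEN mp, OF ij(1), THEN mp, OF ij(2)]
   by (elim exE)
  show ?thesis
  proof (intro exI conjI allI)
   show "good i p" "good j q" unfolding good_def using pq by blast+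
   show "x b i j = 2 * omp (dm 0 (i - j)) p q (%c. v c i) (%c. v c j) b" for b using pq by blast
  qed
 qed
 define U where "U i = (SOME p. good i p)" for i
 have U: "good i (U i)" if "\<bar>i\<bar> < L" for i
  unfolding U_def using ex[OF that that] by (metis someI_ex)
 define u where "u c i = (if \<bar>i\<bar> < L then U i c else 0)" for c i
 have "x b i j = 2 * om 0 u v b i j" for b i j
 proof (cases "\<bar>i\<bar> < L & \<bar>j\<bar> < L")
  case True
  then obtain p q where pq: "good i p" "good j q"
    "x b i j = 2 * omp (dm 0 (i - j)) p q (%c. v c i) (%c. v c j) b" using ex by blast
  have "p = U i" "q = U j" using uniq pq U True by auto
  thus ?thesis using pq True by (simp add: om_omp u_def)
 next
  case False
  hence "x b i j = 0" "(ALL c. u c i = 0 & v c i = 0) \<or> (ALL c. u c j = 0 & v c j = 0)"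
   using xs vs by (auto simp: u_def)
  thus ?thesis by (auto simp: om_omp omp_def)
 qed
 moreover have "u c i = 0" if "\<bar>i\<bar> >= L" for c i using that by (simp add: u_def)
 ultimately show ?thesis by blast
qed

lemma solution_pivot_eqs:
 assumes "!!b i j. x b i j = 2 * om 0 u v b i j" "!!c i. \<bar>u c i\<bar> <= B"
 shows "pivot_eqs x v L B i0 (%c. u c i0)"
 unfolding pivot_eqs_def assms(1) om_omp
 using assms(2) by (intro allI impI exI conjI) auto

end

section \<open>Short conjugators\<close>

definition tel :: "int => int => (int => int) => int => int" where
 "tel N k f i = (SUM i':{-N..N}. of_bool (k dvd i - i' & (i - i') * k >= 0) * f i')"

lemma tel_zero: "(!!i. f i = 0) ==> tel N k f i = 0" by (simp add: tel_def)

lemmas tel_solution = telescope_solution[folded tel_def]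

lemma power_le_int: "1 <= (x::int) ==> a <= b ==> x ^ a <= x ^ b"
 by (rule power_increasing)

context exponents
begin

text \<open>The right-hand side of the difference equation for the exponents of a conjugator of height \<open>s\<close>.\<close>

definition dlt :: "int => word => word => bool => int => int" where
 "dlt s w w' c i = cv 0 w' c i - cv 0 w c (i - s)"

text \<open>The exponents of the conjugator: the unique finitely supported solution.\<close>

definition u0 :: "int => int => word => word => bool => int => int" where
 "u0 N s w w' c = tel N (ht w) (dlt s w w' c)"

text \<open>What remains for the central coordinates of the conjugator after its exponents are fixed.\<close>

definition x1 :: "int => int => word => word => bool => int => int => int" where
 "x1 N s w w' b i j = zz 0 w' b i j - zz 0 w b (i - s) (j - s)
  + om 0 (cv 0 w') (%c i. u0 N s w w' c (i - ht w)) b i j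
  - om 0 (u0 N s w w') (%c i. cv 0 w c (i - s)) b i j"

text \<open>Solvability of the two difference equations, expressed by sums over the orbits of the shift by \<open>ht w\<close>: first of the exponents, then along each diagonal of the central
coordinates, on which \<open>D\<close> is constant.\<close>

definition orbit_crit :: "int => int => word => word => bool" where
 "orbit_crit L s w w' \<longleftrightarrow>
  (ALL c ii. class_sum (3*L) (ht w) ii (dlt s w w' c) = 0) \<and>
  (ALL b \<kappa> ii. class_sum (4*L) (ht w) ii (%i. x1 (3*L) s w w' b i (i - \<kappa>)) = 0)"

lemma dlt_supp:
 assumes "int (length w) <= L" "int (length w') <= L" "\<bar>s\<bar> <= 2 * L" "\<bar>i\<bar> > 3 * L"
 shows "dlt s w w' c i = 0"
 using cv_supp[of w' i c] cv_supp[of w "i - s" c] assms by (simp add: dlt_def)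

lemma abs_dlt: "int (length w) <= L ==> int (length w') <= L ==> \<bar>dlt s w w' c i\<bar> <= 2 * L"
 using abs_cv[of 0 w' c i] abs_cv[of 0 w c "i - s"] by (simp add: dlt_def)

lemma om_supp: "(!!c. u c i = 0) ==> (!!c. v c i = 0) ==> om m u v b i j = 0"
 "(!!c. u c j = 0) ==> (!!c. v c j = 0) ==> om m u v b i j = 0"
 by (auto simp: om_def)

context
 fixes w w' :: word and L s :: int
 assumes len: "int (length w) <= L" "int (length w') <= L" and s: "\<bar>s\<bar> <= 2 * L" and L: "L >= 1"
  and ht: "ht w = ht w'" "ht w ~= 0"
begin

text \<open>The exponents of any conjugator are forced to be \<open>u0\<close>, since two solutions differ by a periodic function with finite support. Hence its central coordinates solve the equation
with right-hand side \<open>x1\<close>, and telescoping gives the vanishing sums.\<close>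

lemma conj_shift_imp_orbit:
 assumes "conj_shift s w w'"
 shows "orbit_crit L s w w'"
proof -
 obtain h where h: "ht h = s" "E (h @ w) (w' @ h)" using assms by (auto simp: conj_shift_def)
 define k where "k = ht w"
 have k: "k ~= 0" "ht w' = k" using ht by (auto simp: k_def)
 have d: "dlt s w w' c i = cv 0 h c i - cv 0 h c (i - k)" for c i
  using conj_eqs(2)[OF h(2), of c i] h(1) k by (simp add: dlt_def)
 have ds: "\<bar>i\<bar> > 3 * L ==> dlt s w w' c i = 0" for c i using dlt_supp len s by blast
 have 1: "class_sum (3*L) k ii (dlt s w w' c) = 0" for c ii
  by (rule telescope_sum[of _ "cv 0 h c" k "3*L" "int (length h)"]) (use d ds cv_supp in auto)
 have L0: "3 * L >= 0" using L by simp
 note t = tel_solution[OF k(1) ds L0 1 abs_dlt[OF len]]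
 have u: "u0 (3*L) s w w' c i - u0 (3*L) s w w' c (i - k) = dlt s w w' c i"
  and us: "\<bar>i\<bar> > 3 * L ==> u0 (3*L) s w w' c i = 0" for c i
  unfolding u0_def k_def[symmetric] by (simp_all only: t)
 have "u0 (3*L) s w w' c i - cv 0 h c i = 0" for c i
 proof (rule periodic_finite_support[OF k(1), of "%i. u0 (3*L) s w w' c i - cv 0 h c i" "3 * L + int (length h)"])
  show "u0 (3*L) s w w' c i - cv 0 h c i = u0 (3*L) s w w' c (i - k) - cv 0 h c (i - k)" for i
   using u[of c i] d[of c i] by linarith
  show "u0 (3*L) s w w' c i - cv 0 h c i = 0" if "\<bar>i\<bar> > 3 * L + int (length h)" for i
   using us[of i c] cv_supp[of h i c] that L by linarith
 qed
 hence uh: "u0 (3*L) s w w' = cv 0 h" by (intro ext) simp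
 have x: "x1 (3*L) s w w' b i j = zz 0 h b i j - zz 0 h b (i - k) (j - k)" for b i j
  using conj_eqs(3)[OF h(2), of b i j] h(1) k by (simp add: x1_def uh k_def[symmetric])
 have "class_sum (4*L) k ii (%i. x1 (3*L) s w w' b i (i - \<kappa>)) = 0" for b \<kappa> ii
 proof (rule telescope_sum[of "%i. x1 (3*L) s w w' b i (i - \<kappa>)" "%i. zz 0 h b i (i - \<kappa>)" k _ "int (length h)"])
  fix i assume i: "\<bar>i\<bar> > 4 * L"
  have "\<bar>k\<bar> <= L" using ht_le[of w] len by (simp add: k_def)
  hence "u0 (3*L) s w w' c (i - k) = 0" "u0 (3*L) s w w' c i = 0" for c using us i L by auto
  moreover have "cv 0 w' c i = 0" "cv 0 w c (i - s) = 0" for c using i s L len by (auto intro!: cv_supp)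
  moreover have "zz 0 w' b i (i - \<kappa>) = 0" "zz 0 w b (i - s) (i - \<kappa> - s) = 0" using i s L len by (auto intro!: zz_supp)
  ultimately show "x1 (3*L) s w w' b i (i - \<kappa>) = 0"
   unfolding x1_def k_def[symmetric] by (simp add: om_supp(1))
 next
  show "zz 0 h b i (i - \<kappa>) = 0" if "\<bar>i\<bar> > int (length h)" for i using that by (intro zz_supp) auto
  show "x1 (3*L) s w w' b i (i - \<kappa>) = zz 0 h b i (i - \<kappa>) - zz 0 h b (i - k) (i - k - \<kappa>)" for i
   using x[of b i "i - \<kappa>"] by (simp add: algebra_simps)
 qed
 thus ?thesis using 1 unfolding orbit_crit_def k_def by blast
qed

lemma u0_props:
 assumes cs: "!!c ii. class_sum (3*L) (ht w) ii (dlt s w w' c) = 0"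
 shows "u0 (3*L) s w w' c i - u0 (3*L) s w w' c (i - ht w) = dlt s w w' c i"
  "\<bar>i\<bar> > 3 * L ==> u0 (3*L) s w w' c i = 0"
  "\<bar>u0 (3*L) s w w' c i\<bar> <= (2 * (3 * L) + 1) * (2 * L)"
proof -
 have L0: "3 * L >= 0" using L by simp
 have ds: "\<bar>i\<bar> > 3 * L ==> dlt s w w' c i = 0" for c i using dlt_supp len s by blast
 note t = tel_solution[OF ht(2) ds L0 cs abs_dlt[OF len]]
 show "u0 (3*L) s w w' c i - u0 (3*L) s w w' c (i - ht w) = dlt s w w' c i"
  "\<bar>i\<bar> > 3 * L ==> u0 (3*L) s w w' c i = 0"
  "\<bar>u0 (3*L) s w w' c i\<bar> <= (2 * (3 * L) + 1) * (2 * L)"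
  unfolding u0_def by (simp_all only: t)
qed

lemma x1_supp:
 assumes cs: "!!c ii. class_sum (3*L) (ht w) ii (dlt s w w' c) = 0"
  and i: "\<bar>i\<bar> > 4 * L"
 shows "x1 (3*L) s w w' b i j = 0"
proof -
 have "\<bar>ht w\<bar> <= L" using ht_le[of w] len by simp
 hence "u0 (3*L) s w w' c (i - ht w) = 0" "u0 (3*L) s w w' c i = 0" for c
  using i L by (auto intro!: u0_props(2)[OF cs])
 moreover have "cv 0 w' c i = 0" "cv 0 w c (i - s) = 0" for c using i s L len by (auto intro!: cv_supp)
 moreover have "zz 0 w' b i j = 0" "zz 0 w b (i - s) (j - s) = 0" using i s L len by (auto intro!: zz_supp)
 ultimately show ?thesis unfolding x1_def by (simp add: om_supp(1))
qed

text \<open>Choosing a word \<open>h0\<close> with exponents \<open>u0\<close> turns the abstract expression into a difference of coordinates of two words. Its own central coordinates telescope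
away.\<close>

lemma orbit_sum_words:
 assumes cs: "!!c ii. class_sum (3*L) (ht w) ii (dlt s w w' c) = 0"
  and h0: "ht h0 = 0" "cv 0 h0 = u0 (3*L) s w w'"
  and N: "4 * L <= N" "int (length h0) + L <= N" "int (length (h0 @ pw 0 s @ w)) <= N" "int (length (w' @ h0 @ pw 0 s)) <= N"
 shows "class_sum N (ht w) ii (%i. (zz 0 (w' @ h0 @ pw 0 s) b i (i - \<mu>) - zz 0 (h0 @ pw 0 s @ w) b i (i - \<mu>)))
  = class_sum (4*L) (ht w) ii (%i. x1 (3*L) s w w' b i (i - \<mu>))"
proof -
 define z where "z b i j = zz 0 h0 b i j - zz 0 h0 b (i - ht w) (j - ht w)" for b i j
 have x: "zz 0 (w' @ h0 @ pw 0 s) b i j - zz 0 (h0 @ pw 0 s @ w) b i j = x1 (3*L) s w w' b i j - z b i j" for b i j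
  by (simp add: zz_append h0 ht_pw x1_def z_def ht(1))
 have hk: "\<bar>ht w\<bar> <= L" using ht_le[of w] len by simp
 have hs: "z b i (i - \<mu>) = 0" if "\<bar>i\<bar> > N" for i
 proof -
  have "\<bar>i\<bar> >= int (length h0)" "\<bar>i - ht w\<bar> >= int (length h0)" using that hk N L by linarith+
  thus ?thesis by (simp add: z_def zz_supp)
 qed
 have "class_sum N (ht w) ii (%i. z b i (i - \<mu>)) = 0"
  by (rule telescope_sum[of "%i. z b i (i - \<mu>)" "%i. zz 0 h0 b i (i - \<mu>)" "ht w" _ "int (length h0)"])
   (use hs in \<open>auto simp: z_def zz_supp diff_diff_eq add.commute\<close>)
 moreover have "class_sum N (ht w) ii (%i. x1 (3*L) s w w' b i (i - \<mu>)) =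
    class_sum (4*L) (ht w) ii (%i. x1 (3*L) s w w' b i (i - \<mu>))"
  by (rule sum_window) (use x1_supp[OF cs] N in auto)
 ultimately show ?thesis
  by (simp add: x right_diff_distrib sum_subtractf del: sum_of_bool_mult_eq)
qed

text \<open>First a word \<open>h0\<close> with the required exponents. Then \<open>h0 t^s w\<close> and \<open>w' h0 t^s\<close> differ by a central element, which must be written as a difference
along the shift by a central element that is again short, although \<open>D\<close> may be huge. The central coordinates are split as \<open>ac + D cc\<close> with bounded integers \<open>ac\<close>
and \<open>cc\<close>: if \<open>D\<close> exceeds the bound \<open>Bs\<close> for the orbit sums, then the sums of \<open>ac\<close> and of \<open>cc\<close> vanish separately and the two parts are
solved separately; otherwise \<open>D\<close> itself is polynomial.\<close>

lemma orbit_imp_short_conjugator: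
 assumes crit: "orbit_crit L s w w'"
 obtains h where "ht h = s" "E (h @ w) (w' @ h)" "int (length h) <= 17000 * (283 * L ^ 3) ^ 8"
proof -
 define k where "k = ht w"
 have k: "k ~= 0" "ht w' = k" using ht by (auto simp: k_def)
 have 1: "class_sum (3*L) (ht w) ii (dlt s w w' c) = 0" for c ii
  using crit by (simp add: orbit_crit_def)
 define U where "U = u0 (3*L) s w w'"
 have u: "U c i - U c (i - k) = dlt s w w' c i" and us: "\<bar>i\<bar> > 3 * L ==> U c i = 0"
  and ub: "\<bar>U c i\<bar> <= (2 * (3 * L) + 1) * (2 * L)" for c i
  unfolding U_def k_def by (simp_all only: u0_props[OF 1])
 obtain h0 where h0: "ht h0 = 0" "!!c i. cv 0 h0 c i = U c i"
   "int (length h0) <= (2 * (3 * L) + 1) * (4 * (3 * L) + 2 * ((2 * (3 * L) + 1) * (2 * L)))"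
  using word_of_vector[of "3 * L" U, OF us ub] L by auto
 have cvh0: "cv 0 h0 = U" using h0(2) by (intro ext) simp
 define rho where "rho = 283 * L ^ 3"
 have L3: "L <= L ^ 2" "L ^ 2 <= L ^ 3" "1 <= L ^ 3" using L power_le_int[OF L, of 1 2] by (auto intro: power_le_int)
 have l1: "rho >= 1" using L3 by (simp add: rho_def)
 have lh0: "int (length h0) <= 280 * L ^ 3"
 proof -
  have "(2 * (3 * L) + 1) * (4 * (3 * L) + 2 * ((2 * (3 * L) + 1) * (2 * L))) = 144 * L ^ 3 + 120 * L\<^sup>2 + 16 * L"
   by (simp add: power2_eq_square power3_eq_cube algebra_simps)
  thus ?thesis using h0(3) L3 by linarith
 qed
 define A A' where "A = h0 @ pw 0 s @ w" and "A' = w' @ h0 @ pw 0 s"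
 have lA: "int (length A) <= rho" "int (length A') <= rho"
  using lh0 len s L3 by (auto simp: A_def A'_def rho_def)
 have htA: "ht A = s + k" "ht A' = s + k" using h0(1) k by (auto simp: A_def A'_def ht_pw k_def)
 have cvA: "cv 0 A c i = cv 0 A' c i" for c i
  using u[of c i] by (simp add: A_def A'_def h0(1) ht_pw k cvh0 dlt_def)
 define aa ac cc where "aa i j = (cP 0 A' False False i j - cP 0 A False False i j) div 2"
  and "ac i j = (cP 0 A' False True i j - cP 0 A False True i j) div 2"
  and "cc i j = (cP 0 A' True True i j - cP 0 A True True i j) div 2" for i j
 have ev: "even (cP 0 A' c c' i j - cP 0 A c c' i j)" for c c' i j
 proof (cases "(c, i) = (c', j)")
  case True
  thus ?thesis using cP_antisym[of 0 A' c c i i] cP_antisym[of 0 A c c i i] by simp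
 next
  case False
  have e: "cP 0 A' c c' i j - cP 0 A c c' i j = (cP 0 A' c c' i j - cv 0 A' c i * cv 0 A' c' j)
   - (cP 0 A c c' i j - cv 0 A c i * cv 0 A c' j)" by (simp add: cvA)
  show ?thesis unfolding e using cP_parity[OF False, of A] cP_parity[OF False, of A'] by (rule dvd_diff[rotated])
 qed
 have half: "2 * aa i j = cP 0 A' False False i j - cP 0 A False False i j"
  "2 * ac i j = cP 0 A' False True i j - cP 0 A False True i j"
  "2 * cc i j = cP 0 A' True True i j - cP 0 A True True i j" for i j
  using ev by (auto simp: aa_def ac_def cc_def)
 have anti: "aa j i = - aa i j" "cc j i = - cc i j" for i j
  using half[of i j] half[of j i] cP_antisym[of 0 A False False j i] cP_antisym[of 0 A' False False j i]
  cP_antisym[of 0 A True True j i] cP_antisym[of 0 A' True True j i] by auto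
 have supp: "aa i j = 0" "ac i j = 0" "cc i j = 0" if "\<bar>i\<bar> > rho \<or> \<bar>j\<bar> > rho" for i j
 proof -
  have "cP 0 A' c c' i j = 0" "cP 0 A c c' i j = 0" for c c'
   using that lA cP_supp[of A i j] cP_supp[of A' i j] by auto
  thus "aa i j = 0" "ac i j = 0" "cc i j = 0" by (auto simp: aa_def ac_def cc_def)
 qed
 have bd: "\<bar>aa i j\<bar> <= 2 * rho\<^sup>2" "\<bar>ac i j\<bar> <= 2 * rho\<^sup>2" "\<bar>cc i j\<bar> <= 2 * rho\<^sup>2" for i j
 proof -
  have "\<bar>cP 0 A' c c' i j\<bar> <= 2 * rho\<^sup>2" "\<bar>cP 0 A c c' i j\<bar> <= 2 * rho\<^sup>2" for c c'
   using abs_cP[of 0 A c c' i j] abs_cP[of 0 A' c c' i j] power_mono[OF lA(1), of 2] power_mono[OF lA(2), of 2]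
   by auto
  note this[of False False] this[of False True] this[of True True]
  thus "\<bar>aa i j\<bar> <= 2 * rho\<^sup>2" "\<bar>ac i j\<bar> <= 2 * rho\<^sup>2" "\<bar>cc i j\<bar> <= 2 * rho\<^sup>2"
   using half[of i j] by linarith+
 qed
 have xF: "zz 0 A' False i j - zz 0 A False i j = 2 * aa i j" for i j
  by (simp add: zz_def half)
 have xT: "zz 0 A' True i j - zz 0 A True i j = 2 * (ac i j + dm 0 (i - j) * cc i j)" for i j
 proof -
  have "zz 0 A' True i j - zz 0 A True i j = (cP 0 A' False True i j - cP 0 A False True i j)
    + dm 0 (i - j) * (cP 0 A' True True i j - cP 0 A True True i j)"
   by (simp add: zz_def algebra_simps)
  also have "... = 2 * ac i j + dm 0 (i - j) * (2 * cc i j)" by (simp only: half)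
  finally show ?thesis by simp
 qed
 have S: "class_sum rho k ii (%i. (zz 0 A' b i (i - \<kappa>) - zz 0 A b i (i - \<kappa>))) = 0" for b \<kappa> ii
 proof -
  have N: "4 * L <= rho" "int (length h0) + L <= rho" using lh0 L3 by (auto simp: rho_def)
  show ?thesis unfolding A_def A'_def k_def
   orbit_sum_words[OF 1 h0(1) cvh0[unfolded U_def] N lA[unfolded A_def A'_def]]
   using crit by (simp add: orbit_crit_def)
 qed
 define Bs where "Bs = (2 * rho + 1) * (2 * rho\<^sup>2)"
 have cl: "int (card {-rho..rho}) = 2 * rho + 1" using l1 by simp
 have Sa: "class_sum rho k ii (%i. aa i (i - \<kappa>)) = 0" for \<kappa> ii
  using S[of ii False \<kappa>] unfolding xF mult.left_commute[of _ 2] sum_distrib_left[symmetric] by simp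
 define Sac Scc where "Sac \<kappa> ii = class_sum rho k ii (%i. ac i (i - \<kappa>))"
  and "Scc \<kappa> ii = class_sum rho k ii (%i. cc i (i - \<kappa>))" for \<kappa> ii
 have S2: "Sac \<kappa> ii + dm 0 \<kappa> * Scc \<kappa> ii = 0" for \<kappa> ii
 proof -
  have "2 * (Sac \<kappa> ii + dm 0 \<kappa> * Scc \<kappa> ii) =
   class_sum rho k ii (%i. (zz 0 A' True i (i - \<kappa>) - zz 0 A True i (i - \<kappa>)))"
   unfolding xT Sac_def Scc_def sum_distrib_left distrib_left sum.distrib[symmetric]
   by (intro sum.cong HOL.refl) (simp add: algebra_simps)
  thus ?thesis unfolding S by simp
 qed
 \<comment> \<open>\<open>|Sac| \<le> Bs < D\<close> and \<open>Sac = - D Scc\<close> leave only \<open>Scc = 0\<close>.\<close>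
 have big: "Sac \<kappa> ii = 0 & Scc \<kappa> ii = 0" if "dm 0 \<kappa> > Bs" for \<kappa> ii
 proof -
  have "\<bar>Sac \<kappa> ii\<bar> <= int (card {-rho..rho}) * (2 * rho\<^sup>2)"
   unfolding Sac_def by (rule abs_sum_le) (use bd in \<open>auto simp: of_bool_def\<close>)
  hence a: "\<bar>Sac \<kappa> ii\<bar> <= Bs" by (simp only: cl Bs_def)
  have "Scc \<kappa> ii = 0"
  proof (rule ccontr)
   assume "Scc \<kappa> ii ~= 0"
   hence "\<bar>dm 0 \<kappa>\<bar> <= \<bar>dm 0 \<kappa> * Scc \<kappa> ii\<bar>" by (rule abs_le_mult)
   thus False using a S2[of \<kappa> ii] that by linarith
  qed
  thus ?thesis using S2[of \<kappa> ii] by simp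
 qed
 \<comment> \<open>For large \<open>D\<close> the two parts stay apart, for small \<open>D\<close> everything is put into the first part.\<close>
 define fC gC where "fC \<kappa> i = (if dm 0 \<kappa> > Bs then ac i (i - \<kappa>) else ac i (i - \<kappa>) + dm 0 \<kappa> * cc i (i - \<kappa>))"
  and "gC \<kappa> i = (if dm 0 \<kappa> > Bs then cc i (i - \<kappa>) else 0)" for \<kappa> i
 define B1 where "B1 = 2 * rho\<^sup>2 * (1 + Bs)"
 have Bs0: "Bs >= 0" using l1 by (simp add: Bs_def)
 have B1: "2 * rho\<^sup>2 <= B1" "B1 >= 0" using Bs0 by (auto simp: B1_def algebra_simps)
 have fb: "\<bar>fC \<kappa> i\<bar> <= B1" "\<bar>gC \<kappa> i\<bar> <= B1" "\<bar>aa i j\<bar> <= B1" for \<kappa> i j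
 proof -
  have "\<bar>dm 0 \<kappa> * cc i (i - \<kappa>)\<bar> <= Bs * (2 * rho\<^sup>2)" if "dm 0 \<kappa> <= Bs"
   using that dm0(3)[of \<kappa>] bd(3) by (intro abs_mult_le) auto
  thus "\<bar>fC \<kappa> i\<bar> <= B1" using bd(2)[of i "i - \<kappa>"] B1 by (auto simp: fC_def B1_def algebra_simps)
  show "\<bar>gC \<kappa> i\<bar> <= B1" using bd(3)[of i "i - \<kappa>"] B1 by (auto simp: gC_def)
  show "\<bar>aa i j\<bar> <= B1" using bd(1)[of i j] B1 by simp
 qed
 have fs: "fC \<kappa> i = 0" "gC \<kappa> i = 0" "aa i (i - \<kappa>) = 0" if "\<bar>i\<bar> > rho" for \<kappa> i
  using that by (auto simp: fC_def gC_def supp)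
 have fS: "class_sum rho k ii (fC \<kappa>) = 0"
  "class_sum rho k ii (gC \<kappa>) = 0" for \<kappa> ii
 proof -
  have *: "Sac \<kappa> ii + dm 0 \<kappa> * Scc \<kappa> ii =
    class_sum rho k ii (%i. (ac i (i - \<kappa>) + dm 0 \<kappa> * cc i (i - \<kappa>)))"
   unfolding Sac_def Scc_def sum_distrib_left distrib_left sum.distrib[symmetric]
   by (intro sum.cong HOL.refl) (simp add: algebra_simps)
  show "class_sum rho k ii (fC \<kappa>) = 0"
   "class_sum rho k ii (gC \<kappa>) = 0"
   unfolding fC_def gC_def using big[of \<kappa> ii] S2[of \<kappa> ii] *
   by (cases "dm 0 \<kappa> > Bs"; simp add: Sac_def Scc_def del: sum_of_bool_mult_eq)+
 qed
 have l0: "rho >= 0" using l1 by simp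
 note tC = tel_solution[OF k(1) fs(1) l0 fS(1) fb(1)]
  and tG = tel_solution[OF k(1) fs(2) l0 fS(2) fb(2)]
  and tA = tel_solution[OF k(1) fs(3) l0 Sa fb(3)]
 define ta tg where "ta i j = tel rho k (%i'. aa i' (i' - (i - j))) i" and "tg i j = tel rho k (gC (i - j)) i" for i j
 \<comment> \<open>The \<open>aa\<close> and \<open>cc\<close> parts must be antisymmetric, so they are solved above the diagonal and reflected.\<close>
 define yaa yac ycc where "yaa i j = (if i < j then ta i j else if j < i then - ta j i else 0)"
  and "yac i j = tel rho k (fC (i - j)) i"
  and "ycc i j = (if i < j then tg i j else if j < i then - tg j i else 0)" for i j
 have tad: "ta i j - ta (i - k) (j - k) = aa i j" and tgd: "tg i j - tg (i - k) (j - k) = gC (i - j) i" for i j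
  using tA(1)[of "i - j" i] tG(1)[of "i - j" i] by (auto simp: ta_def tg_def)
 have d1: "yaa i j - yaa (i - k) (j - k) = aa i j" for i j
  using tad[of i j] tad[of j i] anti(1)[of i j] anti(1)[of i i] by (cases i j rule: linorder_cases) (auto simp: yaa_def)
 have ganti: "gC (j - i) j = - gC (i - j) i" for i j
  using anti(2)[of i j] dm_minus[of 0 "i - j"] by (simp add: gC_def)
 have d2: "ycc i j - ycc (i - k) (j - k) = gC (i - j) i" for i j
  using tgd[of i j] tgd[of j i] ganti[of i j] ganti[of i i]
  by (cases i j rule: linorder_cases) (auto simp: ycc_def)
 have d3: "yac i j - yac (i - k) (j - k) = fC (i - j) i" for i j
  using tC(1)[of "i - j" i] by (simp add: yac_def)
 have far: "ta i j = 0" "tg i j = 0" "yac i j = 0" if "\<bar>i\<bar> > 3 * rho \<or> \<bar>j\<bar> > 3 * rho" for i j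
 proof -
  have "ta i j = 0 & tg i j = 0 & yac i j = 0"
  proof (cases "\<bar>i\<bar> > rho")
   case True
   thus ?thesis using tA(2) tG(2) tC(2) by (simp add: ta_def tg_def yac_def)
  next
   case False
   hence "\<bar>i - j\<bar> > 2 * rho" using that l1 by linarith
   hence "\<bar>i'\<bar> > rho \<or> \<bar>i' - (i - j)\<bar> > rho" for i' by linarith
   hence "aa i' (i' - (i - j)) = 0" "gC (i - j) i' = 0" "fC (i - j) i' = 0" for i'
    using supp[of i' "i' - (i - j)"] by (auto simp: gC_def fC_def)
   thus ?thesis unfolding ta_def tg_def yac_def by (intro conjI tel_zero)
  qed
  thus "ta i j = 0" "tg i j = 0" "yac i j = 0" by auto
 qed
 define B where "B = (2 * rho + 1) * B1"
 have B0: "B >= 0" using B1 l1 by (simp add: B_def)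
 obtain y where y: "ht y = 0" "!!c i. cv 0 y c i = 0" "!!i j. zz 0 y False i j = 2 * yaa i j"
   "!!i j. zz 0 y True i j = 2 * (yac i j + dm 0 (i - j) * ycc i j)"
   "int (length y) <= (2 * (3 * rho) + 1)\<^sup>2 * (24 * (3 * rho) + 6 * B + 6)"
 proof (rule word_of_central[of yaa ycc "3 * rho" yac B])
  show "yaa j i = - yaa i j" "ycc j i = - ycc i j" for i j by (auto simp: yaa_def ycc_def)
  show "yaa i j = 0 & yac i j = 0 & ycc i j = 0" if "3 * rho < \<bar>i\<bar> \<or> 3 * rho < \<bar>j\<bar>" for i j
  proof -
   have "3 * rho < \<bar>j\<bar> \<or> 3 * rho < \<bar>i\<bar>" using that by blast
   thus ?thesis using far[OF that] far[of j i] by (auto simp: yaa_def ycc_def)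
  qed
  show "\<bar>yaa i j\<bar> <= B & \<bar>yac i j\<bar> <= B & \<bar>ycc i j\<bar> <= B" for i j
   using tA(3)[of "i - j" i] tA(3)[of "j - i" j] tG(3)[of "i - j" i] tG(3)[of "j - i" j] tC(3)[of "i - j" i] B0
   by (auto simp: yaa_def yac_def ycc_def ta_def tg_def B_def)
 qed (use l1 in auto)
 have cvy: "cv 0 y = (%c i. 0)" using y(2) by (intro ext)
 have zy: "zz 0 y b i j - zz 0 y b (i - k) (j - k) = zz 0 A' b i j - zz 0 A b i j" for b i j
 proof (cases b)
  case True
  have "zz 0 y True i j - zz 0 y True (i - k) (j - k) = 2 * ((yac i j - yac (i - k) (j - k)) + dm 0 (i - j) * (ycc i j - ycc (i - k) (j - k)))"
   by (simp add: y algebra_simps)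
  also have "... = 2 * (ac i j + dm 0 (i - j) * cc i j)" unfolding d2 d3 by (simp add: fC_def gC_def)
  finally show ?thesis using True xT by simp
 next
  case False
  thus ?thesis using d1[of i j] xF[of i j] by (simp add: y)
 qed
 have "E ((y @ h0 @ pw 0 s) @ w) (w' @ y @ h0 @ pw 0 s)"
 proof -
  have 1: "(y @ h0 @ pw 0 s) @ w = y @ A" by (simp add: A_def)
  have a: "zz 0 (y @ A) b i j = zz 0 y b i j + zz 0 A b i j" for b i j by (simp add: zz_append y(1) cvy)
  have b: "zz 0 (w' @ y @ h0 @ pw 0 s) b i j = zz 0 A' b i j + zz 0 y b (i - k) (j - k)" for b i j
   unfolding A'_def by (simp add: zz_append y(1) cvy k h0(1))
  have "zz 0 (y @ A) b i j = zz 0 (w' @ y @ h0 @ pw 0 s) b i j" for b i j using zy[of b i j] unfolding a b by simp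
  moreover have "cv 0 (y @ A) c i = cv 0 (w' @ y @ h0 @ pw 0 s) c i" for c i
   using cvA[of c i] by (simp add: A'_def y(1) cvy)
  moreover have "ht (y @ A) = ht (w' @ y @ h0 @ pw 0 s)" using htA by (simp add: y(1) A'_def)
  ultimately show ?thesis unfolding 1 E_iff by blast
 qed
 moreover have "ht (y @ h0 @ pw 0 s) = s" using y(1) h0(1) by (simp add: ht_pw)
 moreover have "int (length (y @ h0 @ pw 0 s)) <= 17000 * rho ^ 8"
 proof -
  have p: "rho <= rho ^ 6" "1 <= rho ^ 6" "rho ^ 3 >= 1" "rho <= rho ^ 8" using power_le_int[OF l1, of 1 6] power_le_int[OF l1, of 0 6] power_le_int[OF l1, of 0 3]
   power_le_int[OF l1, of 1 8] by auto
  have "Bs <= (3 * rho) * (2 * rho\<^sup>2)" unfolding Bs_def using l1 by (intro mult_right_mono) auto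
  hence "1 + Bs <= 7 * rho ^ 3" using p by (simp add: power2_eq_square power3_eq_cube)
  hence "B1 <= 2 * rho\<^sup>2 * (7 * rho ^ 3)" unfolding B1_def by (intro mult_left_mono) auto
  hence "B <= (3 * rho) * (2 * rho\<^sup>2 * (7 * rho ^ 3))" unfolding B_def using l1 B1 by (intro mult_mono) auto
  also have "... = 42 * rho ^ 6" by (simp add: eval_nat_numeral)
  finally have "24 * (3 * rho) + 6 * B + 6 <= 330 * rho ^ 6" using p by simp
  moreover have "(2 * (3 * rho) + 1)\<^sup>2 <= (7 * rho)\<^sup>2" using l1 by (intro power_mono) auto
  ultimately have "(2 * (3 * rho) + 1)\<^sup>2 * (24 * (3 * rho) + 6 * B + 6) <= (7 * rho)\<^sup>2 * (330 * rho ^ 6)"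
   using l1 B0 by (intro mult_mono) auto
  also have "... = 16170 * rho ^ 8" by (simp add: eval_nat_numeral)
  finally have "int (length y) <= 16170 * rho ^ 8" using y(5) by simp
  moreover have "int (length h0) + \<bar>s\<bar> <= rho" using lh0 s L3 by (simp add: rho_def)
  ultimately show ?thesis using p by simp
 qed
 ultimately show thesis using that[of "y @ h0 @ pw 0 s"] by (simp add: rho_def)
qed

end

end

section \<open>A bounded criterion for conjugacy\<close>

context exponents
begin

text \<open>The bounds come from \<open>pivot_bound\<close> with values at most \<open>4 L\<^sup>2\<close>, since \<open>6 (4 L\<^sup>2)\<^sup>3 = 384 L\<^sup>6\<close>.\<close>

definition zero_crit :: "int => int => word => word => bool" where
 "zero_crit L s w w' \<longleftrightarrow> (ALL c i. cv 0 w' c i = cv 0 w c (i - s)) \<and>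
  ((ALL c i. cv 0 w' c i = 0) & (ALL b i j. zz 0 w' b i j = zz 0 w b (i - s) (j - s)) \<or>
   (EX i0. \<bar>i0\<bar> < 3 * L & pivot (cv 0 w') i0 & (EX p0. (ALL c. \<bar>p0 c\<bar> <= 384 * L ^ 6) \<and>
    pivot_eqs (%b i j. zz 0 w' b i j - zz 0 w b (i - s) (j - s)) (cv 0 w') (3 * L) (384 * L ^ 6) i0 p0)))"

definition conj_crit :: "int => word => word => bool" where
 "conj_crit L w w' \<longleftrightarrow> ht w = ht w' \<and>
  (EX s. \<bar>s\<bar> <= 2 * L & (if ht w ~= 0 then orbit_crit L s w w' else zero_crit L s w w'))"

context
 fixes w w' :: word and L :: int
 assumes len: "int (length w) <= L" "int (length w') <= L" and L: "L >= 1"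
begin

lemma short_solution:
 assumes s: "\<bar>s\<bar> <= 2 * L" and piv: "pivot (cv 0 w') i0"
  and Z: "Z = (%b i j. zz 0 w' b i j - zz 0 w b (i - s) (j - s))"
  and u: "!!b i j. Z b i j = 2 * om 0 u (cv 0 w') b i j"
 obtains u' where "!!b i j. Z b i j = 2 * om 0 u' (cv 0 w') b i j" "!!c i. \<bar>i\<bar> >= 3 * L ==> u' c i = 0"
  "!!c i. \<bar>u' c i\<bar> <= 384 * L ^ 6"
proof -
 note outer = that
 define dP where "dP c c' i j = cP 0 w' c c' i j - cP 0 w c c' (i - s) (j - s)" for c c' i j
 have cb: "\<bar>dP c c' i j\<bar> <= 4 * L\<^sup>2" for c c' i j
  using abs_cP[of 0 w' c c' i j] abs_cP[of 0 w c c' "i - s" "j - s"] power_mono[OF len(1), of 2] power_mono[OF len(2), of 2]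
  by (simp add: dP_def)
 have cs: "dP c c' i j = 0" if "\<bar>i\<bar> >= 3 * L \<or> \<bar>j\<bar> >= 3 * L" for c c' i j
 proof -
  have "\<bar>i\<bar> >= int (length w') \<or> \<bar>j\<bar> >= int (length w')" "\<bar>i - s\<bar> >= int (length w) \<or> \<bar>j - s\<bar> >= int (length w)"
   using that s len by linarith+
  thus ?thesis by (simp add: cP_supp dP_def)
 qed
 have L2: "L <= L\<^sup>2" "1 <= L\<^sup>2" using power_le_int[OF L, of 1 2] power_le_int[OF L, of 0 2] by auto
 have e: "6 * (4 * L\<^sup>2) ^ 3 = 384 * L ^ 6" by (simp add: power_mult_distrib power_mult[symmetric])
 show thesis
 proof (rule pivot_bound[of Z u "cv 0 w'" "dP False False" "dP False True" "dP True True" "3 * L" "4 * L\<^sup>2" i0])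
  show "Z False i j = dP False False i j" for i j by (simp add: Z zz_def dP_def)
  show "Z True i j = dP False True i j + dm 0 (i - j) * dP True True i j" for i j
   by (simp add: Z zz_def dP_def algebra_simps)
  show "dP True True j i = - dP True True i j" for i j
   using cP_antisym[of 0 w' True True j i] cP_antisym[of 0 w True True "j - s" "i - s"] by (simp add: dP_def)
  show "cv 0 w' c i = 0" if "3 * L <= \<bar>i\<bar>" for c i using that len L by (intro cv_supp) simp
  show "\<bar>cv 0 w' c i\<bar> <= 4 * L\<^sup>2" for c i using abs_cv[of 0 w' c i] len L2 by linarith
  show thesis if "!!b i j. Z b i j = 2 * om 0 u' (cv 0 w') b i j" "!!c i. 3 * L <= \<bar>i\<bar> ==> u' c i = 0"
   "!!c i. \<bar>u' c i\<bar> <= 6 * (4 * L\<^sup>2) ^ 3" for u'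
   using outer[of u'] that unfolding e by blast
 qed (use u cb cs piv L2 in auto)
qed

lemma conj_shift_imp_zero_crit:
 assumes s: "\<bar>s\<bar> <= 2 * L" and ht: "ht w = 0" "ht w' = 0" and cs: "conj_shift s w w'"
 shows "zero_crit L s w w'"
proof -
 define Z where "Z = (%b i j. zz 0 w' b i j - zz 0 w b (i - s) (j - s))"
 obtain u N where u: "!!c i. cv 0 w' c i = cv 0 w c (i - s)"
   "!!b i j. Z b i j = 2 * om 0 u (cv 0 w') b i j"
  using cs unfolding conj_shift_height0[OF ht] Z_def by blast
 show ?thesis
 proof (cases "EX c i. cv 0 w' c i ~= 0")
  case False
  hence z: "cv 0 w' = (%c i. 0)" by (intro ext) auto
  hence "Z b i j = 0" for b i j using u(2) by simp
  thus ?thesis using u(1) z unfolding zero_crit_def Z_def by simp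
 next
  case True
  then obtain i0 where i0: "pivot (cv 0 w') i0" using pivot_exists by blast
  hence "cv 0 w' False i0 ~= 0 \<or> cv 0 w' True i0 ~= 0" by (auto simp: pivot_def)
  hence "\<bar>i0\<bar> < int (length w')" using cv_supp[of w' i0] by (meson not_le)
  hence i0L: "\<bar>i0\<bar> < 3 * L" using len L by linarith
  obtain u' where u': "!!b i j. Z b i j = 2 * om 0 u' (cv 0 w') b i j" "!!c i. \<bar>i\<bar> >= 3 * L ==> u' c i = 0"
    "!!c i. \<bar>u' c i\<bar> <= 384 * L ^ 6"
   by (rule short_solution[OF s i0 Z_def u(2)]) (rule that)
  have "pivot_eqs Z (cv 0 w') (3 * L) (384 * L ^ 6) i0 (%c. u' c i0)"
   by (rule solution_pivot_eqs[OF u'(1,3)])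
  moreover have "\<bar>u' c i0\<bar> <= 384 * L ^ 6" for c by (rule u'(3))
  ultimately have "EX i0. \<bar>i0\<bar> < 3 * L & pivot (cv 0 w') i0 & (EX p0. (ALL c. \<bar>p0 c\<bar> <= 384 * L ^ 6) \<and>
    pivot_eqs Z (cv 0 w') (3 * L) (384 * L ^ 6) i0 p0)" using i0 i0L by (intro exI[of _ i0] conjI exI[of _ "%c. u' c i0"]) auto
  thus ?thesis using u(1) unfolding zero_crit_def Z_def by blast
 qed
qed

lemma zero_crit_imp_short_conjugator:
 assumes s: "\<bar>s\<bar> <= 2 * L" and ht: "ht w = 0" "ht w' = 0" and crit: "zero_crit L s w w'"
 obtains h where "ht h = s" "E (h @ w) (w' @ h)" "int (length h) <= 17000 * (283 * L ^ 3) ^ 8"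
proof -
 define Z where "Z = (%b i j. zz 0 w' b i j - zz 0 w b (i - s) (j - s))"
 have cv: "cv 0 w' c i = cv 0 w c (i - s)" for c i using crit by (simp add: zero_crit_def)
 have L3: "1 <= L ^ 3" "L ^ 3 <= L ^ 24" "L <= L ^ 24" "L ^ 7 <= L ^ 24" "L <= L ^ 6"
  using power_le_int[OF L, of 0 3] power_le_int[OF L, of 1 24] power_le_int[OF L, of 1 6] by (auto intro: power_le_int[OF L])
 have bnd: "17000 * (283 * L ^ 3) ^ 8 >= 17000 * L ^ 24"
  by (simp add: power_mult_distrib power_mult[symmetric])
 have conj: "E ((h0 @ pw 0 s) @ w) (w' @ h0 @ pw 0 s)"
  if "ht h0 = 0" "!!b i j. Z b i j = 2 * om 0 (cv 0 h0) (cv 0 w') b i j" for h0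
 proof -
  have cvw: "cv 0 w c (i - s) = cv 0 w' c i" for c i using cv by simp
  show ?thesis using that(2) om_swap[of 0 "cv 0 w'" "cv 0 h0"]
   by (auto simp: E_iff zz_append ht that(1) ht_pw cvw Z_def algebra_simps)
 qed
 consider (zero) "!!c i. cv 0 w' c i = 0" "!!b i j. Z b i j = 0"
  | (piv) i0 p0 where "\<bar>i0\<bar> < 3 * L" "pivot (cv 0 w') i0" "!!c. \<bar>p0 c\<bar> <= 384 * L ^ 6"
    "pivot_eqs Z (cv 0 w') (3 * L) (384 * L ^ 6) i0 p0"
  using crit unfolding zero_crit_def Z_def by auto
 thus thesis
 proof cases
  case zero
  have "cv 0 w' = (%c i. 0)" using zero(1) by (intro ext)
  hence "E (([] @ pw 0 s) @ w) (w' @ [] @ pw 0 s)" using zero(2) by (intro conj) auto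
  moreover have "int (length (pw 0 s)) <= 17000 * (283 * L ^ 3) ^ 8" using s L3 bnd by simp
  ultimately show thesis using that[of "pw 0 s"] by (simp add: ht_pw)
 next
  case piv
  have xs: "Z b i j = 0" if "3 * L <= \<bar>i\<bar> \<or> 3 * L <= \<bar>j\<bar>" for b i j
  proof -
   have "\<bar>i\<bar> >= int (length w') \<or> \<bar>j\<bar> >= int (length w')" "\<bar>i - s\<bar> >= int (length w) \<or> \<bar>j - s\<bar> >= int (length w)"
    using that s len by linarith+
   thus ?thesis by (simp add: Z_def zz_supp)
  qed
  have vs: "cv 0 w' c i = 0" if "3 * L <= \<bar>i\<bar>" for c i using that len L by (intro cv_supp) simp
  obtain u where u: "!!b i j. Z b i j = 2 * om 0 u (cv 0 w') b i j"
   using pivot_eqs_solvable[OF piv(2,1,4) vs xs] by blast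
  obtain u' where u': "!!b i j. Z b i j = 2 * om 0 u' (cv 0 w') b i j" "!!c i. \<bar>i\<bar> >= 3 * L ==> u' c i = 0"
    "!!c i. \<bar>u' c i\<bar> <= 384 * L ^ 6"
   by (rule short_solution[OF s piv(2) Z_def u]) (rule that)
  obtain h0 where h0: "ht h0 = 0" "!!c i. cv 0 h0 c i = u' c i"
    "int (length h0) <= (2 * (3 * L) + 1) * (4 * (3 * L) + 2 * (384 * L ^ 6))"
  proof (rule word_of_vector[of "3 * L" u' "384 * L ^ 6"])
   show "\<bar>u' c i\<bar> <= 384 * L ^ 6" for c i by (rule u'(3))
  qed (use u'(2) L in auto)
  have "cv 0 h0 = u'" using h0(2) by (intro ext)
  hence E: "E ((h0 @ pw 0 s) @ w) (w' @ h0 @ pw 0 s)" using u'(1) h0(1) by (intro conj) auto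
  have "(2 * (3 * L) + 1) * (4 * (3 * L) + 2 * (384 * L ^ 6)) <= (7 * L) * (780 * L ^ 6)"
   using L L3 by (intro mult_mono) auto
  also have "... = 5460 * L ^ 7" by (simp add: eval_nat_numeral)
  finally have "int (length (h0 @ pw 0 s)) <= 17000 * (283 * L ^ 3) ^ 8"
   using h0(3) s L3 bnd by simp
  thus thesis using that[of "h0 @ pw 0 s"] E h0(1) by (simp add: ht_pw)
 qed
qed

lemma conj_crit_imp_short_conjugator:
 assumes "conj_crit L w w'"
 obtains h where "E (h @ w) (w' @ h)" "int (length h) <= 17000 * (283 * L ^ 3) ^ 8"
 using assms zero_crit_imp_short_conjugator orbit_imp_short_conjugator[OF len _ L]
 unfolding conj_crit_def by (metis (no_types, lifting))

text \<open>Necessity uses the bound on the height of a conjugator, sufficiency the short conjugators of both cases.\<close>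

lemma conj_crit: "conjugate G (\<kappa> w) (\<kappa> w') \<longleftrightarrow> conj_crit L w w'"
proof
 assume "conj_crit L w w'"
 then obtain h where "E (h @ w) (w' @ h)" by (rule conj_crit_imp_short_conjugator)
 thus "conjugate G (\<kappa> w) (\<kappa> w')" by (auto simp: conjugate_code)
next
 assume "conjugate G (\<kappa> w) (\<kappa> w')"
 then obtain s0 where "conj_shift s0 w w'" by (auto simp: conj_shift_iff[symmetric])
 then obtain s where s: "\<bar>s\<bar> <= int (length w) + int (length w')" "conj_shift s w w'" by (rule conj_shift_bounded)
 have s2: "\<bar>s\<bar> <= 2 * L" using s(1) len by linarith
 have ht: "ht w = ht w'" using conj_shift_ht[OF s(2)] .
 show "conj_crit L w w'"
  unfolding conj_crit_def using ht s2 conj_shift_imp_orbit[OF len s2 L ht _ s(2)] conj_shift_imp_zero_crit[OF s2 _ _ s(2)]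
  by auto
qed

end

lemma short_conjugator:
 assumes "conjugate G (\<kappa> w) (\<kappa> w')" "length w <= n" "length w' <= n" "n >= 1"
 obtains h where "\<kappa> h \<otimes>\<^bsub>G\<^esub> \<kappa> w \<otimes>\<^bsub>G\<^esub> inv\<^bsub>G\<^esub> \<kappa> h = \<kappa> w'" "length h <= 17000 * (283 * n ^ 3) ^ 8"
proof -
 interpret group G by (rule group)
 have a: "int (length w) <= int n" "int (length w') <= int n" "int n >= 1" using assms by auto
 obtain h where h: "E (h @ w) (w' @ h)" "int (length h) <= 17000 * (283 * int n ^ 3) ^ 8"
  using conj_crit_imp_short_conjugator[OF a] conj_crit[OF a] assms(1) by blast
 have "\<kappa> h \<otimes>\<^bsub>G\<^esub> \<kappa> w = \<kappa> w' \<otimes>\<^bsub>G\<^esub> \<kappa> h" using h(1) by (simp add: code_eq_iff)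
 hence 1: "\<kappa> h \<otimes>\<^bsub>G\<^esub> \<kappa> w \<otimes>\<^bsub>G\<^esub> inv\<^bsub>G\<^esub> \<kappa> h = \<kappa> w'"
  by (metis code_carrier inv_solve_right m_closed)
 have "int (length h) <= int (17000 * (283 * n ^ 3) ^ 8)" using h(2) by simp
 hence "length h <= 17000 * (283 * n ^ 3) ^ 8" by (simp only: of_nat_le_iff)
 thus thesis using 1 that by blast
qed

end

section \<open>Word norms\<close>

context group
begin

text \<open>The factorisations over which the word norm minimises, with their length kept visible.\<close>

definition spells :: "'a set => 'a list => 'a => bool" where
 "spells S xs g \<longleftrightarrow> set xs <= S \<union> m_inv G ` S & foldr (\<otimes>) xs \<one> = g"

lemma foldr_closed: "set xs <= carrier G ==> foldr (\<otimes>) xs \<one> : carrier G"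
 by (induction xs) auto

lemma foldr_append_mult: "set xs <= carrier G ==> set ys <= carrier G ==>
  foldr (\<otimes>) (xs @ ys) \<one> = foldr (\<otimes>) xs \<one> \<otimes> foldr (\<otimes>) ys \<one>"
 by (induction xs) (auto simp: foldr_closed m_assoc)

lemma spells_append:
 assumes "S <= carrier G" "spells S xs g" "spells S ys h"
 shows "spells S (xs @ ys) (g \<otimes> h)"
proof -
 have "S \<union> m_inv G ` S <= carrier G" using assms(1) by auto
 hence "set xs <= carrier G" "set ys <= carrier G" using assms(2,3) unfolding spells_def by blast+
 from foldr_append_mult[OF this] show ?thesis using assms(2,3) by (auto simp: spells_def)
qed

lemma generate_spells:
 assumes S: "S <= carrier G" and "g : generate G S"
 shows "EX xs. spells S xs g"
proof -
 from assms(2) show "EX xs. spells S xs g"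
 proof induction
  case one
  thus ?case by (intro exI[of _ "[]"]) (simp add: spells_def)
 next
  case (incl h)
  thus ?case using S by (intro exI[of _ "[h]"]) (auto simp: spells_def)
 next
  case (inv h)
  thus ?case using S by (intro exI[of _ "[inv h]"]) (auto simp: spells_def)
 next
  case (eng h1 h2)
  thus ?case using spells_append[OF S] by blast
 qed
qed

lemma norm_le: "spells S xs g ==> word_norm G S g <= length xs"
 unfolding word_norm_def spells_def by (intro Least_le) auto

lemma norm_spelled:
 assumes "spells S ys g"
 shows "EX xs. spells S xs g & length xs = word_norm G S g"
proof -
 have "EX xs. length xs = word_norm G S g & set xs <= S \<union> m_inv G ` S & foldr (\<otimes>) xs \<one> = g"
  unfolding word_norm_def by (rule LeastI_ex) (use assms in \<open>auto simp: spells_def\<close>)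
 thus ?thesis by (auto simp: spells_def)
qed

end

context exponents
begin

lemma word_norm_le_length:
 assumes "finite_gen_set G S"
 obtains c where "c >= 1" "!!w. word_norm G S (\<kappa> w) <= c * length w"
proof -
 interpret group G by (rule group)
 have S: "S <= carrier G" "generate G S = carrier G" using assms by (auto simp: finite_gen_set_def)
 have "EX xs. spells S xs (\<kappa> [x]) & (fst x >= 3 --> xs = [])" for x
 proof (cases "fst x < 3")
  case True
  thus ?thesis using generate_spells[OF S(1), of "\<kappa> [x]"] S(2) by auto
 next
  case False
  thus ?thesis using code_letter[of "fst x" "snd x"] by (intro exI[of _ "[]"]) (auto simp: spells_def)
 qed
 then obtain f where f: "!!x. spells S (f x) (\<kappa> [x])" "!!x. fst x >= 3 ==> f x = []" by metis
 define c where "c = Suc (Max ((%x. length (f x)) ` ({..<3} \<times> UNIV)))"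
 have c: "length (f x) <= c" for x
 proof (cases "fst x < 3")
  case True
  hence "length (f x) <= Max ((%x. length (f x)) ` ({..<3} \<times> UNIV))" by (intro Max_ge image_eqI[of _ _ x]) (auto simp: mem_Times_iff)
  thus ?thesis by (simp add: c_def)
 qed (simp add: f(2))
 have "spells S (concat (map f w)) (\<kappa> w) & length (concat (map f w)) <= c * length w" for w
 proof (induction w)
  case Nil
  thus ?case by (simp add: spells_def one_code)
 next
  case (Cons x w)
  have "spells S (f x @ concat (map f w)) (\<kappa> [x] \<otimes>\<^bsub>G\<^esub> \<kappa> w)" using Cons by (intro spells_append[OF S(1)] f(1)) auto
  thus ?case using Cons c[of x] by simp
 qed
 hence "word_norm G S (\<kappa> w) <= c * length w" for w using norm_le le_trans by meson
 thus thesis using that[of c] by (simp add: c_def)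
qed

text \<open>Rewriting a shortest product of generators letter by letter; together with \<open>word_norm_le_length\<close> this compares each word norm with the length of words up to a
constant.\<close>

lemma short_word:
 assumes "finite_gen_set G S"
 obtains c where "c >= 1" "!!g. g : carrier G ==> EX w. \<kappa> w = g & length w <= c * word_norm G S g"
proof -
 interpret group G by (rule group)
 have S: "S <= carrier G" "generate G S = carrier G" "finite S" using assms by (auto simp: finite_gen_set_def)
 define T where "T = S \<union> m_inv G ` S"
 have T: "finite T" "T <= carrier G" using S by (auto simp: T_def)
 hence "ALL x:T. EX w. \<kappa> w = x" by (auto simp: carrier_code)
 then obtain f where f: "!!x. x : T ==> \<kappa> (f x) = x" by metis
 define c where "c = Suc (Max ((%x. length (f x)) ` T))"
 have c: "length (f x) <= c" if "x : T" for x
  using Max_ge[OF finite_imageI[OF T(1)], of "length (f x)" "%x. length (f x)"] that by (simp add: c_def)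
 have *: "set xs <= T ==> \<kappa> (concat (map f xs)) = foldr (\<otimes>\<^bsub>G\<^esub>) xs \<one>\<^bsub>G\<^esub> & length (concat (map f xs)) <= c * length xs" for xs
 proof (induction xs)
  case (Cons x xs)
  have 1: "\<kappa> (f x @ concat (map f xs)) = \<kappa> (f x) \<otimes>\<^bsub>G\<^esub> \<kappa> (concat (map f xs))" by (simp only: mult_code)
  have 2: "\<kappa> (f x @ concat (map f xs)) = x \<otimes>\<^bsub>G\<^esub> foldr (\<otimes>\<^bsub>G\<^esub>) xs \<one>\<^bsub>G\<^esub>" unfolding 1 using Cons f[of x] by simp
  show ?case using c[of x] Cons by (simp add: 2)
 qed (simp add: one_code)
 have "EX w. \<kappa> w = g & length w <= c * word_norm G S g" if g: "g : carrier G" for g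
 proof -
  obtain ys where "spells S ys g" using generate_spells[OF S(1)] S(2) g by blast
  then obtain xs where "spells S xs g" "length xs = word_norm G S g" using norm_spelled by blast
  thus ?thesis using *[of xs] unfolding spells_def T_def[symmetric] by (intro exI[of _ "concat (map f xs)"]) auto
 qed
 thus thesis using that[of c] by (simp add: c_def)
qed

text \<open>Suprema over balls are therefore maxima.\<close>

lemma finite_norm_ball:
 assumes "finite_gen_set G S"
 shows "finite {g : carrier G. word_norm G S g <= n}"
proof -
 interpret group G by (rule group)
 have S: "S <= carrier G" "generate G S = carrier G" "finite S" using assms by (auto simp: finite_gen_set_def)
 have "{g : carrier G. word_norm G S g <= n} <= (%xs. foldr (\<otimes>\<^bsub>G\<^esub>) xs \<one>\<^bsub>G\<^esub>) ` {xs. set xs <= S \<union> m_inv G ` S & length xs <= n}"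
 proof
  fix g assume g: "g : {g : carrier G. word_norm G S g <= n}"
  obtain ys where "spells S ys g" using generate_spells[OF S(1)] S(2) g by blast
  then obtain xs where "spells S xs g" "length xs = word_norm G S g" using norm_spelled by blast
  thus "g : (%xs. foldr (\<otimes>\<^bsub>G\<^esub>) xs \<one>\<^bsub>G\<^esub>) ` {xs. set xs <= S \<union> m_inv G ` S & length xs <= n}"
   using g by (intro image_eqI[of _ _ xs]) (auto simp: spells_def)
 qed
 thus ?thesis by (rule finite_subset) (intro finite_imageI finite_lists_length_le, use S in simp)
qed

lemma SUP_nat_le: "(!!x. x : A ==> f x <= b) ==> (SUP x\<in>A. f x) <= (b::nat)"
 by (cases "A = {}") (simp add: Sup_nat_def, rule cSUP_least, auto)

text \<open>The short conjugators have length \<open>O(n ^ 24)\<close>; the constants compare word norms with lengths in both directions.\<close>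

theorem Cl_polynomial:
 assumes "finite_gen_set G S"
 shows "polynomially_bounded (%n. real (Cl G S n))"
proof -
 obtain c where c: "c >= 1" "!!g. g : carrier G ==> EX w. \<kappa> w = g & length w <= c * word_norm G S g"
  using short_word[OF assms] by blast
 obtain c' where c': "c' >= 1" "!!w. word_norm G S (\<kappa> w) <= c' * length w"
  using word_norm_le_length[OF assms] by blast
 define K where "K = c' * (17000 * (283 * c ^ 3) ^ 8)"
 have "Cl G S n <= K * n ^ 24" if n: "n >= 1" for n
  unfolding Cl_def
 proof (rule SUP_nat_le)
  fix p assume "p : {(g1, g2). g1 : carrier G & g2 : carrier G \<and>
           word_norm G S g1 <= n & word_norm G S g2 <= n & conjugate G g1 g2}"
  then obtain g1 g2 where p: "p = (g1, g2)" "g1 : carrier G" "g2 : carrier G"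
    "word_norm G S g1 <= n" "word_norm G S g2 <= n" "conjugate G g1 g2" by auto
  obtain w1 w2 where w: "\<kappa> w1 = g1" "length w1 <= c * word_norm G S g1" "\<kappa> w2 = g2" "length w2 <= c * word_norm G S g2"
   using c(2) p by metis
  have "length w1 <= c * n" "length w2 <= c * n" using w p by (meson le_trans mult_le_mono2)+
  then obtain h where h: "\<kappa> h \<otimes>\<^bsub>G\<^esub> \<kappa> w1 \<otimes>\<^bsub>G\<^esub> inv\<^bsub>G\<^esub> \<kappa> h = \<kappa> w2" "length h <= 17000 * (283 * (c * n) ^ 3) ^ 8"
   using short_conjugator[of w1 w2 "c * n"] p w c(1) n by auto
  have "(case p of (g1, g2) => Inf {word_norm G S h |h. h : carrier G & h \<otimes>\<^bsub>G\<^esub> g1 \<otimes>\<^bsub>G\<^esub> inv\<^bsub>G\<^esub> h = g2}) <= word_norm G S (\<kappa> h)"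
   using h(1) w p by (auto intro!: cInf_lower exI[of _ "\<kappa> h"])
  also have "... <= c' * length h" by (rule c'(2))
  also have "... <= c' * (17000 * (283 * (c * n) ^ 3) ^ 8)" using h(2) by simp
  also have "... = K * n ^ 24" by (simp add: K_def power_mult_distrib power_mult[symmetric])
  finally show "(case p of (g1, g2) => Inf {word_norm G S h |h. h : carrier G & h \<otimes>\<^bsub>G\<^esub> g1 \<otimes>\<^bsub>G\<^esub> inv\<^bsub>G\<^esub> h = g2}) <= K * n ^ 24" .
 qed
 hence "real (Cl G S n) <= poly (Polynomial.monom (real K) 24) (real n)" if "n >= 1" for n
  using that by (simp add: poly_monom) (metis of_nat_le_iff of_nat_mult of_nat_power)
 thus ?thesis unfolding polynomially_bounded_def by blast
qed

end

section \<open>Subgroups of finitely generated free abelian groups are separable\<close>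

lemma subgroup_of_int:
 fixes A :: "int set"
 assumes "0 : A" "!!a b n. a : A ==> b : A ==> a + n * b : A"
 obtains d where "d : A" "d >= 0" "!!a. a : A ==> d dvd a"
proof (cases "A = {0}")
 case True thus thesis using that[of 0] by simp
next
 case False
 then obtain a where a: "a : A" "a ~= 0" using assms(1) by auto
 have "EX n. 0 < n & int n : A"
 proof (intro exI conjI)
  show "0 < nat \<bar>a\<bar>" using a by simp
  have "- a : A" using assms(2)[OF assms(1) a(1), of "-1"] by simp
  thus "int (nat \<bar>a\<bar>) : A" using a by (simp add: abs_if)
 qed
 define n where "n = (LEAST n. 0 < n & int n : A)"
 have n: "0 < n" "int n : A" using LeastI_ex[OF \<open>EX n. 0 < n & int n : A\<close>] by (auto simp: n_def)
 have "int n dvd b" if "b : A" for b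
 proof -
  have "b + (- (b div int n)) * int n : A" using assms(2)[OF that n(2)] .
  hence "b mod int n : A" by (simp add: minus_div_mult_eq_mod)
  hence "~ 0 < nat (b mod int n)"
   using not_less_Least[of "nat (b mod int n)" "%n. 0 < n & int n : A"] n(1) by (auto simp: n_def[symmetric] nat_less_iff)
  hence "b mod int n = 0" using n(1) pos_mod_sign[of "int n" b] by linarith
  thus ?thesis by (simp add: dvd_eq_mod_eq_0)
 qed
 thus thesis using that[of "int n"] n by simp
qed

text \<open>A vector outside a subgroup of a finitely generated free abelian group remains outside modulo some \<open>l\<close>. Induction on the rank: project to one coordinate; either
\<open>x\<close> is already separated there, or a multiple of a generator of the projection is subtracted and the kernel is treated by induction.\<close>

lemma subgroup_separable:
 fixes Y :: "('i => int) set"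
 assumes "finite I" "(%i. 0) : Y" "!!a b n. a : Y ==> b : Y ==> (%i. a i + n * b i) : Y"
  and "!!y. y : Y ==> EX i:I. x i ~= y i"
 shows "\<exists>l>0. ALL y:Y. EX i:I. ~ l dvd x i - y i"
 using assms
proof (induction I arbitrary: Y x rule: finite_induct)
 case empty
 from empty.prems(3)[OF empty.prems(1)] show ?case by simp
next
 case (insert a I)
 note lin = insert.prems(2)
 obtain d where d: "d : (%y. y a) ` Y" "d >= 0" "!!b. b : (%y. y a) ` Y ==> d dvd b"
 proof (rule subgroup_of_int[of "(%y. y a) ` Y"])
  show "0 : (%y. y a) ` Y" using insert.prems(1) by (intro image_eqI) auto
  show "u + n * v : (%y. y a) ` Y" if uv: "u : (%y. y a) ` Y" "v : (%y. y a) ` Y" for u v n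
  proof -
   obtain y z where "y : Y" "z : Y" "u = y a" "v = z a" using uv by auto
   thus ?thesis using lin[of y z n] by (intro image_eqI[of _ _ "%i. y i + n * z i"]) auto
  qed
 qed (rule that)
 obtain y0 where y0: "y0 : Y" "y0 a = d" using d(1) by auto
 have da: "d dvd y a" if "y : Y" for y using d(3) that by auto
 show ?case
 proof (cases "d dvd x a")
  case False
  show ?thesis
  proof (cases "d = 0")
   case True
   have "~ \<bar>x a\<bar> + 1 dvd x a" using False True zdvd_not_zless[of "\<bar>x a\<bar>" "\<bar>x a\<bar> + 1"] by simp
   hence "~ \<bar>x a\<bar> + 1 dvd x a - y a" if "y : Y" for y using da[OF that] True by simp
   thus ?thesis by (intro exI[of _ "\<bar>x a\<bar> + 1"]) auto
  next
   case False
   have "~ d dvd x a - y a" if "y : Y" for y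
    using da[OF that] \<open>~ d dvd x a\<close> dvd_diff_left_iff[of d "y a" "x a"] by simp
   thus ?thesis using False d(2) by (intro exI[of _ d]) auto
  qed
 next
  case True
  then obtain q where q: "x a = d * q" by (elim dvdE)
  define x' where "x' i = x i + (- q) * y0 i" for i
  define Y0 where "Y0 = {y : Y. y a = 0}"
  have "\<exists>l>0. ALL y:Y0. EX i:I. ~ l dvd x' i - y i"
  proof (rule insert.IH)
   show "(%i. 0) : Y0" using insert.prems(1) by (simp add: Y0_def)
   show "(%i. u i + n * v i) : Y0" if "u : Y0" "v : Y0" for u v n using that lin by (auto simp: Y0_def)
   show "EX i:I. x' i ~= y i" if "y : Y0" for y
   proof -
    have y: "y : Y" "y a = 0" using that by (auto simp: Y0_def)
    have "EX i:insert a I. x i ~= y i + q * y0 i"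
     using insert.prems(3)[OF lin[OF y(1) y0(1), of q]] .
    thus ?thesis using y q y0(2) by (auto simp: x'_def algebra_simps)
   qed
  qed
  then obtain l where l: "l > 0" "!!y. y : Y0 ==> EX i:I. ~ l dvd x' i - y i" by blast
  show ?thesis
  proof (cases "d = 0")
   case True
   have "EX i:insert a I. ~ l dvd x i - y i" if "y : Y" for y
   proof -
    have "(%i. y i + (- q) * y0 i) : Y0" using lin[OF that y0(1), of "-q"] da[OF that] y0(2) True by (simp add: Y0_def)
    from l(2)[OF this] show ?thesis by (auto simp: x'_def)
   qed
   thus ?thesis using l(1) by blast
  next
   case False
   \<comment> \<open>Divisibility by \<open>l d\<close> at the coordinate \<open>a\<close> pins down the multiple of \<open>y0\<close> modulo \<open>l\<close>.\<close>
   have "EX i:insert a I. ~ l * d dvd x i - y i" if y: "y : Y" for y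
   proof (rule ccontr)
    assume "~ (EX i:insert a I. ~ l * d dvd x i - y i)"
    hence dv: "!!i. i : insert a I ==> l * d dvd x i - y i" by blast
    obtain c where c: "y a = d * c" using da[OF y] by (elim dvdE)
    have "d * l dvd d * (q - c)" using dv[of a] by (simp add: q c right_diff_distrib mult.commute)
    hence lq: "l dvd q - c" using False by simp
    have "(%i. y i + (- c) * y0 i) : Y0" using lin[OF y y0(1), of "-c"] c y0(2) by (simp add: Y0_def)
    from l(2)[OF this] obtain i where i: "i : I" "~ l dvd x' i - (y i + (- c) * y0 i)" by blast
    have "x' i - (y i + (- c) * y0 i) = (x i - y i) - (q - c) * y0 i" by (simp add: x'_def algebra_simps)
    moreover have "l dvd x i - y i" using dv[of i] i(1) by (meson dvd_mult_left insertI2)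
    ultimately show False using i(2) lq by (metis dvd_diff dvd_mult2)
   qed
   thus ?thesis using l(1) False d(2) by (intro exI[of _ "l * d"]) auto
  qed
 qed
qed

section \<open>Periodic functions\<close>

lemma periodic_sum:
 fixes f :: "int => 'a::comm_monoid_add"
 assumes m: "m > 0" and f: "!!i j. m dvd i - j ==> f i = f j"
 shows "(SUM i:{0..<m}. f (i + a)) = (SUM i:{0..<m}. f i)"
proof (rule sum.reindex_bij_witness[of _ "%i. (i - a) mod m" "%i. (i + a) mod m"])
 fix i assume i: "i : {0..<m}"
 show "((i + a) mod m - a) mod m = i" using i by (simp add: mod_diff_left_eq)
 show "((i - a) mod m + a) mod m = i" using i by (simp add: mod_add_left_eq)
 show "f ((i + a) mod m) = f (i + a)"
  by (rule f) (metis dvd_minus_mod dvd_diff_commute)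
qed (use m in auto)

lemma sum_residue:
 fixes m :: int
 assumes "m > 0"
 shows "(SUM n:{0..<m}. of_bool (m dvd n - a) * f n) = (f (a mod m) :: int)"
proof -
 have "n = a mod m \<longleftrightarrow> m dvd n - a" if "n : {0..<m}" for n
  using that assms by (auto simp: mod_eq_dvd_iff[symmetric])
 hence "(SUM n:{0..<m}. of_bool (m dvd n - a) * f n) = (SUM n:{0..<m}. if n = a mod m then f n else 0)"
  by (intro sum.cong) auto
 also have "... = f (a mod m)" using assms by simp
 finally show ?thesis .
qed

lemma cong_periodic_mult:
 fixes p :: "int => int"
 assumes "!!i. [p i = p (i - k)] (mod l)" "k dvd n"
 shows "[p (i + n) = p i] (mod l)"
proof -
 have nat: "[p (i + int t * k) = p i] (mod l)" for i t
 proof (induction t)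
  case (Suc t)
  have "[p (i + int (Suc t) * k) = p (i + int (Suc t) * k - k)] (mod l)" by (rule assms(1))
  thus ?case using Suc by (auto simp: algebra_simps intro: cong_trans)
 qed simp
 obtain q where q: "n = k * q" using assms(2) by (elim dvdE)
 show ?thesis
 proof (cases "q >= 0")
  case True thus ?thesis using nat[of i "nat q"] by (simp add: q mult.commute)
 next
  case False
  thus ?thesis using nat[of "i + n" "nat (- q)"] by (simp add: q algebra_simps cong_sym_eq)
 qed
qed

lemma zero_dvd_bound: "\<bar>c\<bar> + 1 dvd l ==> l dvd c ==> c = 0" for c l :: int
 using zdvd_not_zless[of "\<bar>c\<bar>" "\<bar>c\<bar> + 1"] by (meson abs_ge_zero dvd_abs_iff dvd_trans less_add_one linorder_neqE_linordered_idom not_less zero_less_abs_iff)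

section \<open>Conjugacy separability\<close>

context exponents
begin

text \<open>A window that is short compared with \<open>m\<close> meets each residue class at most once.\<close>

lemma fold_exact:
 assumes "\<bar>i\<bar> + int (length w) < m"
 shows "cv m w c i = cv 0 w c i"
  "\<bar>j\<bar> + int (length w) < m ==> zz m w b i j = zz 0 w b i j"
proof -
 have *: "ut m w c i p = ut 0 w c i p" if "p < length w" "\<bar>i\<bar> + int (length w) < m" for c i p
 proof -
  have "\<bar>i - ht (take p w)\<bar> < m" using ht_take_le[of p w] that by linarith
  hence "m dvd i - ht (take p w) \<longleftrightarrow> i - ht (take p w) = 0"
   using zdvd_not_zless[of "\<bar>i - ht (take p w)\<bar>" m] by auto
  thus ?thesis by (simp add: ut_def)
 qed
 thus "cv m w c i = cv 0 w c i" using assms by (simp add: cv_def)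
 assume j: "\<bar>j\<bar> + int (length w) < m"
 have cP: "cP m w c c' i j = cP 0 w c c' i j" for c c'
  using assms j by (simp add: cP_def * less_trans[of _ "length w"] cong: sum.cong_simp)
 have "dm m (i - j) * cP 0 w True True i j = dm 0 (i - j) * cP 0 w True True i j"
 proof (cases "w = []")
  case False
  hence "cP 0 w True True i j = 0 \<or> \<bar>i\<bar> < int (length w) & \<bar>j\<bar> < int (length w)"
   using cP_supp[of w i j True True] by linarith
  hence "cP 0 w True True i j = 0 \<or> \<bar>i - j\<bar> < m" using assms j by linarith
  moreover have "m dvd i - j \<longleftrightarrow> i - j = 0" if "\<bar>i - j\<bar> < m"
   using that zdvd_not_zless[of "\<bar>i - j\<bar>" m] by auto
  ultimately show ?thesis by (auto simp: dm_def)
 qed simp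
 thus "zz m w b i j = zz 0 w b i j" by (simp add: zz_def cP)
qed

abbreviation "Em R l \<equiv> eqm (fact R) l"

lemma Em_congruence: "word_congruence (Em R l)" by (rule word_congruence_eqm) simp

lemma quotient_eqs:
 assumes "eqm m l (h @ w) (w' @ h)"
 shows "[ht w = ht w'] (mod m)"
  "[cv m h c i + cv m w c (i - ht h) = cv m w' c i + cv m h c (i - ht w')] (mod l)"
  "[zz m h b i j + zz m w b (i - ht h) (j - ht h) + om m (cv m h) (%c i. cv m w c (i - ht h)) b i j =
  zz m w' b i j + zz m h b (i - ht w') (j - ht w') + om m (cv m w') (%c i. cv m h c (i - ht w')) b i j] (mod l)"
proof -
 have "[ht h + ht w = ht h + ht w'] (mod m)" using assms by (simp add: eqm_def add.commute)
 thus "[ht w = ht w'] (mod m)" using cong_add_lcancel by blast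
qed (use assms in \<open>auto simp: eqm_def zz_append\<close>)

end

context exponents
begin

text \<open>No conjugator of height \<open>s\<close> in all sufficiently fine quotients. The uniform statement makes it possible to treat finitely many heights together.\<close>

abbreviation separated :: "int => word => word => bool" where
 "separated s w w' \<equiv> EX R0 l0. l0 > 0 & (ALL R l h. R >= R0 --> l0 dvd l --> ht h = s --> ~ Em R l (h @ w) (w' @ h))"

lemma int_le_fact: "int R <= fact R"
 using fact_ge_self[of R] by (metis of_nat_fact of_nat_le_iff)

lemma fact_ge_int: "nat x <= R ==> x <= fact R"
 using int_le_fact[of R] by linarith

lemma cong_zero_small: "[x = 0] (mod l) ==> \<bar>x\<bar> < l ==> x = 0" for x l :: int
 using zdvd_not_zless[of "\<bar>x\<bar>" l] by (auto simp: cong_0_iff)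

text \<open>If the exponents match, conjugacy at this height says that a vector lies in the subgroup of all \<open>2 (u \<and> v)\<close>. On a window this is a subgroup of a finitely generated free
abelian group, and for \<open>m\<close> larger than the window the equations in the quotient are the reductions modulo \<open>l\<close> of the original ones.\<close>

lemma separate_height0_shift:
 assumes ht: "ht w = 0" "ht w' = 0" and len: "int (length w) <= L" "int (length w') <= L" and s: "\<bar>s\<bar> <= 2 * L"
  and nc: "~ conj_shift s w w'"
 shows "separated s w w'"
proof (cases "EX c i. cv 0 w' c i ~= cv 0 w c (i - s)")
 case True
 then obtain c i where ci: "cv 0 w' c i ~= cv 0 w c (i - s)" by auto
 define x where "x = cv 0 w' c i - cv 0 w c (i - s)"
 have "~ Em R l (h @ w) (w' @ h)" if R: "nat (\<bar>i\<bar> + \<bar>s\<bar> + L + 1) <= R" and l: "\<bar>x\<bar> + 1 dvd l" and h: "ht h = s" for R l h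
 proof
  assume "Em R l (h @ w) (w' @ h)"
  from quotient_eqs(2)[OF this, of c i] have "[cv (fact R) w c (i - s) = cv (fact R) w' c i] (mod l)"
   using ht h by (simp add: add.commute cong_add_lcancel)
  moreover have "\<bar>i\<bar> + \<bar>s\<bar> + L + 1 <= fact R" using fact_ge_int[OF R] .
  ultimately have "[cv 0 w c (i - s) = cv 0 w' c i] (mod l)"
   using len fold_exact(1)[of i w' "fact R" c] fold_exact(1)[of "i - s" w "fact R" c] by simp
  hence "l dvd x" by (simp add: x_def cong_iff_dvd_diff dvd_diff_commute)
  thus False using zero_dvd_bound[OF l] ci by (simp add: x_def)
 qed
 thus ?thesis by (intro exI[of _ "nat (\<bar>i\<bar> + \<bar>s\<bar> + L + 1)"] exI[of _ "\<bar>x\<bar> + 1"]) auto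
next
 case False
 hence cv: "cv 0 w' c i = cv 0 w c (i - s)" for c i by blast
 have L: "L >= 0" using len by linarith
 define W where "W = {-(3*L)..3*L}"
 define I :: "(bool \<times> int \<times> int) set" where "I = UNIV \<times> W \<times> W"
 define Y where "Y = range (%u (b, i, j). 2 * om 0 u (cv 0 w') b i j)"
 define x where "x = (%(b, i, j). zz 0 w' b i j - zz 0 w b (i - s) (j - s))"
 have "\<exists>l>0. ALL y:Y. EX p:I. ~ l dvd x p - y p"
 proof (rule subgroup_separable)
  show "finite I" by (simp add: I_def W_def)
  show "(%p. 0) : Y" unfolding Y_def by (intro image_eqI[of _ _ "%c i. 0"]) auto
  show "(%p. a p + n * b p) : Y" if "a : Y" "b : Y" for a b n
  proof -
   obtain u v where uv: "a = (%(b, i, j). 2 * om 0 u (cv 0 w') b i j)" "b = (%(b, i, j). 2 * om 0 v (cv 0 w') b i j)"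
    using \<open>a : Y\<close> \<open>b : Y\<close> by (auto simp: Y_def)
   have "(%p. a p + n * b p) = (%(b, i, j). 2 * om 0 (%c i. u c i + n * v c i) (cv 0 w') b i j)"
    unfolding om_add_left om_smult uv by (auto simp: fun_eq_iff algebra_simps)
   thus ?thesis by (simp add: Y_def)
  qed
  show "EX p:I. x p ~= y p" if yY: "y : Y" for y
  proof (rule ccontr)
   assume "~ (EX p:I. x p ~= y p)"
   moreover obtain u where u: "y = (%(b, i, j). 2 * om 0 u (cv 0 w') b i j)" using yY by (auto simp: Y_def)
   ultimately have xu: "x (b, i, j) = 2 * om 0 u (cv 0 w') b i j" if "i : W" "j : W" for b i j
    using that by (auto simp: I_def)
   define u' where "u' c i = (if i : W then u c i else 0)" for c i
   have "zz 0 w' b i j - zz 0 w b (i - s) (j - s) = 2 * om 0 u' (cv 0 w') b i j" for b i j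
   proof (cases "i : W & j : W")
    case True
    hence "om 0 u' (cv 0 w') b i j = om 0 u (cv 0 w') b i j" by (simp add: om_def u'_def)
    thus ?thesis using xu[of i j b] True by (simp add: x_def)
   next
    case False
    hence ij: "\<bar>i\<bar> > 3 * L \<or> \<bar>j\<bar> > 3 * L" by (auto simp: W_def)
    hence "zz 0 w' b i j = 0" "zz 0 w b (i - s) (j - s) = 0" using s len L by (auto intro!: zz_supp)
    moreover have "om 0 u' (cv 0 w') b i j = 0"
     using ij
    proof
     assume "\<bar>i\<bar> > 3 * L"
     thus ?thesis using len L by (intro om_supp(1)) (auto simp: u'_def W_def cv_supp)
    next
     assume "\<bar>j\<bar> > 3 * L"
     thus ?thesis using len L by (intro om_supp(2)) (auto simp: u'_def W_def cv_supp)
    qed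
    ultimately show ?thesis by simp
   qed
   moreover have "u' c i = 0" if "\<bar>i\<bar> > 3 * L" for c i using that by (auto simp: u'_def W_def)
   ultimately have "conj_shift s w w'" unfolding conj_shift_height0[OF ht] using cv by blast
   thus False using nc by simp
  qed
 qed
 then obtain l0 where l0: "l0 > 0" "!!y. y : Y ==> EX p:I. ~ l0 dvd x p - y p" by blast
 have "~ Em R l (h @ w) (w' @ h)" if R: "nat (9 * L + 1) <= R" and l: "l0 dvd l" and h: "ht h = s" for R l h
 proof
  assume E: "Em R l (h @ w) (w' @ h)"
  define m where "m = (fact R :: int)"
  have m: "9 * L + 1 <= m" using fact_ge_int[OF R] by (simp add: m_def)
  have "(%(b, i, j). 2 * om 0 (cv m h) (cv 0 w') b i j) : Y" unfolding Y_def by blast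
  from l0(2)[OF this] obtain b i j where ij: "i : W" "j : W" "~ l0 dvd x (b, i, j) - 2 * om 0 (cv m h) (cv 0 w') b i j"
   by (auto simp: I_def)
  have b: "\<bar>i\<bar> <= 3 * L" "\<bar>j\<bar> <= 3 * L" using ij by (auto simp: W_def)
  have e: "cv m w' c i = cv 0 w' c i" "cv m w' c j = cv 0 w' c j" "cv m w c (i - s) = cv 0 w' c i" "cv m w c (j - s) = cv 0 w' c j" for c
   using b s len m L cv[of c i] cv[of c j] by (simp_all add: fold_exact(1))
  have z: "zz m w' b i j = zz 0 w' b i j" "zz m w b (i - s) (j - s) = zz 0 w b (i - s) (j - s)"
   using b s len m L by (auto intro!: fold_exact(2))
  have dmm: "dm m (i - j) = dm 0 (i - j)"
   using b m L zdvd_not_zless[of "\<bar>i - j\<bar>" m] by (auto simp: dm_def)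
  have o: "om m (cv m h) (%c i. cv m w c (i - s)) b i j = om 0 (cv m h) (cv 0 w') b i j"
    "om m (cv m w') (cv m h) b i j = - om 0 (cv m h) (cv 0 w') b i j"
   by (auto simp: om_def e dmm algebra_simps)
  have "[zz m h b i j + zz 0 w b (i - s) (j - s) + om 0 (cv m h) (cv 0 w') b i j
   = zz 0 w' b i j + zz m h b i j - om 0 (cv m h) (cv 0 w') b i j] (mod l)"
   using quotient_eqs(3)[OF E[folded m_def], of b i j] ht h by (simp add: o z)
  hence "l dvd x (b, i, j) - 2 * om 0 (cv m h) (cv 0 w') b i j"
   unfolding cong_iff_dvd_diff by (subst (asm) dvd_diff_commute) (simp add: x_def algebra_simps)
  thus False using ij(3) l dvd_trans by blast
 qed
 thus ?thesis using l0(1) by (intro exI[of _ "nat (9 * L + 1)"] exI[of _ l0]) auto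
qed

lemma Em_shift_step:
 assumes "Em R l (h @ w) (w' @ h)"
 shows "Em R l ((h @ w) @ w) (w' @ (h @ w))" "Em R l ((h @ invw w) @ w) (w' @ (h @ invw w))"
proof -
 interpret F: word_congruence "Em R l" by (rule Em_congruence)
 have A: "Em R l (u @ x) (v @ x)" "Em R l (x @ u) (x @ v)" if "Em R l u v" for u v x
  using F.append[OF that F.refl] F.append[OF F.refl that] by auto
 show "Em R l ((h @ w) @ w) (w' @ (h @ w))" using A(1)[OF assms, of w] by simp
 have "Em R l ((h @ invw w) @ w) h" using A(2)[OF F.inverse[of "invw w"], of h] by simp
 moreover have "Em R l (h @ w @ invw w) h" using A(2)[OF F.inverse[of w], of h] by simp
 moreover have "Em R l (h @ w @ invw w) (w' @ (h @ invw w))" using A(1)[OF assms, of "invw w"] by simp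
 ultimately show "Em R l ((h @ invw w) @ w) (w' @ (h @ invw w))" using F.sym F.trans by blast
qed

lemma Em_shift: "EX h. ht h = s & Em R l (h @ w) (w' @ h) ==> EX h. ht h = s + n * ht w & Em R l (h @ w) (w' @ h)"
proof (induction n rule: int_induct[of _ 0])
 case base thus ?case by simp
next
 case (step1 n)
 then obtain h where "ht h = s + n * ht w" "Em R l (h @ w) (w' @ h)" by blast
 thus ?case using Em_shift_step(1)[of R l h w w'] by (intro exI[of _ "h @ w"]) (auto simp: algebra_simps)
next
 case (step2 n)
 then obtain h where "ht h = s + n * ht w" "Em R l (h @ w) (w' @ h)" by blast
 thus ?case using Em_shift_step(2)[of R l h w w'] by (intro exI[of _ "h @ invw w"]) (auto simp: algebra_simps)
qed

text \<open>The height of a conjugator matters only modulo \<open>R!\<close>, because \<open>t ^ R!\<close> acts trivially on the folded coordinates.\<close>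

lemma Em_shift_period:
 assumes "Em R l (h @ w) (w' @ h)" "[s = ht h] (mod (fact R))"
 shows "EX h'. ht h' = s & Em R l (h' @ w) (w' @ h')"
proof -
 interpret F: word_congruence "Em R l" by (rule Em_congruence)
 define p where "p = pw 0 (s - ht h)"
 have "[s - ht h = ht h - ht h] (mod (fact R))" by (rule cong_diff[OF assms(2)]) simp
 hence p: "Em R l p []" by (simp add: p_def eqm_def ht_pw)
 have A: "Em R l (u @ x) (v @ x)" "Em R l (x @ u) (x @ v)" if "Em R l u v" for u v x
  using F.append[OF that F.refl] F.append[OF F.refl that] by auto
 have h: "Em R l (p @ h) h" using A(1)[OF p, of h] by simp
 have "Em R l ((p @ h) @ w) (w' @ (p @ h))"
  using A(1)[OF h, of w] assms(1) A(2)[OF h, of w'] F.sym F.trans by blast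
 thus ?thesis by (intro exI[of _ "p @ h"]) (simp add: p_def ht_pw)
qed

text \<open>Take the largest \<open>R\<close> and a common multiple of the moduli \<open>l\<close>.\<close>

lemma separate_from_shifts:
 assumes "finite S" "!!s. s : S ==> separated s w w'"
  and "(l1::int) > 0"
 obtains R l where "l > 0" "R >= R1" "l1 dvd l" "!!h. ht h : S ==> ~ Em R l (h @ w) (w' @ h)"
proof -
 obtain Rs ls where rl: "!!s. s : S ==> ls s > 0"
  "!!s R l h. s : S ==> R >= Rs s ==> ls s dvd l ==> ht h = s ==> ~ Em R l (h @ w) (w' @ h)"
  using assms(2) by metis
 define R where "R = R1 + (SUM s:S. Rs s)"
 define l where "l = l1 * (\<Prod>s\<in>S. ls s)"
 have "l > 0" using assms(3) rl(1) by (auto simp: l_def intro!: mult_pos_pos prod_pos)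
 moreover have "R >= R1" "l1 dvd l" by (auto simp: R_def l_def)
 moreover have "~ Em R l (h @ w) (w' @ h)" if "ht h : S" for h
 proof (rule rl(2)[OF that])
  show "Rs (ht h) <= R" using member_le_sum[OF that, of Rs] assms(1) by (simp add: R_def)
  show "ls (ht h) dvd l" using dvd_prodI[OF assms(1) that, of ls] by (simp add: l_def)
 qed simp
 ultimately show thesis using that by blast
qed

text \<open>A conjugator in a fine quotient moves the coordinates of \<open>w\<close> to those of \<open>w'\<close> modulo \<open>R!\<close>, so its height is congruent to one of finitely many small
heights, each of which is excluded. The only exception is that all coordinates vanish; then both words are trivial and conjugate.\<close>

lemma separate_height0:
 assumes ht: "ht w = 0" "ht w' = 0" and nc: "!!s. ~ conj_shift s w w'"
 shows "EX R l. l > 0 & (ALL h. ~ Em R l (h @ w) (w' @ h))"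
proof -
 define L where "L = int (max (length w) (length w'))"
 have len: "int (length w) <= L" "int (length w') <= L" by (auto simp: L_def)
 have L: "L >= 0" using len by linarith
 define zb where "zb = (SUM p:UNIV \<times> {-L..L} \<times> {-L..L}. case p of (b, i, j) => \<bar>zz 0 w b i j\<bar> + \<bar>zz 0 w' b i j\<bar>)"
 have zb0: "zb >= 0" unfolding zb_def by (intro sum_nonneg) auto
 have zb: "\<bar>zz 0 w b i j\<bar> <= zb" "\<bar>zz 0 w' b i j\<bar> <= zb" for b i j
 proof -
  have "\<bar>zz 0 w b i j\<bar> + \<bar>zz 0 w' b i j\<bar> <= zb"
  proof (cases "i : {-L..L} & j : {-L..L}")
   case True
   thus ?thesis unfolding zb_def
    using member_le_sum[of "(b, i, j)" "UNIV \<times> {-L..L} \<times> {-L..L}" "%(b, i, j). \<bar>zz 0 w b i j\<bar> + \<bar>zz 0 w' b i j\<bar>"] by auto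
  next
   case False
   hence "\<bar>i\<bar> >= L \<or> \<bar>j\<bar> >= L" by auto
   hence "zz 0 w b i j = 0" "zz 0 w' b i j = 0" using len by (auto intro!: zz_supp)
   thus ?thesis using zb0 by simp
  qed
  thus "\<bar>zz 0 w b i j\<bar> <= zb" "\<bar>zz 0 w' b i j\<bar> <= zb" by linarith+
 qed
 have l1: "2 * L + zb + 1 > 0" using zb0 L by simp
 obtain R l where R: "l > 0" "R >= nat (2 * L + 1)" "2 * L + zb + 1 dvd l" "!!h. ht h : {-(2*L)..2*L} ==> ~ Em R l (h @ w) (w' @ h)"
 proof (rule separate_from_shifts[OF _ _ l1, of "{-(2*L)..2*L}" w w' "nat (2 * L + 1)"])
  show "separated s w w'"
   if "s : {-(2*L)..2*L}" for s
   using that by (intro separate_height0_shift[OF ht len _ nc]) auto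
 qed (use that in auto)
 define m where "m = (fact R :: int)"
 have m: "2 * L + 1 <= m" using fact_ge_int[OF R(2)] by (simp add: m_def)
 have lb: "2 * L + zb + 1 <= l" using R(1,3) by (simp add: zdvd_imp_le)
 have "~ Em R l (h @ w) (w' @ h)" for h
 proof
  assume E: "Em R l (h @ w) (w' @ h)"
  define s where "s = ht h"
  have no: False if "[s' = s] (mod m)" "\<bar>s'\<bar> <= 2 * L" for s'
  proof -
   have "s' : {-(2*L)..2*L}" using that(2) by auto
   thus False using Em_shift_period[OF E, of s'] that(1) R(4) unfolding s_def m_def by blast
  qed
  have cvm: "cv m w' c i = cv m w c (i - s)" for c i
  proof -
   have "[cv m h c i + cv m w c (i - s) = cv m h c i + cv m w' c i] (mod l)"
    using quotient_eqs(2)[OF E[folded m_def], of c i] ht by (simp add: s_def add.commute)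
   hence "[cv m w c (i - s) - cv m w' c i = 0] (mod l)"
    by (simp add: cong_add_lcancel cong_diff_iff_cong_0)
   moreover have "\<bar>cv m w c (i - s) - cv m w' c i\<bar> < l"
    using abs_cv[of m w c "i - s"] abs_cv[of m w' c i] len lb zb0 by linarith
   ultimately show ?thesis using cong_zero_small by fastforce
  qed
  have origin: "EX i'. m dvd i - i' & \<bar>i'\<bar> < L" if "cv m w' c i ~= 0 \<or> (EX b j. zz m w' b i j ~= 0)" for c i
  proof (rule ccontr)
   assume a: "~ (EX i'. m dvd i - i' & \<bar>i'\<bar> < L)"
   hence "of_bool (m dvd i - i') * cv 0 w' c i' = 0" "of_bool (m dvd i - i') * of_bool (m dvd j - j') * zz 0 w' b i' j' = 0" for i' j' c b j
    using cv_supp[of w' i' c] zz_supp[of w' i' j' b] len by (cases "m dvd i - i'"; force)+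
   note vanish = this
   have "cv m w' c i = 0" "zz m w' b i j = 0" for c b j
    unfolding cv_fold[OF len(2), of m] zz_fold[OF len(2) fold_mod_simps(2)[of R, folded m_def]]
    by (simp_all only: vanish sum.neutral_const)
   thus False using that by simp
  qed
  have shift: False if nz: "cv m w' c (i + s) ~= 0 \<or> (EX b j. zz m w' b (i + s) j ~= 0)" and iL: "\<bar>i\<bar> < L" for c i
  proof -
   obtain i' where i': "m dvd (i + s) - i'" "\<bar>i'\<bar> < L" using origin[OF nz] by blast
   show False
   proof (rule no)
    have "m dvd (i' - i) - s" using i'(1) by (subst dvd_diff_commute) (simp add: algebra_simps)
    thus "[i' - i = s] (mod m)" by (simp add: cong_iff_dvd_diff)
    show "\<bar>i' - i\<bar> <= 2 * L" using i'(2) iL by linarith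
   qed
  qed
  have cv0: "cv 0 w c i = 0" for c i
  proof (rule ccontr)
   assume a: "cv 0 w c i ~= 0"
   hence i: "\<bar>i\<bar> < int (length w)" using cv_supp[of w i c] by linarith
   hence "cv m w c i = cv 0 w c i" using len m by (intro fold_exact) linarith
   hence "cv m w' c (i + s) ~= 0" using cvm[of c "i + s"] a by simp
   thus False using shift[of c i] i len by linarith
  qed
  have cvm0: "cv m w c i = 0" for c i unfolding cv_fold[OF len(1), of m] cv0 by simp
  have cv0': "cv 0 w' c i = 0" for c i
  proof (cases "\<bar>i\<bar> < int (length w')")
   case True
   hence "cv m w' c i = cv 0 w' c i" using len m by (intro fold_exact) linarith
   thus ?thesis using cvm[of c i] cvm0 by simp
  qed (simp add: cv_supp)
  have om0: "cv m w = (%c i. 0)" "cv m w' = (%c i. 0)" using cvm cvm0 by (auto intro!: ext)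
  have zc: "[zz m w' b i j = zz m w b (i - s) (j - s)] (mod l)" for b i j
  proof -
   have "[zz m h b i j + zz m w b (i - s) (j - s) = zz m h b i j + zz m w' b i j] (mod l)"
    using quotient_eqs(3)[OF E[folded m_def], of b i j] ht om0 by (simp add: s_def add.commute)
   thus ?thesis by (simp add: cong_add_lcancel cong_sym_eq)
  qed
  have z0: "zz 0 w b i j = 0" for b i j
  proof (rule ccontr)
   assume a: "zz 0 w b i j ~= 0"
   hence i: "\<bar>i\<bar> < int (length w)" "\<bar>j\<bar> < int (length w)" using zz_supp[of w i j b] by linarith+
   hence e: "zz m w b i j = zz 0 w b i j" using len m by (intro fold_exact) linarith+
   have "zz m w' b (i + s) (j + s) ~= 0"
   proof
    assume "zz m w' b (i + s) (j + s) = 0"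
    hence "[zz 0 w b i j = 0] (mod l)" using zc[of b "i + s" "j + s"] e by (simp add: cong_sym_eq)
    thus False using a cong_zero_small[of "zz 0 w b i j" l] zb(1)[of b i j] lb L by linarith
   qed
   thus False using shift[of True i] i len by fastforce
  qed
  have zm0: "zz m w b i j = 0" for b i j
   unfolding zz_fold[OF len(1) fold_mod_simps(2)[of R, folded m_def]] z0 by simp
  have z0': "zz 0 w' b i j = 0" for b i j
  proof (cases "\<bar>i\<bar> < int (length w') & \<bar>j\<bar> < int (length w')")
   case True
   hence "zz m w' b i j = zz 0 w' b i j" using len m by (intro fold_exact) linarith+
   hence "[zz 0 w' b i j = 0] (mod l)" using zc[of b i j] zm0 by simp
   thus ?thesis using cong_zero_small[of "zz 0 w' b i j" l] zb(2)[of b i j] lb L by linarith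
  qed (auto intro!: zz_supp)
  have "E w w'" using ht cv0 cv0' z0 z0' by (simp add: E_iff)
  hence "conj_shift 0 w w'" unfolding conj_shift_def by (intro exI[of _ "[]"]) auto
  thus False using nc by blast
 qed
 thus ?thesis using R(1) by blast
qed

end

section \<open>Separating words of non-zero height\<close>

text \<open>Orbit sums do not change under folding, as the period \<open>k\<close> divides \<open>m\<close>.\<close>

lemma fold_residue_sum:
 fixes k m :: int
 assumes "k dvd m" "m > 0"
 shows "(SUM i:{0..<m}. of_bool (k dvd i - ii) * (SUM i':A. of_bool (m dvd i - i') * g i')) =
  (SUM i':A. of_bool (k dvd i' - ii) * (g i' :: int))"
proof -
 have "(SUM i:{0..<m}. of_bool (k dvd i - ii) * (SUM i':A. of_bool (m dvd i - i') * g i')) =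
  (SUM i':A. SUM i:{0..<m}. of_bool (m dvd i - i') * (of_bool (k dvd i - ii) * g i'))"
  unfolding sum_distrib_left by (subst sum.swap) (simp only: mult.left_commute)
 also have "... = (SUM i':A. of_bool (k dvd i' mod m - ii) * g i')"
  by (simp only: sum_residue[OF assms(2)])
 also have "... = (SUM i':A. of_bool (k dvd i' - ii) * g i')"
 proof (rule sum.cong[OF HOL.refl])
  fix i'
  have "k dvd i' - i' mod m" using assms(1) by (metis dvd_trans dvd_minus_mod)
  hence "k dvd i' mod m - ii \<longleftrightarrow> k dvd i' - ii"
   using dvd_add_right_iff[of k "i' - i' mod m" "i' mod m - ii"] by simp
  thus "of_bool (k dvd i' mod m - ii) * g i' = of_bool (k dvd i' - ii) * g i'" by simp
 qed
 finally show ?thesis .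
qed

lemma omp_sum:
 "(SUM n:A. of_bool (P n) * omp d p q (%c. v c n) (%c. v' c n) b) =
 omp d p q (%c. SUM n:A. of_bool (P n) * v c n) (%c. SUM n:A. of_bool (P n) * v' c n) b"
 by (cases b) (simp_all add: omp_def sum_distrib_left sum_distrib_right algebra_simps sum_subtractf sum.distrib
   del: sum_of_bool_mult_eq sum_mult_of_bool_eq)

lemma omp_cong:
 assumes "!!c. [p c = p' c] (mod l)" "!!c. [q c = q' c] (mod l)"
 shows "[omp d p q v v' b = omp d p' q' v v' b] (mod l)"
 using assms by (cases b) (auto simp: omp_def intro!: cong_add cong_diff cong_mult)

context exponents
begin

lemma dvd_fact_int: "k ~= 0 ==> nat \<bar>k\<bar> <= R ==> k dvd (fact R :: int)"
proof -
 assume "k ~= 0" "nat \<bar>k\<bar> <= R"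
 hence "nat \<bar>k\<bar> dvd fact R" by (intro dvd_fact) auto
 hence "int (nat \<bar>k\<bar>) dvd int (fact R)" by (simp only: int_dvd_int_iff)
 thus "k dvd (fact R :: int)" by simp
qed

text \<open>The difference equation for the exponents persists in the quotient, and its sum over a full orbit modulo \<open>R!\<close> vanishes.\<close>

lemma separate_class_sum:
 assumes ht: "ht w = ht w'" "ht w ~= 0" and len: "int (length w) <= L" "int (length w') <= L" and s: "\<bar>s\<bar> <= 2 * L"
  and R: "nat \<bar>ht w\<bar> <= R" and E: "Em R l (h @ w) (w' @ h)" "ht h = s"
 shows "l dvd class_sum (3*L) (ht w) ii (dlt s w w' c)"
proof -
 define m where "m = (fact R :: int)"
 define k where "k = ht w"
 have m: "m > 0" "k dvd m" using dvd_fact_int[OF ht(2) R] by (auto simp: m_def k_def)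
 define T where "T = pw 0 s @ w"
 have cT: "cv n T c i = cv n w c (i - s)" for n c i by (simp add: T_def ht_pw)
 have lT: "int (length T) <= 3 * L" "int (length w') <= 3 * L" using s len by (auto simp: T_def)
 define u where "u = cv m h c"
 have d: "cv m w' c i - cv m w c (i - s) = (SUM i':{-(3*L)..3*L}. of_bool (m dvd i - i') * dlt s w w' c i')" for i
  unfolding cT[symmetric] dlt_def cv_fold[OF lT(1), of m] cv_fold[OF lT(2), of m]
  by (simp add: right_diff_distrib sum_subtractf del: sum_of_bool_mult_eq)
 have kk: "k dvd i - k - ii \<longleftrightarrow> k dvd i - ii" for i
  using dvd_add_right_iff[of k "-k" "i - ii"] by (simp add: algebra_simps)
 have per: "of_bool (k dvd i - ii) * u i = of_bool (k dvd j - ii) * u j" if "m dvd i - j" for i j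
 proof -
  have "k dvd i - j" using that m(2) dvd_trans by blast
  hence "k dvd i - ii \<longleftrightarrow> k dvd j - ii" using dvd_add_right_iff[of k "i - j" "j - ii"] by simp
  thus ?thesis using cv_mod[OF that, of h c] by (simp add: u_def)
 qed
 have "(SUM i:{0..<m}. of_bool (k dvd i - ii) * u (i - k)) = (SUM i:{0..<m}. of_bool (k dvd i - ii) * u i)"
  using periodic_sum[OF m(1), of "%i. of_bool (k dvd i - ii) * u i" "-k"] per
  by (simp add: kk del: sum_of_bool_mult_eq)
 hence zero: "(SUM i:{0..<m}. of_bool (k dvd i - ii) * (u i - u (i - k))) = 0"
  by (simp add: right_diff_distrib sum_subtractf del: sum_of_bool_mult_eq)
 have "[(SUM i:{0..<m}. of_bool (k dvd i - ii) * (u i - u (i - k))) =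
  (SUM i:{0..<m}. of_bool (k dvd i - ii) * (cv m w' c i - cv m w c (i - s)))] (mod l)"
 proof (intro cong_sum cong_mult)
  fix i
  have "[u i + cv m w c (i - s) = cv m w' c i + u (i - k)] (mod l)"
   using quotient_eqs(2)[OF E(1)[folded m_def], of c i] ht E(2) by (simp add: u_def k_def)
  thus "[u i - u (i - k) = cv m w' c i - cv m w c (i - s)] (mod l)"
   by (simp add: cong_iff_dvd_diff algebra_simps)
 qed simp
 hence "[0 = class_sum (3*L) k ii (dlt s w w' c)] (mod l)"
  unfolding zero d fold_residue_sum[OF m(2,1)] .
 thus ?thesis by (simp only: k_def[symmetric] cong_sym_eq[of 0] cong_0_iff)
qed

text \<open>In the quotient the exponents of a conjugator need not be \<open>u0\<close>: they may differ from it by a function \<open>p\<close> that is periodic modulo \<open>l\<close>, for which the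
finite support argument is no longer available. Its contribution to the orbit sum through \<open>(i, i - \<mu>)\<close> is bilinear in \<open>p\<close> and in orbit sums, hence unchanged when
\<open>i\<close> alone is moved by a multiple \<open>N'\<close> of the period. But the diagonal through \<open>(i + N', i - \<mu>)\<close> lies outside the support of the words, so its orbit sum is 0.
Therefore the contribution of \<open>p\<close> vanishes modulo \<open>l\<close>.\<close>

lemma separate_orbit_sum:
 assumes ht: "ht w = ht w'" "ht w ~= 0" and h0: "ht h0 = 0"
  and A: "A = h0 @ pw 0 s @ w" and A': "A' = w' @ h0 @ pw 0 s" and cvA: "!!c i. cv 0 A c i = cv 0 A' c i"
  and N: "int (length A) <= N" "int (length A') <= N"
  and R1: "nat \<bar>ht w\<bar> <= R1" "nat (4 * N + 1) <= R1" and R: "R1 + 2 <= R"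
  and E: "Em R l (h @ w) (w' @ h)" "ht h = s" and mu: "\<bar>\<mu>\<bar> <= 2 * N"
 shows "l dvd class_sum N (ht w) ii (%i. (zz 0 A' b i (i - \<mu>) - zz 0 A b i (i - \<mu>)))"
proof -
 define m N' k where "m = (fact R :: int)" and "N' = (fact R1 :: int)" and "k = ht w"
 have N0: "N >= 0" using N by linarith
 have N': "4 * N + 1 <= N'" using fact_ge_int[OF R1(2)] by (simp add: N'_def)
 have kN: "k dvd N'" using dvd_fact_int[OF ht(2) R1(1)] by (simp add: N'_def k_def)
 have "(fact (R1 + 2) :: int) = (int R1 + 2) * ((int R1 + 1) * fact R1)" by (simp add: algebra_simps)
 moreover have "R1 >= 1" using R1(1) ht(2) by linarith
 hence "(int R1 + 2) * ((int R1 + 1) * fact R1) >= 3 * (2 * (fact R1 :: int))" by (intro mult_mono) auto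
 ultimately have "(fact (R1 + 2) :: int) >= 6 * N'" by (simp add: N'_def)
 hence m6: "m >= 6 * N'" using fact_mono[OF R, where 'a = int] by (simp add: m_def)
 have m0: "m > 0" by (simp add: m_def)
 have "N' dvd m" unfolding m_def N'_def using R by (intro fact_dvd) simp
 hence km: "k dvd m" using kN dvd_trans by blast
 have fm: "fold_mod m" by (simp add: m_def)
 have cvAm: "cv m A c i = cv m A' c i" for c i
  unfolding cv_fold[OF N(1), of m] cv_fold[OF N(2), of m] cvA ..
 have k': "ht w' = k" using ht by (simp add: k_def)
 \<comment> \<open>The deviation of the exponents of \<open>h\<close> from those of \<open>h0\<close>; it is periodic modulo \<open>l\<close>.\<close>
 define p where "p c i = cv m h c i - cv m h0 c i" for c i
 define V where "V c i = cv m w c (i - s) + cv m w' c i" for c i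
 define y where "y i j = zz m h b i j - zz m h0 b i j" for i j
 define Xm where "Xm i j = zz m A' b i j - zz m A b i j" for i j
 define X0 where "X0 i j = zz 0 A' b i j - zz 0 A b i j" for i j
 have pk: "[p c i = p c (i - k)] (mod l)" for c i
 proof -
  have "[cv m h c i + cv m w c (i - s) = cv m w' c i + cv m h c (i - k)] (mod l)"
   using quotient_eqs(2)[OF E(1)[folded m_def], of c i] k' E(2) by simp
  moreover have "cv m h0 c i + cv m w c (i - s) = cv m w' c i + cv m h0 c (i - k)"
   using cvAm[of c i] by (simp add: A A' h0 ht_pw k')
  ultimately have "p c i - p c (i - k) = (cv m h c i + cv m w c (i - s)) - (cv m w' c i + cv m h c (i - k))"
   "l dvd (cv m h c i + cv m w c (i - s)) - (cv m w' c i + cv m h c (i - k))"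
   by (simp_all add: p_def cong_iff_dvd_diff)
  thus ?thesis by (simp only: cong_iff_dvd_diff)
 qed
 have pn: "[p c (i + n) = p c i] (mod l)" if "k dvd n" for c i n
  by (rule cong_periodic_mult[where k = k]) (use pk that in auto)
 have Xc: "[Xm i j = (y i j - y (i - k) (j - k)) + om m p V b i j] (mod l)" for i j
 proof -
  have h: "cv m h = (%c i. p c i + cv m h0 c i)" by (intro ext) (simp add: p_def)
  have 1: "[zz m h b i j + zz m w b (i - s) (j - s) + om m (cv m h) (%c i. cv m w c (i - s)) b i j =
  zz m w' b i j + zz m h b (i - k) (j - k) + om m (cv m w') (%c i. cv m h c (i - k)) b i j] (mod l)"
   using quotient_eqs(3)[OF E(1)[folded m_def], of b i j] k' E(2) by simp
  have 2: "om m (cv m h) (%c i. cv m w c (i - s)) b i j =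
    om m p (%c i. cv m w c (i - s)) b i j + om m (cv m h0) (%c i. cv m w c (i - s)) b i j"
   unfolding h om_add_left ..
  have 3: "om m (cv m w') (%c i. cv m h c (i - k)) b i j =
    om m (cv m w') (%c i. p c (i - k)) b i j + om m (cv m w') (%c i. cv m h0 c (i - k)) b i j"
   unfolding h om_add_right ..
  have 4: "[om m (cv m w') (%c i. p c (i - k)) b i j = om m (cv m w') p b i j] (mod l)"
   by (rule om_cong) (use pk in \<open>auto simp: cong_sym_eq\<close>)
  have 5: "om m (cv m w') p b i j = - om m p (cv m w') b i j" by (rule om_swap)
  have 6: "om m p V b i j = om m p (%c i. cv m w c (i - s)) b i j + om m p (cv m w') b i j"
   unfolding V_def om_add_right ..
  have 7: "Xm i j = zz m w' b i j + zz m h0 b (i - k) (j - k) + om m (cv m w') (%c i. cv m h0 c (i - k)) b i j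
   - (zz m h0 b i j + zz m w b (i - s) (j - s) + om m (cv m h0) (%c i. cv m w c (i - s)) b i j)"
   by (simp add: Xm_def A A' zz_append h0 ht_pw k')
  have "l dvd (zz m h b i j + zz m w b (i - s) (j - s) + om m (cv m h) (%c i. cv m w c (i - s)) b i j) -
   (zz m w' b i j + zz m h b (i - k) (j - k) + om m (cv m w') (%c i. cv m h c (i - k)) b i j)"
   using 1 by (simp only: cong_iff_dvd_diff)
  moreover have "l dvd om m (cv m w') (%c i. p c (i - k)) b i j - om m (cv m w') p b i j"
   using 4 by (simp only: cong_iff_dvd_diff)
  ultimately have "l dvd (zz m h b i j + zz m w b (i - s) (j - s) + om m (cv m h) (%c i. cv m w c (i - s)) b i j) -
   (zz m w' b i j + zz m h b (i - k) (j - k) + om m (cv m w') (%c i. cv m h c (i - k)) b i j)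
   + (om m (cv m w') (%c i. p c (i - k)) b i j - om m (cv m w') p b i j)" by (rule dvd_add)
  thus ?thesis unfolding cong_iff_dvd_diff 2 3 5 6 7 y_def
   by (subst dvd_diff_commute) (simp add: algebra_simps)
 qed
 \<comment> \<open>Sums over a full orbit of the shift by \<open>k\<close> on pairs of indices modulo \<open>m\<close>.\<close>
 define Osum where "Osum f i j = (SUM n:{0..<m}. of_bool (k dvd n) * f (i + n) (j + n))" for f :: "int => int => int" and i j
 have kper: "k dvd n \<longleftrightarrow> k dvd n'" if "m dvd n - n'" for n n'
  using dvd_add_right_iff[of k "n - n'" n'] dvd_trans[OF km that] by simp
 have shift_per: "(SUM n:{0..<m}. of_bool (k dvd n) * g (n + a)) = (SUM n:{0..<m}. of_bool (k dvd n) * g n)"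
  if "k dvd a" "!!i j. m dvd i - j ==> g i = g j" for g :: "int => int" and a
 proof -
  have "k dvd n + a \<longleftrightarrow> k dvd n" for n using dvd_add_left_iff[OF that(1)] .
  thus ?thesis using periodic_sum[OF m0, of "%n. of_bool (k dvd n) * g n" a] kper that(2)
   by (simp del: sum_of_bool_mult_eq)
 qed
 have y0: "Osum (%i j. y i j - y (i - k) (j - k)) i j = 0" for i j
 proof -
  have yper: "y (i + n) (j + n) = y (i + n') (j + n')" if "m dvd n - n'" for n n'
   using zz_mod[OF fm, of "i + n" "i + n'" "j + n" "j + n'"] that by (simp add: y_def)
  have "(SUM n:{0..<m}. of_bool (k dvd n) * y (i + (n + - k)) (j + (n + - k))) = (SUM n:{0..<m}. of_bool (k dvd n) * y (i + n) (j + n))"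
   by (rule shift_per) (use yper in auto)
  thus ?thesis by (simp add: Osum_def right_diff_distrib sum_subtractf add_diff_eq del: sum_of_bool_mult_eq)
 qed
 define cV where "cV c i = (SUM n:{0..<m}. of_bool (k dvd n) * V c (i + n))" for c i
 have cVper: "cV c (i + N') = cV c i" for c i
 proof -
  have vper: "V c (i + n) = V c (i + n')" if "m dvd n - n'" for n n'
   using cv_mod[of m "i + n" "i + n'" w' c] cv_mod[of m "i + n - s" "i + n' - s" w c] that by (simp add: V_def)
  have "(SUM n:{0..<m}. of_bool (k dvd n) * V c (i + (n + N'))) = cV c i"
   unfolding cV_def by (rule shift_per[OF kN]) (use vper in auto)
  thus ?thesis by (simp add: cV_def add.assoc add.commute[of N'] del: sum_of_bool_mult_eq)
 qed
 have OX: "[Osum Xm i j = omp (dm m (i - j)) (%c. p c i) (%c. p c j) (%c. cV c i) (%c. cV c j) b] (mod l)" for i j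
 proof -
  have "[Osum Xm i j = Osum (%i j. (y i j - y (i - k) (j - k)) + om m p V b i j) i j] (mod l)"
   unfolding Osum_def by (intro cong_sum cong_mult Xc) simp
  also have "Osum (%i j. (y i j - y (i - k) (j - k)) + om m p V b i j) i j =
   Osum (%i j. y i j - y (i - k) (j - k)) i j + Osum (om m p V b) i j"
   by (simp add: Osum_def distrib_left sum.distrib del: sum_of_bool_mult_eq)
  also have "... = Osum (om m p V b) i j" unfolding y0 by simp
  also have "[Osum (om m p V b) i j = (SUM n:{0..<m}. of_bool (k dvd n) *
    omp (dm m (i - j)) (%c. p c i) (%c. p c j) (%c. V c (i + n)) (%c. V c (j + n)) b)] (mod l)"
   unfolding Osum_def
  proof (rule cong_sum)
   fix n
   show "[of_bool (k dvd n) * om m p V b (i + n) (j + n) = of_bool (k dvd n) *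
    omp (dm m (i - j)) (%c. p c i) (%c. p c j) (%c. V c (i + n)) (%c. V c (j + n)) b] (mod l)"
   proof (cases "k dvd n")
    case True
    thus ?thesis by (simp add: om_omp) (intro omp_cong pn)
   qed simp
  qed
  also have "(SUM n:{0..<m}. of_bool (k dvd n) *
    omp (dm m (i - j)) (%c. p c i) (%c. p c j) (%c. V c (i + n)) (%c. V c (j + n)) b) =
   omp (dm m (i - j)) (%c. p c i) (%c. p c j) (%c. cV c i) (%c. cV c j) b"
   unfolding cV_def by (rule omp_sum)
  finally show ?thesis .
 qed
 have OX0: "Osum Xm i j = (SUM i':{-N..N}. SUM j':{-N..N}. of_bool (k dvd i' - i) * of_bool (m dvd (i - j) - (i' - j')) * X0 i' j')" for i j
 proof -
  have Xf: "Xm i j = (SUM i':{-N..N}. SUM j':{-N..N}. of_bool (m dvd i - i') * of_bool (m dvd j - j') * X0 i' j')" for i j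
   unfolding Xm_def zz_fold[OF N(1) fm] zz_fold[OF N(2) fm] X0_def
   by (simp add: right_diff_distrib sum_subtractf del: sum_of_bool_mult_eq sum_mult_of_bool_eq)
  have "Osum Xm i j = (SUM n:{0..<m}. SUM x:{-N..N}\<times>{-N..N}. of_bool (m dvd n - (fst x - i)) *
    (of_bool (k dvd n) * of_bool (m dvd j + n - snd x) * X0 (fst x) (snd x)))"
   unfolding Osum_def Xf sum.cartesian_product' sum_distrib_left
   by (intro sum.cong HOL.refl) (simp add: algebra_simps)
  also have "... = (SUM x:{-N..N}\<times>{-N..N}. SUM n:{0..<m}. of_bool (m dvd n - (fst x - i)) *
    (of_bool (k dvd n) * of_bool (m dvd j + n - snd x) * X0 (fst x) (snd x)))"
   by (rule sum.swap)
  also have "... = (SUM x:{-N..N}\<times>{-N..N}. of_bool (k dvd (fst x - i) mod m) * of_bool (m dvd j + (fst x - i) mod m - snd x) * X0 (fst x) (snd x))"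
   by (simp only: sum_residue[OF m0])
  also have "... = (SUM x:{-N..N}\<times>{-N..N}. of_bool (k dvd fst x - i) * of_bool (m dvd (i - j) - (fst x - snd x)) * X0 (fst x) (snd x))"
  proof (rule sum.cong[OF HOL.refl])
   fix x :: "int \<times> int"
   define r where "r = (fst x - i) mod m"
   have r: "m dvd r - (fst x - i)" unfolding r_def by (metis dvd_minus_mod dvd_diff_commute)
   have "m dvd j + r - snd x \<longleftrightarrow> m dvd (j + r - snd x) - (r - (fst x - i))" by (simp only: dvd_diff_left_iff[OF r])
   also have "... \<longleftrightarrow> m dvd (i - j) - (fst x - snd x)" by (subst dvd_diff_commute[of m "i - j"]) (simp add: algebra_simps)
   finally show "of_bool (k dvd (fst x - i) mod m) * of_bool (m dvd j + (fst x - i) mod m - snd x) * X0 (fst x) (snd x) =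
    of_bool (k dvd fst x - i) * of_bool (m dvd (i - j) - (fst x - snd x)) * X0 (fst x) (snd x)"
    using kper[OF r] by (simp add: r_def)
  qed
  finally show ?thesis unfolding sum.cartesian_product' fst_conv snd_conv .
 qed
 have "Osum Xm ii (ii - \<mu>) = class_sum N k ii (%i'. X0 i' (i' - \<mu>))"
  unfolding OX0
 proof (rule sum.cong[OF HOL.refl])
  fix i' assume i': "i' : {-N..N}"
  have "of_bool (k dvd i' - ii) * of_bool (m dvd (ii - (ii - \<mu>)) - (i' - j')) * X0 i' j' =
   (if j' = i' - \<mu> then of_bool (k dvd i' - ii) * X0 i' (i' - \<mu>) else 0)" if "j' : {-N..N}" for j'
  proof -
   have "\<bar>\<mu> - (i' - j')\<bar> < m" using i' that mu m6 N' N0 by auto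
   hence "m dvd \<mu> - (i' - j') \<longleftrightarrow> \<mu> - (i' - j') = 0" using zdvd_not_zless[of "\<bar>\<mu> - (i' - j')\<bar>" m] by auto
   thus ?thesis by auto
  qed
  hence "(SUM j':{-N..N}. of_bool (k dvd i' - ii) * of_bool (m dvd (ii - (ii - \<mu>)) - (i' - j')) * X0 i' j') =
   (SUM j':{-N..N}. if j' = i' - \<mu> then of_bool (k dvd i' - ii) * X0 i' (i' - \<mu>) else 0)" by (rule sum.cong[OF HOL.refl])
  also have "... = of_bool (k dvd i' - ii) * X0 i' (i' - \<mu>)"
  proof (cases "i' - \<mu> : {-N..N}")
   case False
   hence "\<bar>i' - \<mu>\<bar> > N" by auto
   hence "X0 i' (i' - \<mu>) = 0" using N by (simp add: X0_def zz_supp)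
   thus ?thesis by simp
  qed simp
  finally show "(SUM j':{-N..N}. of_bool (k dvd i' - ii) * of_bool (m dvd (ii - (ii - \<mu>)) - (i' - j')) * X0 i' j') =
   of_bool (k dvd i' - ii) * X0 i' (i' - \<mu>)" .
 qed
 \<comment> \<open>All pairs of indices in the support have difference at most \<open>2 N\<close>, and \<open>N'\<close> and \<open>m\<close> are much larger.\<close>
 moreover have "Osum Xm (ii + N') (ii - \<mu>) = 0"
  unfolding OX0
 proof (intro sum.neutral ballI)
  fix i' j' assume ij: "i' : {-N..N}" "j' : {-N..N}"
  hence "0 < (ii + N' - (ii - \<mu>)) - (i' - j')" "(ii + N' - (ii - \<mu>)) - (i' - j') < m"
   using mu m6 N' N0 by auto
  hence "~ m dvd (ii + N' - (ii - \<mu>)) - (i' - j')" by (rule zdvd_not_zless)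
  thus "of_bool (k dvd i' - (ii + N')) * of_bool (m dvd (ii + N' - (ii - \<mu>)) - (i' - j')) * X0 i' j' = 0" by simp
 qed
 \<comment> \<open>Here \<open>N' = R1!\<close> does not divide \<open>\<mu>\<close> unless \<open>\<mu> = 0\<close>, so the exponent \<open>D\<close> is the same for \<open>\<mu>\<close> and \<open>\<mu> + N'\<close>. For \<open>\<mu> = 0\<close> the form multiplied by \<open>D\<close> vanishes by antisymmetry.\<close>
 moreover have "[Osum Xm (ii + N') (ii - \<mu>) = Osum Xm ii (ii - \<mu>)] (mod l)"
 proof -
  define j where "j = ii - \<mu>"
  have pN: "[p c (ii + N') = p c ii] (mod l)" for c by (rule pn[OF kN])
  have "[omp (dm m (ii + N' - j)) (%c. p c (ii + N')) (%c. p c j) (%c. cV c (ii + N')) (%c. cV c j) b =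
   omp (dm m (ii + N' - j)) (%c. p c ii) (%c. p c j) (%c. cV c ii) (%c. cV c j) b] (mod l)"
   unfolding cVper by (rule omp_cong) (use pN in auto)
  also have "omp (dm m (ii + N' - j)) (%c. p c ii) (%c. p c j) (%c. cV c ii) (%c. cV c j) b =
   omp (dm m (ii - j)) (%c. p c ii) (%c. p c j) (%c. cV c ii) (%c. cV c j) b"
  proof (cases "\<mu> = 0")
   case True
   thus ?thesis by (simp add: j_def omp_def mult.commute)
  next
   case False
   have nz: "~ m dvd \<mu>" "~ m dvd \<mu> + N'"
    using False mu m6 N' N0 zdvd_not_zless[of "\<bar>\<mu>\<bar>" m] zdvd_not_zless[of "\<mu> + N'" m] by auto
   have "~ fact R1 dvd \<mu>" using False mu N' N0 zdvd_not_zless[of "\<bar>\<mu>\<bar>" N'] by (auto simp: N'_def)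
   hence "rk (\<mu> + N') = rk \<mu>" by (rule rk_period) (simp add: N'_def)
   hence "dm m (\<mu> + N') = dm m \<mu>" using nz by (simp add: dm_def D_def)
   thus ?thesis by (simp add: j_def add.commute)
  qed
  finally show ?thesis using OX[of "ii + N'" j] OX[of ii j] unfolding j_def[symmetric] using cong_sym cong_trans by blast
 qed
 ultimately show ?thesis
  by (simp add: X0_def k_def cong_0_iff cong_sym_eq[of 0] del: sum_of_bool_mult_eq)
qed

text \<open>One of the sums in \<open>orbit_crit\<close> is not 0, and it is not divisible by any multiple of its absolute value plus 1.\<close>

lemma separate_shift_nonzero:
 assumes ht: "ht w = ht w'" "ht w ~= 0" and len: "int (length w) <= L" "int (length w') <= L" and s: "\<bar>s\<bar> <= 2 * L" and L: "L >= 1"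
  and nc: "~ conj_shift s w w'"
 shows "separated s w w'"
proof (cases "EX c ii. class_sum (3*L) (ht w) ii (dlt s w w' c) ~= 0")
 case True
 then obtain c ii where nz: "class_sum (3*L) (ht w) ii (dlt s w w' c) ~= 0" by blast
 define C where "C = class_sum (3*L) (ht w) ii (dlt s w w' c)"
 have "~ Em R l (h @ w) (w' @ h)" if "R >= nat \<bar>ht w\<bar>" "\<bar>C\<bar> + 1 dvd l" "ht h = s" for R l h
  using separate_class_sum[OF ht len s that(1) _ that(3)] zero_dvd_bound[OF that(2)] nz unfolding C_def by blast
 thus ?thesis by (intro exI[of _ "nat \<bar>ht w\<bar>"] exI[of _ "\<bar>C\<bar> + 1"]) auto
next
 case False
 hence cs: "class_sum (3*L) (ht w) ii (dlt s w w' c) = 0" for c ii by blast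
 note up = u0_props[OF len s L ht cs]
 obtain h0 where h0: "ht h0 = 0" "!!c i. cv 0 h0 c i = u0 (3*L) s w w' c i"
  "int (length h0) <= (2 * (3 * L) + 1) * (4 * (3 * L) + 2 * ((2 * (3 * L) + 1) * (2 * L)))"
  using word_of_vector[of "3 * L" "u0 (3*L) s w w'", OF up(2,3)] L by auto
 have cvh0: "cv 0 h0 = u0 (3*L) s w w'" using h0(2) by (intro ext)
 define A A' where "A = h0 @ pw 0 s @ w" and "A' = w' @ h0 @ pw 0 s"
 have cvA: "cv 0 A c i = cv 0 A' c i" for c i
  using up(1)[of c i] ht by (simp add: A_def A'_def h0(1) ht_pw cvh0 dlt_def)
 define N where "N = 4 * L + int (length h0) + int (length A) + int (length A')"
 have N: "4 * L <= N" "int (length h0) + L <= N" "int (length A) <= N" "int (length A') <= N"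
  using L by (auto simp: N_def)
 note os = orbit_sum_words[OF len s L ht cs h0(1) cvh0 N[unfolded A_def A'_def], folded A_def A'_def]
 have "~ orbit_crit L s w w'"
  using orbit_imp_short_conjugator[OF len s L ht] nc unfolding conj_shift_def by blast
 then obtain b \<mu> ii where nz: "class_sum N (ht w) ii (%i. (zz 0 A' b i (i - \<mu>) - zz 0 A b i (i - \<mu>))) ~= 0"
  using cs unfolding orbit_crit_def os by blast
 define C where "C = class_sum N (ht w) ii (%i. (zz 0 A' b i (i - \<mu>) - zz 0 A b i (i - \<mu>)))"
 have mu: "\<bar>\<mu>\<bar> <= 2 * N"
 proof (rule ccontr)
  assume a: "~ \<bar>\<mu>\<bar> <= 2 * N"
  have "C = 0" unfolding C_def
  proof (intro sum.neutral ballI)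
   fix i assume "i : {-N..N}"
   hence "\<bar>i - \<mu>\<bar> > N" using a by auto
   thus "of_bool (ht w dvd i - ii) * (zz 0 A' b i (i - \<mu>) - zz 0 A b i (i - \<mu>)) = 0"
    using N by (simp add: zz_supp)
  qed
  thus False using nz by (simp add: C_def)
 qed
 define R1 where "R1 = max (nat \<bar>ht w\<bar>) (nat (4 * N + 1))"
 have R1: "nat \<bar>ht w\<bar> <= R1" "nat (4 * N + 1) <= R1" by (auto simp: R1_def)
 have "~ Em R l (h @ w) (w' @ h)" if "R1 + 2 <= R" "\<bar>C\<bar> + 1 dvd l" "ht h = s" for R l h
  using separate_orbit_sum[OF ht h0(1) A_def A'_def cvA N(3,4) R1 that(1) _ that(3) mu, of l ii b]
   zero_dvd_bound[OF that(2)] nz unfolding C_def by blast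
 thus ?thesis by (intro exI[of _ "R1 + 2"] exI[of _ "\<bar>C\<bar> + 1"]) auto
qed

text \<open>For non-zero height \<open>k\<close> only the heights modulo \<open>k\<close> of a conjugator matter, which are finitely many.\<close>

lemma separate_words:
 assumes nc: "!!s. ~ conj_shift s w w'"
 shows "EX R l. l > 0 & (ALL h. ~ Em R l (h @ w) (w' @ h))"
proof (cases "ht w = ht w'")
 case False
 define R where "R = nat (\<bar>ht w - ht w'\<bar> + 1)"
 have "~ Em R 1 (h @ w) (w' @ h)" for h
 proof
  assume "Em R 1 (h @ w) (w' @ h)"
  hence "(fact R :: int) dvd ht w - ht w'" by (auto dest: quotient_eqs(1) simp: cong_iff_dvd_diff)
  moreover have "\<bar>ht w - ht w'\<bar> + 1 <= fact R" by (rule fact_ge_int) (simp add: R_def)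
  ultimately show False using False zdvd_not_zless[of "\<bar>ht w - ht w'\<bar>" "fact R"] by auto
 qed
 thus ?thesis by (intro exI[of _ R] exI[of _ 1]) auto
next
 case True
 show ?thesis
 proof (cases "ht w = 0")
  case z: True
  thus ?thesis using separate_height0[of w w'] True nc by simp
 next
  case False
  define L where "L = int (max (length w) (length w'))"
  have len: "int (length w) <= L" "int (length w') <= L" by (auto simp: L_def)
  have L: "L >= 1" using False len ht_le[of w] by linarith
  define S where "S = (%s. s mod ht w) ` UNIV"
  have Sb: "\<bar>s\<bar> <= 2 * L" if "s : S" for s
  proof -
   obtain t where "s = t mod ht w" using \<open>s : S\<close> by (auto simp: S_def)
   thus ?thesis using abs_mod_less[OF False, of t] ht_le[of w] len by linarith
  qed
  hence fS: "finite S" by (intro finite_subset[of S "{-(2*L)..2*L}"]) (auto simp: abs_le_iff minus_le_iff)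
  obtain R l where R: "l > 0" "!!h. ht h : S ==> ~ Em R l (h @ w) (w' @ h)"
  proof (rule separate_from_shifts[OF fS, of w w' 1 0])
   show "separated s w w'" if "s : S" for s
    by (rule separate_shift_nonzero[OF True False len Sb[OF that] L nc])
  qed (use that in auto)
  have "~ Em R l (h @ w) (w' @ h)" for h
  proof
   assume "Em R l (h @ w) (w' @ h)"
   then obtain h' where h': "ht h' = ht h + (- (ht h div ht w)) * ht w" "Em R l (h' @ w) (w' @ h')"
    using Em_shift[of "ht h" R l w w' "- (ht h div ht w)"] by blast
   hence "ht h' : S" unfolding S_def by (intro image_eqI[of _ _ "ht h"]) (auto simp: minus_div_mult_eq_mod)
   thus False using R(2) h'(2) by blast
  qed
  thus ?thesis using R(1) by blast
 qed
qed

end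

section \<open>Finite quotients\<close>

context exponents
begin

abbreviation "Q R l \<equiv> word_group (Em R l)"

text \<open>There are \<open>R!\<close> heights, \<open>2 R!\<close> exponents modulo \<open>l\<close> and \<open>2 (R!)\<^sup>2\<close> central coordinates modulo \<open>l\<close>.\<close>

lemma finite_quotient:
 assumes l: "(l::int) > 0"
 shows "finite (carrier (Q R l))" "order (Q R l) <= fact R * nat l ^ (2 * fact R + 2 * (fact R)\<^sup>2)"
proof -
 interpret F: word_congruence "Em R l" by (rule Em_congruence)
 define m where "m = (fact R :: int)"
 have "m = int (fact R)" by (simp add: m_def)
 hence m: "m > 0" "nat m = fact R" by (simp add: m_def, simp only: nat_int)
 define cl zl where "cl = List.product [False, True] [0..m - 1]"
  and "zl = List.product [False, True] (List.product [0..m - 1] [0..m - 1])"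
 define f where "f w = (ht w mod m, map (%(c, i). cv m w c i mod l) cl @ map (%(b, i, j). zz m w b i j mod l) zl)" for w
 define K :: nat where "K = 2 * fact R + 2 * (fact R)\<^sup>2"
 define B where "B = {0..<m} \<times> {xs. set xs <= {0..<l} & length xs = K}"
 have e: "Em R l u w" if "f u = f w" for u w
 proof -
  have len: "length (map (%(c, i). cv m u c i mod l) cl) = length (map (%(c, i). cv m w c i mod l) cl)" by simp
  have eq: "ht u mod m = ht w mod m" "!!c i. (c, i) : set cl ==> cv m u c i mod l = cv m w c i mod l"
   "!!b i j. (b, i, j) : set zl ==> zz m u b i j mod l = zz m w b i j mod l"
   using that unfolding f_def prod.inject append_eq_append_conv[OF disjI1[OF len]] map_eq_conv by auto
  have r: "i mod m : set [0..m - 1]" "m dvd i - i mod m" for i using m by auto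
  have "cv m u c i mod l = cv m w c i mod l" for c i
   using eq(2)[of c "i mod m"] r(1)[of i] cv_mod[OF r(2)[of i], of u c] cv_mod[OF r(2)[of i], of w c]
   by (cases c) (auto simp: cl_def)
  moreover have "zz m u b i j mod l = zz m w b i j mod l" for b i j
   using eq(3)[of b "i mod m" "j mod m"] r(1)[of i] r(1)[of j]
    zz_mod[OF _ r(2)[of i] r(2)[of j], of u b] zz_mod[OF _ r(2)[of i] r(2)[of j], of w b]
   by (cases b) (auto simp: zl_def m_def)
  ultimately show ?thesis using eq(1) by (simp add: eqm_def cong_def m_def)
 qed
 have "length [0..m - 1] = fact R" using m by simp
 hence "length cl + length zl = K" by (simp add: cl_def zl_def K_def power2_eq_square)
 hence "f w : B" for w using m l by (auto simp: f_def B_def)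
 hence X: "range f <= B" by blast
 have fin: "finite B" by (simp add: B_def finite_lists_length_eq)
 have "card B = fact R * nat l ^ K"
  by (simp add: B_def card_cartesian_product card_lists_length_eq m(2))
 thus "finite (carrier (Q R l))" "order (Q R l) <= fact R * nat l ^ (2 * fact R + 2 * (fact R)\<^sup>2)"
  using F.order_le[OF e X fin] by (auto simp: K_def)
qed

lemma quotient_map:
 obtains \<phi> where "\<phi> : epi G (Q R l)" "!!w. \<phi> (\<kappa> w) = class_code (Em R l) w"
 using word_group_epi[of E "Em R l", OF word_congruence_axioms Em_congruence E_imp_eqm] by auto

theorem conjugacy_separable: "conjugacy_separable G"
 unfolding conjugacy_separable_def
proof (intro ballI impI)
 fix g1 g2 assume g: "g1 : carrier G" "g2 : carrier G" "~ conjugate G g1 g2"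
 then obtain w1 w2 where w: "g1 = \<kappa> w1" "g2 = \<kappa> w2" by (auto simp: carrier_code)
 have "~ conj_shift s w1 w2" for s using g(3) w by (auto simp: conj_shift_iff[symmetric])
 then obtain R l where R: "l > 0" "!!h. ~ Em R l (h @ w1) (w2 @ h)" using separate_words by blast
 interpret F: word_congruence "Em R l" by (rule Em_congruence)
 obtain \<phi> where \<phi>: "\<phi> : epi G (Q R l)" "!!w. \<phi> (\<kappa> w) = class_code (Em R l) w" by (rule quotient_map[of R l]) (rule that)
 have "~ conjugate (Q R l) (\<phi> g1) (\<phi> g2)" using R(2) by (auto simp: w \<phi>(2) F.conjugate_code)
 thus "\<exists>(Q :: nat monoid) \<phi>. group Q & finite (carrier Q) & \<phi> : epi G Q & ~ conjugate Q (\<phi> g1) (\<phi> g2)"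
  using F.group finite_quotient(1)[OF R(1)] \<phi>(1) by blast
qed

section \<open>Residual finiteness growth\<close>

text \<open>For the least \<open>R\<close> with \<open>N \<le> R!\<close> both \<open>(R - 1)!\<close> and \<open>R\<close> are at most \<open>N\<close>.\<close>

lemma fact_between: "(N::nat) >= 1 ==> EX R. N <= fact R & fact R <= N\<^sup>2"
proof -
 assume N: "N >= 1"
 define R where "R = (LEAST R. N <= fact R)"
 have R: "N <= fact R" unfolding R_def by (rule LeastI[of _ N]) (rule fact_ge_self)
 have "fact R <= N\<^sup>2"
 proof (cases R)
  case 0 thus ?thesis using N by simp
 next
  case (Suc r)
  hence r: "(fact r :: nat) < N" using not_less_Least[of r "%R. N <= fact R"] by (simp add: R_def)
  hence "Suc r <= N" using fact_ge_self[of r] by simp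
  hence "Suc r * fact r <= N * N" using r by (intro mult_mono) auto
  thus ?thesis by (simp add: Suc power2_eq_square)
 qed
 thus ?thesis using R by blast
qed

text \<open>A non-trivial coordinate is small or has the form \<open>s + 2 ^ x q\<close> with \<open>s\<close> and \<open>q\<close> at most \<open>B\<close>, but \<open>x\<close> arbitrarily large.
For small \<open>x\<close> the coordinate itself is small enough. For large \<open>x\<close> it is congruent to \<open>s\<close> modulo \<open>2 ^ B\<close>, which suffices if \<open>s\<close> is not
0. If \<open>s = 0\<close>, an odd \<open>l\<close> larger than \<open>|q|\<close> is used, since powers of 2 are invertible modulo \<open>l\<close>.\<close>

lemma small_modulus:
 assumes w: "~ E w []" and n: "length w <= n" "n >= 1" and R: "2 * n + 1 <= fact R"
 obtains l where "l > 0" "nat l <= 2 ^ (4 * n\<^sup>2 + 2)" "~ Em R l w []"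
proof -
 define m where "m = (fact R :: int)"
 have "int (2 * n + 1) <= int (fact R)" using R by (simp only: of_nat_le_iff)
 hence m: "2 * int n + 1 <= m" by (simp add: m_def)
 define B where "B = 2 * n\<^sup>2"
 have "n * 1 <= n * n" using n(2) by (intro mult_le_mono2)
 hence B: "n <= B" "B >= 1" using n(2) unfolding B_def power2_eq_square by linarith+
 have B2: "B < 2 ^ B" by (rule less_exp)
 have small: "B + 2 ^ B * B + 1 <= 2 ^ (2 * B + 2)"
 proof -
  have "2 ^ B * B <= 2 ^ B * (2 ^ B :: nat)" using B2 by simp
  moreover have "B + 1 <= 2 ^ B * (2 ^ B :: nat)"
  proof -
   have "(2::nat) ^ B * 1 <= 2 ^ B * 2 ^ B" by (intro mult_le_mono2) simp
   thus ?thesis using B2 by linarith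
  qed
  moreover have "(2::nat) ^ (2 * B + 2) = 4 * (2 ^ B * 2 ^ B)" by (simp add: power_add mult_2)
  ultimately show ?thesis by linarith
 qed
 have e: "4 * n\<^sup>2 + 2 = 2 * B + 2" by (simp add: B_def)
 note outer = that
 have fin: thesis if lx: "~ int l dvd x" "l > 0" "l <= B + 2 ^ B * B + 1" "Em R (int l) w [] ==> int l dvd x" for l :: nat and x :: int
 proof (rule outer[of "int l"])
  show "nat (int l) <= 2 ^ (4 * n\<^sup>2 + 2)" unfolding e nat_int using lx(3) small by linarith
  show "~ Em R (int l) w []" using lx(1,4) by blast
 qed (use lx(2) in simp)
 have fin1: thesis if "x ~= 0" "\<bar>x\<bar> <= int B" "!!l. Em R l w [] ==> l dvd x" for x
 proof (rule fin[of "B + 1" x])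
  show "~ int (B + 1) dvd x" using that zdvd_not_zless[of "\<bar>x\<bar>" "int (B + 1)"] by auto
 qed (use that in auto)
 have nm: "int (length w) <= int n" using n by simp
 consider (ht) "ht w ~= 0" | (cv) c i where "cv 0 w c i ~= 0" | (zz) b i j where "zz 0 w b i j ~= 0"
  using w unfolding E_iff by auto
 thus thesis
 proof cases
  case ht
  have "~ Em R 1 w []"
   using ht ht_le[of w] nm m zdvd_not_zless[of "\<bar>ht w\<bar>" m] by (auto simp: eqm_def cong_0_iff m_def)
  thus thesis using that[of 1] by simp
 next
  case cv
  hence "\<bar>i\<bar> < int (length w)" using cv_supp[of w i c] by linarith
  hence eq: "cv m w c i = cv 0 w c i" using nm m by (intro fold_exact) linarith
  have dv: "l dvd cv 0 w c i" if "Em R l w []" for l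
   unfolding eq[symmetric] using that by (simp add: eqm_def cong_0_iff m_def)
  have "\<bar>cv 0 w c i\<bar> <= int B" using abs_cv[of 0 w c i] nm B(1) by linarith
  thus thesis using fin1[OF cv _ dv] by blast
 next
  case zz
  hence "\<bar>i\<bar> < int (length w)" "\<bar>j\<bar> < int (length w)" using zz_supp[of w i j b] by linarith+
  hence eq: "zz m w b i j = zz 0 w b i j" using nm m by (intro fold_exact) linarith+
  have dv: "l dvd zz 0 w b i j" if "Em R l w []" for l
   unfolding eq[symmetric] using that by (simp add: eqm_def cong_0_iff m_def)
  have PB: "\<bar>cP 0 w c c' i j\<bar> <= int B" for c c'
  proof -
   have "int (length w) ^ 2 <= int n ^ 2" using nm by (intro power_mono) auto
   moreover have "int B = 2 * int n ^ 2" by (simp add: B_def)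
   ultimately show ?thesis using abs_cP[of 0 w c c' i j] by linarith
  qed
  show thesis
  proof (cases "b & i ~= j")
   case False
   hence "\<bar>zz 0 w b i j\<bar> <= int B" using PB by (auto simp: zz_def dm_def)
   thus thesis using fin1[OF zz _ dv] by blast
  next
   case True
   define s q where "s = cP 0 w False True i j" and "q = cP 0 w True True i j"
   have sq: "\<bar>s\<bar> <= int B" "\<bar>q\<bar> <= int B" using PB by (auto simp: s_def q_def)
   define x where "x = X (rk (i - j))"
   have z: "zz 0 w b i j = s + 2 ^ x * q" using True by (simp add: zz_def dm_def D_def s_def q_def x_def)
   show thesis
   proof (cases "x <= B")
    case le: True
    have "\<bar>2 ^ x * q\<bar> <= 2 ^ B * int B" using sq(2) le by (intro abs_mult_le) (auto intro: power_increasing)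
    hence "\<bar>zz 0 w b i j\<bar> < int (B + 2 ^ B * B + 1)" using sq(1) z by simp
    hence "~ int (B + 2 ^ B * B + 1) dvd zz 0 w b i j"
     using zz zdvd_not_zless[of "\<bar>zz 0 w b i j\<bar>" "int (B + 2 ^ B * B + 1)"] by auto
    thus thesis by (rule fin) (use dv in auto)
   next
    case gt: False
    show thesis
    proof (cases "s = 0")
     case False
     have "int (2 ^ B) dvd 2 ^ x * q" using gt by (simp add: le_imp_power_dvd)
     hence "int (2 ^ B) dvd zz 0 w b i j \<longleftrightarrow> int (2 ^ B) dvd s" unfolding z using dvd_add_left_iff by blast
     moreover have "~ int (2 ^ B) dvd s"
     proof -
      have "\<bar>s\<bar> < int (2 ^ B)" using sq(1) B2 by (smt (verit) of_nat_less_iff)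
      thus ?thesis using False zdvd_not_zless[of "\<bar>s\<bar>" "int (2 ^ B)"] by auto
     qed
     ultimately have nd: "~ int (2 ^ B) dvd zz 0 w b i j" by simp
     have "2 ^ B * 1 <= 2 ^ B * B" using B(2) by (intro mult_le_mono2) simp
     hence "2 ^ B <= B + 2 ^ B * B + 1" by linarith
     thus thesis by (rule fin[OF nd, rotated]) (use dv in auto)
    next
     case True
     hence q0: "q ~= 0" using zz z by auto
     have "coprime (int (2 * B + 1)) (2 ^ x)" by simp
     hence "int (2 * B + 1) dvd zz 0 w b i j \<longleftrightarrow> int (2 * B + 1) dvd q"
      unfolding z True by (simp add: coprime_dvd_mult_right_iff)
     moreover have "~ int (2 * B + 1) dvd q" using q0 sq(2) zdvd_not_zless[of "\<bar>q\<bar>" "int (2 * B + 1)"] by auto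
     ultimately have nd: "~ int (2 * B + 1) dvd zz 0 w b i j" by simp
     have "1 * B <= 2 ^ B * B" by (intro mult_le_mono1) simp
     hence "2 * B + 1 <= B + 2 ^ B * B + 1" by linarith
     thus thesis by (rule fin[OF nd, rotated]) (use dv in auto)
    qed
   qed
  qed
 qed
qed

text \<open>With \<open>R!\<close> between \<open>2 n + 1\<close> and its square, the order is at most \<open>R! l ^ (4 (R!)\<^sup>2)\<close>, where \<open>(R!)\<^sup>2 = O(n ^ 4)\<close> and
\<open>log l = O(n\<^sup>2)\<close>.\<close>

lemma Rf_le:
 assumes n: "n >= 1" and S: "!!g. g : carrier G ==> word_norm G S g <= n' ==> EX w. \<kappa> w = g & length w <= n"
 shows "Rf G S n' <= 2 ^ (3280 * n ^ 6)"
 unfolding Rf_def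
proof (rule SUP_nat_le)
 fix g assume g: "g : {g : carrier G. g ~= \<one>\<^bsub>G\<^esub> & word_norm G S g <= n'}"
 then obtain w where w: "\<kappa> w = g" "length w <= n" using S by blast
 have nE: "~ E w []" using g w by (auto simp: one_code code_eq_iff)
 define N where "N = 2 * n + 2"
 obtain R where R: "N <= fact R" "fact R <= N\<^sup>2" using fact_between[of N] by (auto simp: N_def)
 obtain l where l: "l > 0" "nat l <= 2 ^ (4 * n\<^sup>2 + 2)" "~ Em R l w []"
  using small_modulus[OF nE w(2) n, of R] R(1) by (auto simp: N_def)
 interpret F: word_congruence "Em R l" by (rule Em_congruence)
 obtain \<phi> where \<phi>: "\<phi> : epi G (Q R l)" "!!w. \<phi> (\<kappa> w) = class_code (Em R l) w" by (rule quotient_map[of R l]) (rule that)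
 have "\<phi> g ~= \<one>\<^bsub>Q R l\<^esub>" using w(1)[symmetric] l(3) by (simp add: \<phi>(2) F.one_code F.code_eq_iff)
 hence "Inf {order Q | (Q :: nat monoid) \<phi>.
       group Q & finite (carrier Q) & \<phi> : hom G Q & \<phi> g ~= \<one>\<^bsub>Q\<^esub>} <= order (Q R l)"
  using F.group finite_quotient(1)[OF l(1)] \<phi>(1) by (intro cInf_lower) (auto simp: epi_def)
 also have "... <= fact R * nat l ^ (2 * fact R + 2 * (fact R)\<^sup>2)" by (rule finite_quotient(2)[OF l(1)])
 also have "... <= N\<^sup>2 * (2 ^ (4 * n\<^sup>2 + 2)) ^ (2 * N\<^sup>2 + 2 * (N\<^sup>2)\<^sup>2)"
 proof (rule mult_le_mono[OF R(2)])
  have "nat l ^ (2 * fact R + 2 * (fact R)\<^sup>2) <= nat l ^ (2 * N\<^sup>2 + 2 * (N\<^sup>2)\<^sup>2)"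
   using R(2) l(1) by (intro power_increasing add_mono mult_le_mono2 power_mono) auto
  also have "... <= (2 ^ (4 * n\<^sup>2 + 2)) ^ (2 * N\<^sup>2 + 2 * (N\<^sup>2)\<^sup>2)" by (rule power_mono[OF l(2)]) simp
  finally show "nat l ^ (2 * fact R + 2 * (fact R)\<^sup>2) <= (2 ^ (4 * n\<^sup>2 + 2)) ^ (2 * N\<^sup>2 + 2 * (N\<^sup>2)\<^sup>2)" .
 qed
 also have "... <= 2 ^ N\<^sup>2 * (2 ^ (4 * n\<^sup>2 + 2)) ^ (2 * N\<^sup>2 + 2 * (N\<^sup>2)\<^sup>2)"
  by (intro mult_le_mono1 less_imp_le less_exp)
 also have "... = 2 ^ (N\<^sup>2 + (4 * n\<^sup>2 + 2) * (2 * N\<^sup>2 + 2 * (N\<^sup>2)\<^sup>2))"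
  by (simp only: power_add power_mult)
 also have "... <= 2 ^ (3280 * n ^ 6)"
 proof (rule power_increasing)
  have N4: "N <= 4 * n" using n by (simp add: N_def)
  have p: "n ^ a <= n ^ 6" if "a <= 6" for a using n that by (intro power_increasing) auto
  have "N\<^sup>2 <= (4 * n)\<^sup>2" using N4 by (intro power_mono) auto
  hence a: "N\<^sup>2 <= 16 * n\<^sup>2" by (simp add: power_mult_distrib)
  hence "(N\<^sup>2)\<^sup>2 <= (16 * n\<^sup>2)\<^sup>2" by (intro power_mono) auto
  hence b: "(N\<^sup>2)\<^sup>2 <= 256 * n ^ 4" by (simp add: power_mult_distrib power_mult[symmetric])
  have "n\<^sup>2 <= n ^ 4" using n by (intro power_increasing) auto
  hence "2 * N\<^sup>2 + 2 * (N\<^sup>2)\<^sup>2 <= 544 * n ^ 4" using a b by simp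
  moreover have "4 * n\<^sup>2 + 2 <= 6 * n\<^sup>2" using n by simp
  ultimately have "(4 * n\<^sup>2 + 2) * (2 * N\<^sup>2 + 2 * (N\<^sup>2)\<^sup>2) <= (6 * n\<^sup>2) * (544 * n ^ 4)" by (rule mult_le_mono[rotated])
  also have "... = 3264 * n ^ 6" by (simp add: power_add[symmetric])
  finally show "N\<^sup>2 + (4 * n\<^sup>2 + 2) * (2 * N\<^sup>2 + 2 * (N\<^sup>2)\<^sup>2) <= 3280 * n ^ 6" using a p[of 2] by simp
 qed simp
 finally show "Inf {order Q | (Q :: nat monoid) \<phi>.
       group Q & finite (carrier Q) & \<phi> : hom G Q & \<phi> g ~= \<one>\<^bsub>Q\<^esub>} <= 2 ^ (3280 * n ^ 6)" .
qed

theorem Rf_exponential: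
 assumes "finite_gen_set G S"
 shows "(%n. real (Rf G S n)) \<prec> (%n. exp (real n powi 6))"
proof -
 obtain c where c: "c >= 1" "!!g. g : carrier G ==> EX w. \<kappa> w = g & length w <= c * word_norm G S g"
  using short_word[OF assms] by blast
 define C where "C = 3280 * c"
 have C: "C >= 1" using c(1) by (simp add: C_def)
 have "real (Rf G S n) <= real C * exp (real (C * n) powi 6)" if n: "n >= 1" for n
 proof -
  have "Rf G S n <= 2 ^ (3280 * (c * n) ^ 6)"
  proof (rule Rf_le)
   show "1 <= c * n" using c(1) n by simp
   fix g assume "g : carrier G" "word_norm G S g <= n"
   thus "EX w. \<kappa> w = g & length w <= c * n" using c(2)[of g] by (meson le_trans mult_le_mono2)
  qed
  hence "real (Rf G S n) <= 2 ^ (3280 * (c * n) ^ 6)"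
   by (metis of_nat_le_iff of_nat_numeral of_nat_power)
  also have "... <= exp 1 ^ (3280 * (c * n) ^ 6)" using exp_ge_add_one_self[of 1] by (intro power_mono) auto
  also have "... = exp (real (3280 * (c * n) ^ 6))" by (simp add: exp_of_nat_mult[symmetric])
  also have "... <= exp (real (C * n) powi 6)"
  proof -
   have "3280 * (c * n) ^ 6 <= 3280 ^ 6 * (c * n) ^ 6" by (intro mult_le_mono1) simp
   also have "... = (C * n) ^ 6" by (simp add: C_def power_mult_distrib)
   finally have "real (3280 * (c * n) ^ 6) <= real ((C * n) ^ 6)" by (simp only: of_nat_le_iff)
   also have "... = real (C * n) powi 6" by (simp add: power_int_def)
   finally show ?thesis by simp
  qed
  also have "... <= real C * exp (real (C * n) powi 6)" using C by simp
  finally show ?thesis .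
 qed
 thus ?thesis unfolding dominated_def using C by blast
qed

section \<open>Conjugacy separability growth\<close>

lemma odd_part: "(n::nat) > 0 ==> EX e b. n = 2 ^ e * b & odd b"
proof (induction n rule: less_induct)
 case (less n)
 show ?case
 proof (cases "even n")
  case True
  then obtain k where k: "n = 2 * k" by (elim evenE)
  then obtain e b where "k = 2 ^ e * b" "odd b" using less.IH[of k] less.prems by auto
  thus ?thesis using k by (intro exI[of _ "Suc e"] exI[of _ b]) simp
 next
  case False thus ?thesis by (intro exI[of _ 0] exI[of _ n]) simp
 qed
qed

lemma cv_pw2: "cv 0 (pw 2 2) c i = (if c & i = 0 then 2 else 0)"
 by (simp add: cv_pw)

text \<open>The key example. Put \<open>k = (r - 1)!\<close>, \<open>d = D k = 2 ^ X r\<close> and \<open>y = [a_0, c_k] [a_k, c_0]\<inverse>\<close>, so that \<open>[c_0, c_k] = y ^ d\<close>.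
Conjugating \<open>c_0\<^sup>2\<close> by \<open>c_k ^ (- t)\<close> multiplies it by \<open>y ^ (2 d t)\<close>, and the exponent \<open>d\<close> cannot be reached in the group. In a finite quotient
whose order has 2-part less than \<open>d\<close> the image of \<open>y ^ d\<close> has odd order, so that \<open>d\<close> and \<open>2 d t\<close> become congruent for some \<open>t\<close>.\<close>

lemma Conj_ge:
 assumes S: "finite_gen_set G S" and r: "r >= 2"
  and norm: "!!w. length w <= 10 * fact (r - 1) ==> word_norm G S (\<kappa> w) <= n"
 shows "2 ^ X r <= Conj G S n"
proof -
 interpret group G by (rule group)
 define k where "k = (fact (r - 1) :: int)"
 have k: "k >= 1" by (simp add: k_def)
 define d where "d = (2::nat) ^ X r"
 have Dk: "dm 0 k = int d" "dm 0 (- k) = int d"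
 proof -
  have "rk k = r" by (simp only: k_def rk_fact[OF r])
  thus "dm 0 k = int d" "dm 0 (- k) = int d"
   using k dm_minus[of 0 k] by (auto simp: dm_def D_def d_def rk_minus)
 qed
 define w1 where "w1 = pw 2 2"
 define z where "z = comw (lw True 0 1) (lw True k 1)"
 define w2 where "w2 = w1 @ z"
 define y where "y = comw (lw False 0 1) (lw True k 1) @ comw (lw False k (- 1)) (lw True 0 1)"
 define yn where "yn t = concat (replicate t y)" for t
 have w1: "ht w1 = 0" "!!c i. cv 0 w1 c i = (if c & i = 0 then 2 else 0)" "!!b i j. zz 0 w1 b i j = 0"
  by (auto simp: w1_def ht_pw cv_pw2)
 have z: "ht z = 0" "cv 0 z c i = 0" "zz 0 z b i j = (if b then 2 * int d * (of_bool (i = 0 & j = k) - of_bool (i = k & j = 0)) else 0)" for c b i j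
  using k Dk by (auto simp: z_def cv_comw zz_comw om_def cv_lw)
 \<comment> \<open>The commutator form at \<open>(0, k)\<close> and \<open>(k, 0)\<close> has opposite signs, which is the reason for the second factor of \<open>y\<close>.\<close>
 have y: "ht y = 0" "cv 0 y c i = 0" "zz 0 y b i j = (if b then 2 * (of_bool (i = 0 & j = k) - of_bool (i = k & j = 0)) else 0)" for c b i j
  using k by (auto simp: y_def zz_append cv_comw zz_comw om_def cv_lw)
 have cvy: "cv 0 y = (%c i. 0)" "cv 0 z = (%c i. 0)" using y(2) z(2) by (auto intro!: ext)
 have yn: "ht (yn t) = 0" "cv 0 (yn t) = (%c i. 0)" "zz 0 (yn t) b i j = int t * zz 0 y b i j" for t b i j
  using power_coords[OF y(1), of t 0] by (auto simp: yn_def y(2) intro!: ext)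
 have w2y: "E w2 (w1 @ yn d)"
  by (auto simp: E_iff w2_def zz_append w1(1) z y yn cvy)
 have conjy: "E (lw True k (- int t) @ w1) (w1 @ yn (2 * d * t) @ lw True k (- int t))" for t
  using k Dk by (auto simp: E_iff zz_append w1 yn y(3) lw_def ht_pw om_def cv_pw)
 have nc: "~ conjugate G (\<kappa> w1) (\<kappa> w2)"
 proof
  assume "conjugate G (\<kappa> w1) (\<kappa> w2)"
  then obtain s where "conj_shift s w1 w2" by (auto simp: conj_shift_iff[symmetric])
  moreover have h: "ht w1 = 0" "ht w2 = 0" by (auto simp: w2_def w1 z)
  have cw2: "cv 0 w2 = cv 0 w1" by (intro ext) (simp add: w2_def cvy)
  ultimately obtain u where u: "!!c i. cv 0 w1 c i = cv 0 w1 c (i - s)"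
   "!!b i j. zz 0 w2 b i j - zz 0 w1 b (i - s) (j - s) = 2 * om 0 u (cv 0 w1) b i j"
   unfolding conj_shift_height0[OF h] cw2 by blast
  have "zz 0 z True 0 k = 2 * om 0 u (cv 0 w1) True 0 k"
   using u(2)[of True 0 k] by (simp add: w2_def zz_append w1 cvy)
  \<comment> \<open>A conjugator with exponent \<open>u\<close> of \<open>c_k\<close> would multiply by \<open>y ^ (- 2 d u)\<close> instead of \<open>y ^ d\<close>.\<close>
  hence "int d * (1 + 2 * u True k) = 0" using k by (simp add: z om_def w1 Dk algebra_simps)
  hence "1 + 2 * u True k = 0" by (simp add: d_def)
  thus False by presburger
 qed
 have big: "2 ^ X r <= order Q" if Q: "group Q" "finite (carrier Q)" "\<phi> : epi G Q" "~ conjugate Q (\<phi> (\<kappa> w1)) (\<phi> (\<kappa> w2))"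
  for Q :: "nat monoid" and \<phi>
 proof (rule ccontr)
  assume less: "~ 2 ^ X r <= order Q"
  interpret Q: group Q by (rule Q(1))
  interpret \<phi>: group_hom G Q \<phi> using Q(3) by unfold_locales (auto simp: epi_def)
  have pos: "order Q > 0" using Q.order_gt_0_iff_finite Q(2) by simp
  then obtain e b where eb: "order Q = 2 ^ e * b" "odd b" using odd_part by blast
  hence "2 ^ e <= order Q" using odd_pos by fastforce
  hence "(2::nat) ^ e < 2 ^ X r" using less by linarith
  hence "e < X r" by (rule power_less_imp_less_exp[rotated]) simp
  hence eX: "e <= X r" by simp
  define \<eta> where "\<eta> = \<phi> (\<kappa> y)"
  have \<eta>: "\<eta> : carrier Q" by (simp add: \<eta>_def)
  have pow: "\<phi> (\<kappa> (yn t)) = \<eta> [^]\<^bsub>Q\<^esub> t" for t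
   unfolding yn_def pow_code[symmetric] \<eta>_def by (rule \<phi>.hom_nat_pow) simp
  have "d * b = order Q * 2 ^ (X r - e)" using eX by (simp add: eb d_def power_add[symmetric] mult.commute mult.left_commute)
  hence db: "\<eta> [^]\<^bsub>Q\<^esub> (d * b) = \<one>\<^bsub>Q\<^esub>"
   using Q.pow_order_eq_1[OF \<eta>] \<eta> by (simp add: Q.nat_pow_pow[symmetric])
  \<comment> \<open>This is where \<open>b\<close> odd is used: \<open>2 d t = d + d b\<close>, and \<open>d b\<close> is a multiple of the order of the quotient.\<close>
  obtain t where t: "b + 1 = 2 * t" using eb(2) by (metis even_plus_one_iff evenE)
  have "2 * d * t = d * b + d" using t by (metis add_mult_distrib2 mult.assoc mult.commute nat_mult_1_right)
  hence "\<eta> [^]\<^bsub>Q\<^esub> (2 * d * t) = \<eta> [^]\<^bsub>Q\<^esub> d"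
   using db \<eta> by (simp add: Q.nat_pow_mult[symmetric])
  hence yy: "\<phi> (\<kappa> (yn (2 * d * t))) = \<phi> (\<kappa> (yn d))" by (simp add: pow)
  define h where "h = lw True k (- int t)"
  have "\<phi> (\<kappa> (h @ w1)) = \<phi> (\<kappa> (w1 @ yn (2 * d * t) @ h))" using conjy[of t] by (simp add: h_def code_eq_iff[symmetric])
  also have "... = \<phi> (\<kappa> w1) \<otimes>\<^bsub>Q\<^esub> (\<phi> (\<kappa> (yn (2 * d * t))) \<otimes>\<^bsub>Q\<^esub> \<phi> (\<kappa> h))" by (simp flip: mult_code)
  also have "... = \<phi> (\<kappa> (w1 @ yn d)) \<otimes>\<^bsub>Q\<^esub> \<phi> (\<kappa> h)" unfolding yy by (simp flip: mult_code add: Q.m_assoc)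
  also have "\<kappa> (w1 @ yn d) = \<kappa> w2" using w2y sym by (simp add: code_eq_iff)
  finally have "\<phi> (\<kappa> h) \<otimes>\<^bsub>Q\<^esub> \<phi> (\<kappa> w1) = \<phi> (\<kappa> w2) \<otimes>\<^bsub>Q\<^esub> \<phi> (\<kappa> h)" by (simp flip: mult_code)
  hence "\<phi> (\<kappa> h) \<otimes>\<^bsub>Q\<^esub> \<phi> (\<kappa> w1) \<otimes>\<^bsub>Q\<^esub> inv\<^bsub>Q\<^esub> \<phi> (\<kappa> h) = \<phi> (\<kappa> w2)"
   by (metis Q.inv_solve_right Q.m_closed \<phi>.hom_closed code_carrier)
  thus False using Q(4) unfolding conjugate_def by (meson \<phi>.hom_closed code_carrier)
 qed
 define I where "I p = (case p of (g1, g2) => Inf {order Q | (Q :: nat monoid) \<phi>.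
       group Q & finite (carrier Q) & \<phi> : epi G Q & ~ conjugate Q (\<phi> g1) (\<phi> g2)})" for p
 define P where "P = {(g1, g2). g1 : carrier G & g2 : carrier G \<and>
           word_norm G S g1 <= n & word_norm G S g2 <= n & ~ conjugate G g1 g2}"
 have CI: "Conj G S n = Sup (I ` P)" unfolding Conj_def P_def I_def by (simp add: case_prod_beta')
 have fact1: "(fact (r - 1) :: nat) >= 1" by simp
 have kf: "k = int (fact (r - 1))" by (simp add: k_def)
 have "int (length w2) = 2 + 4 + 4 * k + 0" unfolding w2_def z_def comw_def
  using length_lw[of True 0 1] length_lw[of True k 1] k by (simp add: w1_def)
 hence "length w2 = 6 + 4 * fact (r - 1)" unfolding kf by linarith
 hence "length w2 <= 10 * fact (r - 1)" "length w1 <= 10 * fact (r - 1)"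
  using fact1 unfolding w1_def length_pw by linarith+
 hence "word_norm G S (\<kappa> w1) <= n" "word_norm G S (\<kappa> w2) <= n" using norm by blast+
 hence "(\<kappa> w1, \<kappa> w2) : P" using nc by (simp add: P_def)
 moreover have "finite P"
  by (rule finite_subset[of _ "{g : carrier G. word_norm G S g <= n} \<times> {g : carrier G. word_norm G S g <= n}"])
   (use finite_norm_ball[OF S] in \<open>auto simp: P_def\<close>)
 ultimately have up: "I (\<kappa> w1, \<kappa> w2) <= Conj G S n" unfolding CI
  by (metis cSUP_upper bdd_above_finite finite_imageI)
 have low: "2 ^ X r <= I (\<kappa> w1, \<kappa> w2)" unfolding I_def prod.case
 proof (rule cInf_greatest)
  obtain Q :: "nat monoid" and \<phi> where Q: "group Q" "finite (carrier Q)" "\<phi> : epi G Q"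
    "~ conjugate Q (\<phi> (\<kappa> w1)) (\<phi> (\<kappa> w2))"
   using conjugacy_separable nc unfolding conjugacy_separable_def by (meson code_carrier)
  hence "order Q : {order Q | (Q :: nat monoid) \<phi>. group Q & finite (carrier Q) & \<phi> : epi G Q & ~ conjugate Q (\<phi> (\<kappa> w1)) (\<phi> (\<kappa> w2))}"
   by (intro CollectI exI[of _ Q] exI[of _ \<phi>] conjI) simp_all
  thus "{order Q | (Q :: nat monoid) \<phi>. group Q & finite (carrier Q) & \<phi> : epi G Q & ~ conjugate Q (\<phi> (\<kappa> w1)) (\<phi> (\<kappa> w2))} ~= {}"
   by (metis empty_iff)
 next
  fix x assume "x : {order Q | (Q :: nat monoid) \<phi>. group Q & finite (carrier Q) & \<phi> : epi G Q & ~ conjugate Q (\<phi> (\<kappa> w1)) (\<phi> (\<kappa> w2))}"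
  thus "2 ^ X r <= x" by (elim CollectE exE conjE) (simp add: big)
 qed
 show ?thesis using le_trans[OF low up] .
qed

text \<open>For given \<open>n\<close> take \<open>r\<close> with \<open>(r - 1)! \<le> n < r!\<close>.\<close>

theorem Conj_dominates:
 assumes S: "finite_gen_set G S" and \<Phi>: "!!r n. n < fact r ==> \<Phi> n <= (2::nat) ^ X r"
 shows "(%n. real (\<Phi> n)) \<prec> (%n. real (Conj G S n))"
proof -
 obtain c where c: "c >= 1" "!!w. word_norm G S (\<kappa> w) <= c * length w" using word_norm_le_length[OF S] by blast
 define C where "C = 10 * c"
 have C: "C >= 1" using c by (simp add: C_def)
 have "\<Phi> n <= Conj G S (C * n)" if n: "n >= 1" for n
 proof -
  define r where "r = (LEAST r. n < fact r)"
  have ex: "n < fact (n + 2)"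
  proof -
   have "n + 2 <= fact (n + 2)" by (rule fact_ge_self)
   thus ?thesis by linarith
  qed
  have r: "n < fact r" unfolding r_def using ex by (rule LeastI)
  have r2: "r >= 2"
  proof (rule ccontr)
   assume "~ r >= 2"
   hence "r = 0 \<or> r = 1" by auto
   thus False using r n by auto
  qed
  hence le: "fact (r - 1) <= n" using not_less_Least[of "r - 1" "%r. n < fact r"] by (simp add: r_def[symmetric])
  have "2 ^ X r <= Conj G S (C * n)"
  proof (rule Conj_ge[OF S r2])
   fix w :: word assume "length w <= 10 * fact (r - 1)"
   hence "length w <= 10 * n" using le by linarith
   hence "c * length w <= c * (10 * n)" by (rule mult_le_mono2)
   hence "word_norm G S (\<kappa> w) <= c * (10 * n)" using c(2)[of w] by linarith
   thus "word_norm G S (\<kappa> w) <= C * n" by (simp add: C_def mult_ac)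
  qed
  thus ?thesis using \<Phi>[OF r] by simp
 qed
 hence "real (\<Phi> n) <= real C * real (Conj G S (C * n))" if "n >= 1" for n
 proof -
  have "\<Phi> n * 1 <= Conj G S (C * n) * C" using that C \<open>!!n. 1 <= n ==> \<Phi> n <= Conj G S (C * n)\<close> by (intro mult_le_mono) auto
  hence "real (\<Phi> n * 1) <= real (Conj G S (C * n) * C)" by (simp only: of_nat_le_iff)
  thus ?thesis by (simp add: mult.commute)
 qed
 thus ?thesis unfolding dominated_def using C by blast
qed

end

abbreviation step_rel :: "tm => (config \<times> config) set" where
 "step_rel M \<equiv> {(c1, c2). tm_step M c1 = Some c2}"

section \<open>Counter programs on Turing machines\<close>

text \<open>Programs with counters and a read-only input. \<open>LEFT\<close> and \<open>RIGHT\<close> move the input head, and \<open>ACC\<close> halts and accepts.\<close>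

datatype com = INC nat | DEC nat | LEFT | RIGHT | SEQ com com | WHILE nat com | IFSYM nat com com | ACC

type_synonym pconf = "com list \<times> int \<times> (nat => nat)"

primrec shift_num :: "move => int" where
 "shift_num Move_Left = - 1" | "shift_num Stay = 0" | "shift_num Move_Right = 1"

text \<open>One step of a program, as seen by a machine: it depends on the stack of pending commands, the scanned
 symbol \<open>a\<close> and the set \<open>z\<close> of the counters that are 0, and it moves the input head by \<open>m\<close>
 and changes counter \<open>r\<close> by \<open>d r\<close>.\<close>

fun nxt :: "com list => nat => (nat => bool) => (com list \<times> move \<times> (nat => move)) option" where
 "nxt [] a z = None"
| "nxt (ACC # k) a z = None"
| "nxt (INC r # k) a z = Some (k, Stay, (%_. Stay)(r := Move_Right))"
| "nxt (DEC r # k) a z = Some (k, Stay, (%_. Stay)(r := if z r then Stay else Move_Left))"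
| "nxt (LEFT # k) a z = Some (k, Move_Left, %_. Stay)"
| "nxt (RIGHT # k) a z = Some (k, Move_Right, %_. Stay)"
| "nxt (SEQ c d # k) a z = Some (c # d # k, Stay, %_. Stay)"
| "nxt (WHILE r c # k) a z = Some (if z r then k else c # WHILE r c # k, Stay, %_. Stay)"
| "nxt (IFSYM b c d # k) a z = Some (if a = b then c # k else d # k, Stay, %_. Stay)"

definition pstep :: "nat list => pconf => pconf option" where
 "pstep w = (%(s, p, R). map_option (%(s', m, d). (s', p + shift_num m, %r. nat (int (R r) + shift_num (d r))))
  (nxt s (word_tape w p) (%r. R r = 0)))"

definition psteps :: "nat list => nat => pconf => pconf => bool" where
 "psteps w t x y \<longleftrightarrow> (x, y) : {(x, y). pstep w x = Some y} ^^ t"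

lemma psteps_0 [simp]: "psteps w 0 x y \<longleftrightarrow> x = y" by (auto simp: psteps_def)

lemma psteps_add: "psteps w s x y ==> psteps w t y z ==> psteps w (s + t) x z"
 unfolding psteps_def relpow_add by blast

lemma psteps_1: "psteps w (Suc 0) x y \<longleftrightarrow> pstep w x = Some y" by (simp add: psteps_def)

text \<open>Executing \<open>c\<close> on top of an arbitrary stack removes it from the stack within \<open>T\<close> steps. The quantification over stacks makes the rules below compositional.\<close>

definition runs :: "nat list => com => nat => int \<times> (nat => nat) => int \<times> (nat => nat) => bool" where
 "runs w c T x y \<longleftrightarrow> (\<exists>t\<le>T. ALL k. psteps w t (c # k, x) (k, y))"

lemma runs_mono: "runs w c T x y ==> T <= T' ==> runs w c T' x y" unfolding runs_def using le_trans by blast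

lemma runs_step: "(!!k. pstep w (c # k, x) = Some (k, y)) ==> runs w c 1 x y"
 unfolding runs_def by (intro exI[of _ 1]) (simp add: psteps_1)

lemma runs_INC: "runs w (INC r) 1 (p, R) (p, R(r := Suc (R r)))"
 by (rule runs_step) (auto simp: pstep_def fun_eq_iff nat_add_distrib)

lemma runs_DEC: "runs w (DEC r) 1 (p, R) (p, R(r := R r - 1))"
 by (rule runs_step) (auto simp: pstep_def fun_eq_iff)

lemma runs_LEFT: "runs w LEFT 1 (p, R) (p - 1, R)" and runs_RIGHT: "runs w RIGHT 1 (p, R) (p + 1, R)"
 by (rule runs_step; simp add: pstep_def)+

lemma psteps_first: "pstep w (c # k, x) = Some (k', y) ==> psteps w t (k', y) z ==> psteps w (Suc t) (c # k, x) z"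
 using psteps_add[of w 1 _ "(k', y)" t z] by (simp add: psteps_1)

lemma runs_two:
 assumes "runs w c S x y" "\<exists>t\<le>T. ALL k. psteps w t (f k, y) (k, z)" "!!k. pstep w (d # k, x) = Some (c # f k, x)"
 shows "runs w d (Suc (S + T)) x z"
proof -
 obtain s t where *: "s <= S" "!!k. psteps w s (c # k, x) (k, y)" "t <= T" "!!k. psteps w t (f k, y) (k, z)"
  using assms(1,2) unfolding runs_def by blast
 have "psteps w (Suc (s + t)) (d # k, x) (k, z)" for k by (rule psteps_first[OF assms(3) psteps_add[OF *(2,4)]])
 thus ?thesis unfolding runs_def using *(1,3) by (intro exI[of _ "Suc (s + t)"]) simp
qed

lemma runs_SEQ: "runs w c S x y ==> runs w d T y z ==> runs w (SEQ c d) (Suc (S + T)) x z"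
 by (rule runs_two[where f = "%k. d # k"]) (simp_all add: runs_def pstep_def split: prod.split)

lemma runs_IFSYM:
 assumes "runs w (if word_tape w p = a then c else d) T (p, R) z"
 shows "runs w (IFSYM a c d) (Suc T) (p, R) z"
 using runs_two[OF assms, of 0 "%k. k" z "IFSYM a c d"] by (simp add: pstep_def)

lemma runs_WHILE:
 assumes "!!i. i < n ==> R i r ~= 0 & runs w c T (p i, R i) (p (Suc i), R (Suc i))" "R n r = (0 :: nat)"
 shows "runs w (WHILE r c) (Suc (n * Suc T)) (p 0, R 0) (p n, R n)"
 using assms
proof (induction n arbitrary: R p)
 case 0 thus ?case by (intro runs_step[THEN runs_mono]) (auto simp: pstep_def)
next
 case (Suc n)
 have "runs w (WHILE r c) (Suc (n * Suc T)) (p (Suc 0), R (Suc 0)) (p (Suc n), R (Suc n))"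
  by (rule Suc.IH[of "%i. R (Suc i)" "%i. p (Suc i)"]) (use Suc.prems in auto)
 moreover have "R 0 r ~= 0" "runs w c T (p 0, R 0) (p (Suc 0), R (Suc 0))" using Suc.prems(1)[of 0] by auto
 ultimately have "runs w (WHILE r c) (Suc (T + Suc (n * Suc T))) (p 0, R 0) (p (Suc n), R (Suc n))"
  by (intro runs_two[where f = "%k. WHILE r c # k"]) (simp_all add: runs_def pstep_def)
 thus ?case by (rule runs_mono) simp
qed

lemma runs_clear: "R r <= B ==> runs w (WHILE r (DEC r)) (Suc (B * 2)) (p, R) (p, R(r := 0))"
proof -
 assume B: "R r <= B"
 have "runs w (WHILE r (DEC r)) (Suc (R r * Suc 1)) (p, R(r := R r - 0)) (p, R(r := R r - R r))"
 proof (rule runs_WHILE[where p = "%_. p" and R = "%i. R(r := R r - i)"])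
  fix i assume "i < R r"
  thus "(R(r := R r - i)) r ~= 0 & runs w (DEC r) 1 (p, R(r := R r - i)) (p, R(r := R r - Suc i))"
   using runs_DEC[of w r p "R(r := R r - i)"] by simp
 qed simp
 thus ?thesis using runs_mono[of w _ "Suc (R r * Suc 1)" _ _ "Suc (B * 2)"] B by simp
qed

lemma runs_move: "r ~= r' ==> R r <= B ==>
 runs w (WHILE r (SEQ (INC r') (DEC r))) (Suc (B * 4)) (p, R) (p, R(r := 0, r' := R r' + R r))"
proof -
 assume r: "r ~= r'" and B: "R r <= B"
 define Q where "Q i = R(r := R r - i, r' := R r' + i)" for i
 have "runs w (WHILE r (SEQ (INC r') (DEC r))) (Suc (R r * Suc (Suc (1 + 1)))) (p, Q 0) (p, Q (R r))"
 proof (rule runs_WHILE[where p = "%_. p" and R = Q])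
  fix i assume i: "i < R r"
  have "runs w (SEQ (INC r') (DEC r)) (Suc (1 + 1)) (p, Q i) (p, Q (Suc i))"
   by (rule runs_SEQ[OF runs_INC runs_DEC, THEN back_subst[of "runs w _ _ _"]]) (use r in \<open>auto simp: Q_def fun_eq_iff\<close>)
  thus "Q i r ~= 0 & runs w (SEQ (INC r') (DEC r)) (Suc (1 + 1)) (p, Q i) (p, Q (Suc i))"
   using i r by (simp add: Q_def)
 qed (use r in \<open>simp add: Q_def\<close>)
 hence "runs w (WHILE r (SEQ (INC r') (DEC r))) (Suc (B * 4)) (p, Q 0) (p, Q (R r))" by (rule runs_mono) (use B in simp)
 thus ?thesis by (simp add: Q_def)
qed

subsection \<open>Machines from transition functions\<close>

definition rule_of :: "nat => nat list => (nat \<times> move) list \<times> nat => rule" where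
 "rule_of q as x = (q, map2 (%a (b, m). (a, b, m)) as (fst x), snd x)"

text \<open>A finite transition function is realised by a list of rules: one rule for each state and each tuple of scanned symbols.\<close>

lemma machine_exists:
 fixes \<delta> :: "nat => nat list => ((nat \<times> move) list \<times> nat) option"
 assumes fin: "finite Q"
  and len: "!!q as acts q'. (q, as) : Q ==> \<delta> q as = Some (acts, q') ==> length acts = length as"
 shows "EX M. work_tapes M = k & (ALL q ts. (q, map (%t. t 0) ts) : Q --> tm_step M (q, ts) =
  map_option (%(acts, q'). (q', map2 (%(b, m) t. shift_tape m (t(0 := b))) acts ts)) (\<delta> q (map (%t. t 0) ts)))"
proof -
 define S where "S = (%(q, as). rule_of q as (the (\<delta> q as))) ` (Q \<inter> {(q, as). \<delta> q as ~= None})"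
 have "finite S" using fin by (simp add: S_def)
 then obtain rs where rs: "set rs = S" using finite_list by blast
 have app: "r : S ==> applicable (q, ts) r ==> EX x. \<delta> q (map (%t. t 0) ts) = Some x & r = rule_of q (map (%t. t 0) ts) x" for r q ts
 proof -
  assume "r : S" and a: "applicable (q, ts) r"
  then obtain q' as acts q'' where r: "(q', as) : Q" "\<delta> q' as = Some (acts, q'')" "r = rule_of q' as (acts, q'')"
   by (auto simp: S_def)
  have "map fst (map2 (%a (b, m). (a, b, m)) as acts) = as"
   using len[OF r(1,2)] by (intro nth_equalityI) (auto split: prod.split)
  hence "q' = q" "as = map (%t. t 0) ts" using a r(3) by (auto simp: applicable_def rule_of_def)
  thus ?thesis using r by blast
 qed
 have "tm_step (TM k rs) (q, ts) = map_option (%(acts, q'). (q', map2 (%(b, m) t. shift_tape m (t(0 := b))) acts ts)) (\<delta> q (map (%t. t 0) ts))"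
  if Q: "(q, map (%t. t 0) ts) : Q" for q ts
 proof (cases "\<delta> q (map (%t. t 0) ts)")
  case None
  hence "find (applicable (q, ts)) rs = None" using app[of _ q ts] rs by (auto simp: find_None_iff)
  thus ?thesis by (simp add: tm_step_def None)
 next
  case (Some x)
  obtain acts q' where x: "x = (acts, q')" by (cases x)
  let ?as = "map (%t. t 0) ts"
  have l: "length acts = length ts" using len[OF Q] Some x by simp
  have "rule_of q ?as x : S" using Q Some by (force simp: S_def)
  moreover have "map fst (map2 (%a (b, m). (a, b, m)) ?as acts) = ?as"
   using l by (intro nth_equalityI) (auto split: prod.split)
  hence "applicable (q, ts) (rule_of q ?as x)" by (simp add: applicable_def rule_of_def x)
  ultimately have "find (applicable (q, ts)) rs ~= None" using rs unfolding find_None_iff by blast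
  then obtain r where r: "find (applicable (q, ts)) rs = Some r" by blast
  hence "r : S" "applicable (q, ts) r" using rs by (auto simp: find_Some_iff)
  hence "r = rule_of q ?as x" using app[of r q ts] Some by auto
  moreover have "map2 (%(_, b, m) t. shift_tape m (t(0 := b))) (map2 (%a (b, m). (a, b, m)) ?as acts) ts =
    map2 (%(b, m) t. shift_tape m (t(0 := b))) acts ts"
   using l by (intro nth_equalityI) (auto split: prod.split)
  ultimately show ?thesis by (simp add: tm_step_def r rule_of_def x Some)
 qed
 thus ?thesis by (intro exI[of _ "TM k rs"]) simp
qed

subsection \<open>Compilation\<close>

text \<open>The stacks that occur while \<open>c\<close> runs on top of the stack \<open>k\<close>. They are finitely many and serve as states of a machine.\<close>

primrec conts :: "com => com list => com list set" where
 "conts (INC r) k = {INC r # k}"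
| "conts (DEC r) k = {DEC r # k}"
| "conts LEFT k = {LEFT # k}"
| "conts RIGHT k = {RIGHT # k}"
| "conts ACC k = {ACC # k}"
| "conts (SEQ c d) k = insert (SEQ c d # k) (conts c (d # k) \<union> conts d k)"
| "conts (WHILE r c) k = insert (WHILE r c # k) (conts c (WHILE r c # k))"
| "conts (IFSYM a c d) k = insert (IFSYM a c d # k) (conts c k \<union> conts d k)"

lemma finite_conts: "finite (conts c k)" by (induction c arbitrary: k) auto

lemma conts_start: "c # k : conts c k" by (cases c) auto

lemma conts_closed: "s : conts c k ==> nxt s a z = Some (s', m, d) ==> s' : insert k (conts c k)"
proof (induction c arbitrary: k s)
 case (SEQ c d)
 consider "s = SEQ c d # k" | "s : conts c (d # k)" | "s : conts d k" using SEQ.prems by auto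
 thus ?case
 proof cases
  case 1 thus ?thesis using SEQ.prems by (auto simp: conts_start)
 next
  case 2 thus ?thesis using SEQ.IH(1)[OF 2 SEQ.prems(2)] by (auto simp: conts_start)
 next
  case 3 thus ?thesis using SEQ.IH(2)[OF 3 SEQ.prems(2)] by auto
 qed
next
 case (WHILE r c)
 consider "s = WHILE r c # k" | "s : conts c (WHILE r c # k)" using WHILE.prems by auto
 thus ?case
 proof cases
  case 1 thus ?thesis using WHILE.prems by (auto simp: conts_start split: if_splits)
 next
  case 2 thus ?thesis using WHILE.IH[OF 2 WHILE.prems(2)] by auto
 qed
next
 case (IFSYM b c d)
 consider "s = IFSYM b c d # k" | "s : conts c k" | "s : conts d k" using IFSYM.prems by auto
 thus ?case
 proof cases
  case 1 thus ?thesis using IFSYM.prems by (auto simp: conts_start)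
 next
  case 2 thus ?thesis using IFSYM.IH(1)[OF 2 IFSYM.prems(2)] by auto
 next
  case 3 thus ?thesis using IFSYM.IH(2)[OF 3 IFSYM.prems(2)] by auto
 qed
qed auto

definition reg_tape :: "nat => tape" where "reg_tape v = (%i. of_bool (i = - int v))"

definition tapes :: "nat => nat list => int => (nat => nat) => tape list" where
 "tapes m w p R = (%i. word_tape w (i + p)) # map (%r. reg_tape (R r)) [0..<m]"

primrec regs :: "com => nat set" where
 "regs (INC r) = {r}" | "regs (DEC r) = {r}" | "regs LEFT = {}" | "regs RIGHT = {}" | "regs ACC = {}"
| "regs (SEQ c d) = regs c \<union> regs d" | "regs (WHILE r c) = insert r (regs c)" | "regs (IFSYM a c d) = regs c \<union> regs d"

lemma regs_conts: "s : conts c k ==> x : set s ==> regs x <= regs c \<union> \<Union> (regs ` set k)"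
 by (induction c arbitrary: k s) fastforce+

lemma nxt_regs: "nxt s a z = Some (s', m, d) ==> d r ~= Stay ==> EX x:set s. r : regs x"
 by (induction s a z rule: nxt.induct) (auto split: if_splits)

lemma nxt_Move_Left: "nxt s a z = Some (s', m, d) ==> d r = Move_Left ==> ~ z r"
 by (induction s a z rule: nxt.induct) (auto split: if_splits)

lemma nxt_cong: "ALL x:set s. ALL r:regs x. z r = z' r ==> nxt s a z = nxt s a z'"
 by (cases "(s, a, z)" rule: nxt.cases) auto

lemma shift_word_tape: "shift_tape m (%i. word_tape w (i + p)) = (%i. word_tape w (i + (p + shift_num m)))"
 by (cases m) (auto simp: algebra_simps)

lemma shift_reg_tape: "(m = Move_Left ==> v > 0) ==> shift_tape m (reg_tape v) = reg_tape (nat (int v + shift_num m))"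
 by (cases m) (auto simp: reg_tape_def)

lemma set_word_tape: "set w <= {..K} ==> word_tape w i <= (K :: nat)"
 unfolding word_tape_def using nth_mem[of "nat i" w] by fastforce

text \<open>Counter \<open>r\<close> is kept as the position of a single mark on tape \<open>r + 1\<close>, so that incrementing, decrementing and testing for 0 are single head movements and reads;
the mark is written in the first step. The second part, that halting of the machine comes from halting of the program, is needed for semi-decision procedures.\<close>

theorem compile:
 fixes K :: nat
 assumes m: "!!r. r : regs c ==> r < m"
 obtains M where
  "!!w t x. set w <= {..K} ==> psteps w t ([c], 0, %_. 0) x ==> pstep w x = None ==>
   EX cf. halts_in M w (Suc t) cf & (accepting cf \<longleftrightarrow> (EX k. fst x = ACC # k))"
  "!!w t cf. set w <= {..K} ==> halts_in M w t cf ==> EX t x. psteps w t ([c], 0, %_. 0) x & pstep w x = None"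
proof -
 define S where "S = insert [] (conts c [])"
 have S: "finite S" by (simp add: S_def finite_conts)
 obtain idx :: "com list => nat" where idx: "inj_on idx S" using finite_imp_inj_to_nat_seg[OF S] by metis
 \<comment> \<open>State 0 is initial and state 1 accepts, so all other stacks are numbered from 2 on.\<close>
 define num where "num s = (if EX k. s = ACC # k then 1 else 2 + idx s)" for s
 define dec where "dec q = inv_into S idx (q - 2)" for q
 have dec: "dec (num s) = s" if "s : S" "\<nexists>k. s = ACC # k" for s
  using that inv_into_f_f[OF idx] by (simp add: dec_def num_def)
 define \<delta> where "\<delta> q as = (if q = 0 then Some ((hd as, Stay) # replicate m (1, Stay), num [c])
  else if q = 1 then None
  else map_option (%(s', mv, d). ((hd as, mv) # map (%r. (as ! Suc r, d r)) [0..<m], num s'))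
   (nxt (dec q) (hd as) (%r. as ! Suc r = 1)))" for q as
 define Q where "Q = {..Max (num ` S)} \<times> {as. set as <= {..max K 1} & length as = Suc m}"
 have num: "num s <= Max (num ` S)" if "s : S" for s using that S by simp
 have Qfin: "finite Q" unfolding Q_def by (intro finite_SigmaI finite_atMost finite_lists_length_eq)
 have Qlen: "length acts = length as" if "(q, as) : Q" "\<delta> q as = Some (acts, q')" for q as acts q'
  using that by (auto simp: \<delta>_def Q_def split: if_splits)
 obtain M where M: "work_tapes M = m"
  "!!q ts. (q, map (%t. t 0) ts) : Q ==> tm_step M (q, ts) =
   map_option (%(acts, q'). (q', map2 (%(b, m) t. shift_tape m (t(0 := b))) acts ts)) (\<delta> q (map (%t. t 0) ts))"
 proof -
  note outer = that
  have "EX M. work_tapes M = m & (ALL q ts. (q, map (%t. t 0) ts) : Q --> tm_step M (q, ts) =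
  map_option (%(acts, q'). (q', map2 (%(b, m) t. shift_tape m (t(0 := b))) acts ts)) (\<delta> q (map (%t. t 0) ts)))"
   by (rule machine_exists[OF Qfin]) (rule Qlen)
  thus thesis using outer by blast
 qed
 define Inv :: "pconf => bool" where "Inv = (%(s, p, R). s : S & (\<forall>r\<ge>m. R r = 0))"
 define conf where "conf w = (%(s, p, R). (num s, tapes m w p R))" for w
 have upd: "t(0 := t 0) = t" for t :: tape by auto
 have step: "tm_step M (conf w x) = map_option (conf w) (pstep w x) & (ALL y. pstep w x = Some y --> Inv y)"
  if w: "set w <= {..K}" and "Inv x" for w x
 proof -
  obtain s p R where x: "x = (s, p, R)" by (cases x)
  have s: "s : S" and R: "!!r. r >= m ==> R r = 0" using that by (auto simp: Inv_def x)
  have sm: "r < m" if "y : set s" "r : regs y" for y r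
   using s that regs_conts[of s c "[]" y] m by (auto simp: S_def)
  let ?as = "map (%t. t 0) (tapes m w p R)"
  have as: "?as = word_tape w p # map (%r. of_bool (R r = 0)) [0..<m]"
   by (auto simp: tapes_def reg_tape_def)
  have inQ: "(num s, ?as) : Q" using num[OF s] set_word_tape[OF w, of p] by (auto simp: Q_def as le_max_iff_disj)
  show ?thesis
  proof (cases "EX k. s = ACC # k")
   case True
   hence "\<delta> (num s) ?as = None" "pstep w x = None" by (auto simp: \<delta>_def num_def pstep_def x)
   thus ?thesis using M(2)[OF inQ] by (simp add: conf_def x)
  next
   case False
   have nx: "nxt s (word_tape w p) (%r. (word_tape w p # map (%r. of_bool (R r = 0)) [0..<m]) ! Suc r = (1::nat)) =
    nxt s (word_tape w p) (%r. R r = 0)"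
    by (rule nxt_cong) (use sm in force)
   have \<delta>: "\<delta> (num s) ?as = map_option (%(s', mv, d). ((hd ?as, mv) # map (%r. (?as ! Suc r, d r)) [0..<m], num s'))
    (nxt s (word_tape w p) (%r. R r = 0))"
    unfolding \<delta>_def dec[OF s False] as list.sel nx using False by (simp add: num_def)
   show ?thesis
   proof (cases "nxt s (word_tape w p) (%r. R r = 0)")
    case None
    thus ?thesis using M(2)[OF inQ] \<delta> by (simp add: conf_def x pstep_def)
   next
    case (Some n)
    obtain s' mv d where n: "n = (s', mv, d)" by (cases n)
    define R' where "R' = (%r. nat (int (R r) + shift_num (d r)))"
    have st: "pstep w x = Some (s', p + shift_num mv, R')" by (simp add: x pstep_def Some n R'_def)
    have "s' : S" using s conts_closed[of s c "[]" "word_tape w p" "%r. R r = 0" s' mv d] Some n by (auto simp: S_def)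
    moreover have "R' r = 0" if "r >= m" for r
    proof -
     have "d r = Stay" using nxt_regs[OF Some[unfolded n], of r] sm that by fastforce
     thus ?thesis using R[OF that] by (simp add: R'_def)
    qed
    ultimately have inv: "Inv (s', p + shift_num mv, R')" by (simp add: Inv_def)
    have t: "shift_tape (d r) (reg_tape (R r)) = reg_tape (R' r)" for r
     unfolding R'_def using nxt_Move_Left[OF Some[unfolded n], of r] by (intro shift_reg_tape) auto
    have a: "?as ! Suc r = reg_tape (R r) 0" if "r < m" for r using that by (simp add: as reg_tape_def)
    have hd: "hd ?as = word_tape w (0 + p)" by (simp add: as)
    have "map2 (%(b, m) t. shift_tape m (t(0 := b))) ((hd ?as, mv) # map (%r. (?as ! Suc r, d r)) [0..<m]) (tapes m w p R)
     = tapes m w (p + shift_num mv) R'"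
    proof -
     have "shift_tape mv ((%i. word_tape w (i + p))(0 := hd ?as)) = (%i. word_tape w (i + (p + shift_num mv)))"
      unfolding hd upd[of "%i. word_tape w (i + p)"] shift_word_tape ..
     moreover have "map2 (%(b, m) t. shift_tape m (t(0 := b))) (map (%r. (?as ! Suc r, d r)) [0..<m]) (map (%r. reg_tape (R r)) [0..<m])
       = map (%r. reg_tape (R' r)) [0..<m]"
      by (rule nth_equalityI) (simp_all add: a t)
     ultimately show ?thesis by (simp add: tapes_def)
    qed
    thus ?thesis using M(2)[OF inQ] \<delta> inv unfolding Some n st by (simp add: conf_def x)
   qed
  qed
 qed
 have fwd: "(conf w x, conf w y) : step_rel M ^^ t & Inv y"
  if "psteps w t x y" "Inv x" and w: "set w <= {..K}" for w t x y
  using that(1,2) unfolding psteps_def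
 proof (induction t arbitrary: y)
  case (Suc t)
  then obtain z where "(x, z) : {(x, y). pstep w x = Some y} ^^ t" "pstep w z = Some y" by (elim relpow_Suc_E) simp
  moreover from this have "(conf w x, conf w z) : step_rel M ^^ t & Inv z" using Suc by blast
  ultimately show ?case using step[OF w, of z] relpow_Suc_I[of "conf w x" "conf w z" t _ "conf w y"] by simp
 qed auto
 have bwd: "EX y. psteps w t x y & Inv y & cf = conf w y"
  if "(conf w x, cf) : step_rel M ^^ t" "Inv x" and w: "set w <= {..K}" for w t x cf
  using that(1,2) unfolding psteps_def
 proof (induction t arbitrary: cf)
  case (Suc t)
  then obtain cf' where "(conf w x, cf') : step_rel M ^^ t" "tm_step M cf' = Some cf" by auto
  then obtain z where "(x, z) : {(x, y). pstep w x = Some y} ^^ t" "Inv z" "cf' = conf w z" "tm_step M cf' = Some cf"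
   using Suc by blast
  then obtain y where y: "pstep w z = Some y" "Inv y" "cf = conf w y" using step[OF w, of z] by (cases "pstep w z") auto
  have "(x, y) : {(x, y). pstep w x = Some y} ^^ Suc t"
   by (rule relpow_Suc_I[OF \<open>(x, z) : _\<close>]) (simp add: y)
  thus ?case using y by blast
 qed auto
 define x0 :: pconf where "x0 = ([c], 0, %_. 0)"
 have inv0: "Inv x0" by (simp add: Inv_def x0_def S_def conts_start)
 have start: "tm_step M (init_config M w) = Some (conf w x0)" if w: "set w <= {..K}" for w
 proof -
  have as: "map (%t. t 0) (word_tape w # replicate m (word_tape [])) = word_tape w 0 # replicate m 0"
   by (simp add: word_tape_def)
  have "(0, word_tape w 0 # replicate m 0) : Q" using set_word_tape[OF w, of 0] by (auto simp: Q_def le_max_iff_disj)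
  note M' = M(2)[of 0 "word_tape w # replicate m (word_tape [])", unfolded as, OF this]
  have "map2 (%(b, m) t. shift_tape m (t(0 := b))) (replicate m (1, Stay)) (replicate m (word_tape [])) =
   map (%r. reg_tape 0) [0..<m]"
   by (rule nth_equalityI) (auto simp: reg_tape_def word_tape_def)
  thus ?thesis unfolding init_config_def M(1) M'
   by (simp add: \<delta>_def conf_def x0_def tapes_def)
 qed
 show thesis
 proof (rule that)
  fix w t x assume w: "set w <= {..K}" and st: "psteps w t ([c], 0, %_. 0) x" "pstep w x = None"
  have f: "(conf w x0, conf w x) : step_rel M ^^ t" "Inv x" using fwd[of w t x0 x] st inv0 w by (auto simp: x0_def)
  have "(init_config M w, conf w x) : step_rel M ^^ Suc t"
   using start[OF w] f(1) by (intro relpow_Suc_I2) auto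
  moreover have "tm_step M (conf w x) = None" using step[OF w f(2)] st(2) by simp
  moreover have "accepting (conf w x) \<longleftrightarrow> (EX k. fst x = ACC # k)"
   by (auto simp: accepting_def conf_def num_def split: prod.split)
  ultimately show "EX cf. halts_in M w (Suc t) cf & (accepting cf \<longleftrightarrow> (EX k. fst x = ACC # k))"
   unfolding halts_in_def by blast
 next
  fix w t cf assume w: "set w <= {..K}" and h: "halts_in M w t cf"
  have "t ~= 0" using h start[OF w] by (intro notI) (simp add: halts_in_def)
  then obtain t' where t: "t = Suc t'" by (cases t) auto
  have "(init_config M w, cf) : step_rel M ^^ Suc t'" using h by (simp add: halts_in_def t)
  then obtain cf' where "tm_step M (init_config M w) = Some cf'" "(cf', cf) : step_rel M ^^ t'"
   by (elim relpow_Suc_E2) auto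
  hence "(conf w x0, cf) : step_rel M ^^ t'" using start[OF w] by simp
  then obtain y where y: "psteps w t' x0 y" "Inv y" "cf = conf w y" using bwd inv0 w by blast
  hence "pstep w y = None" using step[OF w y(2)] h by (simp add: halts_in_def)
  thus "EX t x. psteps w t ([c], 0, %_. 0) x & pstep w x = None" using y(1) unfolding x0_def by blast
 qed
qed

section \<open>Functions computable in polynomial time in unary\<close>

text \<open>Powers \<open>n ^ c\<close> without leading constants bound all polynomials when \<open>n \<ge> 2\<close>, and they are closed under products and composition.\<close>

definition pbd :: "(nat => nat) => bool" where "pbd f \<longleftrightarrow> (EX c. \<forall>n\<ge>2. f n <= n ^ c)"

lemma pow_pow_le: "2 <= n ==> a <= b ==> (n::nat) ^ a <= n ^ b" by (rule power_increasing) auto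

lemma pbd_power: "pbd (%n. n ^ c)" by (auto simp: pbd_def)

lemma pbd_const: "pbd (%n. k)"
 unfolding pbd_def
proof (intro exI[of _ k] allI impI)
 fix n :: nat assume "2 <= n"
 have "k < 2 ^ k" by (rule less_exp)
 also have "... <= n ^ k" using \<open>2 <= n\<close> by (rule power_mono) simp
 finally show "k <= n ^ k" by simp
qed

lemma pbd_mult: "pbd f ==> pbd g ==> pbd (%n. f n * g n)"
 unfolding pbd_def
proof (elim exE)
 fix a b assume "\<forall>n\<ge>2. f n <= n ^ a" "\<forall>n\<ge>2. g n <= n ^ b"
 hence "\<forall>n\<ge>2. f n * g n <= n ^ (a + b)" unfolding power_add by (blast intro: mult_le_mono)
 thus "EX c. \<forall>n\<ge>2. f n * g n <= n ^ c" by blast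
qed

lemma pbd_add: "pbd f ==> pbd g ==> pbd (%n. f n + g n)"
 unfolding pbd_def
proof (elim exE)
 fix a b assume *: "\<forall>n\<ge>2. f n <= n ^ a" "\<forall>n\<ge>2. g n <= n ^ b"
 have "f n + g n <= n ^ Suc (a + b)" if n: "n >= 2" for n
 proof -
  have "f n <= n ^ (a + b)" by (rule le_trans[OF *(1)[rule_format, OF n] pow_pow_le[OF n]]) simp
  moreover have "g n <= n ^ (a + b)" by (rule le_trans[OF *(2)[rule_format, OF n] pow_pow_le[OF n]]) simp
  ultimately have "f n + g n <= 2 * n ^ (a + b)" by simp
  also have "... <= n ^ Suc (a + b)" using n by simp
  finally show ?thesis .
 qed
 thus "EX c. \<forall>n\<ge>2. f n + g n <= n ^ c" by blast
qed

lemma pbd_Suc: "pbd f ==> pbd (%n. Suc (f n))"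
 using pbd_add[OF pbd_const[of 1]] by simp

lemma pbd_pow: "pbd f ==> pbd (%n. f n ^ k)"
 by (induction k) (simp_all add: pbd_const pbd_mult)

lemmas pbd_intros = pbd_power pbd_const pbd_mult pbd_add pbd_Suc pbd_pow pbd_power[of 1, simplified]

locale alphabet = fixes K :: nat
begin

text \<open>A common size bound \<open>n\<close> for the input word, whose letters are positive so that the blank marks its end.\<close>

definition adm :: "nat list => nat => bool" where
 "adm w n \<longleftrightarrow> 2 <= n & length w <= n & set w <= {1..K}"

abbreviation bounded_by :: "(nat list => (nat => nat) => nat) => nat => bool" where
 "bounded_by F c \<equiv> ALL w n e. adm w n --> (ALL v. e v <= n) --> F w e <= n ^ c"

text \<open>Polynomial growth in the input and in the values of the variables.\<close>

definition PB :: "(nat list => (nat => nat) => nat) => bool" where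
 "PB F \<longleftrightarrow> (EX c. bounded_by F c)"

abbreviation computes_in :: "com => (nat => nat) => nat => (nat list => (nat => nat) => nat) => nat => bool" where
 "computes_in C rho q F c \<equiv> ALL w n R. adm w n --> (ALL v. R (rho v) <= n) --> (\<forall>r\<ge>q. R r = 0) -->
  runs w C (n ^ c) (0, R) (0, R(q := F w (%v. R (rho v))))"

definition computes :: "com => (nat => nat) => nat => (nat list => (nat => nat) => nat) => bool" where
 "computes C rho q F \<longleftrightarrow> (EX c. computes_in C rho q F c)"

text \<open>Functions of an input word \<open>w\<close> and an environment \<open>e\<close> of numbers that are polynomially bounded and computed by a program in polynomial time. Register
\<open>rho v\<close> holds the variable \<open>v\<close>, the registers from \<open>q\<close> on are free, and the result is left in register \<open>q\<close>. Variables are de Bruijn indices: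
binding a variable makes it number 0 and shifts the others by one.\<close>

definition PT :: "(nat list => (nat => nat) => nat) => bool" where
 "PT F \<longleftrightarrow> PB F & (ALL rho q. (ALL v. rho v < q) --> (EX C. computes C rho q F))"

abbreviation "PTb P \<equiv> PT (%w e. of_bool (P w e))"

lemma adm_mono: "adm w n ==> n <= n' ==> adm w n'" by (auto simp: adm_def)

lemma adm_power: "adm w n ==> adm w (n ^ Suc c)"
 by (rule adm_mono) (auto simp: adm_def)

lemma le_power_Suc: "2 <= n ==> n <= (n::nat) ^ Suc c" by simp

lemma computesI:
 assumes "pbd f" "!!w n R. adm w n ==> ALL v. R (rho v) <= n ==> \<forall>r\<ge>q. R r = 0 ==>
  runs w C (f n) (0, R) (0, R(q := F w (%v. R (rho v))))"
 shows "computes C rho q F"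
proof -
 obtain c where c: "\<forall>n\<ge>2. f n <= n ^ c" using assms(1) unfolding pbd_def by blast
 show ?thesis unfolding computes_def
 proof (rule exI[of _ c], intro allI impI)
  fix w n R assume a: "adm w n" "ALL v. R (rho v) <= n" "\<forall>r\<ge>q. R r = 0"
  hence "f n <= n ^ c" using c by (simp add: adm_def)
  thus "runs w C (n ^ c) (0, R) (0, R(q := F w (%v. R (rho v))))" by (rule runs_mono[OF assms(2)[OF a]])
 qed
qed

lemma PBI: "pbd f ==> (!!w n e. adm w n ==> ALL v. e v <= n ==> F w e <= f n) ==> PB F"
 unfolding PB_def pbd_def adm_def by (meson le_trans)

lemma PBE: "PB F ==> EX c. bounded_by F (Suc c)"
 unfolding PB_def
proof (elim exE)
 fix c assume c: "ALL w n e. adm w n --> (ALL v. e v <= n) --> F w e <= n ^ c"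
 have "F w e <= n ^ Suc c" if a: "adm w n" "ALL v. e v <= n" for w n e
 proof -
  have "n ^ c <= n ^ Suc c" using a(1) by (intro pow_pow_le) (auto simp: adm_def)
  thus ?thesis using c a by (meson le_trans)
 qed
 thus "EX c. bounded_by F (Suc c)" by blast
qed

lemma PT_PB: "PT F ==> PB F" by (simp add: PT_def)

lemma PT_computes: "PT F ==> (!!v. rho v < q) ==> EX C. computes C rho q F"
 by (simp add: PT_def)

lemma PTI: "PB F ==> (!!rho q. ALL v. rho v < q ==> EX C. computes C rho q F) ==> PT F"
 by (simp add: PT_def)

lemma PB_mono: "PB F ==> (!!w e. H w e <= F w e) ==> PB H"
 unfolding PB_def by (meson le_trans)

lemma PB_var: "PB (%w e. e v)"
 by (rule PBI[OF pbd_power[of 1]]) simp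

lemma PB_const: "PB (%w e. k)"
 by (rule PBI[OF pbd_const[of k]]) simp

lemma PB_length: "PB (%w e. length w)"
 by (rule PBI[OF pbd_power[of 1]]) (simp add: adm_def)

lemma PB_add: "PB F ==> PB H ==> PB (%w e. F w e + H w e)"
 by (drule PBE, drule PBE, elim exE, rule PBI[OF pbd_add[OF pbd_power pbd_power]]) (rule add_mono; blast)

lemma PB_mult: "PB F ==> PB H ==> PB (%w e. F w e * H w e)"
 by (drule PBE, drule PBE, elim exE, rule PBI[OF pbd_mult[OF pbd_power pbd_power]]) (rule mult_le_mono; blast)

lemma PB_rename: assumes "PB F" shows "PB (%w e. F w (%v. e (g v)))"
proof -
 obtain c where c: "bounded_by F (Suc c)" using PBE[OF assms] by blast
 show ?thesis
 proof (rule PBI[OF pbd_power[of "Suc c"]])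
  fix w n and e :: "nat => nat" assume "adm w n" "ALL v. e v <= n"
  thus "F w (%v. e (g v)) <= n ^ Suc c" by (intro c[rule_format]) simp_all
 qed
qed

lemma PB_let:
 assumes "PB A" "PB (%w e. H w (%k. e (Suc k)) (e 0))"
 shows "PB (%w e. H w e (A w e))"
proof -
 obtain a where a: "bounded_by A (Suc a)" using PBE[OF assms(1)] by blast
 obtain b where b: "bounded_by (%w e. H w (%k. e (Suc k)) (e 0)) (Suc b)"
  using PBE[OF assms(2)] by blast
 show ?thesis
 proof (rule PBI[OF pbd_pow[OF pbd_power]])
  fix w n and e :: "nat => nat" assume n: "adm w n" and e: "ALL v. e v <= n"
  have "n <= n ^ Suc a" using n by (intro le_power_Suc) (simp add: adm_def)
  hence "ALL v. case_nat (A w e) e v <= n ^ Suc a" using e[rule_format] a[rule_format, OF n e[rule_format]] by (auto split: nat.split intro: le_trans simp del: power_Suc)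
  thus "H w e (A w e) <= (n ^ Suc a) ^ Suc b" using b[rule_format, OF adm_power[OF n], of "case_nat (A w e) e"] by simp
 qed
qed

lemma PT_rename: "PT F ==> PT (%w e. F w (%v. e (g v)))"
proof (rule PTI)
 fix rho :: "nat => nat" and q assume F: "PT F" and "ALL v. rho v < q"
 then obtain C where C: "computes C (%v. rho (g v)) q F" using PT_computes[OF F, of "%v. rho (g v)" q] by blast
 hence "computes C rho q (%w e. F w (%v. e (g v)))" unfolding computes_def by (elim ex_forward) blast
 thus "EX C. computes C rho q (%w e. F w (%v. e (g v)))" by blast
qed (simp add: PT_PB PB_rename)

lemma PT_0: "PT (%w e. 0)"
proof (rule PTI[OF PB_const])
 fix rho :: "nat => nat" and q
 have "computes (WHILE q (DEC q)) rho q (%w e. 0)"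
  by (rule computesI[OF pbd_const[of "Suc (0 * 2)"]], rule runs_clear) simp
 thus "EX C. computes C rho q (%w e. 0)" by blast
qed

lemma PT_Suc: "PT F ==> PT (%w e. Suc (F w e))"
proof (rule PTI)
 assume F: "PT F"
 show "PB (%w e. Suc (F w e))" using PB_add[OF PB_const[of 1] PT_PB[OF F]] by simp
 fix rho :: "nat => nat" and q assume "ALL v. rho v < q"
 then obtain C c where c: "computes_in C rho q F c" using PT_computes[OF F] unfolding computes_def by blast
 have "computes (SEQ C (INC q)) rho q (%w e. Suc (F w e))"
 proof (rule computesI)
  show "pbd (%n. Suc (n ^ c + 1))" by (intro pbd_intros)
  fix w n R assume "adm w n" "ALL v. R (rho v) <= n" "\<forall>r\<ge>q. R r = (0::nat)"
  hence "runs w C (n ^ c) (0, R) (0, R(q := F w (%v. R (rho v))))" using c by blast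
  from runs_SEQ[OF this runs_INC[of w q]]
  show "runs w (SEQ C (INC q)) (Suc (n ^ c + 1)) (0, R) (0, R(q := Suc (F w (%v. R (rho v)))))" by simp
 qed
 thus "EX C. computes C rho q (%w e. Suc (F w e))" by blast
qed

lemma PT_const: "PT (%w e. k)"
 by (induction k) (auto intro: PT_0 PT_Suc)

lemma PT_var: "PT (%w e. e v)"
proof (rule PTI[OF PB_var])
 fix rho :: "nat => nat" and q assume rho: "ALL v. rho v < q"
 define r where "r = rho v"
 have r: "r ~= q" "r ~= Suc q" "r < q" using rho[rule_format, of v] by (auto simp: r_def)
 let ?B = "SEQ (INC q) (SEQ (INC (Suc q)) (DEC r))"
 let ?C = "SEQ (WHILE r ?B) (WHILE (Suc q) (SEQ (INC r) (DEC (Suc q))))"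
 have "computes ?C rho q (%w e. e v)"
 proof (rule computesI)
  show "pbd (%n. Suc (Suc (n ^ 1 * Suc (Suc (1 + Suc (1 + 1)))) + Suc (n ^ 1 * 4)))" by (intro pbd_intros)
  fix w n R assume n: "adm w n" "ALL v. R (rho v) <= n" and z: "\<forall>r\<ge>q. R r = (0::nat)"
  define Q where "Q i = R(q := i, Suc q := i, r := R r - i)" for i
  have rn: "R r <= n ^ 1" using n(2) by (simp add: r_def)
  have "runs w (WHILE r ?B) (Suc (R r * Suc (Suc (1 + Suc (1 + 1))))) (0, Q 0) (0, Q (R r))"
  proof (rule runs_WHILE[where p = "%_. 0" and R = Q])
   fix i assume i: "i < R r"
   have "runs w ?B (Suc (1 + Suc (1 + 1))) (0, Q i) (0, Q (Suc i))"
    by (rule runs_SEQ[OF runs_INC runs_SEQ[OF runs_INC runs_DEC], THEN back_subst[of "runs w ?B _ _"]])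
     (use r in \<open>auto simp: Q_def fun_eq_iff\<close>)
   thus "Q i r ~= 0 & runs w ?B (Suc (1 + Suc (1 + 1))) (0, Q i) (0, Q (Suc i))" using i r by (simp add: Q_def)
  qed (use r in \<open>simp add: Q_def\<close>)
  hence 1: "runs w (WHILE r ?B) (Suc (n ^ 1 * Suc (Suc (1 + Suc (1 + 1))))) (0, Q 0) (0, Q (R r))"
   by (rule runs_mono) (use rn in \<open>simp only: Suc_le_mono mult_le_mono1\<close>)
  have 2: "Q (R r) (Suc q) <= n ^ 1" using r rn by (simp add: Q_def)
  have "Q 0 = R" "(Q (R r))(Suc q := 0, r := Q (R r) r + Q (R r) (Suc q)) = R(q := R (rho v))"
   using r z by (auto simp: Q_def fun_eq_iff r_def)
  thus "runs w ?C (Suc (Suc (n ^ 1 * Suc (Suc (1 + Suc (1 + 1)))) + Suc (n ^ 1 * 4))) (0, R) (0, R(q := R (rho v)))"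
   using runs_SEQ[OF 1 runs_move[of "Suc q" r "Q (R r)" "n ^ 1" w 0]] 2 r by simp
 qed
 thus "EX C. computes C rho q (%w e. e v)" by blast
qed

end

context alphabet
begin

text \<open>Iterating a polynomial-time step is in general exponential. Here all intermediate values are bounded by one polynomially bounded function, so each of the polynomially many iterations takes
polynomial time.\<close>

lemma PT_rec:
 assumes N: "PT N" and A: "PT A" and S: "PT (%w e. S w (%k. e (Suc (Suc k))) (e (Suc 0)) (e 0))"
  and B: "PB B" and le: "!!w e i. i <= N w e ==> rec_nat (A w e) (S w e) i <= B w e"
 shows "PT (%w e. rec_nat (A w e) (S w e) (N w e))"
proof (rule PTI)
 show "PB (%w e. rec_nat (A w e) (S w e) (N w e))" by (rule PB_mono[OF B le]) simp
 fix rho :: "nat => nat" and q assume rho: "ALL v. rho v < q"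
 have "rho v < Suc (Suc q)" for v using rho[rule_format, of v] by simp
 then obtain CN CA where "computes CN rho q N" "computes CA rho (Suc (Suc q)) A"
  using PT_computes[OF N, of rho q] PT_computes[OF A, of rho "Suc (Suc q)"] rho by blast
 then obtain cN cA where cN: "computes_in CN rho q N cN"
  and cA: "computes_in CA rho (Suc (Suc q)) A cA"
  unfolding computes_def by blast
 define rho' where "rho' = case_nat (Suc (Suc q)) (case_nat (Suc q) rho)"
 have rho'q: "rho' v < Suc (Suc (Suc q))" for v
  using rho by (auto simp: rho'_def less_Suc_eq split: nat.split)
 obtain CS where "computes CS rho' (Suc (Suc (Suc q))) (%w e. S w (%k. e (Suc (Suc k))) (e (Suc 0)) (e 0))"
  using PT_computes[OF S, of rho' "Suc (Suc (Suc q))"] rho'q by blast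
 then obtain cS where cS: "computes_in CS rho' (Suc (Suc (Suc q))) (%w e. S w (%k. e (Suc (Suc k))) (e (Suc 0)) (e 0)) cS"
  unfolding computes_def by blast
 obtain a where a: "bounded_by N (Suc a)" using PBE[OF PT_PB[OF N]] by blast
 obtain b where b: "bounded_by B (Suc b)" using PBE[OF B] by blast
 let ?clr = "%r. WHILE r (DEC r)"
 let ?mv = "%r r'. WHILE r (SEQ (INC r') (DEC r))"
 \<comment> \<open>Register \<open>q\<close> counts the remaining iterations, \<open>q + 1\<close> the completed ones, and \<open>q + 2\<close> holds the current value; the step leaves its result in \<open>q + 3\<close>.\<close>
 let ?body = "SEQ CS (SEQ (?clr (Suc (Suc q))) (SEQ (?mv (Suc (Suc (Suc q))) (Suc (Suc q))) (SEQ (INC (Suc q)) (DEC q))))"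
 let ?C = "SEQ CN (SEQ CA (SEQ (WHILE q ?body) (SEQ (?clr (Suc q)) (?mv (Suc (Suc q)) q))))"
 define m where "m = Suc (a + b)"
 define tb where "tb n = Suc ((n ^ m) ^ cS + Suc (Suc (n ^ m * 2) + Suc (Suc (n ^ m * 4) + Suc (1 + 1))))" for n
 have tb: "pbd tb" unfolding tb_def by (intro pbd_intros)
 have "computes ?C rho q (%w e. rec_nat (A w e) (S w e) (N w e))"
 proof (rule computesI)
  show "pbd (%n. Suc (n ^ cN + Suc ((n ^ m) ^ cA + Suc (Suc (n ^ m * Suc (tb n)) + Suc (Suc (n ^ m * 2) + Suc (n ^ m * 4))))))"
   by (intro pbd_intros tb)
  fix w n R assume n: "adm w n" "ALL v. R (rho v) <= n" and z: "\<forall>r\<ge>q. R r = (0::nat)"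
  define e where "e = (%v. R (rho v))"
  have e: "ALL v. e v <= n" using n by (simp add: e_def)
  have n2: "2 <= n" using n by (simp add: adm_def)
  have nm: "n <= n ^ m" "n ^ Suc a <= n ^ m" "n ^ Suc b <= n ^ m"
   using pow_pow_le[OF n2, of 1 m] pow_pow_le[OF n2, of "Suc a" m] pow_pow_le[OF n2, of "Suc b" m] by (simp_all add: m_def)
  have admm: "adm w (n ^ m)" by (rule adm_mono[OF n(1) nm(1)])
  define N' where "N' = N w e"
  define X where "X = rec_nat (A w e) (S w e)"
  have N': "N' <= n ^ m" using a[rule_format, OF n(1), of e] e nm(2) unfolding N'_def by (meson le_trans)
  have X: "X i <= n ^ m" if "i <= N'" for i
   using le[of i w e] that b[rule_format, OF n(1), of e] e nm(3) unfolding N'_def X_def by (meson le_trans)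
  define Q where "Q i = R(q := N' - i, Suc q := i, Suc (Suc q) := X i)" for i
  have 1: "runs w CN (n ^ cN) (0, R) (0, R(q := N'))" using cN n z unfolding N'_def e_def by blast
  have "runs w CA ((n ^ m) ^ cA) (0, R(q := N')) (0, (R(q := N'))(Suc (Suc q) := A w (%v. (R(q := N')) (rho v))))"
   using rho z e nm(1) by (intro cA[rule_format] admm) (auto simp: e_def intro: le_trans)
  moreover have "(%v. (R(q := N')) (rho v)) = e" using rho by (auto simp: e_def fun_eq_iff)
  moreover have "(R(q := N'))(Suc (Suc q) := A w e) = Q 0" using z by (auto simp: Q_def X_def fun_eq_iff)
  ultimately have 2: "runs w CA ((n ^ m) ^ cA) (0, R(q := N')) (0, Q 0)" by simp
  have 3: "runs w (WHILE q ?body) (Suc (N' * Suc (tb n))) (0, Q 0) (0, Q N')"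
  proof (rule runs_WHILE[where p = "%_. 0"])
   fix i assume i: "i < N'"
   have ne: "rho v ~= q" "rho v ~= Suc q" "rho v ~= Suc (Suc q)" for v using rho[rule_format, of v] by auto
   have Qe: "(%v. Q i (rho' (Suc (Suc v)))) = e" "Q i (rho' (Suc 0)) = i" "Q i (rho' 0) = X i"
    by (auto simp: e_def fun_eq_iff Q_def rho'_def ne)
   have "Q i (rho' v) <= n ^ m" for v
   proof (cases v)
    case 0 thus ?thesis using Qe(3) X[of i] i by simp
   next
    case (Suc v')
    show ?thesis
    proof (cases v')
     case 0 thus ?thesis using Qe(2) i N' Suc by simp
    next
     case (Suc v'')
     thus ?thesis using fun_cong[OF Qe(1), of v''] \<open>v = Suc v'\<close> e nm(1) by (metis le_trans)
    qed
   qed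
   hence "runs w CS ((n ^ m) ^ cS) (0, Q i) (0, (Q i)(Suc (Suc (Suc q)) := S w (%v. Q i (rho' (Suc (Suc v)))) (Q i (rho' (Suc 0))) (Q i (rho' 0))))"
    by (intro cS[rule_format] admm) (use z in \<open>auto simp: Q_def\<close>)
   hence s: "runs w CS ((n ^ m) ^ cS) (0, Q i) (0, (Q i)(Suc (Suc (Suc q)) := X (Suc i)))" unfolding Qe by (simp add: X_def)
   have "runs w ?body (tb n) (0, Q i) (0, Q (Suc i))" unfolding tb_def
    by (rule runs_SEQ[OF s runs_SEQ[OF runs_clear runs_SEQ[OF runs_move runs_SEQ[OF runs_INC runs_DEC]]], THEN back_subst[of "runs w ?body _ _"]])
     (use i X[of i] X[of "Suc i"] z in \<open>auto simp: Q_def fun_eq_iff\<close>)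
   thus "Q i q ~= 0 & runs w ?body (tb n) (0, Q i) (0, Q (Suc i))" using i by (simp add: Q_def)
  qed (simp add: Q_def)
  have 3: "runs w (WHILE q ?body) (Suc (n ^ m * Suc (tb n))) (0, Q 0) (0, Q N')"
   by (rule runs_mono[OF 3]) (use N' in \<open>simp only: Suc_le_mono mult_le_mono1\<close>)
  have "runs w ?C (Suc (n ^ cN + Suc ((n ^ m) ^ cA + Suc (Suc (n ^ m * Suc (tb n)) + Suc (Suc (n ^ m * 2) + Suc (n ^ m * 4))))))
   (0, R) (0, R(q := X N'))"
   by (rule runs_SEQ[OF 1 runs_SEQ[OF 2 runs_SEQ[OF 3 runs_SEQ[OF runs_clear runs_move]]], THEN back_subst[of "runs w ?C _ _"]])
    (use N' X[of N'] z in \<open>auto simp: Q_def fun_eq_iff\<close>)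
  thus "runs w ?C (Suc (n ^ cN + Suc ((n ^ m) ^ cA + Suc (Suc (n ^ m * Suc (tb n)) + Suc (Suc (n ^ m * 2) + Suc (n ^ m * 4)))))) (0, R) (0, R(q := rec_nat (A w (%v. R (rho v))) (S w (%v. R (rho v))) (N w (%v. R (rho v)))))"
   unfolding X_def N'_def e_def .
 qed
 thus "EX C. computes C rho q (%w e. rec_nat (A w e) (S w e) (N w e))" by blast
qed

text \<open>A recursion of length 1.\<close>

lemma PT_let:
 assumes A: "PT A" and H: "PT (%w e. H w (%k. e (Suc k)) (e 0))"
 shows "PT (%w e. H w e (A w e))"
proof -
 have "PT (%w e. rec_nat (A w e) (%i x. H w e x) 1)"
 proof (rule PT_rec[OF PT_const A])
  show "PT (%w e. H w (%k. e (Suc (Suc k))) (e 0))"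
   using PT_rename[OF H, of "case_nat 0 (%k. Suc (Suc k))"] by simp
  show "PB (%w e. A w e + H w e (A w e))" by (rule PB_add[OF PT_PB[OF A] PB_let[OF PT_PB[OF A] PT_PB[OF H]]])
  fix w e i assume "i <= (1::nat)"
  thus "rec_nat (A w e) (%i x. H w e x) i <= A w e + H w e (A w e)" by (cases i) auto
 qed
 thus ?thesis by simp
qed

definition sym :: "nat list => nat => nat" where "sym w j = (if j < length w then w ! j else 0)"

lemma word_tape_sym: "word_tape w (int j) = sym w j" by (simp add: word_tape_def sym_def)

primrec incs :: "nat => nat => com" where
 "incs q 0 = WHILE (Suc q) (DEC (Suc q))" | "incs q (Suc k) = SEQ (INC q) (incs q k)"

lemma runs_incs: "R (Suc q) = 0 ==> runs w (incs q k) (Suc (3 * k)) (p, R) (p, R(q := R q + k))"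
proof (induction k arbitrary: R)
 case 0 thus ?case using runs_clear[of R "Suc q" 0 w p] by (simp add: fun_upd_idem)
next
 case (Suc k)
 have "runs w (incs q (Suc k)) (Suc (1 + Suc (3 * k))) (p, R) (p, (R(q := Suc (R q)))(q := (R(q := Suc (R q))) q + k))"
  unfolding incs.simps by (rule runs_SEQ[OF runs_INC Suc.IH]) (use Suc.prems in simp)
 moreover have "R(q := Suc (R q), q := (R(q := Suc (R q))) q + k) = R(q := R q + Suc k)" by (auto simp: fun_eq_iff)
 ultimately show ?case by (simp only: fun_upd_upd) (rule runs_mono, assumption, simp)
qed

text \<open>The symbol under the head is compared with each letter of the alphabet in turn.\<close>

primrec addsym :: "nat => nat => com" where
 "addsym q 0 = incs q 0" | "addsym q (Suc a) = IFSYM (Suc a) (incs q (Suc a)) (addsym q a)"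

lemma runs_addsym: "R (Suc q) = 0 ==> word_tape w p <= k ==>
 runs w (addsym q k) (Suc (4 * k)) (p, R) (p, R(q := R q + word_tape w p))"
proof (induction k)
 case 0 thus ?case using runs_incs[of R q w 0 p] by simp
next
 case (Suc k)
 have "runs w (if word_tape w p = Suc k then incs q (Suc k) else addsym q k) (4 + 4 * k) (p, R) (p, R(q := R q + word_tape w p))"
 proof (cases "word_tape w p = Suc k")
  case True
  thus ?thesis using runs_mono[OF runs_incs[of R q w "Suc k" p], of "4 + 4 * k"] Suc.prems(1) by simp
 next
  case False
  hence le: "word_tape w p <= k" using Suc.prems(2) by simp
  show ?thesis unfolding if_not_P[OF False] by (rule runs_mono[OF Suc.IH[OF _ le]]) (use Suc.prems in simp_all)
 qed
 hence "runs w (addsym q (Suc k)) (Suc (4 + 4 * k)) (p, R) (p, R(q := R q + word_tape w p))"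
  unfolding addsym.simps by (rule runs_IFSYM)
 thus ?case by (rule runs_mono) simp
qed

text \<open>The head moves right as many times as a counter says, reads, and returns to the origin.\<close>

lemma PT_sym_var: "PT (%w e. sym w (e 0))"
proof (rule PTI)
 have sym: "sym w j <= K" if "adm w n" for w n j
  using that nth_mem[of j w] by (fastforce simp: sym_def adm_def)
 show "PB (%w e. sym w (e 0))" by (rule PBI[OF pbd_const[of K]]) (rule sym)
 fix rho :: "nat => nat" and q assume rho: "ALL v. rho v < q"
 have "rho v < Suc q" for v using rho[rule_format, of v] by simp
 then obtain CV where "computes CV rho (Suc q) (%w e. e 0)" using PT_computes[OF PT_var] by blast
 then obtain c where c: "computes_in CV rho (Suc q) (%w e. e 0) c" unfolding computes_def by blast
 let ?f = "SEQ RIGHT (SEQ (DEC (Suc q)) (INC (Suc (Suc q))))" and ?b = "SEQ LEFT (DEC (Suc (Suc q)))"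
 let ?C = "SEQ CV (SEQ (WHILE (Suc q) ?f) (SEQ (addsym q K) (WHILE (Suc (Suc q)) ?b)))"
 have "computes ?C rho q (%w e. sym w (e 0))"
 proof (rule computesI)
  show "pbd (%n. Suc (n ^ c + Suc (Suc (n ^ 1 * Suc 5) + Suc (Suc (4 * K) + Suc (n ^ 1 * Suc 3)))))" by (intro pbd_intros)
  fix w n R assume n: "adm w n" "ALL v. R (rho v) <= n" and z: "\<forall>r\<ge>q. R r = (0::nat)"
  define j where "j = R (rho 0)"
  have j: "j <= n" using n by (simp add: j_def)
  define Q where "Q i = R(Suc q := j - i, Suc (Suc q) := i)" for i
  have 1: "runs w CV (n ^ c) (0, R) (0, Q 0)"
   using c n z unfolding Q_def j_def by (auto intro!: c[rule_format, THEN back_subst[of "runs w CV (n ^ c) (0, R)"]] simp: fun_eq_iff)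
  have 2: "runs w (WHILE (Suc q) ?f) (Suc (j * Suc 5)) (int 0, Q 0) (int j, Q j)"
  proof (rule runs_WHILE)
   fix i assume i: "i < j"
   have "runs w ?f (Suc (1 + Suc (1 + 1))) (int i, Q i) (int (Suc i), Q (Suc i))"
    by (rule runs_SEQ[OF runs_RIGHT runs_SEQ[OF runs_DEC runs_INC], THEN back_subst[of "runs w ?f _ _"]])
     (use i in \<open>auto simp: Q_def fun_eq_iff\<close>)
   thus "Q i (Suc q) ~= 0 & runs w ?f 5 (int i, Q i) (int (Suc i), Q (Suc i))" using i by (simp add: Q_def runs_mono)
  qed (simp add: Q_def)
  have 2: "runs w (WHILE (Suc q) ?f) (Suc (n ^ 1 * Suc 5)) (0, Q 0) (int j, Q j)"
   by (rule runs_mono[OF 2[unfolded of_nat_0]]) (use j in simp)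
  define s where "s = sym w j"
  define Q' where "Q' i = R(q := s, Suc (Suc q) := j - i)" for i
  have 3: "runs w (addsym q K) (Suc (4 * K)) (int j, Q j) (int j, Q' 0)"
   by (rule runs_addsym[of "Q j" q w "int j" K, THEN back_subst[of "runs w _ _ _"]])
    (use z sym[OF n(1)] in \<open>auto simp: Q_def Q'_def word_tape_sym s_def fun_eq_iff\<close>)
  have 4: "runs w (WHILE (Suc (Suc q)) ?b) (Suc (j * Suc 3)) (int (j - 0), Q' 0) (int (j - j), Q' j)"
  proof (rule runs_WHILE[where p = "%i. int (j - i)"])
   fix i assume i: "i < j"
   have "runs w ?b (Suc (1 + 1)) (int (j - i), Q' i) (int (j - Suc i), Q' (Suc i))"
    by (rule runs_SEQ[OF runs_LEFT runs_DEC, THEN back_subst[of "runs w ?b _ _"]])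
     (use i in \<open>auto simp: Q'_def fun_eq_iff\<close>)
   thus "Q' i (Suc (Suc q)) ~= 0 & runs w ?b 3 (int (j - i), Q' i) (int (j - Suc i), Q' (Suc i))" using i by (simp add: Q'_def runs_mono)
  qed (simp add: Q'_def)
  have 4: "runs w (WHILE (Suc (Suc q)) ?b) (Suc (n ^ 1 * Suc 3)) (int j, Q' 0) (0, R(q := s))"
  proof -
   have "Q' j = R(q := s)" using z by (auto simp: Q'_def fun_eq_iff)
   thus ?thesis using runs_mono[OF 4, of "Suc (n ^ 1 * Suc 3)"] j by simp
  qed
  show "runs w ?C (Suc (n ^ c + Suc (Suc (n ^ 1 * Suc 5) + Suc (Suc (4 * K) + Suc (n ^ 1 * Suc 3))))) (0, R) (0, R(q := sym w (R (rho 0))))"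
   using runs_SEQ[OF 1 runs_SEQ[OF 2 runs_SEQ[OF 3 4]]] unfolding s_def j_def .
 qed
 thus "EX C. computes C rho q (%w e. sym w (e 0))" by blast
qed

lemma PT_sym: "PT F ==> PT (%w e. sym w (F w e))"
 using PT_let[of F "%w e x. sym w x"] PT_sym_var by simp

lemma PT_length: "PT (%w e. length w)"
proof (rule PTI[OF PB_length])
 fix rho :: "nat => nat" and q assume rho: "ALL v. rho v < q"
 let ?f = "SEQ RIGHT (SEQ (INC q) (INC (Suc (Suc q))))" and ?b = "SEQ LEFT (DEC (Suc (Suc q)))"
 let ?i = "IFSYM 0 (DEC (Suc q)) ?f"
 let ?C = "SEQ (INC (Suc q)) (SEQ (WHILE (Suc q) ?i) (WHILE (Suc (Suc q)) ?b))"
 have "computes ?C rho q (%w e. length w)"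
 proof (rule computesI)
  show "pbd (%n. Suc (1 + Suc (Suc (Suc (n ^ 1) * Suc 6) + Suc (n ^ 1 * Suc 3))))" by (intro pbd_intros)
  fix w n R assume n: "adm w n" "ALL v. R (rho v) <= n" and z: "\<forall>r\<ge>q. R r = (0::nat)"
  define L where "L = length w"
  have L: "L <= n" using n by (simp add: L_def adm_def)
  define Q where "Q i = R(Suc q := of_bool (i <= L), q := min i L, Suc (Suc q) := min i L)" for i
  have "runs w (INC (Suc q)) 1 (0, R) (0, R(Suc q := Suc (R (Suc q))))" by (rule runs_INC)
  moreover have "R(Suc q := Suc (R (Suc q))) = Q 0" using z by (auto simp: Q_def fun_eq_iff)
  ultimately have 1: "runs w (INC (Suc q)) 1 (0, R) (0, Q 0)" by simp
  have 2: "runs w (WHILE (Suc q) ?i) (Suc (Suc L * Suc 6)) (int (min 0 L), Q 0) (int (min (Suc L) L), Q (Suc L))"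
  proof (rule runs_WHILE[where p = "%i. int (min i L)"])
   fix i assume i: "i < Suc L"
   have "runs w (if word_tape w (int (min i L)) = 0 then DEC (Suc q) else ?f) (Suc (1 + Suc (1 + 1))) (int (min i L), Q i) (int (min (Suc i) L), Q (Suc i))"
   proof (cases "i = L")
    case True
    have "runs w (DEC (Suc q)) 1 (int L, Q L) (int L, Q (Suc L))"
     by (rule runs_DEC[of w "Suc q" _ "Q L", THEN back_subst[of "runs w _ _ _"]]) (auto simp: Q_def fun_eq_iff)
    moreover have "word_tape w (int L) = 0" by (simp add: word_tape_def L_def)
    ultimately show ?thesis using True by (simp add: runs_mono)
   next
    case False
    hence iL: "i < L" using i by simp
    hence "w ! i : set w" by (simp add: L_def)
    hence "w ! i ~= 0" using n(1) unfolding adm_def by force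
    hence "word_tape w (int i) ~= 0" using iL by (simp add: word_tape_def L_def)
    moreover have "runs w ?f (Suc (1 + Suc (1 + 1))) (int i, Q i) (int (Suc i), Q (Suc i))"
     by (rule runs_SEQ[OF runs_RIGHT runs_SEQ[OF runs_INC runs_INC], THEN back_subst[of "runs w ?f _ _"]])
      (use iL in \<open>auto simp: Q_def fun_eq_iff\<close>)
    ultimately show ?thesis using iL by simp
   qed
   hence "runs w ?i (Suc (Suc (1 + Suc (1 + 1)))) (int (min i L), Q i) (int (min (Suc i) L), Q (Suc i))" by (rule runs_IFSYM)
   thus "Q i (Suc q) ~= 0 & runs w ?i 6 (int (min i L), Q i) (int (min (Suc i) L), Q (Suc i))"
    using i by (simp add: Q_def runs_mono)
  qed (simp add: Q_def)
  have 2: "runs w (WHILE (Suc q) ?i) (Suc (Suc (n ^ 1) * Suc 6)) (0, Q 0) (int L, Q (Suc L))"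
   using runs_mono[OF 2, of "Suc (Suc (n ^ 1) * Suc 6)"] L by simp
  define Q' where "Q' i = R(q := L, Suc (Suc q) := L - i)" for i
  have Q': "Q (Suc L) = Q' 0" using z by (auto simp: Q'_def Q_def fun_eq_iff)
  have 4: "runs w (WHILE (Suc (Suc q)) ?b) (Suc (L * Suc 3)) (int (L - 0), Q' 0) (int (L - L), Q' L)"
  proof (rule runs_WHILE[where p = "%i. int (L - i)"])
   fix i assume i: "i < L"
   have "runs w ?b (Suc (1 + 1)) (int (L - i), Q' i) (int (L - Suc i), Q' (Suc i))"
    by (rule runs_SEQ[OF runs_LEFT runs_DEC, THEN back_subst[of "runs w ?b _ _"]])
     (use i in \<open>auto simp: Q'_def fun_eq_iff\<close>)
   thus "Q' i (Suc (Suc q)) ~= 0 & runs w ?b 3 (int (L - i), Q' i) (int (L - Suc i), Q' (Suc i))" using i by (simp add: Q'_def runs_mono)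
  qed (simp add: Q'_def)
  have 4: "runs w (WHILE (Suc (Suc q)) ?b) (Suc (n ^ 1 * Suc 3)) (int L, Q (Suc L)) (0, R(q := L))"
  proof -
   have "Q' L = R(q := L)" using z by (auto simp: Q'_def fun_eq_iff)
   thus ?thesis unfolding Q' using runs_mono[OF 4, of "Suc (n ^ 1 * Suc 3)"] L by simp
  qed
  show "runs w ?C (Suc (1 + Suc (Suc (Suc (n ^ 1) * Suc 6) + Suc (n ^ 1 * Suc 3)))) (0, R) (0, R(q := length w))"
   using runs_SEQ[OF 1 runs_SEQ[OF 2 4]] unfolding L_def .
 qed
 thus "EX C. computes C rho q (%w e. length w)" by blast
qed

end

context alphabet
begin

section \<open>Arithmetic, sums and bounded quantifiers\<close>

lemma PT_cong: "PT F ==> (!!w e. H w e = F w e) ==> PT H"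
proof -
 assume "PT F" "!!w e. H w e = F w e"
 moreover from this(2) have "H = F" by (intro ext)
 ultimately show ?thesis by simp
qed

lemma PT_add: assumes "PT A" "PT N" shows "PT (%w e. A w e + N w e)"
proof -
 have r: "rec_nat a (%i x. Suc x) n = a + n" for a n by (induction n) auto
 show ?thesis
  by (rule PT_cong[OF PT_rec[of N A "%w e i x. Suc x" "%w e. A w e + N w e"]])
   (auto simp: r assms intro!: PT_Suc PT_var PB_add[OF PT_PB[OF assms(1)] PT_PB[OF assms(2)]])
qed

lemma PT_pred: assumes "PT N" shows "PT (%w e. N w e - 1)"
proof -
 have r: "rec_nat 0 (%i x. i) n = n - 1" for n by (induction n) auto
 show ?thesis
  by (rule PT_cong[OF PT_rec[of N "%w e. 0" "%w e i x. i" N]])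
   (auto simp: r assms intro!: PT_0 PT_var PT_PB[OF assms])
qed

lemma PT_diff: assumes "PT A" "PT N" shows "PT (%w e. A w e - N w e)"
proof -
 have r: "rec_nat a (%i x. x - Suc 0) n = a - n" for a n by (induction n) auto
 show ?thesis
  by (rule PT_cong[OF PT_rec[of N A "%w e i x. x - Suc 0" A]])
   (use PT_pred[OF PT_var[of 0]] in \<open>auto simp: r assms intro!: PT_PB[OF assms(1)]\<close>)
qed

lemma PB_sum:
 assumes "PB N" "PB (%w e. H w (%k. e (Suc k)) (e 0))"
 shows "PB (%w e. \<Sum>i<N w e. H w e i)"
proof -
 obtain a where a: "bounded_by N (Suc a)" using PBE[OF assms(1)] by blast
 obtain b where b: "bounded_by (%w e. H w (%k. e (Suc k)) (e 0)) (Suc b)"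
  using PBE[OF assms(2)] by blast
 show ?thesis
 proof (rule PBI)
  show "pbd (%n. n ^ Suc a * (n ^ Suc a) ^ Suc b)" by (intro pbd_intros)
  fix w n and e :: "nat => nat" assume n: "adm w n" and e: "ALL v. e v <= n"
  have na: "n <= n ^ Suc a" using n by (intro le_power_Suc) (simp add: adm_def)
  have N: "N w e <= n ^ Suc a" using a n e by blast
  have "H w e i <= (n ^ Suc a) ^ Suc b" if "i < N w e" for i
  proof -
   have "ALL v. case_nat i e v <= n ^ Suc a"
   proof
    fix v show "case_nat i e v <= n ^ Suc a" using that N e na by (cases v) (auto intro: le_trans simp del: power_Suc)
   qed
   thus ?thesis using b[rule_format, OF adm_power[OF n], of "case_nat i e"] by simp
  qed
  hence "(\<Sum>i<N w e. H w e i) <= N w e * (n ^ Suc a) ^ Suc b" using sum_bounded_above[of "{..<N w e}" "H w e" "(n ^ Suc a) ^ Suc b"] by (simp del: power_Suc)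
  also have "... <= n ^ Suc a * (n ^ Suc a) ^ Suc b" using N by (rule mult_le_mono1)
  finally show "(\<Sum>i<N w e. H w e i) <= n ^ Suc a * (n ^ Suc a) ^ Suc b" .
 qed
qed

lemma PT_sum:
 assumes N: "PT N" and H: "PT (%w e. H w (%k. e (Suc k)) (e 0))"
 shows "PT (%w e. \<Sum>i<N w e. H w e i)"
proof -
 have r: "rec_nat 0 (%i x. x + f i) n = (\<Sum>i<n. f i)" for f :: "nat => nat" and n by (induction n) auto
 show ?thesis
 proof (rule PT_cong)
  show "PT (%w e. rec_nat 0 (%i x. x + H w e i) (N w e))"
  proof (rule PT_rec[OF N PT_0])
   have "PT (%w e. H w (%k. e (Suc (Suc k))) (e (Suc 0)))" using PT_rename[OF H, of Suc] .
   thus "PT (%w e. e 0 + H w (%k. e (Suc (Suc k))) (e (Suc 0)))" by (rule PT_add[OF PT_var])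
   show "PB (%w e. \<Sum>i<N w e. H w e i)" by (rule PB_sum[OF PT_PB[OF N] PT_PB[OF H]])
   show "rec_nat 0 (%i x. x + H w e i) i <= (\<Sum>i<N w e. H w e i)" if "i <= N w e" for w e i
    unfolding r using that by (intro sum_mono2) auto
  qed
 qed (simp add: r)
qed

lemma PT_mult: assumes "PT A" "PT N" shows "PT (%w e. A w e * N w e)"
 using PT_sum[OF assms(1), of "%w e i. N w e"] PT_rename[OF assms(2), of Suc] by simp

lemma PT_power: "PT A ==> PT (%w e. A w e ^ k)"
 by (induction k) (auto intro: PT_const PT_mult simp: PT_const)

lemma PTb_le: "PT A ==> PT B ==> PTb (%w e. A w e <= B w e)"
 by (rule PT_cong[OF PT_diff[OF PT_const[of 1] PT_diff[of A B]]]) auto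

lemma PTb_not: "PTb P ==> PTb (%w e. ~ P w e)"
 by (rule PT_cong[OF PT_diff[OF PT_const[of 1]]]) auto

lemma PTb_conj: "PTb P ==> PTb Q ==> PTb (%w e. P w e & Q w e)"
 by (rule PT_cong[OF PT_mult[of "%w e. of_bool (P w e)" "%w e. of_bool (Q w e)"]]) auto

lemma PTb_cong: "PTb P ==> (!!w e. Q w e \<longleftrightarrow> P w e) ==> PTb Q"
 by (rule PT_cong) simp_all

lemma PTb_disj: "PTb P ==> PTb Q ==> PTb (%w e. P w e \<or> Q w e)"
 by (rule PTb_cong[OF PTb_not[OF PTb_conj[OF PTb_not PTb_not]]]) auto

lemma PTb_imp: "PTb P ==> PTb Q ==> PTb (%w e. P w e --> Q w e)"
 by (rule PTb_cong[OF PTb_disj[OF PTb_not]]) auto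

lemma PTb_const: "PTb (%w e. b)" by (rule PT_const)

lemma PTb_less: "PT A ==> PT B ==> PTb (%w e. A w e < B w e)"
 by (rule PTb_cong[OF PTb_not[OF PTb_le[of B A]]]) auto

lemma PTb_eq: "PT A ==> PT B ==> PTb (%w e. A w e = B w e)"
 by (rule PTb_cong[OF PTb_conj[OF PTb_le[of A B] PTb_le[of B A]]]) auto

lemma PT_if: assumes "PTb P" "PT A" "PT B" shows "PT (%w e. if P w e then A w e else B w e)"
 by (rule PT_cong[OF PT_add[OF PT_mult[OF assms(1,2)] PT_mult[OF PTb_not[OF assms(1)] assms(3)]]]) auto

lemma PTb_if: assumes "PTb P" "PTb A" "PTb B" shows "PTb (%w e. if P w e then A w e else B w e)"
 by (rule PT_cong[OF PT_if[OF assms]]) auto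

lemma PTb_all:
 assumes "PT N" "PTb (%w e. P w (%k. e (Suc k)) (e 0))"
 shows "PTb (%w e. \<forall>i<N w e. P w e i)"
 by (rule PTb_cong[OF PTb_eq[OF PT_sum[of N "%w e i. of_bool (~ P w e i)"] PT_0]])
  (use assms PTb_not[OF assms(2)] in auto)

lemma PTb_ex:
 assumes "PT N" "PTb (%w e. P w (%k. e (Suc k)) (e 0))"
 shows "PTb (%w e. \<exists>i<N w e. P w e i)"
 by (rule PTb_cong[OF PTb_not[OF PTb_all[OF assms(1) PTb_not[OF assms(2)]]]]) auto

lemma PTb_all_bool: "PTb (%w e. P w e False) ==> PTb (%w e. P w e True) ==> PTb (%w e. ALL b. P w e b)"
 by (rule PTb_cong[OF PTb_conj[of "%w e. P w e False" "%w e. P w e True"]]) (simp_all add: all_bool_eq conj_commute)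

text \<open>The quotient counts the positive multiples of the divisor up to the dividend, so that bounded sums suffice.\<close>

lemma PT_div: assumes "PT A" "PT B" shows "PT (%w e. A w e div B w e)"
proof -
 have *: "x div y = (if y = 0 then 0 else \<Sum>i<x. of_bool (Suc i * y <= x))" for x y :: nat
 proof (cases "y = 0")
  case False
  have *: "Suc i * y <= x \<longleftrightarrow> i < x div y" for i
   using False less_eq_div_iff_mult_less_eq[of y "Suc i" x] by (simp only: Suc_le_eq)
  have "(\<Sum>i<x. of_bool (Suc i * y <= x)) = card {i : {..<x}. i < x div y}"
   unfolding * by (simp add: sum_of_bool_eq Int_def)
  also have "{i : {..<x}. i < x div y} = {..<x div y}"
  proof (rule equalityI; rule subsetI)
   fix i assume "i : {..<x div y}"
   thus "i : {i : {..<x}. i < x div y}" using less_le_trans[OF _ div_le_dividend[of x y], of i] by simp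
  qed simp
  finally show ?thesis using False by (simp del: mult_Suc)
 qed simp
 show ?thesis
 proof (rule PT_cong)
  have "PTb (%w e. Suc (e 0) * B w (%k. e (Suc k)) <= A w (%k. e (Suc k)))"
   by (intro PTb_le PT_mult PT_Suc PT_var PT_rename[OF assms(1)] PT_rename[OF assms(2)])
  from PT_sum[OF assms(1), of "%w e i. of_bool (Suc i * B w e <= A w e)", OF this]
  show "PT (%w e. if B w e = 0 then 0 else \<Sum>i<A w e. of_bool (Suc i * B w e <= A w e))"
   by (intro PT_if PTb_eq assms PT_0)
 qed (rule *)
qed

lemma PT_mod: "PT A ==> PT B ==> PT (%w e. A w e mod B w e)"
 by (rule PT_cong[OF PT_diff[OF _ PT_mult[OF PT_div[of A B]]]]) (auto simp: modulo_nat_def)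

lemma PTb_dvd: "PT A ==> PT B ==> PTb (%w e. A w e dvd B w e)"
 by (rule PTb_cong[OF PTb_eq[OF PT_mod[of B A] PT_0]]) (auto simp: dvd_eq_mod_eq_0)

lemma PT_min: "PT A ==> PT B ==> PT (%w e. min (A w e) (B w e))"
 unfolding min_def by (intro PT_if PTb_le)

lemmas PT_intros = PT_0 PT_Suc PT_const PT_var PT_add PT_pred PT_diff PT_mult PT_power PT_sum PT_div PT_mod PT_min PT_if
 PTb_le PTb_less PTb_eq PTb_not PTb_conj PTb_disj PTb_imp PTb_const PTb_if PTb_all PTb_ex PTb_dvd PT_length PT_sym

subsection \<open>Integers\<close>

text \<open>Integers are differences of two unary numbers.\<close>

definition PTi :: "(nat list => (nat => nat) => int) => bool" where
 "PTi F \<longleftrightarrow> (EX A B. PT A & PT B & F = (%w e. int (A w e) - int (B w e)))"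

lemma PTiI: "PT A ==> PT B ==> (!!w e. F w e = int (A w e) - int (B w e)) ==> PTi F"
 unfolding PTi_def by (intro exI[of _ A] exI[of _ B]) auto

lemma PTi_rename: "PTi F ==> PTi (%w e. F w (%v. e (g v)))"
 unfolding PTi_def using PT_rename by blast

lemma PTi_cong: "PTi F ==> (!!w e. H w e = F w e) ==> PTi H"
 unfolding PTi_def by presburger

lemma PTi_int: "PT A ==> PTi (%w e. int (A w e))"
 by (rule PTiI[of A "%w e. 0"]) (auto intro: PT_0)

lemma PTi_minus: "PTi F ==> PTi (%w e. - F w e)"
 unfolding PTi_def by (elim exE conjE, intro exI conjI, assumption, assumption) auto

lemma PTi_add: "PTi F ==> PTi H ==> PTi (%w e. F w e + H w e)"
 unfolding PTi_def[of F] PTi_def[of H]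
proof (elim exE conjE)
 fix A B A' B' assume *: "PT A" "PT B" "PT A'" "PT B'" "F = (%w e. int (A w e) - int (B w e))" "H = (%w e. int (A' w e) - int (B' w e))"
 show ?thesis by (rule PTiI[OF PT_add[OF *(1,3)] PT_add[OF *(2,4)]]) (simp add: *)
qed

lemma PTi_diff: "PTi F ==> PTi H ==> PTi (%w e. F w e - H w e)"
 by (rule PTi_cong[OF PTi_add[OF _ PTi_minus]]) auto

lemma PTi_mult: "PTi F ==> PTi H ==> PTi (%w e. F w e * H w e)"
 unfolding PTi_def[of F] PTi_def[of H]
proof (elim exE conjE)
 fix A B A' B' assume *: "PT A" "PT B" "PT A'" "PT B'" "F = (%w e. int (A w e) - int (B w e))" "H = (%w e. int (A' w e) - int (B' w e))"
 show ?thesis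
  by (rule PTiI[OF PT_add[OF PT_mult[OF *(1,3)] PT_mult[OF *(2,4)]] PT_add[OF PT_mult[OF *(1,4)] PT_mult[OF *(2,3)]]])
   (simp add: * algebra_simps)
qed

lemma PTi_const: "PTi (%w e. k)"
 by (rule PTiI[of "%w e. nat k" "%w e. nat (- k)"]) (auto intro: PT_const)

lemma PTi_if: "PTb P ==> PTi F ==> PTi H ==> PTi (%w e. if P w e then F w e else H w e)"
 unfolding PTi_def[of F] PTi_def[of H]
proof (elim exE conjE)
 fix A B A' B' assume P: "PTb P"
  and *: "PT A" "PT B" "PT A'" "PT B'" "F = (%w e. int (A w e) - int (B w e))" "H = (%w e. int (A' w e) - int (B' w e))"
 show ?thesis by (rule PTiI[OF PT_if[OF P *(1,3)] PT_if[OF P *(2,4)]]) (simp add: *)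
qed

lemma PTi_of_bool: "PTb P ==> PTi (%w e. of_bool (P w e))"
 by (rule PTi_cong[OF PTi_int[of "%w e. of_bool (P w e)"]]) auto

lemma PTi_sum:
 assumes "PT N" "PTi (%w e. H w (%k. e (Suc k)) (e 0))"
 shows "PTi (%w e. \<Sum>i<N w e. H w e i)"
proof -
 obtain A B where *: "PT A" "PT B" "(%w e. H w (%k. e (Suc k)) (e 0)) = (%w e. int (A w e) - int (B w e))"
  using assms(2) unfolding PTi_def by blast
 have H: "H w e i = int (A w (case_nat i e)) - int (B w (case_nat i e))" for w e i
  using fun_cong[OF fun_cong[OF *(3)], of w "case_nat i e"] by simp
 have s: "case_nat (e 0) (%k. e (Suc k)) = e" for e :: "nat => nat" by (rule ext) (simp split: nat.split)
 show ?thesis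
  by (rule PTiI[OF PT_sum[OF assms(1), of "%w e i. A w (case_nat i e)"] PT_sum[OF assms(1), of "%w e i. B w (case_nat i e)"]])
   (simp_all add: s * H sum_subtractf)
qed

text \<open>Sums over the symmetric windows in which the coordinates of words live.\<close>

lemma PTi_sum_window:
 assumes N: "PT N" and H: "PTi (%w e. H w (%k. e (Suc k)) (int (e 0) - int (N w (%k. e (Suc k)))))"
 shows "PTi (%w e. SUM i:{- int (N w e)..int (N w e)}. H w e i)"
proof (rule PTi_cong[OF PTi_sum[of "%w e. Suc (2 * N w e)" "%w e i. H w e (int i - int (N w e))"]])
 show "(SUM i:{- int (N w e)..int (N w e)}. H w e i) = (\<Sum>i<Suc (2 * N w e). H w e (int i - int (N w e)))" for w e
  by (rule sum.reindex_bij_witness[of _ "%i. int i - int (N w e)" "%i. nat (i + int (N w e))"]) auto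
qed (use H in \<open>auto intro!: PT_Suc PT_mult PT_const N\<close>)

lemma PTb_eq_int: "PTi F ==> PTi H ==> PTb (%w e. F w e = H w e)"
 unfolding PTi_def
proof (elim exE conjE)
 fix A B A' B' assume *: "PT A" "PT B" "PT A'" "PT B'" "F = (%w e. int (A w e) - int (B w e))" "H = (%w e. int (A' w e) - int (B' w e))"
 show ?thesis
  by (rule PTb_cong[OF PTb_eq[OF PT_add[OF *(1,4)] PT_add[OF *(3,2)]]]) (auto simp: *(5,6))
qed

lemma PTb_le_int: "PTi F ==> PTi H ==> PTb (%w e. F w e <= H w e)"
 unfolding PTi_def
proof (elim exE conjE)
 fix A B A' B' assume *: "PT A" "PT B" "PT A'" "PT B'" "F = (%w e. int (A w e) - int (B w e))" "H = (%w e. int (A' w e) - int (B' w e))"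
 show ?thesis
  by (rule PTb_cong[OF PTb_le[OF PT_add[OF *(1,4)] PT_add[OF *(3,2)]]]) (auto simp: *(5,6))
qed

lemma PTb_less_int: "PTi F ==> PTi H ==> PTb (%w e. F w e < H w e)"
 by (rule PTb_cong[OF PTb_not[OF PTb_le_int[of H F]]]) auto

lemma PT_nat_abs: "PTi F ==> PT (%w e. nat \<bar>F w e\<bar>)"
 unfolding PTi_def
proof (elim exE conjE)
 fix A B assume *: "PT A" "PT B" "F = (%w e. int (A w e) - int (B w e))"
 show ?thesis
  by (rule PT_cong[OF PT_add[OF PT_diff[OF *(1,2)] PT_diff[OF *(2,1)]]]) (auto simp: *(3))
qed

lemma PTi_abs: "PTi F ==> PTi (%w e. \<bar>F w e\<bar>)"
 by (rule PTi_cong[OF PTi_int[OF PT_nat_abs]]) auto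

lemma PTb_dvd_int: "PTi F ==> PTi H ==> PTb (%w e. F w e dvd H w e)"
 by (rule PTb_cong[OF PTb_dvd[OF PT_nat_abs[of F] PT_nat_abs[of H]]]) (auto simp: nat_abs_dvd_iff dvd_nat_abs_iff)

lemma int_window: "(ALL i. \<bar>i\<bar> <= int N --> P i) \<longleftrightarrow> (\<forall>x<Suc (2 * N). P (int x - int N))"
proof (intro iffI allI impI)
 fix i assume *: "\<forall>x<Suc (2 * N). P (int x - int N)" "\<bar>i\<bar> <= int N"
 hence "nat (i + int N) < Suc (2 * N)" "int (nat (i + int N)) - int N = i" by linarith+
 thus "P i" using *(1) by metis
qed auto

lemma PTb_all_int:
 assumes N: "PT N" and P: "PTb (%w e. P w (%k. e (Suc k)) (int (e 0) - int (N w (%k. e (Suc k)))))"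
 shows "PTb (%w e. ALL i. \<bar>i\<bar> <= int (N w e) --> P w e i)"
 unfolding int_window
 by (rule PTb_all[of "%w e. Suc (2 * N w e)" "%w e i. P w e (int i - int (N w e))"]) (auto intro!: PT_Suc PT_mult PT_const N P)

lemma PTb_ex_int:
 assumes N: "PT N" and P: "PTb (%w e. P w (%k. e (Suc k)) (int (e 0) - int (N w (%k. e (Suc k)))))"
 shows "PTb (%w e. EX i. \<bar>i\<bar> <= int (N w e) & P w e i)"
 by (rule PTb_cong[OF PTb_not[OF PTb_all_int[OF N PTb_not[OF P]]]]) auto

lemma all_bool_fun: "(\<forall>p :: bool => int. Q p) \<longleftrightarrow> (ALL x y. Q (%c. if c then y else x))"
proof (intro iffI allI)
 fix p :: "bool => int" assume "ALL x y. Q (%c. if c then y else x)"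
 hence "Q (%c. if c then p True else p False)" by blast
 moreover have "(%c. if c then p True else p False) = p" by auto
 ultimately show "Q p" by simp
qed auto

lemma PTb_ex_int_pair:
 assumes N: "PT N" and P: "PTb (%w e. P w (%k. e (Suc (Suc k)))
  (%c. if c then int (e 0) - int (N w (%k. e (Suc (Suc k)))) else int (e (Suc 0)) - int (N w (%k. e (Suc (Suc k))))))"
 shows "PTb (%w e. \<exists>p :: bool => int. (ALL c. \<bar>p c\<bar> <= int (N w e)) & P w e p)"
proof (rule PTb_cong)
 show "PTb (%w e. EX x. \<bar>x\<bar> <= int (N w e) & (EX y. \<bar>y\<bar> <= int (N w e) & P w e (%c. if c then y else x)))"
  by (intro PTb_ex_int PT_rename[OF N] N P)
 show "(EX p. (ALL c. \<bar>p c\<bar> <= int (N w e)) & P w e p) \<longleftrightarrow>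
  (EX x. \<bar>x\<bar> <= int (N w e) & (EX y. \<bar>y\<bar> <= int (N w e) & P w e (%c. if c then y else x)))" for w e
  using all_bool_fun[of "%p. ~ ((ALL c. \<bar>p c\<bar> <= int (N w e)) & P w e p)"] by (auto split: if_splits)
qed

end

context alphabet
begin

section \<open>Simulating a machine by arithmetic\<close>

text \<open>Unary numbers cannot hold powers, but powers cut off at a small bound can be computed by a bounded recursion.\<close>

lemma PT_min_power:
 assumes "PT B" "PT N" "PT Y"
 shows "PT (%w e. min (B w e ^ N w e) (Y w e))"
proof (rule PT_cong)
 have r: "rec_nat (min 1 y) (%i x. min (b * x) y) n = min (b ^ n) y" for b y n :: nat
 proof (induction n)
  case (Suc n)
  have "min (b * min (b ^ n) y) y = min (b * b ^ n) y"
  proof (cases "b = 0 \<or> b ^ n <= y")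
   case False
   hence "b ^ n <= b * b ^ n" "y <= b * y" by simp_all
   hence "min (b * y) y = y" "min (b ^ n) y = y" "min (b * b ^ n) y = y" using False by linarith+
   thus ?thesis by (simp only:)
  qed auto
  thus ?case using Suc by simp
 qed simp
 show "PT (%w e. rec_nat (min 1 (Y w e)) (%i x. min (B w e * x) (Y w e)) (N w e))"
 proof (rule PT_rec[OF assms(2)])
  show "PT (%w e. min (B w (%k. e (Suc (Suc k))) * e 0) (Y w (%k. e (Suc (Suc k)))))"
   by (intro PT_min PT_mult PT_var PT_rename[OF assms(1)] PT_rename[OF assms(3)])
  show "rec_nat (min 1 (Y w e)) (%i x. min (B w e * x) (Y w e)) i <= Y w e" for w e i unfolding r by simp
 qed (intro PT_min PT_const assms PT_PB)+
 show "min (B w e ^ N w e) (Y w e) = rec_nat (min 1 (Y w e)) (%i x. min (B w e * x) (Y w e)) (N w e)" for w e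
  unfolding r ..
qed

lemma PT_min_fact:
 assumes "PT N" "PT Y"
 shows "PT (%w e. min (fact (N w e)) (Y w e))"
proof (rule PT_cong)
 have r: "rec_nat (min 1 y) (%i x. min (Suc i * x) y) n = min (fact n) y" for y n :: nat
 proof (induction n)
  case (Suc n)
  have "y <= Suc n * y" by simp
  thus ?case using Suc by (auto simp: min_def simp del: mult_Suc) (auto intro: le_trans)
 qed simp
 show "PT (%w e. rec_nat (min 1 (Y w e)) (%i x. min (Suc i * x) (Y w e)) (N w e))"
 proof (rule PT_rec[OF assms(1)])
  show "PT (%w e. min (Suc (e (Suc 0)) * e 0) (Y w (%k. e (Suc (Suc k)))))"
   by (intro PT_min PT_mult PT_Suc PT_var PT_rename[OF assms(2)])
  show "rec_nat (min 1 (Y w e)) (%i x. min (Suc i * x) (Y w e)) i <= Y w e" for w e i unfolding r by simp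
 qed (intro PT_min PT_const assms PT_PB)+
 show "min (fact (N w e)) (Y w e) = rec_nat (min 1 (Y w e)) (%i x. min (Suc i * x) (Y w e)) (N w e)" for w e
  unfolding r ..
qed

lemma PTb_power_le: "PT B ==> PT N ==> PT Y ==> PTb (%w e. B w e ^ N w e <= Y w e)"
 by (rule PTb_cong[OF PTb_le[OF PT_min_power[of B N "%w e. Suc (Y w e)"], of Y]]) (auto intro: PT_Suc)

lemma PT_triangle: "PT A ==> PT (%w e. triangle (A w e))"
 unfolding triangle_def by (intro PT_div PT_mult PT_Suc PT_const)

lemma PT_prod_encode: "PT A ==> PT B ==> PT (%w e. prod_encode (A w e, B w e))"
 unfolding prod_encode_def prod.case by (intro PT_add PT_triangle)

text \<open>The pairing function is inverted by a search, written as a double sum.\<close>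

lemma PT_prod_decode:
 assumes "PT Z"
 shows "PT (%w e. fst (prod_decode (Z w e)))" "PT (%w e. snd (prod_decode (Z w e)))"
proof -
 have "(\<Sum>a<Suc z. \<Sum>b<Suc z. of_bool (prod_encode (a, b) = z) * f a b) = case_prod f (prod_decode z)" for f :: "nat => nat => nat" and z
 proof -
  obtain x y where xy: "prod_decode z = (x, y)" by (cases "prod_decode z")
  hence z: "prod_encode (x, y) = z" by (metis prod_decode_inverse)
  have "prod_encode (a, b) = z \<longleftrightarrow> b = y & a = x" for a b unfolding z[symmetric] by auto
  hence "of_bool (prod_encode (a, b) = z) * f a b = (if b = y then of_bool (a = x) * f x y else 0)" for a b by auto
  hence "(\<Sum>b<Suc z. of_bool (prod_encode (a, b) = z) * f a b) = of_bool (a = x) * f x y" for a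
   using le_prod_encode_2[of y x] unfolding z by (simp add: sum.delta del: sum.lessThan_Suc)
  hence "(\<Sum>a<Suc z. \<Sum>b<Suc z. of_bool (prod_encode (a, b) = z) * f a b) = (\<Sum>a<Suc z. of_bool (a = x) * f x y)" by simp
  also have "... = (\<Sum>a<Suc z. if a = x then f x y else 0)" by (intro sum.cong) auto
  also have "... = f x y" using le_prod_encode_1[of x y] unfolding z by (simp add: sum.delta del: sum.lessThan_Suc)
  finally show ?thesis by (simp add: xy)
 qed
 note * = this
 have "PT (%w e. \<Sum>a<Suc (Z w e). \<Sum>b<Suc (Z w e). of_bool (prod_encode (a, b) = Z w e) * a)"
   "PT (%w e. \<Sum>a<Suc (Z w e). \<Sum>b<Suc (Z w e). of_bool (prod_encode (a, b) = Z w e) * b)"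
  by (intro PT_sum PT_Suc PT_mult PTb_eq PT_prod_encode PT_var PT_rename[OF assms] assms)+
 thus "PT (%w e. fst (prod_decode (Z w e)))" "PT (%w e. snd (prod_decode (Z w e)))"
  using *[of _ "%a b. a"] *[of _ "%a b. b"] by (simp_all add: fst_def snd_def del: sum.lessThan_Suc)
qed

text \<open>The components of a list code. The number \<open>j\<close> is fixed, so this is an iterated pairing function.\<close>

primrec comp :: "nat => nat => nat" where
 "comp 0 z = fst (prod_decode (z - 1))" | "comp (Suc j) z = comp j (snd (prod_decode (z - 1)))"

lemma comp_list_encode: "j < length xs ==> comp j (list_encode xs) = xs ! j"
proof (induction xs arbitrary: j)
 case (Cons x xs) thus ?case by (cases j) auto
qed simp

lemma PT_comp: "PT Z ==> PT (%w e. comp j (Z w e))"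
 by (induction j arbitrary: Z) (auto intro!: PT_prod_decode PT_pred[unfolded One_nat_def])

lemma PT_list_encode: "(!!j. j : set js ==> PT (%w e. f j w e)) ==> PT (%w e. list_encode (map (%j. f j w e) js))"
 by (induction js) (auto intro!: PT_0 PT_Suc PT_prod_encode)

lemma prod_encode_le: "prod_encode (a, b) <= (a + b + 1) * (a + b + 1)"
proof -
 have "triangle n <= n * Suc n" for n unfolding triangle_def by (rule div_le_dividend)
 from this[of "a + b"] show ?thesis by (simp add: prod_encode_def algebra_simps)
qed

primrec list_bound :: "nat => nat => nat" where
 "list_bound 0 v = 0"
| "list_bound (Suc m) v = Suc ((v + list_bound m v + 1) * (v + list_bound m v + 1))"

lemma list_encode_le: "(!!x. x : set xs ==> x <= v) ==> list_encode xs <= list_bound (length xs) v"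
proof (induction xs)
 case (Cons x xs)
 hence h: "x + list_encode xs + 1 <= v + list_bound (length xs) v + 1" by (intro add_mono) auto
 show ?case using le_trans[OF prod_encode_le[of x "list_encode xs"] mult_le_mono[OF h h]] by (simp del: mult_Suc mult_Suc_right)
qed simp

lemma PB_list_bound: "PB V ==> PB (%w e. list_bound m (V w e))"
proof (induction m)
 case (Suc m)
 have "PB (%w e. 1 + (V w e + list_bound m (V w e) + 1) * (V w e + list_bound m (V w e) + 1))"
  by (intro PB_add PB_mult PB_const Suc)
 thus ?case by simp
qed (simp add: PB_const)

end

subsection \<open>Simulation of a machine by arithmetic\<close>

text \<open>The two halves of a tape are written as numbers in base \<open>b\<close>. The state of a machine with \<open>k\<close> work
 tapes becomes a vector \<open>v\<close>: the control state is \<open>v 0\<close>, and \<open>v (2 * i + 1)\<close> and \<open>v (2 * i + 2)\<close>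
 are the left half of tape \<open>i\<close> and the right half, whose last digit is the scanned symbol.\<close>

locale machine_digits =
 fixes M :: tm and b :: nat
 assumes b: "b >= 2" and sym_less: "!!r x. r : set (rules M) ==> x : set (fst (snd r)) ==> fst (snd x) < b"
begin

definition k where "k = Suc (work_tapes M)"

definition app :: "rule => (nat => nat) => bool" where
 "app r v \<longleftrightarrow> fst r = v 0 & length (fst (snd r)) = k & (\<forall>i<k. fst (fst (snd r) ! i) = v (2 * i + 2) mod b)"

definition upd_left :: "nat => move => nat => nat" where
 "upd_left c m l = (case m of Move_Left => l div b | Stay => l | Move_Right => l * b + c)"

definition upd_right :: "nat => move => nat => nat => nat" where
 "upd_right c m l r = (case m of Move_Left => (r div b * b + c) * b + l mod b | Stay => r div b * b + c | Move_Right => r div b)"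

definition upd :: "rule => (nat => nat) => nat => nat" where
 "upd r v j = (if j = 0 then snd (snd r) else let i = (j - 1) div 2; x = fst (snd r) ! i in
  if odd j then upd_left (fst (snd x)) (snd (snd x)) (v (2 * i + 1))
  else upd_right (fst (snd x)) (snd (snd x)) (v (2 * i + 1)) (v (2 * i + 2)))"

definition nx :: "(nat => nat) => nat => nat" where
 "nx v = (case find (%r. app r v) (rules M) of None => v | Some r => upd r v)"

definition tape_digits :: "tape => nat => nat => bool" where
 "tape_digits t l r \<longleftrightarrow> (ALL x. t (int x) = r div b ^ x mod b & t (- int x - 1) = l div b ^ x mod b)"

definition rep :: "config => (nat => nat) => bool" where
 "rep c v \<longleftrightarrow> fst c = v 0 & length (snd c) = k & (\<forall>i<k. tape_digits (snd c ! i) (v (2 * i + 1)) (v (2 * i + 2)))"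

lemma digit_Suc: "c < b ==> (x * b + c) div b ^ Suc y mod b = x div b ^ y mod b"
 using b by (simp add: div_mult2_eq)

text \<open>Writing and moving act on the two numbers by division with remainder by \<open>b\<close>.\<close>

lemma tape_digits_upd:
 assumes t: "tape_digits t l r" and c: "c < b"
 shows "tape_digits (shift_tape m (t(0 := c))) (upd_left c m l) (upd_right c m l r)"
proof -
 have p: "t (int x) = r div b ^ x mod b" and n: "t (- int x - 1) = l div b ^ x mod b" for x using t by (auto simp: tape_digits_def)
 have d: "z div b ^ Suc x = z div b div b ^ x" for x z by (simp add: div_mult2_eq)
 have w: "(t(0 := c)) (int x) = (r div b * b + c) div b ^ x mod b" for x
 proof (cases x)
  case (Suc y)
  have "(t(0 := c)) (int x) = t (int (Suc y))" by (simp add: Suc)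
  also have "... = r div b div b ^ y mod b" by (simp only: p d)
  finally show ?thesis unfolding Suc digit_Suc[OF c] .
 qed (use c in simp)
 have w': "(t(0 := c)) (- int x - 1) = l div b ^ x mod b" for x using n by simp
 show ?thesis
 proof (cases m)
  case Stay thus ?thesis using w w' by (simp add: tape_digits_def upd_left_def upd_right_def)
 next
  case Move_Right
  have 1: "(t(0 := c)) (int x + 1) = r div b div b ^ x mod b" for x
   using w[of "Suc x"] digit_Suc[OF c, of "r div b" x] by (simp add: add.commute)
  have 2: "(t(0 := c)) (- int x - 1 + 1) = (l * b + c) div b ^ x mod b" for x
  proof (cases x)
   case (Suc y)
   have "- int x - 1 + 1 = - int y - 1" by (simp add: Suc)
   thus ?thesis unfolding Suc digit_Suc[OF c] using w'[of y] by (simp only:)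
  qed (use c in simp)
  show ?thesis unfolding Move_Right tape_digits_def upd_left_def upd_right_def move.case shift_tape.simps using 1 2 by blast
 next
  case Move_Left
  have 1: "(t(0 := c)) (int x - 1) = ((r div b * b + c) * b + l mod b) div b ^ x mod b" for x
  proof (cases x)
   case 0 thus ?thesis using w'[of 0] b by simp
  next
   case (Suc y)
   have "int x - 1 = int y" by (simp add: Suc)
   moreover have "l mod b < b" using b by simp
   ultimately show ?thesis unfolding Suc using w[of y] digit_Suc[of "l mod b" "r div b * b + c" y] by (simp only:)
  qed
  have 2: "(t(0 := c)) (- int x - 1 - 1) = l div b div b ^ x mod b" for x
   using w'[of "Suc x"] unfolding d by (simp add: algebra_simps)
  show ?thesis unfolding Move_Left tape_digits_def upd_left_def upd_right_def move.case shift_tape.simps using 1 2 by blast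
 qed
qed

lemma app_iff: "rep c v ==> applicable c r \<longleftrightarrow> app r v"
proof -
 assume r: "rep c v"
 have "(snd c ! i) 0 = v (2 * i + 2) mod b" if "i < k" for i
  using r that unfolding rep_def tape_digits_def by (metis (no_types, lifting) div_by_1 of_nat_0 power_0)
 thus ?thesis using r by (auto simp: applicable_def app_def rep_def list_eq_iff_nth_eq)
qed

lemma step_rep:
 assumes "rep c v"
 shows "tm_step M c = None \<longleftrightarrow> (ALL r:set (rules M). ~ app r v)" "tm_step M c = Some c' ==> rep c' (nx v)"
proof -
 have f: "find (applicable c) (rules M) = find (%r. app r v) (rules M)"
  using app_iff[OF assms] by (metis (full_types))
 show "tm_step M c = None \<longleftrightarrow> (ALL r:set (rules M). ~ app r v)"
 proof (cases "find (%r. app r v) (rules M)")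
  case None
  hence "ALL r:set (rules M). ~ app r v" unfolding find_None_iff by blast
  moreover have "tm_step M c = None" by (simp add: tm_step_def f None)
  ultimately show ?thesis by blast
 next
  case (Some r)
  hence "r : set (rules M)" "app r v" by (auto simp: find_Some_iff)
  moreover have "tm_step M c ~= None" by (simp add: tm_step_def f Some split: prod.split)
  ultimately show ?thesis by blast
 qed
 assume "tm_step M c = Some c'"
 then obtain q acts q' where r: "find (%r. app r v) (rules M) = Some (q, acts, q')"
  and c': "c' = (q', map2 (%(_, b, m) t. shift_tape m (t(0 := b))) acts (snd c))"
  unfolding tm_step_def f by (auto split: option.splits)
 hence mem: "(q, acts, q') : set (rules M)" "app (q, acts, q') v" by (auto simp: find_Some_iff)
 have "tape_digits (snd c' ! i) (nx v (2 * i + 1)) (nx v (2 * i + 2))" if i: "i < k" for i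
 proof -
  obtain a d m where x: "acts ! i = (a, d, m)" by (cases "acts ! i")
  have len: "length acts = k" "length (snd c) = k" using mem(2) assms by (auto simp: app_def rep_def)
  have "d < b" using sym_less[OF mem(1), of "acts ! i"] nth_mem[of i acts] i len by (simp add: x)
  moreover have "tape_digits (snd c ! i) (v (2 * i + 1)) (v (2 * i + 2))" using assms i by (simp add: rep_def)
  ultimately have "tape_digits (shift_tape m ((snd c ! i)(0 := d))) (upd_left d m (v (2 * i + 1))) (upd_right d m (v (2 * i + 1)) (v (2 * i + 2)))"
   by (intro tape_digits_upd)
  moreover have "snd c' ! i = shift_tape m ((snd c ! i)(0 := d))" using i len by (simp add: c' x)
  ultimately show ?thesis by (simp add: nx_def r upd_def x)
 qed
 moreover have "fst c' = nx v 0" by (simp add: c' nx_def r upd_def)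
 moreover have "length (snd c') = k" using mem(2) assms by (simp add: c' rep_def app_def)
 ultimately show "rep c' (nx v)" unfolding rep_def by blast
qed

definition start :: "nat => nat => nat" where "start n j = (if j = 2 then \<Sum>i<n. b ^ i else 0)"

lemma start_digit: "(\<Sum>i<n. b ^ i) div b ^ x mod b = of_bool (x < n)"
proof (induction x arbitrary: n)
 case 0
 show ?case using b by (cases n) (simp_all add: sum.lessThan_Suc_shift sum_distrib_left[symmetric] mod_Suc del: sum.lessThan_Suc)
next
 case (Suc x)
 show ?case
 proof (cases n)
  case (Suc m)
  have "(\<Sum>i<n. b ^ i) = (\<Sum>i<m. b ^ i) * b + 1"
   by (simp add: Suc sum.lessThan_Suc_shift sum_distrib_left mult.commute del: sum.lessThan_Suc)
  thus ?thesis using digit_Suc[of 1 "\<Sum>i<m. b ^ i" x] Suc.IH[of m] b Suc by simp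
 qed simp
qed

lemma rep_start: "rep (init_config M (replicate n 1)) (start n)"
proof -
 have "tape_digits (word_tape (replicate n 1)) 0 (\<Sum>i<n. b ^ i)" unfolding tape_digits_def start_digit by (auto simp: word_tape_def)
 moreover have "tape_digits (word_tape []) 0 0" by (auto simp: tape_digits_def word_tape_def)
 ultimately show ?thesis by (auto simp: rep_def init_config_def start_def k_def nth_Cons' )
qed

text \<open>The iteration \<open>nx\<close> is stationary once no rule applies, so halting within \<open>x\<close> steps is read off after exactly \<open>x\<close> steps.\<close>

lemma halts_iff: "(\<exists>t\<le>x. EX c. halts_in M (replicate n 1) t c) \<longleftrightarrow> (ALL r:set (rules M). ~ app r ((nx ^^ x) (start n)))"
proof -
 have stuck: "nx v = v" if "ALL r:set (rules M). ~ app r v" for v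
  using that by (auto simp: nx_def split: option.split simp: find_Some_iff)
 have "(\<exists>t\<le>x. EX c. halts_in M (replicate n 1) t c & rep c ((nx ^^ x) (start n))) \<or>
  (EX c. (init_config M (replicate n 1), c) : step_rel M ^^ x & rep c ((nx ^^ x) (start n)))"
 proof (induction x)
  case 0 thus ?case using rep_start by simp
 next
  case (Suc x)
  thus ?case
  proof (elim disjE exE conjE)
   fix t c assume t: "t <= x" "halts_in M (replicate n 1) t c" "rep c ((nx ^^ x) (start n))"
   hence "nx ((nx ^^ x) (start n)) = (nx ^^ x) (start n)" using step_rep(1)[OF t(3)] by (intro stuck) (simp add: halts_in_def)
   hence "rep c ((nx ^^ Suc x) (start n))" using t(3) by simp
   thus ?thesis using t(2) le_SucI[OF t(1)] by blast
  next
   fix c assume c: "(init_config M (replicate n 1), c) : step_rel M ^^ x" "rep c ((nx ^^ x) (start n))"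
   show ?thesis
   proof (cases "tm_step M c")
    case None
    hence "nx ((nx ^^ x) (start n)) = (nx ^^ x) (start n)" using step_rep(1)[OF c(2)] by (intro stuck) simp
    thus ?thesis using c None by (intro disjI1 exI[of _ x] conjI exI[of _ c]) (auto simp: halts_in_def)
   next
    case (Some c')
    have "(init_config M (replicate n 1), c') : step_rel M ^^ Suc x"
     by (rule relpow_Suc_I[OF c(1)]) (simp add: Some)
    moreover have "rep c' ((nx ^^ Suc x) (start n))" using step_rep(2)[OF c(2) Some] by simp
    ultimately show ?thesis by blast
   qed
  qed
 qed
 thus ?thesis
 proof (elim disjE exE conjE)
  fix t c assume t: "t <= x" "halts_in M (replicate n 1) t c" "rep c ((nx ^^ x) (start n))"
  hence "ALL r:set (rules M). ~ app r ((nx ^^ x) (start n))" using step_rep(1)[OF t(3)] by (simp add: halts_in_def)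
  thus ?thesis using t(1,2) by blast
 next
  fix c assume c: "(init_config M (replicate n 1), c) : step_rel M ^^ x" "rep c ((nx ^^ x) (start n))"
  show ?thesis
  proof
   assume "ALL r:set (rules M). ~ app r ((nx ^^ x) (start n))"
   thus "\<exists>t\<le>x. EX c. halts_in M (replicate n 1) t c" using c step_rep(1)[OF c(2)] unfolding halts_in_def by blast
  next
   assume "\<exists>t\<le>x. EX c. halts_in M (replicate n 1) t c"
   then obtain t c' where t: "t <= x" "(init_config M (replicate n 1), c') : step_rel M ^^ t" "tm_step M c' = None"
    unfolding halts_in_def by blast
   have "(init_config M (replicate n 1), c) : step_rel M ^^ t O step_rel M ^^ (x - t)"
    using c(1) t(1) unfolding relpow_add[symmetric] by simp
   then obtain c'' where c'': "(init_config M (replicate n 1), c'') : step_rel M ^^ t"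
    "(c'', c) : step_rel M ^^ (x - t)" by blast
   have det: "single_valued (step_rel M)" by (auto simp: single_valued_def)
   have "single_valued (step_rel M ^^ t)" using det by (rule single_valued_relpow)
   hence "c'' = c'" using c''(1) t(2) by (meson single_valuedD)
   have "x - t = 0"
   proof (rule ccontr)
    assume "x - t ~= 0"
    then obtain y where "x - t = Suc y" by (cases "x - t") auto
    then obtain z where "(c'', z) : step_rel M" using relpow_Suc_D2 c''(2) by metis
    thus False using t(3) \<open>c'' = c'\<close> by simp
   qed
   hence "c = c'" using c''(2) \<open>c'' = c'\<close> by simp
   thus "ALL r:set (rules M). ~ app r ((nx ^^ x) (start n))" using t(3) step_rep(1)[OF c(2)] by simp
  qed
 qed
qed

end

context machine_digits
begin

definition dim where "dim = 2 * k + 1"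

definition code :: "(nat => nat) => nat" where "code v = list_encode (map v [0..<dim])"

definition upd_all :: "rule list => (nat => nat) => nat => nat" where
 "upd_all rs v j = (case find (%r. app r v) rs of None => v j | Some r => upd r v j)"

lemma upd_all_simps: "upd_all [] v j = v j" "upd_all (r # rs) v j = (if app r v then upd r v j else upd_all rs v j)"
 by (simp_all add: upd_all_def)

lemma nx_upd_all: "nx v j = upd_all (rules M) v j"
 by (simp add: nx_def upd_all_def split: option.split)

lemma app_cong: "(!!j. j < dim ==> v j = v' j) ==> app r v \<longleftrightarrow> app r v'"
 by (auto simp: app_def dim_def)

lemma upd_cong: "(!!j. j < dim ==> v j = v' j) ==> j < dim ==> upd r v j = upd r v' j"
proof -
 assume v: "!!j. j < dim ==> v j = v' j" and j: "j < dim"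
 define i where "i = (j - 1) div 2"
 show ?thesis
 proof (cases "j = 0")
  case False
  hence "2 * i + 1 < dim" "2 * i + 2 < dim" using j unfolding i_def dim_def by presburger+
  thus ?thesis by (simp only: upd_def i_def[symmetric] Let_def v)
 qed (simp add: upd_def)
qed

lemma nx_cong: "(!!j. j < dim ==> v j = v' j) ==> j < dim ==> nx v j = nx v' j"
proof -
 assume v: "!!j. j < dim ==> v j = v' j" and j: "j < dim"
 have "upd_all rs v j = upd_all rs v' j" for rs
  by (induction rs) (simp_all add: upd_all_simps v[OF j] upd_cong[of v v', OF v j] app_cong[of v v', OF v])
 thus ?thesis by (simp add: nx_upd_all)
qed

text \<open>Each step adds a bounded number of digits to each half tape. After \<open>x\<close> steps the numbers are exponential in \<open>x\<close>, which is harmless for \<open>x\<close>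
logarithmic in the size of the input.\<close>

definition state_bound :: "nat => (nat => nat) => bool" where
 "state_bound e v \<longleftrightarrow> v 0 <= sum_list (map (%r. snd (snd r)) (rules M)) & (\<forall>j<dim. 0 < j --> v j < b ^ e)"

lemma digit_less: "x < b ^ e ==> c < b ==> x * b + c < b ^ Suc e"
proof -
 assume x: "x < b ^ e" "c < b"
 hence "x * b + b <= b ^ e * b" using mult_le_mono1[of "Suc x" "b ^ e" b] by simp
 thus ?thesis using x by (simp add: mult.commute)
qed

lemma state_bound_nx: "state_bound e v ==> state_bound (Suc (Suc e)) (nx v)"
proof -
 assume v: "state_bound e v"
 have le: "x < b ^ Suc (Suc e)" if "x < b ^ e \<or> x < b ^ Suc e" for x
  using that b power_increasing[of e "Suc (Suc e)" b] power_increasing[of "Suc e" "Suc (Suc e)" b] by (auto intro: less_le_trans simp del: power_Suc)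
 show ?thesis
 proof (cases "find (%r. app r v) (rules M)")
  case None
  hence "nx v = v" by (simp add: nx_def)
  thus ?thesis using v le by (auto simp: state_bound_def simp del: power_Suc)
 next
  case (Some r)
  hence r: "r : set (rules M)" "app r v" by (auto simp: find_Some_iff)
  have nx: "nx v = upd r v" by (simp add: nx_def Some)
  have "snd (snd r) <= sum_list (map (%r. snd (snd r)) (rules M))" using r(1) by (intro member_le_sum_list) auto
  moreover have "upd r v j < b ^ Suc (Suc e)" if j: "0 < j" "j < dim" for j
  proof -
   define i where "i = (j - 1) div 2"
   have i: "i < k" "2 * i + 1 < dim" "2 * i + 2 < dim" using j unfolding i_def dim_def by presburger+
   obtain a c m where x: "fst (snd r) ! i = (a, c, m)" by (cases "fst (snd r) ! i")
   have "fst (snd r) ! i : set (fst (snd r))" using r(2) i by (simp add: app_def)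
   hence c: "c < b" using sym_less[OF r(1), of "fst (snd r) ! i"] by (simp add: x)
   have l: "v (2 * i + 1) < b ^ e" and r: "v (2 * i + 2) < b ^ e" using v i by (auto simp: state_bound_def)
   have d: "y div b < b ^ e" if "y < b ^ e" for y using that by (meson div_le_dividend le_less_trans)
   have lc: "upd_left c m (v (2 * i + 1)) < b ^ Suc (Suc e)"
    using digit_less[OF l c] d[OF l] l le by (cases m) (auto simp: upd_left_def simp del: power_Suc)
   have rb: "v (2 * i + 2) div b * b + c < b ^ Suc e" by (rule digit_less[OF d[OF r] c])
   have "v (2 * i + 1) mod b < b" using b by simp
   from digit_less[OF rb this] have rc: "upd_right c m (v (2 * i + 1)) (v (2 * i + 2)) < b ^ Suc (Suc e)"
    using rb d[OF r] le by (cases m) (auto simp: upd_right_def simp del: power_Suc)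
   show ?thesis unfolding upd_def Let_def i_def[symmetric] x fst_conv snd_conv using lc rc j(1) by simp
  qed
  moreover have "nx v 0 = snd (snd r)" by (simp add: nx upd_def)
  ultimately show ?thesis by (simp add: state_bound_def nx del: power_Suc)
 qed
qed

lemma state_bound_start: "state_bound (Suc n) (start n)"
proof -
 have "(\<Sum>i<n. b ^ i) < b ^ n" for n
 proof (induction n)
  case (Suc n)
  hence "(\<Sum>i<Suc n. b ^ i) < 2 * b ^ n" by simp
  also have "... <= b ^ Suc n" using b by simp
  finally show ?case .
 qed simp
 moreover have "b ^ n <= b ^ Suc n" using b by (intro power_increasing) auto
 ultimately have "(\<Sum>i<n. b ^ i) < b ^ Suc n" by (rule less_le_trans)
 thus ?thesis using b by (simp add: state_bound_def start_def)
qed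

lemma state_bound_iter: "state_bound (Suc n + 2 * x) ((nx ^^ x) (start n))"
proof (induction x)
 case (Suc x) thus ?case using state_bound_nx[OF Suc] by simp
qed (simp add: state_bound_start)

lemma code_comp: "j < dim ==> alphabet.comp j (code v) = v j"
 using alphabet.comp_list_encode[of j "map v [0..<dim]"] by (simp add: code_def)

lemma code_cong: "(!!j. j < dim ==> v j = v' j) ==> code v = code v'"
 by (auto simp: code_def intro!: arg_cong[where f = list_encode])

end

locale simulation = alphabet K + machine_digits M b for K M b
begin

definition nxc :: "nat => nat" where "nxc z = code (nx (%j. comp j z))"

lemma nxc_code: "nxc (code v) = code (nx v)"
 unfolding nxc_def by (rule code_cong, rule nx_cong) (simp_all add: code_comp)

lemma nxc_iter: "(nxc ^^ x) (code v) = code ((nx ^^ x) v)"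
 by (induction x) (simp_all add: nxc_code)

lemma code_le: "state_bound e v ==> b ^ e <= y ==> code v <= list_bound dim (sum_list (map (%r. snd (snd r)) (rules M)) + y)"
proof -
 assume v: "state_bound e v" and y: "b ^ e <= y"
 have "x <= sum_list (map (%r. snd (snd r)) (rules M)) + y" if x: "x : set (map v [0..<dim])" for x
 proof -
  obtain j where j: "x = v j" "j < dim" using x by auto
  show ?thesis
  proof (cases "j = 0")
   case True thus ?thesis using v j by (simp add: state_bound_def)
  next
   case False
   hence "v j < b ^ e" using v j by (simp add: state_bound_def)
   thus ?thesis using y j by simp
  qed
 qed
 from list_encode_le[of "map v [0..<dim]", OF this] show ?thesis by (simp add: code_def)
qed

lemma PTb_all_const: "(!!i. i < (n::nat) ==> PTb (%w e. P i w e)) ==> PTb (%w e. \<forall>i<n. P i w e)"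
proof (induction n)
 case (Suc n)
 have "PTb (%w e. (\<forall>i<n. P i w e) & P n w e)" using Suc by (intro PTb_conj) auto
 thus ?case by (rule PTb_cong) (auto simp: less_Suc_eq)
qed (simp add: PTb_const[of True, simplified])

lemma PT_app: "PT Z ==> PTb (%w e. app r (%j. comp j (Z w e)))"
 unfolding app_def by (intro PTb_conj PTb_eq PTb_const PTb_all_const PT_const PT_mod PT_comp)

lemma PT_upd: "PT Z ==> PT (%w e. upd r (%j. comp j (Z w e)) j)"
proof -
 assume Z: "PT Z"
 have "PT (%w e. upd_left c m (comp j (Z w e)))" for c m j
  by (cases m) (auto simp: upd_left_def intro!: PT_intros PT_comp Z)
 moreover have "PT (%w e. upd_right c m (comp j (Z w e)) (comp j' (Z w e)))" for c m j j'
  by (cases m) (auto simp: upd_right_def intro!: PT_intros PT_comp Z)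
 ultimately show ?thesis unfolding upd_def Let_def
  by (cases "j = 0"; cases "odd j") (simp_all add: PT_const del: comp.simps)
qed

lemma PT_nxc: "PT Z ==> PT (%w e. nxc (Z w e))"
proof -
 assume Z: "PT Z"
 have "PT (%w e. upd_all rs (%j. comp j (Z w e)) j)" for rs j
  by (induction rs) (simp_all add: upd_all_simps PT_comp[OF Z] PT_if PT_app[OF Z] PT_upd[OF Z])
 thus ?thesis unfolding nxc_def code_def nx_upd_all by (intro PT_list_encode)
qed

text \<open>A simulation is only attempted if the numbers that occur stay below a given bound \<open>Y\<close>. The conjunction makes the function total and polynomial.\<close>

lemma PTb_halts:
 assumes N: "PT N" and X: "PT X" and Y: "PT Y"
 shows "PTb (%w e. b ^ (Suc (N w e) + 2 * X w e) <= Y w e & (\<exists>t\<le>X w e. EX c. halts_in M (replicate (N w e) 1) t c))"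
proof -
 define g where "g w e \<longleftrightarrow> b ^ (Suc (N w e) + 2 * X w e) <= Y w e" for w e
 have g: "PTb g" unfolding g_def by (intro PTb_power_le PT_const PT_add PT_mult PT_Suc N X Y)
 define n where "n w e = (if g w e then N w e else 0)" for w e
 define x where "x w e = (if g w e then X w e else 0)" for w e
 define z0 where "z0 w e = code (%j. if j = 2 then \<Sum>i<n w e. min (b ^ i) (Y w e) else 0)" for w e
 have n: "PT n" and x: "PT x" unfolding n_def x_def by (intro PT_if g N X PT_0)+
 have "PT (%w e. if j = 2 then \<Sum>i<n w e. min (b ^ i) (Y w e) else 0)" for j :: nat
  by (cases "j = 2") (simp_all add: PT_0, intro PT_sum n PT_min_power PT_const PT_var PT_rename[OF Y])
 hence z0: "PT z0" unfolding z0_def code_def by (intro PT_list_encode)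
 have z0_eq: "z0 w e = code (start (n w e))" for w e
 proof -
  have "min (b ^ i) (Y w e) = b ^ i" if "i < n w e" for i
  proof -
   have gg: "g w e" "i < N w e" using that by (auto simp: n_def split: if_splits)
   have "b ^ i <= b ^ (Suc (N w e) + 2 * X w e)" using b gg by (intro power_increasing) auto
   thus ?thesis using gg by (simp add: g_def min_def)
  qed
  hence eq: "(\<Sum>i<n w e. min (b ^ i) (Y w e)) = (\<Sum>i<n w e. b ^ i)" by (intro sum.cong) auto
  show ?thesis unfolding z0_def eq start_def[abs_def] ..
 qed
 have r: "rec_nat z (%i. nxc) m = (nxc ^^ m) z" for z m by (induction m) simp_all
 have rec: "PT (%w e. rec_nat (z0 w e) (%i z. nxc z) (x w e))"
 proof (rule PT_rec[OF x z0])
  show "PT (%w e. nxc (e 0))" by (intro PT_nxc PT_var)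
  show "PB (%w e. list_bound dim (sum_list (map (%r. snd (snd r)) (rules M)) + (Y w e + b)))"
   by (intro PB_list_bound PB_add PB_const PT_PB[OF Y])
  fix w e i assume i: "i <= x w e"
  have "b ^ (Suc (n w e) + 2 * i) <= Y w e + b"
  proof (cases "g w e")
   case True
   hence "Suc (n w e) + 2 * i <= Suc (N w e) + 2 * X w e" using i by (simp add: n_def x_def)
   hence "b ^ (Suc (n w e) + 2 * i) <= b ^ (Suc (N w e) + 2 * X w e)" using b by (intro power_increasing) auto
   thus ?thesis using True unfolding g_def by linarith
  next
   case False thus ?thesis using i by (simp add: n_def x_def)
  qed
  thus "rec_nat (z0 w e) (%i z. nxc z) i <= list_bound dim (sum_list (map (%r. snd (snd r)) (rules M)) + (Y w e + b))"
   unfolding r z0_eq nxc_iter by (rule code_le[OF state_bound_iter])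
 qed
 define z where "z w e = rec_nat (z0 w e) (%i z. nxc z) (x w e)" for w e
 have z: "PT z" using rec by (simp add: z_def[abs_def])
 have "PTb (%w e. ALL r:set rs. ~ app r (%j. comp j (z w e)))" for rs
 proof (induction rs)
  case (Cons r rs)
  have "PTb (%w e. ~ app r (%j. comp j (z w e)) & (ALL r:set rs. ~ app r (%j. comp j (z w e))))"
   by (intro PTb_conj PTb_not PT_app z Cons)
  thus ?case by (rule PTb_cong) simp
 qed (simp add: PTb_const[of True, simplified])
 hence "PTb (%w e. g w e & (ALL r:set (rules M). ~ app r (%j. comp j (z w e))))" by (intro PTb_conj g)
 thus ?thesis
 proof (rule PTb_cong)
  fix w e
  have "app r (%j. comp j (z w e)) \<longleftrightarrow> app r ((nx ^^ x w e) (start (n w e)))" for r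
   unfolding z_def r z0_eq nxc_iter by (rule app_cong) (simp add: code_comp)
  thus "b ^ (Suc (N w e) + 2 * X w e) <= Y w e & (\<exists>t\<le>X w e. EX c. halts_in M (replicate (N w e) 1) t c) \<longleftrightarrow>
    g w e & (ALL r:set (rules M). ~ app r (%j. comp j (z w e)))"
   unfolding halts_iff by (cases "g w e") (simp_all add: g_def n_def x_def)
 qed
qed

end

section \<open>The exponents attached to a machine\<close>

text \<open>The bound \<open>r! \<le> x\<close> ensures \<open>n + x \<le> 2 x\<close> for the inputs in question, so that the time also bounds the output.\<close>

definition good :: "tm => nat => nat => bool" where
 "good M r x \<longleftrightarrow> 1 <= x & fact r <= x & (\<forall>n<fact r. \<exists>t\<le>x. EX c. halts_in M (replicate n 1) t c)"

definition expo :: "tm => nat => nat" where "expo M r = (LEAST x. good M r x)"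

lemma good_mono: "x <= y ==> good M r x ==> good M r y"
 unfolding good_def by (meson le_trans)

lemma good_exists: assumes "!!n. EX t c. halts_in M (replicate n 1) t c" shows "EX x. good M r x"
proof -
 obtain T where T: "!!n. EX c. halts_in M (replicate n 1) (T n) c" using assms by metis
 have "T n <= sum T {..<fact r}" if "n < fact r" for n using that by (intro member_le_sum) auto
 hence "\<exists>t\<le>sum T {..<fact r} + fact r. EX c. halts_in M (replicate n 1) t c" if "n < fact r" for n
  using T[of n] that by (intro exI[of _ "T n"]) (simp add: trans_le_add1)
 moreover have "1 <= sum T {..<fact r} + fact r" using fact_ge_1[of r, where 'a = nat] by linarith
 ultimately have "good M r (sum T {..<fact r} + fact r)" unfolding good_def by simp
 thus ?thesis ..
qed

text \<open>For a property that persists, the least witness cut off at \<open>N\<close> is the number of failures below \<open>N\<close>. In this form it is a bounded sum.\<close>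

lemma count_Least:
 assumes "!!x y. x <= y ==> P x ==> P y" "EX x. P x"
 shows "(\<Sum>x<N. of_bool (~ P x)) = min (LEAST x. P x) (N :: nat)"
proof -
 define L where "L = (LEAST x. P x)"
 have "P L" unfolding L_def using assms(2) by (rule LeastI_ex)
 hence "~ P x \<longleftrightarrow> x < L" for x using assms(1)[of L x] not_less_Least[of x P] unfolding L_def[symmetric] by (metis not_le)
 hence "(\<Sum>x<N. of_bool (~ P x)) = card {x : {..<N}. x < L}" by (simp add: sum_of_bool_eq Int_def)
 also have "{x : {..<N}. x < L} = {..<min L N}" by auto
 finally show ?thesis by (simp add: L_def)
qed

text \<open>A logarithm rounded up, so that \<open>2 ^ clog q\<close> lies above \<open>q\<close> and is still linear in \<open>q\<close>.\<close>

definition clog :: "nat => nat" where "clog q = (LEAST c. q < 2 ^ c)"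

lemma clog_count: "clog q = (\<Sum>c<q. of_bool (~ q < 2 ^ c))"
proof -
 have ex: "q < 2 ^ q" by (rule less_exp)
 have "(\<Sum>c<q. of_bool (~ q < (2::nat) ^ c)) = min (LEAST c. q < 2 ^ c) q"
 proof (rule count_Least)
  fix x y :: nat assume "x <= y" "q < (2::nat) ^ x"
  moreover have "(2::nat) ^ x <= 2 ^ y" using \<open>x <= y\<close> by (rule power_increasing) simp
  ultimately show "q < 2 ^ y" by linarith
 qed (use ex in blast)
 moreover have "(LEAST c. q < (2::nat) ^ c) <= q" using ex by (rule Least_le)
 ultimately show ?thesis by (simp add: clog_def)
qed

lemma clog: "q < 2 ^ clog q" "2 ^ clog q <= 2 * q + 1"
proof -
 have ex: "q < 2 ^ q" by (rule less_exp)
 show "q < 2 ^ clog q" unfolding clog_def using ex by (rule LeastI)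
 show "2 ^ clog q <= 2 * q + 1"
 proof (cases "clog q")
  case (Suc c)
  hence "~ q < 2 ^ c" using not_less_Least[of c "%c. q < 2 ^ c"] by (simp add: clog_def)
  thus ?thesis by (simp add: Suc)
 qed simp
qed

lemma clog_pos: "q >= 1 ==> clog q >= 1"
 using clog(1)[of q] by (cases "clog q") auto

lemma rk_count: "k ~= 0 ==> rk k = (\<Sum>r<Suc (nat \<bar>k\<bar>). of_bool (fact r dvd k))"
proof -
 assume k: "k ~= 0"
 have ex: "~ (fact (Suc (nat \<bar>k\<bar>)) :: int) dvd k" by (rule not_fact_dvd[OF k]) simp
 have "(\<Sum>r<Suc (nat \<bar>k\<bar>). of_bool (~ ~ (fact r :: int) dvd k)) = min (LEAST r. ~ (fact r :: int) dvd k) (Suc (nat \<bar>k\<bar>))"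
  by (rule count_Least) (use ex fact_dvd dvd_trans in blast)+
 moreover have "rk k <= Suc (nat \<bar>k\<bar>)" by (rule rk_le[OF ex])
 ultimately show ?thesis by (simp add: rk_def)
qed

context simulation
begin

lemma PT_clog: "PT Q ==> PT (%w e. clog (Q w e))"
 unfolding clog_count not_less
 by (intro PT_sum PTb_power_le PT_const PT_var) (simp_all add: PT_rename)

lemma PT_rk: assumes "PTi F" shows "PT (%w e. if F w e = 0 then 0 else rk (F w e))"
proof (rule PT_cong)
 note A = PT_nat_abs[OF assms]
 show "PT (%w e. if F w e = 0 then 0 else \<Sum>r<Suc (nat \<bar>F w e\<bar>). of_bool (min (fact r) (Suc (nat \<bar>F w e\<bar>)) dvd nat \<bar>F w e\<bar>))"
  by (intro PT_if PT_0 PTb_eq_int PTi_const assms PT_sum PT_Suc PTb_dvd PT_min_fact A PT_rename[OF A] PT_var)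
 show "(if F w e = 0 then 0 else rk (F w e)) =
   (if F w e = 0 then 0 else \<Sum>r<Suc (nat \<bar>F w e\<bar>). of_bool (min (fact r) (Suc (nat \<bar>F w e\<bar>)) dvd nat \<bar>F w e\<bar>))" for w e
 proof (cases "F w e = 0")
  case False
  define n where "n = nat \<bar>F w e\<bar>"
  have n: "n > 0" using False by (simp add: n_def)
  have "min (fact r) (Suc n) dvd n \<longleftrightarrow> (fact r :: int) dvd F w e" for r
  proof -
   have "(fact r :: int) dvd F w e \<longleftrightarrow> fact r dvd n"
    unfolding n_def by (metis dvd_nat_abs_iff of_nat_fact)
   moreover have "~ Suc n dvd n" using n by (meson dvd_imp_le not_less_eq_eq order_refl)
   moreover have "~ fact r dvd n" if "fact r > n" using that n dvd_imp_le by (meson not_le)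
   ultimately show ?thesis by (cases "fact r <= n") (auto simp: min_def)
  qed
  thus ?thesis using False rk_count[OF False] by (simp add: n_def[symmetric] del: sum.lessThan_Suc)
 qed simp
qed

text \<open>For \<open>x\<close> below a logarithm of \<open>q\<close> all quantities in \<open>good\<close> can be cut off at bounds polynomial in \<open>q\<close>.\<close>

lemma good_window:
 assumes "x < clog q" "b <= 2 ^ \<beta>"
 shows "good M r x \<longleftrightarrow> 1 <= x & min (fact r) (Suc x) <= x & (\<forall>n<min (fact r) (Suc x).
  b ^ (Suc n + 2 * x) <= (2 * q + 1) ^ (3 * \<beta>) & (\<exists>t\<le>x. EX c. halts_in M (replicate n 1) t c))"
proof -
 have "b ^ (Suc n + 2 * x) <= (2 * q + 1) ^ (3 * \<beta>)" if "n <= x" for n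
 proof -
  have "b ^ (Suc n + 2 * x) <= (2 ^ \<beta>) ^ (Suc n + 2 * x)" using assms(2) by (rule power_mono) simp
  also have "... <= (2 ^ \<beta>) ^ (3 * clog q)" using that assms(1) by (intro power_increasing) auto
  also have "... = (2 ^ clog q) ^ (3 * \<beta>)" by (simp add: power_mult[symmetric] mult_ac)
  also have "... <= (2 * q + 1) ^ (3 * \<beta>)" using clog(2)[of q] by (rule power_mono) simp
  finally show ?thesis .
 qed
 thus ?thesis unfolding good_def by (cases "fact r <= x") auto
qed

text \<open>The point where the running time of the machine becomes irrelevant: below \<open>clog Q\<close> only that many steps must be simulated, and beyond it the value of \<open>expo M\<close> is
not needed.\<close>

lemma PT_capped_power:
 assumes R: "PT R" and Q: "PT Q" and total: "!!n. EX t c. halts_in M (replicate n 1) t c"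
 shows "PT (%w e. 2 ^ min (expo M (R w e)) (clog (Q w e)))"
proof -
 have b2: "b <= 2 ^ b" using less_exp[of b] by simp
 define g where "g r q x \<longleftrightarrow> 1 <= x & min (fact r) (Suc x) <= x & (\<forall>n<min (fact r) (Suc x).
  b ^ (Suc n + 2 * x) <= (2 * q + 1) ^ (3 * b) & (\<exists>t\<le>x. EX c. halts_in M (replicate n 1) t c))" for r q x
 have "PTb (%w e. g (R w (%k. e (Suc k))) (Q w (%k. e (Suc k))) (e 0))"
  unfolding g_def by (intro PTb_conj PTb_le PT_const PT_var PT_min_fact PT_Suc PT_rename[OF R] PTb_all PTb_halts
   PT_power PT_add PT_mult PT_rename[OF Q])
 hence c: "PT (%w e. \<Sum>x<clog (Q w e). of_bool (~ g (R w e) (Q w e) x))" by (intro PT_sum PT_clog Q PTb_not)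
 have eq: "min (expo M r) (clog q) = (\<Sum>x<clog q. of_bool (~ g r q x))" for r q
 proof -
  have "(\<Sum>x<clog q. of_bool (~ g r q x)) = (\<Sum>x<clog q. of_bool (~ good M r x))"
  proof (rule sum.cong)
   fix x assume "x : {..<clog q}"
   hence "good M r x \<longleftrightarrow> g r q x" unfolding g_def by (intro good_window b2) simp
   thus "of_bool (~ g r q x) = of_bool (~ good M r x)" by simp
  qed simp
  also have "... = min (expo M r) (clog q)" unfolding expo_def
   by (rule count_Least) (use good_mono good_exists[OF total] in blast)+
  finally show ?thesis ..
 qed
 show ?thesis
 proof (rule PT_cong)
  show "PT (%w e. min (2 ^ (\<Sum>x<clog (Q w e). of_bool (~ g (R w e) (Q w e) x))) (2 * Q w e + 1))"
   by (intro PT_min_power PT_const c PT_add PT_mult Q)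
  fix w e
  have "(2::nat) ^ min (expo M (R w e)) (clog (Q w e)) <= 2 ^ clog (Q w e)" by (rule power_increasing) auto
  also note clog(2)
  finally show "2 ^ min (expo M (R w e)) (clog (Q w e)) =
   min (2 ^ (\<Sum>x<clog (Q w e). of_bool (~ g (R w e) (Q w e) x))) (2 * Q w e + 1)" unfolding eq by simp
 qed
qed

end

section \<open>A criterion with small coefficients\<close>

context exponents
begin

lemma abs_u0:
 assumes "int (length w) <= L" "int (length w') <= L" "L >= 1"
 shows "\<bar>u0 (3 * L) s w w' c i\<bar> <= 14 * L\<^sup>2"
proof -
 have "\<bar>u0 (3 * L) s w w' c i\<bar> <= int (card {-(3*L)..3*L}) * (2 * L)"
  unfolding u0_def tel_def
 proof (rule abs_sum_le)
  fix i' show "\<bar>of_bool (ht w dvd i - i' & 0 <= (i - i') * ht w) * dlt s w w' c i'\<bar> <= 2 * L"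
   using abs_dlt[OF assms(1,2), of s c i'] assms(3) by simp
 qed
 also have "... = (6 * L + 1) * (2 * L)" using assms(3) by simp
 also have "... <= (7 * L) * (2 * L)" using assms(3) by (intro mult_right_mono) auto
 finally show ?thesis by (simp add: power2_eq_square)
qed

text \<open>If \<open>d \<le> 2 ^ c\<close> nothing changes. Otherwise \<open>d\<close> and \<open>2 ^ c\<close> both exceed \<open>|a|\<close>, so each equation says that \<open>a = q =
0\<close>.\<close>

lemma capped_eq:
 assumes "\<bar>a\<bar> < 2 ^ c" "D' = min d (2 ^ c)" "d >= 1"
 shows "a + D' * q = 0 \<longleftrightarrow> a + d * q = (0::int)"
proof (cases "d < 2 ^ c")
 case False
 have *: "a + e * q = 0 \<longleftrightarrow> a = 0 & q = 0" if "e >= 2 ^ c" for e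
 proof
  assume e: "a + e * q = 0"
  have "q = 0"
  proof (rule ccontr)
   assume "q ~= 0"
   hence "\<bar>e\<bar> * 1 <= \<bar>e\<bar> * \<bar>q\<bar>" by (intro mult_left_mono) auto
   hence "\<bar>e\<bar> <= \<bar>e * q\<bar>" by (simp add: abs_mult)
   moreover have "\<bar>e * q\<bar> = \<bar>a\<bar>" using e by (metis abs_minus_cancel eq_neg_iff_add_eq_0)
   ultimately show False using that assms(1) by linarith
  qed
  thus "a = 0 & q = 0" using e by simp
 qed simp
 show ?thesis using *[of d] *[of D'] False assms(2) by auto
qed (use assms in simp)

context
 fixes c :: nat and L :: int and w w' :: word and s :: int
 assumes c: "c >= 1" and len: "int (length w) <= L" "int (length w') <= L" and L: "L >= 1"
  and big: "2000 * L ^ 7 < 2 ^ c"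
begin

interpretation capped: exponents "%r. min (X r) c"
 by unfold_locales (use X_pos c in simp)

lemma capped_dm: "capped.dm 0 k = (if k = 0 then 0 else min (D k) (2 ^ c))"
proof -
 have "(2::int) ^ min (X r) c = min (2 ^ X r) (2 ^ c)" for r by (simp add: min_def)
 thus ?thesis by (simp add: capped.dm_def capped.D_def D_def)
qed

text \<open>The constant 2000 covers all values of \<open>a\<close> that arise below, from products of a value of \<open>u\<close> with an exponent to orbit sums.\<close>

lemma capped_dm_eq: "\<bar>a\<bar> <= 2000 * L ^ 7 ==> a + capped.dm 0 k * q = 0 \<longleftrightarrow> a + dm 0 k * q = 0"
 using capped_eq[of a c "min (D k) (2 ^ c)" "D k" q] big D_ge2[of k] unfolding capped_dm by (simp add: dm_def)

lemma L_powers: "1 <= L ^ n" "a <= b ==> L ^ a <= L ^ b" using L by (auto intro: power_increasing)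

lemma abs_cP_L: "\<bar>cP 0 w d d' i j\<bar> <= 2 * L\<^sup>2" "\<bar>cP 0 w' d d' i j\<bar> <= 2 * L\<^sup>2"
 using abs_cP[of 0 w d d' i j] abs_cP[of 0 w' d d' i j] power_mono[OF len(1), of 2] power_mono[OF len(2), of 2] by auto

lemma capped_zz:
 "capped.zz 0 w' b i j = capped.zz 0 w b (i - s) (j - s) \<longleftrightarrow> zz 0 w' b i j = zz 0 w b (i - s) (j - s)"
proof (cases b)
 case True
 have "\<bar>cP 0 w' False True i j - cP 0 w False True (i - s) (j - s)\<bar> <= 2000 * L ^ 7"
  using abs_cP_L(1)[of False True "i - s" "j - s"] abs_cP_L(2)[of False True i j] L_powers(2)[of 2 7] L_powers(1)[of 7] by linarith
 from capped_dm_eq[OF this, of "i - j" "cP 0 w' True True i j - cP 0 w True True (i - s) (j - s)"]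
 show ?thesis using True by (simp add: zz_def capped.zz_def algebra_simps)
qed (simp add: zz_def capped.zz_def)

lemma capped_omp:
 assumes "!!c. \<bar>p c\<bar> <= 384 * L ^ 6" "!!c. \<bar>q c\<bar> <= 384 * L ^ 6"
 shows "capped.zz 0 w' b i j - capped.zz 0 w b (i - s) (j - s) = 2 * omp (capped.dm 0 (i - j)) p q (%c. cv 0 w' c i) (%c. cv 0 w' c j) b \<longleftrightarrow>
  zz 0 w' b i j - zz 0 w b (i - s) (j - s) = 2 * omp (dm 0 (i - j)) p q (%c. cv 0 w' c i) (%c. cv 0 w' c j) b"
proof (cases b)
 case True
 have v: "\<bar>cv 0 w' d k\<bar> <= L" for d k using abs_cv[of 0 w' d k] len by linarith
 have pv: "\<bar>p False * cv 0 w' True j\<bar> <= 384 * L ^ 7" "\<bar>cv 0 w' False i * q True\<bar> <= 384 * L ^ 7"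
  using mult_mono[OF assms(1)[of False] v[of True j]] mult_mono[OF v[of False i] assms(2)[of True]] L
  by (simp_all add: abs_mult eval_nat_numeral mult_ac)
 have "\<bar>cP 0 w' False True i j - cP 0 w False True (i - s) (j - s) - 2 * (p False * cv 0 w' True j - cv 0 w' False i * q True)\<bar> <= 2000 * L ^ 7"
  using pv abs_cP_L(1)[of False True "i - s" "j - s"] abs_cP_L(2)[of False True i j] L_powers(2)[of 2 7, simplified] L_powers(1)[of 7]
  unfolding right_diff_distrib by linarith
 from capped_dm_eq[OF this, of "i - j" "cP 0 w' True True i j - cP 0 w True True (i - s) (j - s)
   - 2 * (p True * cv 0 w' True j - cv 0 w' True i * q True)"]
 show ?thesis using True by (simp add: zz_def capped.zz_def omp_def algebra_simps)
qed (simp add: zz_def capped.zz_def omp_def)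

lemma capped_pivot_eqs:
 assumes p0: "!!c. \<bar>p0 c\<bar> <= 384 * L ^ 6"
 shows "capped.pivot_eqs (%b i j. capped.zz 0 w' b i j - capped.zz 0 w b (i - s) (j - s)) (cv 0 w') (3 * L) (384 * L ^ 6) i0 p0 \<longleftrightarrow>
  pivot_eqs (%b i j. zz 0 w' b i j - zz 0 w b (i - s) (j - s)) (cv 0 w') (3 * L) (384 * L ^ 6) i0 p0"
 unfolding pivot_eqs_def capped.pivot_eqs_def
proof (intro iff_allI imp_cong HOL.refl iff_exI conj_cong)
 fix i j :: int and p q :: "bool => int" and b
 assume "ALL c. \<bar>p c\<bar> <= 384 * L ^ 6 & \<bar>q c\<bar> <= 384 * L ^ 6"
 hence p: "!!c. \<bar>p c\<bar> <= 384 * L ^ 6" and q: "!!c. \<bar>q c\<bar> <= 384 * L ^ 6" by blast+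
qed (rule capped_omp; use p0 in blast)+

lemma capped_zero_crit: "capped.zero_crit L s w w' \<longleftrightarrow> zero_crit L s w w'"
 unfolding zero_crit_def capped.zero_crit_def capped_zz
 by (intro conj_cong disj_cong HOL.refl iff_exI capped_pivot_eqs) blast

lemma capped_orbit_crit: "capped.orbit_crit L s w w' \<longleftrightarrow> orbit_crit L s w w'"
proof -
 have u: "\<bar>u0 (3 * L) s w w' d i\<bar> <= 14 * L\<^sup>2" for d i by (rule abs_u0[OF len L])
 have v: "\<bar>cv 0 w d k\<bar> <= L" "\<bar>cv 0 w' d k\<bar> <= L" for d k using abs_cv[of 0 w d k] abs_cv[of 0 w' d k] len by linarith+
 have vu: "\<bar>x * y\<bar> <= 14 * L ^ 3" if "\<bar>x\<bar> <= L" "\<bar>y\<bar> <= 14 * L\<^sup>2" for x y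
  using mult_mono[OF that] L by (simp add: abs_mult eval_nat_numeral)
 define A where "A i j = cP 0 w' False True i j - cP 0 w False True (i - s) (j - s)
  + (cv 0 w' False i * u0 (3 * L) s w w' True (j - ht w) - u0 (3 * L) s w w' False (i - ht w) * cv 0 w' True j)
  - (u0 (3 * L) s w w' False i * cv 0 w True (j - s) - cv 0 w False (i - s) * u0 (3 * L) s w w' True j)" for i j
 define B where "B i j = cP 0 w' True True i j - cP 0 w True True (i - s) (j - s)
  + (cv 0 w' True i * u0 (3 * L) s w w' True (j - ht w) - u0 (3 * L) s w w' True (i - ht w) * cv 0 w' True j)
  - (u0 (3 * L) s w w' True i * cv 0 w True (j - s) - cv 0 w True (i - s) * u0 (3 * L) s w w' True j)" for i j
 have x1: "x1 (3 * L) s w w' True i j = A i j + dm 0 (i - j) * B i j"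
  "capped.x1 (3 * L) s w w' True i j = A i j + capped.dm 0 (i - j) * B i j"
  "capped.x1 (3 * L) s w w' False i j = x1 (3 * L) s w w' False i j" for i j
  by (simp_all add: x1_def capped.x1_def om_def capped.om_def zz_def capped.zz_def A_def B_def algebra_simps)
 have A: "\<bar>A i j\<bar> <= 60 * L ^ 3" for i j
  unfolding A_def
  using vu[OF v(2)[of False i] u[of True "j - ht w"]] vu[OF v(2)[of True j] u[of False "i - ht w"]]
   vu[OF v(1)[of True "j - s"] u[of False i]] vu[OF v(1)[of False "i - s"] u[of True j]]
   abs_cP_L(1)[of False True "i - s" "j - s"] abs_cP_L(2)[of False True i j] L_powers(2)[of 2 3] by (simp add: mult.commute)
 have "class_sum (4*L) (ht w) ii (%i. capped.x1 (3*L) s w w' b i (i - \<kappa>)) = 0 \<longleftrightarrow>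
   class_sum (4*L) (ht w) ii (%i. x1 (3*L) s w w' b i (i - \<kappa>)) = 0" for b \<kappa> ii
 proof (cases b)
  case True
  define SA where "SA = class_sum (4*L) (ht w) ii (%i. A i (i - \<kappa>))"
  define SB where "SB = class_sum (4*L) (ht w) ii (%i. B i (i - \<kappa>))"
  have "\<bar>SA\<bar> <= int (card {-(4*L)..4*L}) * (60 * L ^ 3)" unfolding SA_def
  proof (rule abs_sum_le)
   fix i show "\<bar>of_bool (ht w dvd i - ii) * A i (i - \<kappa>)\<bar> <= 60 * L ^ 3" using A[of i "i - \<kappa>"] L_powers(1)[of 3] L by simp
  qed
  also have "... = (8 * L + 1) * (60 * L ^ 3)" using L by simp
  also have "... <= (9 * L) * (60 * L ^ 3)" using L L_powers(1)[of 3] by (intro mult_right_mono) auto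
  also have "... = 540 * L ^ 4" by (simp add: eval_nat_numeral)
  also have "... <= 2000 * L ^ 7" using L_powers(2)[of 4 7] L_powers(1)[of 7] by linarith
  finally have SA: "\<bar>SA\<bar> <= 2000 * L ^ 7" .
  have *: "class_sum (4*L) (ht w) ii (%i. (A i (i - \<kappa>) + d * B i (i - \<kappa>))) = SA + d * SB" for d
   unfolding SA_def SB_def sum_distrib_left sum.distrib[symmetric] by (intro sum.cong) (auto simp: algebra_simps)
  show ?thesis using capped_dm_eq[OF SA, of \<kappa> SB] True by (simp add: x1 *)
 qed (simp add: x1)
 thus ?thesis unfolding orbit_crit_def capped.orbit_crit_def by simp
qed

end

text \<open>Conjugacy of words of length \<open>L\<close> is the same for the exponents \<open>X\<close> and for their truncation at \<open>c\<close>, a logarithm of a polynomial in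
\<open>L\<close>.\<close>

lemma capped_conj_crit:
 assumes "c >= 1" "int (length w) <= L" "int (length w') <= L" "L >= 1" "2000 * L ^ 7 < 2 ^ c"
 shows "exponents.conj_crit (%r. min (X r) c) L w w' \<longleftrightarrow> conj_crit L w w'"
proof -
 interpret capped: exponents "%r. min (X r) c" by unfold_locales (use X_pos assms in simp)
 show ?thesis unfolding conj_crit_def capped.conj_crit_def
  using capped_zero_crit[OF assms] capped_orbit_crit[OF assms] by simp
qed

end

context exponents
begin

section \<open>Bounding the quantifiers\<close>

definition orbit_window :: "nat => int => word => word => bool" where
 "orbit_window l s w w' \<longleftrightarrow>
  (ALL c. ALL ii. \<bar>ii\<bar> <= int (3 * l) --> class_sum (int (3 * l)) (ht w) ii (dlt s w w' c) = 0) \<and>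
  (ALL b. ALL \<kappa>. \<bar>\<kappa>\<bar> <= int (8 * l) --> (ALL ii. \<bar>ii\<bar> <= int (4 * l) -->
    class_sum (int (4 * l)) (ht w) ii (%i. x1 (int (3 * l)) s w w' b i (i - \<kappa>)) = 0))"

definition zero_window :: "nat => int => word => word => bool" where
 "zero_window l s w w' \<longleftrightarrow> (ALL c. ALL i. \<bar>i\<bar> <= int (3 * l) --> cv 0 w' c i = cv 0 w c (i - s)) \<and>
  ((ALL c. ALL i. \<bar>i\<bar> <= int (3 * l) --> cv 0 w' c i = 0) \<and>
    (ALL b. ALL i. \<bar>i\<bar> <= int (3 * l) --> (ALL j. \<bar>j\<bar> <= int (3 * l) --> zz 0 w' b i j = zz 0 w b (i - s) (j - s))) \<or>
   (EX i0. \<bar>i0\<bar> <= int (3 * l) & (\<bar>i0\<bar> < int (3 * l) \<and>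
    (cv 0 w' False i0 ~= 0 \<or> (ALL i. \<bar>i\<bar> <= int (3 * l) --> cv 0 w' False i = 0) & cv 0 w' True i0 ~= 0) \<and>
    (EX p0. (ALL c. \<bar>p0 c\<bar> <= int (384 * l ^ 6)) \<and>
      (ALL i. \<bar>i\<bar> <= int (3 * l) --> (ALL j. \<bar>j\<bar> <= int (3 * l) --> (\<bar>i\<bar> < int (3 * l) --> \<bar>j\<bar> < int (3 * l) -->
       (EX p. (ALL c. \<bar>p c\<bar> <= int (384 * l ^ 6)) & (EX q. (ALL c. \<bar>q c\<bar> <= int (384 * l ^ 6)) \<and>
        ((i = i0 --> (ALL c. p c = p0 c)) & (j = i0 --> (ALL c. q c = p0 c)) \<and>
        (ALL b. zz 0 w' b i i0 - zz 0 w b (i - s) (i0 - s) = 2 * omp (dm 0 (i - i0)) p p0 (%c. cv 0 w' c i) (%c. cv 0 w' c i0) b \<and>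
         zz 0 w' b i0 i - zz 0 w b (i0 - s) (i - s) = 2 * omp (dm 0 (i0 - i)) p0 p (%c. cv 0 w' c i0) (%c. cv 0 w' c i) b \<and>
         zz 0 w' b j i0 - zz 0 w b (j - s) (i0 - s) = 2 * omp (dm 0 (j - i0)) q p0 (%c. cv 0 w' c j) (%c. cv 0 w' c i0) b \<and>
         zz 0 w' b i0 j - zz 0 w b (i0 - s) (j - s) = 2 * omp (dm 0 (i0 - j)) p0 q (%c. cv 0 w' c i0) (%c. cv 0 w' c j) b \<and>
         zz 0 w' b i j - zz 0 w b (i - s) (j - s) = 2 * omp (dm 0 (i - j)) p q (%c. cv 0 w' c i) (%c. cv 0 w' c j) b)))))))))))"

text \<open>The criterion with all quantifiers bounded, which is possible because the coordinates vanish outside a window and class sums depend only on residues.\<close>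

definition conj_window :: "nat => word => word => bool" where
 "conj_window l w w' \<longleftrightarrow> ht w = ht w' \<and>
  (EX s. \<bar>s\<bar> <= int (2 * l) & (if ht w ~= 0 then orbit_window l s w w' else zero_window l s w w'))"

context
 fixes l :: nat and s :: int and w w' :: word
 assumes len: "length w <= l" "length w' <= l" and l: "l >= 1" and s: "\<bar>s\<bar> <= 2 * int l"
begin

lemma all_window: "(!!i. \<bar>i\<bar> > N ==> P i) ==> (ALL i. P i) \<longleftrightarrow> (ALL i. \<bar>i\<bar> <= N --> P i)" for N :: int
 by (meson not_le)

lemma pivot_window: "(ALL i j. \<bar>i\<bar> < N --> \<bar>j\<bar> < N --> (\<exists>p q :: bool => int. (ALL c. \<bar>p c\<bar> <= B & \<bar>q c\<bar> <= B) \<and>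
   (i = i0 --> p = p0) & (j = i0 --> q = p0) & R i j p q)) \<longleftrightarrow>
 (ALL i. \<bar>i\<bar> <= N --> (ALL j. \<bar>j\<bar> <= N --> (\<bar>i\<bar> < N --> \<bar>j\<bar> < N --> (EX p. (ALL c. \<bar>p c\<bar> <= B) & (EX q. (ALL c. \<bar>q c\<bar> <= B) \<and>
   ((i = i0 --> (ALL c. p c = p0 c)) & (j = i0 --> (ALL c. q c = p0 c)) & R i j p q))))))" for N B :: int
proof -
 have le: "\<bar>i\<bar> < N ==> \<bar>i\<bar> <= N" for i :: int by simp
 have e: "(\<exists>p q :: bool => int. (ALL c. \<bar>p c\<bar> <= B & \<bar>q c\<bar> <= B) & (i = i0 --> p = p0) & (j = i0 --> q = p0) & R i j p q) \<longleftrightarrow>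
  (EX p. (ALL c. \<bar>p c\<bar> <= B) & (EX q. (ALL c. \<bar>q c\<bar> <= B) \<and>
   ((i = i0 --> (ALL c. p c = p0 c)) & (j = i0 --> (ALL c. q c = p0 c)) & R i j p q)))" for i j
  unfolding fun_eq_iff by blast
 show ?thesis unfolding e using le by blast
qed

text \<open>If a class misses the window, its sum is empty; otherwise it has a representative inside.\<close>

lemma all_class: "(ALL ii. class_sum N h ii f = 0) \<longleftrightarrow>
 (ALL ii. \<bar>ii\<bar> <= N --> class_sum N h ii f = (0::int))" for N h :: int and f
proof (intro iffI allI impI)
 fix ii assume *: "ALL ii. \<bar>ii\<bar> <= N --> class_sum N h ii f = (0::int)"
 show "class_sum N h ii f = 0"
 proof (cases "EX i0:{-N..N}. h dvd i0 - ii")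
  case True
  then obtain i0 where "i0 : {-N..N}" "h dvd i0 - ii" by blast
  hence i0: "\<bar>i0\<bar> <= N" "h dvd i0 - ii" by auto
  have "h dvd i - ii \<longleftrightarrow> h dvd i - i0" for i
   using dvd_add_left_iff[OF i0(2), of "i - i0"] by simp
  thus ?thesis using *[rule_format, OF i0(1)] by simp
 next
  case False thus ?thesis by (intro sum.neutral) auto
 qed
qed blast

lemma zero_window: "zero_crit (int l) s w w' \<longleftrightarrow> zero_window l s w w'"
proof -
 have v: "cv 0 w' c i = 0" "cv 0 w c (i - s) = 0" if "\<bar>i\<bar> > int (3 * l)" for c i
  using that len s by (auto intro!: cv_supp)
 have z: "zz 0 w' b i j = 0" "zz 0 w b (i - s) (j - s) = 0" if "\<bar>i\<bar> > int (3 * l) \<or> \<bar>j\<bar> > int (3 * l)" for b i j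
  using that len s by (auto intro!: zz_supp)
 have 1: "(ALL i. cv 0 w' c i = cv 0 w c (i - s)) \<longleftrightarrow> (ALL i. \<bar>i\<bar> <= int (3 * l) --> cv 0 w' c i = cv 0 w c (i - s))" for c
  by (rule all_window) (simp add: v)
 have 2: "(ALL i. cv 0 w' c i = 0) \<longleftrightarrow> (ALL i. \<bar>i\<bar> <= int (3 * l) --> cv 0 w' c i = 0)" for c
  by (rule all_window) (simp add: v)
 have 3: "(ALL i j. zz 0 w' b i j = zz 0 w b (i - s) (j - s)) \<longleftrightarrow>
  (ALL i. \<bar>i\<bar> <= int (3 * l) --> (ALL j. \<bar>j\<bar> <= int (3 * l) --> zz 0 w' b i j = zz 0 w b (i - s) (j - s)))" for b
  using z by (metis not_le)
 have le: "\<bar>i\<bar> < int (3 * l) ==> \<bar>i\<bar> <= int (3 * l)" for i by simp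
 have e: "3 * int l = int (3 * l)" "384 * int l ^ 6 = int (384 * l ^ 6)" by simp_all
 have ex: "(EX i0. \<bar>i0\<bar> < N & P i0 & P' i0) \<longleftrightarrow> (EX i0. \<bar>i0\<bar> <= N & (\<bar>i0\<bar> < N & P i0 & P' i0))" for N :: int and P P'
  by (meson less_imp_le)
 show ?thesis
  unfolding zero_crit_def zero_window_def pivot_def pivot_eqs_def 1 2 3 e pivot_window ex ..
qed

lemma orbit_window: "ht w = ht w' ==> ht w ~= 0 ==> orbit_crit (int l) s w w' \<longleftrightarrow> orbit_window l s w w'"
proof -
 assume ht: "ht w = ht w'" "ht w ~= 0"
 have e: "3 * int l = int (3 * l)" "4 * int l = int (4 * l)" by simp_all
 have 1: "(ALL c ii. class_sum (int (3 * l)) (ht w) ii (dlt s w w' c) = 0) \<longleftrightarrow>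
  (ALL c. ALL ii. \<bar>ii\<bar> <= int (3 * l) --> class_sum (int (3 * l)) (ht w) ii (dlt s w w' c) = 0)"
  by (intro iff_allI all_class)
 have "(ALL \<kappa> ii. class_sum (int (4 * l)) (ht w) ii (%i. x1 (int (3 * l)) s w w' b i (i - \<kappa>)) = 0) \<longleftrightarrow>
  (ALL \<kappa>. \<bar>\<kappa>\<bar> <= int (8 * l) --> (ALL ii. \<bar>ii\<bar> <= int (4 * l) -->
    class_sum (int (4 * l)) (ht w) ii (%i. x1 (int (3 * l)) s w w' b i (i - \<kappa>)) = 0))"
  if cs: "ALL c ii. class_sum (int (3 * l)) (ht w) ii (dlt s w w' c) = 0" for b
 proof -
  have L: "int (length w) <= int l" "int (length w') <= int l" "1 <= int l" using len l by simp_all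
  have "x1 (int (3 * l)) s w w' b i j = 0" if j: "\<bar>j\<bar> > int (4 * l)" for i j
  proof -
   have "\<bar>ht w\<bar> <= int l" using ht_le[of w] len by simp
   hence "u0 (3 * int l) s w w' c (j - ht w) = 0" "u0 (3 * int l) s w w' c j = 0" for c
    using j l cs by (auto intro!: u0_props(2)[OF L(1,2) s L(3) ht])
   moreover have "cv 0 w' c j = 0" "cv 0 w c (j - s) = 0" for c using j s l len by (auto intro!: cv_supp)
   moreover have "zz 0 w' b i j = 0" "zz 0 w b (i - s) (j - s) = 0" using j s l len by (auto intro!: zz_supp)
   ultimately show ?thesis unfolding x1_def by (simp add: om_supp(2))
  qed
  hence "(ALL ii. class_sum (int (4 * l)) (ht w) ii (%i. x1 (int (3 * l)) s w w' b i (i - \<kappa>)) = 0)"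
   if "\<bar>\<kappa>\<bar> > int (8 * l)" for \<kappa> using that by (intro allI sum.neutral) auto
  thus ?thesis unfolding all_class[symmetric] by (rule all_window)
 qed
 thus ?thesis unfolding orbit_crit_def orbit_window_def e 1[symmetric] by blast
qed

end

lemma conj_window:
 assumes "length w <= l" "length w' <= l" "l >= 1"
 shows "conj_crit (int l) w w' \<longleftrightarrow> conj_window l w w'"
proof -
 have e: "int (2 * l) = 2 * int l" by simp
 show ?thesis unfolding conj_crit_def conj_window_def e
  using zero_window[OF assms] orbit_window[OF assms] by auto
qed

end

section \<open>Deciding the criterion in polynomial time\<close>

context alphabet
begin

text \<open>Words that can be read off the input letter by letter; a letter \<open>(i, b)\<close> is coded by \<open>2 * i + of_bool b\<close>.\<close>

definition PTW :: "(nat list => word) => bool" where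
 "PTW W \<longleftrightarrow> PT (%w e. length (W w)) & (EX A. PT (%w e. A w (e 0)) \<and>
  (ALL w p. p < length (W w) --> A w p = 2 * fst (W w ! p) + of_bool (snd (W w ! p))))"

definition sg :: "nat => int" where "sg a = (if odd a then 1 else - 1)"

lemma PTi_sg: "PT A ==> PTi (%w e. sg (A w e))"
 unfolding sg_def by (intro PTi_if PTb_not PTb_dvd PT_const PTi_const)

lemma sgb_sg: "a = 2 * i + of_bool b ==> sgb b = sg a" "a = 2 * i + of_bool b ==> i = a div 2"
 by (auto simp: sg_def sgb_def)

lemma ht_take_sum: "p <= length w ==> ht (take p w) = (\<Sum>q<p. dt (w ! q))"
proof (induction p)
 case (Suc p) thus ?case by (simp add: take_Suc_conv_app_nth)
qed simp

lemma PTW_sums: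
 assumes "PTW W"
 obtains A where "PT (%w e. length (W w))" "PT (%w e. A w (e 0))"
  "!!w p. p < length (W w) ==> dt (W w ! p) = (if A w p div 2 = 0 then sg (A w p) else 0)"
  "!!w c i p. p < length (W w) ==> ut 0 (W w) c i p = (if A w p div 2 = (if c then 2 else 1) \<and>
   i = (\<Sum>q<p. if A w q div 2 = 0 then sg (A w q) else 0) then sg (A w p) else 0)"
proof -
 obtain A where A: "PT (%w e. length (W w))" "PT (%w e. A w (e 0))"
  "ALL w p. p < length (W w) --> A w p = 2 * fst (W w ! p) + of_bool (snd (W w ! p))"
  using assms unfolding PTW_def by blast
 have d: "dt (W w ! p) = (if A w p div 2 = 0 then sg (A w p) else 0)" if "p < length (W w)" for w p
  using sgb_sg[OF A(3)[rule_format, OF that]] by (simp add: dt_def)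
 have u: "ut 0 (W w) c i p = (if A w p div 2 = (if c then 2 else 1) \<and>
   i = (\<Sum>q<p. if A w q div 2 = 0 then sg (A w q) else 0) then sg (A w p) else 0)" if p: "p < length (W w)" for w c i p
 proof -
  have "ht (take p (W w)) = (\<Sum>q<p. if A w q div 2 = 0 then sg (A w q) else 0)"
   using ht_take_sum[of p "W w"] p d by simp
  thus ?thesis using sgb_sg[OF A(3)[rule_format, OF p]] by (simp add: ut_def)
 qed
 show thesis by (rule that[of A]) (fact A(1), fact A(2), fact d, fact u)
qed

lemma PT_app_var: "PT (%w e. A w (e 0)) ==> PT P ==> PT (%w e. A w (P w e))"
 using PT_let[of P "%w e x. A w x"] by simp

lemma PTi_height_sum:
 assumes A: "PT (%w e. A w (e 0))" and P: "PT P"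
 shows "PTi (%w e. \<Sum>q<P w e. if A w q div 2 = 0 then sg (A w q) else 0)"
 by (intro PTi_sum PTi_if PTb_eq PT_div PT_const PTi_sg PTi_const PT_var PT_app_var[OF A] P)

lemma PTi_ht: assumes "PTW W" shows "PTi (%w e. ht (W w))"
proof -
 obtain A where A: "PT (%w e. length (W w))" "PT (%w e. A w (e 0))"
  "!!w p. p < length (W w) ==> dt (W w ! p) = (if A w p div 2 = 0 then sg (A w p) else 0)"
  by (rule PTW_sums[OF assms]) blast
 show ?thesis
 proof (rule PTi_cong[OF PTi_height_sum[OF A(2,1)]])
  show "ht (W w) = (\<Sum>q<length (W w). if A w q div 2 = 0 then sg (A w q) else 0)" for w
   using ht_take_sum[of "length (W w)" "W w"] A(3) by simp
 qed
qed

lemma PTi_cv: assumes "PTW W" "PTi F" shows "PTi (%w e. cv 0 (W w) c (F w e))"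
proof -
 obtain A where A: "PT (%w e. length (W w))" "PT (%w e. A w (e 0))"
  and u: "!!w c i p. p < length (W w) ==> ut 0 (W w) c i p = (if A w p div 2 = (if c then 2 else 1) \<and>
   i = (\<Sum>q<p. if A w q div 2 = 0 then sg (A w q) else 0) then sg (A w p) else 0)"
  by (rule PTW_sums[OF assms(1)]) blast
 show ?thesis
 proof (rule PTi_cong)
  show "PTi (%w e. \<Sum>p<length (W w). if A w p div 2 = (if c then 2 else 1) \<and>
   F w e = (\<Sum>q<p. if A w q div 2 = 0 then sg (A w q) else 0) then sg (A w p) else 0)"
   by (intro PTi_sum A(1) PTi_if PTb_conj PTb_eq PT_div PT_const PTi_sg PTi_const PT_var PT_app_var[OF A(2)] PTb_eq_int
    PTi_rename[OF assms(2)] PTi_height_sum[OF A(2)])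
 qed (simp add: cv_def u)
qed

text \<open>The coordinates are defined by explicit finite sums over positions precisely so that such closure properties apply.\<close>

lemma PTi_cP: assumes "PTW W" "PTi F" "PTi H" shows "PTi (%w e. cP 0 (W w) c c' (F w e) (H w e))"
proof -
 obtain A where A: "PT (%w e. length (W w))" "PT (%w e. A w (e 0))"
  and u: "!!w c i p. p < length (W w) ==> ut 0 (W w) c i p = (if A w p div 2 = (if c then 2 else 1) \<and>
   i = (\<Sum>q<p. if A w q div 2 = 0 then sg (A w q) else 0) then sg (A w p) else 0)"
  by (rule PTW_sums[OF assms(1)]) blast
 define v where "v w c i p = (if A w p div 2 = (if c then 2 else 1) \<and>
   i = (\<Sum>q<p. if A w q div 2 = 0 then sg (A w q) else 0) then sg (A w p) else 0)" for w c i p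
 have v: "PTi (%w e. v w c (F w e) (P w e))" if "PTi F" "PT P" for c F P unfolding v_def
  by (intro PTi_if PTb_conj PTb_eq PT_div PT_const PTi_sg PTi_const PT_app_var[OF A(2)] PTb_eq_int that PTi_height_sum[OF A(2)])
 show ?thesis
 proof (rule PTi_cong)
  show "PTi (%w e. \<Sum>p'<length (W w). \<Sum>p<p'. v w c (F w e) p * v w c' (H w e) p' - v w c' (H w e) p * v w c (F w e) p')"
   by (intro PTi_sum A(1) PTi_diff PTi_mult v PT_var PTi_rename[OF assms(2)] PTi_rename[OF assms(3)])
 qed (simp add: cP_def u v_def)
qed

end

context simulation
begin

context
 fixes q :: "nat list => nat"
 assumes total: "!!n. EX t c. halts_in M (replicate n 1) t c"
  and q: "PT (%w e. q w)" "!!w. q w >= 1"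
begin

text \<open>The truncated exponents depend on the input, through the number \<open>q\<close> that bounds the coefficients.\<close>

definition Xq :: "nat list => nat => nat" where "Xq w r = min (expo M r) (clog (q w))"

lemma expo_pos: "expo M r >= 1"
proof -
 have "good M r (expo M r)" unfolding expo_def using good_exists[OF total] by (rule LeastI_ex)
 thus ?thesis by (simp add: good_def)
qed

lemma ex: "exponents (Xq w)"
 by unfold_locales (use expo_pos clog_pos[OF q(2)] in \<open>simp add: Xq_def\<close>)

lemma PTi_dm: assumes "PTi F" shows "PTi (%w e. exponents.dm (Xq w) 0 (F w e))"
proof (rule PTi_cong)
 show "PTi (%w e. if F w e = 0 then 0 else int (2 ^ min (expo M (if F w e = 0 then 0 else rk (F w e))) (clog (q w))))"
  by (intro PTi_if PTb_eq_int assms PTi_const PTi_int PT_capped_power[OF _ _ total] PT_rk q(1))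
 show "exponents.dm (Xq w) 0 (F w e) = (if F w e = 0 then 0 else int (2 ^ min (expo M (if F w e = 0 then 0 else rk (F w e))) (clog (q w))))" for w e
  by (simp add: exponents.dm_def[OF ex] exponents.D_def[OF ex] Xq_def)
qed

lemma PTi_zz: assumes "PTW W" "PTi F" "PTi H" shows "PTi (%w e. exponents.zz (Xq w) 0 (W w) c (F w e) (H w e))"
 unfolding exponents.zz_def[OF ex]
 by (intro PTi_if PTb_const PTi_add PTi_mult PTi_cP PTi_dm PTi_diff assms)

context
 fixes l :: "nat list => nat" and W W' :: "nat list => word"
 assumes l: "PT (%w e. l w)" and W: "PTW W" "PTW W'"
begin

lemma PTi_dlt: "PTi S ==> PTi F ==> PTi (%w e. exponents.dlt (S w e) (W w) (W' w) c (F w e))"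
 unfolding exponents.dlt_def[OF ex] by (intro PTi_diff PTi_cv W)

lemma PTi_u0:
 assumes "PT N" "PTi S" "PTi F"
 shows "PTi (%w e. exponents.u0 (int (N w e)) (S w e) (W w) (W' w) c (F w e))"
 unfolding exponents.u0_def[OF ex] tel_def
 by (intro PTi_sum_window PTi_mult PTi_of_bool PTb_conj PTb_dvd_int PTb_le_int PTi_dlt PTi_ht W PTi_diff PTi_int PTi_const
  PT_var PT_rename[OF assms(1)] PTi_rename[OF assms(2)] PTi_rename[OF assms(3)] assms(1))

lemma PTi_x1:
 assumes "PT N" "PTi S" "PTi F" "PTi H"
 shows "PTi (%w e. exponents.x1 (Xq w) (int (N w e)) (S w e) (W w) (W' w) c (F w e) (H w e))"
 unfolding exponents.x1_def[OF ex] exponents.om_def[OF ex]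
 by (intro PTi_add PTi_diff PTi_if PTb_const PTi_mult PTi_zz PTi_cv PTi_dm PTi_u0 PTi_ht W assms)

lemma PTb_orbit:
 assumes S: "PTi S"
 shows "PTb (%w e. exponents.orbit_window (Xq w) (l w) (S w e) (W w) (W' w))"
proof -
 have N: "PT (%w e. k * l w)" for k by (intro PT_mult PT_const l)
 have 1: "PTb (%w e. ALL ii. \<bar>ii\<bar> <= int (3 * l w) --> class_sum (int (3 * l w)) (ht (W w)) ii (exponents.dlt (S w e) (W w) (W' w) c) = 0)" for c
  by (intro PTb_all_int N PTb_eq_int PTi_const PTi_sum_window PTi_mult PTi_of_bool PTb_dvd_int PTi_ht W PTi_dlt
   PTi_rename[OF S] PTi_diff PTi_int PT_var)
 have 2: "PTb (%w e. ALL \<kappa>. \<bar>\<kappa>\<bar> <= int (8 * l w) --> (ALL ii. \<bar>ii\<bar> <= int (4 * l w) -->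
   class_sum (int (4 * l w)) (ht (W w)) ii (%i. exponents.x1 (Xq w) (int (3 * l w)) (S w e) (W w) (W' w) c i (i - \<kappa>)) = 0))" for c
  by (intro PTb_all_int N PTb_eq_int PTi_const PTi_sum_window PTi_mult PTi_of_bool PTb_dvd_int PTi_ht W PTi_x1
   PTi_rename[OF S] PTi_diff PTi_int PT_var)
 show ?thesis unfolding exponents.orbit_window_def[OF ex] by (intro PTb_conj PTb_all_bool 1 2)
qed

lemma PTb_omp_eq:
 assumes "PTi S" "PTi F" "PTi H" "!!c. PTi (%w e. p w e c)" "!!c. PTi (%w e. r w e c)"
 shows "PTb (%w e. exponents.zz (Xq w) 0 (W' w) c (F w e) (H w e) - exponents.zz (Xq w) 0 (W w) c (F w e - S w e) (H w e - S w e) =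
  2 * omp (exponents.dm (Xq w) 0 (F w e - H w e)) (p w e) (r w e) (%c. cv 0 (W' w) c (F w e)) (%c. cv 0 (W' w) c (H w e)) c)"
 unfolding omp_def
 by (intro PTb_eq_int PTi_diff PTi_zz W PTi_mult PTi_const PTi_if PTb_const PTi_add PTi_dm PTi_cv assms)

lemma PTb_zero:
 assumes S: "PTi S"
 shows "PTb (%w e. exponents.zero_window (Xq w) (l w) (S w e) (W w) (W' w))"
proof -
 have N: "PT (%w e. k * l w)" for k by (intro PT_mult PT_const l)
 have B: "PT (%w e. 384 * l w ^ 6)" by (intro PT_mult PT_const PT_power l)
 have 1: "PTb (%w e. ALL i. \<bar>i\<bar> <= int (3 * l w) --> cv 0 (W' w) c i = cv 0 (W w) c (i - S w e))" for c
  by (intro PTb_all_int N PTb_eq_int PTi_cv W PTi_diff PTi_int PT_var PTi_rename[OF S])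
 have 2: "PTb (%w e. ALL i. \<bar>i\<bar> <= int (3 * l w) --> cv 0 (W' w) c i = 0)" for c
  by (intro PTb_all_int N PTb_eq_int PTi_cv W PTi_diff PTi_int PT_var PTi_const)
 have 3: "PTb (%w e. ALL i. \<bar>i\<bar> <= int (3 * l w) --> (ALL j. \<bar>j\<bar> <= int (3 * l w) -->
   exponents.zz (Xq w) 0 (W' w) c i j = exponents.zz (Xq w) 0 (W w) c (i - S w e) (j - S w e)))" for c
  by (intro PTb_all_int N PTb_eq_int PTi_zz W PTi_diff PTi_int PT_var PTi_rename[OF S])
 have eqs: "PTb (%w e. (F w e = I w e --> (ALL c. p w e c = p0 w e c)) & (H w e = I w e --> (ALL c. r w e c = p0 w e c)) \<and>
   (ALL b. exponents.zz (Xq w) 0 (W' w) b (F w e) (I w e) - exponents.zz (Xq w) 0 (W w) b (F w e - Y w e) (I w e - Y w e) = 2 * omp (exponents.dm (Xq w) 0 (F w e - I w e)) (p w e) (p0 w e) (%c. cv 0 (W' w) c (F w e)) (%c. cv 0 (W' w) c (I w e)) b \<and>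
     exponents.zz (Xq w) 0 (W' w) b (I w e) (F w e) - exponents.zz (Xq w) 0 (W w) b (I w e - Y w e) (F w e - Y w e) = 2 * omp (exponents.dm (Xq w) 0 (I w e - F w e)) (p0 w e) (p w e) (%c. cv 0 (W' w) c (I w e)) (%c. cv 0 (W' w) c (F w e)) b \<and>
     exponents.zz (Xq w) 0 (W' w) b (H w e) (I w e) - exponents.zz (Xq w) 0 (W w) b (H w e - Y w e) (I w e - Y w e) = 2 * omp (exponents.dm (Xq w) 0 (H w e - I w e)) (r w e) (p0 w e) (%c. cv 0 (W' w) c (H w e)) (%c. cv 0 (W' w) c (I w e)) b \<and>
     exponents.zz (Xq w) 0 (W' w) b (I w e) (H w e) - exponents.zz (Xq w) 0 (W w) b (I w e - Y w e) (H w e - Y w e) = 2 * omp (exponents.dm (Xq w) 0 (I w e - H w e)) (p0 w e) (r w e) (%c. cv 0 (W' w) c (I w e)) (%c. cv 0 (W' w) c (H w e)) b \<and>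
     exponents.zz (Xq w) 0 (W' w) b (F w e) (H w e) - exponents.zz (Xq w) 0 (W w) b (F w e - Y w e) (H w e - Y w e) = 2 * omp (exponents.dm (Xq w) 0 (F w e - H w e)) (p w e) (r w e) (%c. cv 0 (W' w) c (F w e)) (%c. cv 0 (W' w) c (H w e)) b))"
  if "PTi F" "PTi H" "PTi I" "PTi Y" "!!c. PTi (%w e. p w e c)" "!!c. PTi (%w e. r w e c)" "!!c. PTi (%w e. p0 w e c)" for F H I Y p r p0
  by (intro PTb_conj PTb_imp PTb_eq_int[of F] PTb_eq_int[of H] PTb_all_bool PTb_eq_int[of "%w e. p w e _"] PTb_eq_int[of "%w e. r w e _"]
   PTb_omp_eq that)
 show ?thesis unfolding exponents.zero_window_def[OF ex]
  apply (intro PTb_conj PTb_disj PTb_all_bool 1 2 3)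
  apply (rule PTb_ex_int[OF N])
  apply (intro PTb_conj PTb_disj)
   apply (intro PTb_less_int PTi_abs PTi_int N PTi_diff PT_var)
   apply (intro PTb_not PTb_eq_int PTi_cv W PTi_diff PTi_int N PT_var PTi_const)
  apply (intro PTb_all_int PTb_not PTb_eq_int PTi_cv W PTi_diff PTi_int N PT_var PTi_const)
  apply (intro PTb_not PTb_eq_int PTi_cv W PTi_diff PTi_int N PT_var PTi_const)
  apply (rule PTb_ex_int_pair[OF B])
  apply (rule PTb_all_int[OF N])+
  apply (rule PTb_imp, intro PTb_less_int PTi_abs PTi_int N PTi_diff PT_var)+
  apply (rule PTb_ex_int_pair[OF B])+
  apply (rule eqs)
  apply (intro PTi_diff PTi_int PT_var N B PTi_if PTb_const PTi_rename[OF S])+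
  done
qed

lemma PTb_conj_window: "PTb (%w e. exponents.conj_window (Xq w) (l w) (W w) (W' w))"
 unfolding exponents.conj_window_def[OF ex]
 by (intro PTb_conj PTb_eq_int PTi_ht W PTb_ex_int PTb_if PTb_not PTi_const PTb_orbit PTb_zero PT_mult PT_const l PTi_diff PTi_int PT_var)

end

end

end

section \<open>Machines for the conjugacy problem and the word problem\<close>

lemma finite_regs: "finite (regs c)" by (induction c) auto

lemma regs_bound: "EX m. ALL r:regs c. r < m"
 using finite_nat_set_iff_bounded[of "regs c"] finite_regs by blast

lemma compile_ex:
 fixes c :: com and K :: nat
 shows "EX M. (ALL w t x. set w <= {..K} --> psteps w t ([c], 0, %_. 0) x --> pstep w x = None -->
   (EX cf. halts_in M w (Suc t) cf & (accepting cf \<longleftrightarrow> (EX k. fst x = ACC # k)))) \<and>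
  (ALL w t cf. set w <= {..K} --> halts_in M w t cf --> (EX t x. psteps w t ([c], 0, %_. 0) x & pstep w x = None))"
proof -
 obtain m where m: "ALL r:regs c. r < m" using regs_bound by blast
 show ?thesis
 proof (rule compile[of c m K], goal_cases)
  case (1 r) thus ?case using m by blast
 next
  case (2 M)
  show ?case by (rule exI[of _ M], intro conjI allI impI; (rule 2; assumption))
 qed
qed

lemma psteps_prefix: "psteps w (s + t) x z ==> EX y. psteps w s x y & psteps w t y z"
 unfolding psteps_def relpow_add by blast

lemma psteps_det: "psteps w t x y ==> psteps w t x z ==> y = z"
proof -
 have "single_valued ({(x, y). pstep w x = Some y} ^^ t)" by (rule single_valued_relpow) (auto simp: single_valued_def)
 thus "psteps w t x y ==> psteps w t x z ==> y = z" unfolding psteps_def by (meson single_valuedD)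
qed

lemma no_halt: assumes "!!t. EX z. psteps w t x z" shows "~ (psteps w t x z & pstep w z = None)"
proof
 assume z: "psteps w t x z & pstep w z = None"
 obtain z' where "psteps w (t + 1) x z'" using assms by blast
 then obtain y where y: "psteps w t x y" "psteps w 1 y z'" using psteps_prefix by blast
 thus False using psteps_det[of w t x y z] z by (simp add: psteps_1)
qed

lemma loop_runs: "R r ~= 0 ==> EX z. psteps w t ([WHILE r (INC r)], p, R) z"
proof (induction t arbitrary: R rule: less_induct)
 case (less t)
 consider "t = 0" | "t = 1" | u where "t = Suc (Suc u)" by (metis One_nat_def not0_implies_Suc)
 thus ?case
 proof cases
  case 1 thus ?thesis by simp
 next
  case 2
  have "psteps w 1 ([WHILE r (INC r)], p, R) ([INC r, WHILE r (INC r)], p, R)"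
   unfolding One_nat_def psteps_1 using less.prems by (simp add: pstep_def)
  thus ?thesis unfolding 2 by blast
 next
  case 3
  have "u < t" "(R(r := Suc (R r))) r ~= 0" using 3 by simp_all
  then obtain z where z: "psteps w u ([WHILE r (INC r)], p, R(r := Suc (R r))) z" using less.IH by blast
  have "psteps w 1 (INC r # [WHILE r (INC r)], p, R) ([WHILE r (INC r)], p, R(r := Suc (R r)))"
   unfolding One_nat_def psteps_1 by (auto simp: pstep_def fun_eq_iff nat_add_distrib)
  from psteps_add[OF this z] have "psteps w (Suc u) (INC r # [WHILE r (INC r)], p, R) z" by simp
  hence "psteps w (Suc (Suc u)) ([WHILE r (INC r)], p, R) z"
   by (rule psteps_first[rotated]) (use less.prems in \<open>simp add: pstep_def\<close>)
  thus ?thesis using 3 by blast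
 qed
qed

context alphabet
begin

lemma PTb_program:
 assumes "PTb (%w e. P w)"
 shows "EX C c. ALL w. set w <= {1..K} --> runs w C ((length w + 2) ^ c) (0, %_. 0) (0, (%_. 0)(1 := of_bool (P w)))"
proof -
 obtain C where "computes C (%_. 0) 1 (%w e. of_bool (P w))" using PT_computes[OF assms, of "%_. 0" 1] by auto
 then obtain c where c: "ALL w n R. adm w n --> (ALL v::nat. R 0 <= n) --> (\<forall>r\<ge>1. R r = 0) -->
  runs w C (n ^ c) (0, R) (0, R(1 := of_bool (P w)))" unfolding computes_def by blast
 show ?thesis
 proof (rule exI[of _ C], rule exI[of _ c], intro allI impI)
  fix w :: "nat list" assume "set w <= {1..K}"
  hence "adm w (length w + 2)" by (simp add: adm_def)
  thus "runs w C ((length w + 2) ^ c) (0, %_. 0) (0, (%_. 0)(1 := of_bool (P w)))"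
   using c by auto
 qed
qed

theorem PTb_decider:
 assumes "PTb (%w e. P w)"
 shows "\<exists>M (p :: nat poly). ALL w. set w <= {1..K} -->
  (EX t c. halts_in M w t c & t <= poly p (length w) & (accepting c \<longleftrightarrow> P w))"
proof -
 obtain C c where C: "ALL w. set w <= {1..K} --> runs w C ((length w + 2) ^ c) (0, %_. 0) (0, (%_. 0)(1 := of_bool (P w)))"
  using PTb_program[OF assms] by blast
 let ?c = "SEQ C (WHILE 1 ACC)"
 obtain M where M: "ALL w t x. set w <= {..K} --> psteps w t ([?c], 0, %_. 0) x --> pstep w x = None -->
   (EX cf. halts_in M w (Suc t) cf & (accepting cf \<longleftrightarrow> (EX k. fst x = ACC # k)))"
  using compile_ex[of K ?c] by blast
 have "EX t cf. halts_in M w t cf & t <= poly ([:2, 1:] ^ c + [:3:]) (length w) & (accepting cf \<longleftrightarrow> P w)" if w: "set w <= {1..K}" for w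
 proof -
  obtain t where t: "t <= (length w + 2) ^ c" "ALL k. psteps w t (C # k, 0, %_. 0) (k, 0, (%_. 0)(1 := of_bool (P w)))"
   using C w unfolding runs_def by blast
  define R :: "nat => nat" where "R = (%_. 0)(1 := of_bool (P w))"
  define x :: pconf where "x = (if P w then [ACC, WHILE 1 ACC] else [], 0, R)"
  have "psteps w (t + 1) ([C, WHILE 1 ACC], 0, %_. 0) x"
  proof (rule psteps_add)
   show "psteps w t ([C, WHILE 1 ACC], 0, %_. 0) ([WHILE 1 ACC], 0, R)" using t(2) by (simp add: R_def)
   show "psteps w 1 ([WHILE 1 ACC], 0, R) x" unfolding One_nat_def psteps_1 by (simp add: pstep_def x_def R_def)
  qed
  hence "psteps w (Suc (t + 1)) ([?c], 0, %_. 0) x" by (rule psteps_first[rotated]) (simp add: pstep_def)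
  moreover have "pstep w x = None" by (simp add: x_def pstep_def)
  moreover have "set w <= {..K}" using w by auto
  ultimately obtain cf where cf: "halts_in M w (Suc (Suc (t + 1))) cf" "accepting cf \<longleftrightarrow> (EX k. fst x = ACC # k)"
   using M by blast
  moreover have "Suc (Suc (t + 1)) <= poly ([:2, 1:] ^ c + [:3:]) (length w)" using t(1) by (simp add: poly_power add.commute)
  moreover have "(EX k. fst x = ACC # k) \<longleftrightarrow> P w" by (simp add: x_def)
  ultimately show ?thesis by blast
 qed
 thus ?thesis by blast
qed

text \<open>Run the decision program and then loop if the answer is negative.\<close>

theorem PTb_semidecider:
 assumes "PTb (%w e. P w)"
 shows "EX M. ALL w. set w <= {1..K} --> (P w \<longleftrightarrow> (EX t c. halts_in M w t c))"
proof -
 have "PTb (%w e. ~ P w)" using assms by (rule PTb_not)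
 from PTb_program[OF this] obtain C c
  where C: "ALL w. set w <= {1..K} --> runs w C ((length w + 2) ^ c) (0, %_. 0) (0, (%_. 0)(1 := of_bool (~ P w)))"
  by blast
 let ?c = "SEQ C (WHILE 1 (INC 1))"
 obtain M where M: "ALL w t x. set w <= {..K} --> psteps w t ([?c], 0, %_. 0) x --> pstep w x = None -->
   (EX cf. halts_in M w (Suc t) cf & (accepting cf \<longleftrightarrow> (EX k. fst x = ACC # k)))"
  and M': "ALL w t cf. set w <= {..K} --> halts_in M w t cf --> (EX t x. psteps w t ([?c], 0, %_. 0) x & pstep w x = None)"
  using compile_ex[of K ?c] by blast
 have "P w \<longleftrightarrow> (EX t c. halts_in M w t c)" if w: "set w <= {1..K}" for w
 proof -
  have wK: "set w <= {..K}" using w by auto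
  obtain t where t: "ALL k. psteps w t (C # k, 0, %_. 0) (k, 0, (%_. 0)(1 := of_bool (~ P w)))"
   using C w unfolding runs_def by blast
  define R :: "nat => nat" where "R = (%_. 0)(1 := of_bool (~ P w))"
  have "psteps w t ([C, WHILE 1 (INC 1)], 0, %_. 0) ([WHILE 1 (INC 1)], 0, R)" using t by (simp add: R_def)
  hence st: "psteps w (Suc t) ([?c], 0, %_. 0) ([WHILE 1 (INC 1)], 0, R)"
   by (rule psteps_first[rotated]) (simp add: pstep_def)
  show ?thesis
  proof (cases "P w")
   case True
   hence "psteps w (Suc 0) ([WHILE 1 (INC 1)], 0, R) ([], 0, R)" unfolding psteps_1 by (simp add: pstep_def R_def)
   from psteps_add[OF st this] have "EX cf. halts_in M w (Suc (Suc t + Suc 0)) cf & (accepting cf \<longleftrightarrow> (EX k. fst ([] :: com list, 0 :: int, R) = ACC # k))"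
    by (rule M[rule_format, OF wK]) (simp add: pstep_def)
   thus ?thesis using True by blast
  next
   case False
   have "EX z. psteps w u ([?c], 0, %_. 0) z" for u
   proof -
    have "R 1 ~= 0" using False by (simp add: R_def)
    then obtain z where "psteps w u ([WHILE 1 (INC 1)], 0, R) z" using loop_runs by blast
    from psteps_add[OF st this] have "psteps w (u + Suc t) ([?c], 0, %_. 0) z" by (simp add: add.commute)
    thus ?thesis using psteps_prefix by blast
   qed
   hence "~ (psteps w u ([?c], 0, %_. 0) z & pstep w z = None)" for u z by (rule no_halt)
   thus ?thesis using M' wK False by blast
  qed
 qed
 thus ?thesis by blast
qed

subsection \<open>Substituting words for letters\<close>

text \<open>A finite table is a nested case distinction.\<close>

lemma PT_table: assumes "PT N" shows "PT (%w e. if N w e < m then f (N w e) else d)"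
proof (induction m)
 case (Suc m)
 have "PT (%w e. if N w e = m then f m else if N w e < m then f (N w e) else d)"
  by (intro PT_if PTb_eq assms PT_const Suc)
 thus ?case by (rule PT_cong) (auto simp: less_Suc_eq)
qed (simp add: PT_const)

text \<open>All words \<open>\<tau> x\<close> have the same positive length, so the letter at a given position is found by division.\<close>

definition subst_word :: "nat => (nat => word) => (nat list => nat) => (nat list => nat) => nat list => word" where
 "subst_word L \<tau> off len w = concat (map \<tau> (map (%p. sym w (off w + p)) [0..<len w]))"

lemma concat_uniform: "(!!x. length (\<tau> x) = L) ==> length (concat (map \<tau> xs)) = L * length xs \<and>
 (\<forall>p < L * length xs. concat (map \<tau> xs) ! p = \<tau> (xs ! (p div L)) ! (p mod L))"
proof (induction xs)
 case (Cons x xs)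
 have "(\<tau> x @ concat (map \<tau> xs)) ! p = \<tau> ((x # xs) ! (p div L)) ! (p mod L)" if "p < L + L * length xs" for p
 proof (cases "p < L")
  case False
  then obtain r where p: "p = L + r" "r < L * length xs" using \<open>p < L + L * length xs\<close> le_Suc_ex[of L p] by auto
  hence "L > 0" by (cases L) auto
  thus ?thesis using Cons p by (simp add: nth_append)
 qed (use Cons.prems in \<open>simp add: nth_append\<close>)
 thus ?case using Cons by simp
qed simp

lemma PTW_subst:
 assumes off: "PT (%w e. off w)" and len: "PT (%w e. len w)" and L: "!!x. length (\<tau> x) = L" "L > 0"
  and big: "!!x. x > m ==> \<tau> x = \<tau> (Suc m)"
 shows "PTW (subst_word L \<tau> off len)"
proof -
 define f where "f n = (let y = \<tau> (n div L) ! (n mod L) in 2 * fst y + of_bool (snd y))" for n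
 define A where "A w p = (let n = min (sym w (off w + p div L)) (Suc m) * L + p mod L in if n < Suc (Suc m) * L then f n else 0)" for w p
 have A: "PT (%w e. A w (e 0))" unfolding A_def Let_def
  by (intro PT_table PT_add PT_mult PT_min PT_sym PT_div PT_mod PT_var PT_const off)
 have l: "length (subst_word L \<tau> off len w) = L * len w" for w
  using concat_uniform[of \<tau> L, OF L(1)] by (simp add: subst_word_def del: map_map)
 show ?thesis unfolding PTW_def l
 proof (intro conjI exI[of _ A] allI impI A PT_mult PT_const len)
  fix w p assume p: "p < L * len w"
  define x where "x = sym w (off w + p div L)"
  have pd: "p div L < len w" using p L(2) by (simp add: less_mult_imp_div_less mult.commute)
  have "subst_word L \<tau> off len w ! p = \<tau> x ! (p mod L)"
   using concat_uniform[of \<tau> L "map (%p. sym w (off w + p)) [0..<len w]", OF L(1)] p pd by (simp add: subst_word_def x_def del: map_map)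
  also have "\<tau> x = \<tau> (min x (Suc m))" using big[of x] by (cases "x > m") (auto simp: min_def)
  finally have e: "subst_word L \<tau> off len w ! p = \<tau> (min x (Suc m)) ! (p mod L)" .
  have pm: "p mod L < L" using L(2) by simp
  define n where "n = min x (Suc m) * L + p mod L"
  have n: "n div L = min x (Suc m)" "n mod L = p mod L" using pm by (simp_all add: n_def)
  have "n < Suc (min x (Suc m)) * L" using pm by (simp add: n_def)
  also have "... <= Suc (Suc m) * L" by (rule mult_le_mono1) simp
  finally have "n < Suc (Suc m) * L" .
  hence "A w p = f n" by (simp add: A_def x_def[symmetric] n_def[symmetric] Let_def del: mult_Suc)
  thus "A w p = 2 * fst (subst_word L \<tau> off len w ! p) + of_bool (snd (subst_word L \<tau> off len w ! p))"
   by (simp add: f_def n e Let_def)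
 qed
qed

text \<open>The position of the separator 1, or the length of the input if there is none; in the latter case the second word is empty.\<close>

definition sep :: "nat list => nat" where
 "sep w = (\<Sum>p<length w. of_bool (\<forall>q<Suc p. sym w q ~= 1))"

lemma PT_sep: "PT (%w e. sep w)"
 unfolding sep_def by (intro PT_sum PT_length PTb_all PT_Suc PT_var PTb_not PTb_eq PT_sym PT_const)

lemma sep_eq: assumes "1 \<notin> set u" shows "sep (u @ 1 # v) = length u" "sep u = length u"
proof -
 have "sep w = length u" if "length u <= length w" "!!p. p < length u ==> sym w p ~= 1" "length u < length w ==> sym w (length u) = 1" for w
 proof -
  have "{p : {..<length w}. \<forall>q<Suc p. sym w q ~= 1} = {..<length u}"
  proof (rule equalityI; rule subsetI)
   fix p assume p: "p : {p : {..<length w}. \<forall>q<Suc p. sym w q ~= 1}"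
   show "p : {..<length u}"
   proof (rule ccontr)
    assume "p \<notin> {..<length u}"
    hence "length u < Suc p" "length u < length w" using p by auto
    thus False using p that(3) by auto
   qed
  next
   fix p assume "p : {..<length u}"
   thus "p : {p : {..<length w}. \<forall>q<Suc p. sym w q ~= 1}" using that(1,2) by auto
  qed
  thus ?thesis by (simp add: sep_def sum_of_bool_eq Int_def)
 qed
 moreover have "u ! p ~= 1" if "p < length u" for p using assms nth_mem[OF that] by metis
 ultimately show "sep (u @ 1 # v) = length u" "sep u = length u" by (auto simp: sym_def nth_append)
qed

lemma subst_word_parts:
 assumes "1 \<notin> set u"
 shows "subst_word L \<tau> (%w. 0) sep (u @ 1 # v) = concat (map \<tau> u)"
  "subst_word L \<tau> (%w. Suc (sep w)) (%w. length w - Suc (sep w)) (u @ 1 # v) = concat (map \<tau> v)"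
  "subst_word L \<tau> (%w. 0) sep u = concat (map \<tau> u)"
  "subst_word L \<tau> (%w. Suc (sep w)) (%w. length w - Suc (sep w)) u = []"
proof -
 have 1: "map (%p. sym (u @ 1 # v) (0 + p)) [0..<length u] = u" "map (%p. sym u (0 + p)) [0..<length u] = u"
  by (rule nth_equalityI; simp add: sym_def nth_append)+
 have 2: "map (%p. sym (u @ 1 # v) (Suc (length u) + p)) [0..<length v] = v"
  by (rule nth_equalityI; simp add: sym_def nth_append)
 show "subst_word L \<tau> (%w. 0) sep (u @ 1 # v) = concat (map \<tau> u)"
  "subst_word L \<tau> (%w. Suc (sep w)) (%w. length w - Suc (sep w)) (u @ 1 # v) = concat (map \<tau> v)"
  "subst_word L \<tau> (%w. 0) sep u = concat (map \<tau> u)"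
  "subst_word L \<tau> (%w. Suc (sep w)) (%w. length w - Suc (sep w)) u = []"
  unfolding subst_word_def sep_eq[OF assms] using 1 2 by simp_all
qed

end

section \<open>The presentation\<close>

context exponents
begin

lemma code_filter: "\<kappa> (filter (%x. fst x < 3) u) = \<kappa> u"
proof (induction u)
 case (Cons x u)
 have e: "\<kappa> (x # v) = \<kappa> [x] \<otimes>\<^bsub>G\<^esub> \<kappa> v" for v by simp
 show ?case
 proof (cases "fst x < 3")
  case True thus ?thesis using Cons e[of u] e[of "filter (%x. fst x < 3) u"] by simp
 next
  case False
  hence "\<kappa> [x] = \<kappa> []" using code_letter[of "fst x" "snd x"] by (simp add: one_code)
  hence "\<kappa> (x # u) = \<kappa> ([] @ u)" using e[of u] mult_code[of "[]" u] by metis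
  thus ?thesis using False Cons by simp
 qed
qed simp

lemma words_append [simp]: "u @ v : words k \<longleftrightarrow> u : words k & v : words k"
 by (auto simp: words_def)

lemma words_simps [simp]: "[] : words k" "x # u : words k \<longleftrightarrow> fst x < k & u : words k"
 by (cases x, auto simp: words_def)+

lemma words_invw [simp]: "u : words k ==> invw u : words k"
 by (induction u) auto

lemma carrier_words: assumes "g : carrier G" obtains u where "u : words 3" "\<kappa> u = g"
proof -
 obtain w where "g = \<kappa> w" using assms by (auto simp: carrier_code)
 moreover have "filter (%x. fst x < 3) w : words 3" by (induction w) auto
 ultimately show thesis using that code_filter by blast
qed

text \<open>An economical choice of relators would gain nothing: only the enumerability of the set matters.\<close>

definition relators :: "word set" where "relators = {w : words 3. \<kappa> w = \<kappa> []}"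

lemma cancel_word: "u : words k ==> w : words k ==> v : words k ==> (u @ invw w @ w @ v, u @ v) : pres_eq k R"
proof (induction w)
 case (Cons x w)
 have "((u @ invw w) @ [(fst x, ~ snd x), (fst x, ~ ~ snd x)] @ w @ v, (u @ invw w) @ w @ v) : pres_eq k R"
  by (rule pres_eq.cancel) (use Cons.prems in simp_all)
 hence "(u @ invw (x # w) @ (x # w) @ v, u @ invw w @ w @ v) : pres_eq k R" by simp
 thus ?case using Cons by (auto intro: pres_eq.trans)
qed (simp add: pres_eq.refl)

text \<open>Two words are equal in the presented group if their quotient is a relator: insert \<open>u\<inverse> u\<close>, which is an equality by free cancellation, and delete the relator.\<close>

lemma pres_eq_iff: "(u, v) : pres_eq 3 relators \<longleftrightarrow> u : words 3 & v : words 3 & \<kappa> u = \<kappa> v"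
proof
 interpret group G by (rule group)
 assume "(u, v) : pres_eq 3 relators"
 thus "u : words 3 & v : words 3 & \<kappa> u = \<kappa> v"
 proof (induction rule: pres_eq.induct)
  case (cancel u v i b)
  have "E (u @ [(i, b)] @ invw [(i, b)] @ v) (u @ v)" by (rule E_insert)
  thus ?case using cancel by (simp add: code_eq_iff)
 next
  case (relator u v r)
  hence "\<kappa> r = \<one>\<^bsub>G\<^esub>" by (simp add: relators_def one_code)
  hence "\<kappa> u \<otimes>\<^bsub>G\<^esub> (\<kappa> r \<otimes>\<^bsub>G\<^esub> \<kappa> v) = \<kappa> u \<otimes>\<^bsub>G\<^esub> \<kappa> v" by (metis l_one code_carrier)
  thus ?case using relator by simp
 qed auto
next
 interpret group G by (rule group)
 assume a: "u : words 3 & v : words 3 & \<kappa> u = \<kappa> v"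
 have "\<kappa> (u @ invw v) = \<kappa> v \<otimes>\<^bsub>G\<^esub> inv\<^bsub>G\<^esub> \<kappa> v" using a mult_code[of u "invw v"] by simp
 also have "... = \<kappa> []" using r_inv[OF code_carrier[of v]] by (simp only: one_code)
 finally have "u @ invw v : relators" using a by (simp add: relators_def)
 hence "([] @ (u @ invw v) @ v, [] @ v) : pres_eq 3 relators" by (intro pres_eq.relator) (use a in auto)
 moreover have "(u @ invw v @ v @ [], u @ []) : pres_eq 3 relators" by (rule cancel_word) (use a in auto)
 ultimately show "(u, v) : pres_eq 3 relators" by (auto intro: pres_eq.sym pres_eq.trans)
qed

lemma presentation: "G \<cong> presented_group 3 relators"
proof -
 define \<phi> where "\<phi> g = {w : words 3. \<kappa> w = g}" for g
 have cls: "pres_eq 3 relators `` {u} = \<phi> (\<kappa> u)" if "u : words 3" for u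
  using that by (auto simp: pres_eq_iff \<phi>_def)
 have "\<phi> : iso G (presented_group 3 relators)"
  unfolding iso_def
 proof (intro CollectI conjI homI)
  show "\<phi> g : carrier (presented_group 3 relators)" if g: "g : carrier G" for g
  proof -
   obtain u where "u : words 3" "\<kappa> u = g" using carrier_words[OF g] .
   thus ?thesis using cls by (auto simp: presented_group_def quotient_def)
  qed
  show "\<phi> (g \<otimes>\<^bsub>G\<^esub> h) = \<phi> g \<otimes>\<^bsub>presented_group 3 relators\<^esub> \<phi> h" if g: "g : carrier G" and h: "h : carrier G" for g h
  proof -
   obtain u where u: "u : words 3" "\<kappa> u = g" using carrier_words[OF g] .
   obtain v where v: "v : words 3" "\<kappa> v = h" using carrier_words[OF h] .
   have "pres_eq 3 relators `` {a @ b} = \<phi> (g \<otimes>\<^bsub>G\<^esub> h)" if "a : \<phi> g" "b : \<phi> h" for a b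
    using that cls[of "a @ b"] mult_code[of a b] by (auto simp: \<phi>_def)
   moreover have "u : \<phi> g" "v : \<phi> h" using u v by (auto simp: \<phi>_def)
   ultimately show ?thesis by (auto simp: presented_group_def)
  qed
  show "bij_betw \<phi> (carrier G) (carrier (presented_group 3 relators))"
   unfolding bij_betw_def
  proof
   show "inj_on \<phi> (carrier G)"
   proof (rule inj_onI)
    fix g h assume g: "g : carrier G" and "h : carrier G" and eq: "\<phi> g = \<phi> h"
    obtain u where "u : words 3" "\<kappa> u = g" using carrier_words[OF g] .
    hence "u : \<phi> h" using eq by (auto simp: \<phi>_def)
    thus "g = h" using \<open>\<kappa> u = g\<close> by (simp add: \<phi>_def)
   qed
   show "\<phi> ` carrier G = carrier (presented_group 3 relators)"
   proof
    show "\<phi> ` carrier G <= carrier (presented_group 3 relators)"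
    proof (rule image_subsetI)
     fix g assume g: "g : carrier G"
     obtain u where "u : words 3" "\<kappa> u = g" using carrier_words[OF g] .
     thus "\<phi> g : carrier (presented_group 3 relators)" using cls by (auto simp: presented_group_def quotient_def)
    qed
    show "carrier (presented_group 3 relators) <= \<phi> ` carrier G"
     using cls by (auto simp: presented_group_def quotient_def)
   qed
  qed
 qed
 thus ?thesis by (auto simp: is_iso_def)
qed

end

lemma set_encode: "u : words k ==> set (encode u) <= {2..2 * k + 1}"
 by (fastforce simp: encode_def words_def)

context simulation
begin

text \<open>Let \<open>\<tau>\<close> replace each input symbol by a word for the corresponding generator. Padding with the trivial letter 3 makes these words equally long. The same predicate covers
an input without separator, where it decides conjugacy to 1, that is, the word problem.\<close>

lemma conj_decidable:
 fixes gs :: "nat list"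
 assumes total: "!!n. EX t c. halts_in M (replicate n 1) t c"
 defines "H \<equiv> word_group (exponents.eqm (expo M) 0 0)"
 assumes gs: "set gs <= carrier H"
 obtains P where "PTb (%w e. P w)"
  "!!u v. u : words (length gs) ==> v : words (length gs) ==>
   P (encode u @ 1 # encode v) \<longleftrightarrow> conjugate H (eval_word H gs u) (eval_word H gs v)"
  "!!u. u : words (length gs) ==> P (encode u) \<longleftrightarrow> conjugate H (eval_word H gs u) \<one>\<^bsub>H\<^esub>"
proof -
 have e: "exponents (expo M)" by unfold_locales (rule expo_pos[where q = "%_. 1", OF total PT_const], simp)
 interpret exponents "expo M" by (rule e)
 have H: "H = G" by (simp add: H_def)
 define k where "k = length gs"
 have "ALL i. EX s. i < k --> \<kappa> s = gs ! i"
 proof (intro allI)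
  fix i show "EX s. i < k --> \<kappa> s = gs ! i"
  proof (cases "i < k")
   case True
   hence "gs ! i : range \<kappa>" using gs nth_mem[of i gs] by (auto simp: H carrier_code k_def)
   then obtain s where "gs ! i = \<kappa> s" by (rule rangeE)
   thus ?thesis by (intro exI[of _ s]) simp
  qed simp
 qed
 then obtain \<sigma> where \<sigma>: "!!i. i < k ==> \<kappa> (\<sigma> i) = gs ! i" by metis
 \<comment> \<open>Any common bound for the lengths of the words \<open>\<sigma> i\<close>; the successor makes it positive.\<close>
 define L where "L = Suc (\<Sum>i<k. length (\<sigma> i))"
 have \<sigma>L: "length (\<sigma> i) <= L" if "i < k" for i using member_le_sum[of i "{..<k}" "%i. length (\<sigma> i)"] that by (simp add: L_def)
 define base where "base x = (if 2 <= x & x <= 2 * k + 1 then if odd x then \<sigma> ((x - 2) div 2) else invw (\<sigma> ((x - 2) div 2)) else [])" for x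
 define \<tau> where "\<tau> x = base x @ replicate (L - length (base x)) (3, True)" for x
 have \<tau>L: "length (\<tau> x) = L" for x
 proof -
  have "(x - 2) div 2 < k" if "2 <= x" "x <= 2 * k + 1" using that by presburger
  hence "length (base x) <= L" using \<sigma>L by (auto simp: base_def)
  thus ?thesis by (simp add: \<tau>_def)
 qed
 have L0: "L > 0" by (simp add: L_def)
 have big: "\<tau> x = \<tau> (Suc (2 * k + 1))" if "x > 2 * k + 1" for x using that by (simp add: \<tau>_def base_def)
 interpret grp: group G by (rule group)
 have pad: "\<kappa> (u @ replicate n (3, True)) = \<kappa> u" for u n
 proof (induction n)
  case (Suc n)
  have "\<kappa> (u @ replicate (Suc n) (3, True)) = \<kappa> ((u @ replicate n (3, True)) @ [(3, True)])"
   by (simp add: replicate_append_same)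
  also have "... = \<kappa> (u @ replicate n (3, True)) \<otimes>\<^bsub>G\<^esub> \<kappa> [(3, True)]" by (rule mult_code[symmetric])
  also have "... = \<kappa> u" unfolding Suc code_letter by (simp add: grp.r_one[OF code_carrier])
  finally show ?case .
 qed simp
 have "\<kappa> (\<tau> (2 + 2 * i + of_bool b)) = (if b then gs ! i else inv\<^bsub>G\<^esub> (gs ! i))" if "i < k" for i b
  using that \<sigma>[OF that] pad by (auto simp: \<tau>_def base_def simp flip: inv_code)
 hence ev: "\<kappa> (concat (map \<tau> (encode u))) = eval_word G gs u" if "u : words k" for u
  using that
 proof (induction u)
  case (Cons x u)
  obtain i b where x: "x = (i, b)" by (cases x)
  have "\<kappa> (concat (map \<tau> (encode (x # u)))) = \<kappa> (\<tau> (2 + 2 * i + of_bool b)) \<otimes>\<^bsub>G\<^esub> \<kappa> (concat (map \<tau> (encode u)))"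
   unfolding mult_code by (simp add: encode_def x)
  also have "... = (if b then gs ! i else inv\<^bsub>G\<^esub> (gs ! i)) \<otimes>\<^bsub>G\<^esub> eval_word G gs u"
  proof -
   have "i < k" "u : words k" using Cons.prems(2) by (simp_all add: x)
   thus ?thesis using Cons.prems(1) Cons.IH by simp
  qed
  also have "... = eval_word G gs (x # u)" by (simp add: eval_word_def x)
  finally show ?case .
 qed (simp add: encode_def eval_word_def one_code)
 define W W' where "W = subst_word L \<tau> (%w. 0) sep" and "W' = subst_word L \<tau> (%w. Suc (sep w)) (%w. length w - Suc (sep w))"
 have PW: "PTW W" unfolding W_def
  by (rule PTW_subst[where m = "2 * k + 1"], rule PT_0, rule PT_sep, rule \<tau>L, rule L0, rule big)
 have Pd: "PT (%w e. length w - Suc (sep w))" by (intro PT_diff PT_length PT_Suc PT_sep)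
 have PW': "PTW W'" unfolding W'_def
  by (rule PTW_subst[where m = "2 * k + 1"], rule PT_Suc[OF PT_sep], rule Pd, rule \<tau>L, rule L0, rule big)
 define l where "l w = L * length w + 1" for w :: "nat list"
 \<comment> \<open>The bound for the coefficients in \<open>capped_conj_crit\<close>.\<close>
 define q where "q w = 2000 * l w ^ 7" for w
 have Pl: "PT (%w e. l w)" unfolding l_def by (intro PT_add PT_mult PT_const PT_length)
 have Pq: "PT (%w e. q w)" unfolding q_def by (intro PT_mult PT_power PT_const Pl)
 have l1: "l w >= 1" for w by (simp add: l_def)
 have q1: "q w >= 1" for w using l1[of w] by (simp add: q_def Suc_le_eq)
 define P where "P w = exponents.conj_window (Xq q w) (l w) (W w) (W' w)" for w
 have PP: "PTb (%w e. P w)" unfolding P_def by (rule PTb_conj_window[OF total Pq q1 Pl PW PW'])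
 have crit: "P w \<longleftrightarrow> conjugate G (\<kappa> (W w)) (\<kappa> (W' w))" for w
 proof -
  have "sep w <= length w" using sum_bounded_above[of "{..<length w}" "%p. of_bool (\<forall>q<Suc p. sym w q ~= 1)" "1::nat"] by (simp add: sep_def)
  hence len: "length (W w) <= l w" "length (W' w) <= l w"
   using concat_uniform[of \<tau> L, OF \<tau>L] by (simp_all add: W_def W'_def subst_word_def l_def le_SucI del: map_map)
  have len': "int (length (W w)) <= int (l w)" "int (length (W' w)) <= int (l w)" "int (l w) >= 1" using len l1[of w] by simp_all
  have "P w \<longleftrightarrow> exponents.conj_crit (Xq q w) (int (l w)) (W w) (W' w)"
   unfolding P_def by (rule exponents.conj_window[OF ex[OF total Pq q1] len l1, symmetric])
  also have "Xq q w = (%r. min (expo M r) (clog (q w)))" by (rule ext) (simp add: Xq_def[OF total Pq q1])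
  also have "exponents.conj_crit (%r. min (expo M r) (clog (q w))) (int (l w)) (W w) (W' w) \<longleftrightarrow> conj_crit (int (l w)) (W w) (W' w)"
  proof (rule capped_conj_crit[OF _ len'])
   show "clog (q w) >= 1" by (rule clog_pos[OF q1])
   have "int (q w) < int (2 ^ clog (q w))" using clog(1)[of "q w"] by (simp only: of_nat_less_iff)
   thus "2000 * int (l w) ^ 7 < 2 ^ clog (q w)" by (simp add: q_def)
  qed
  also have "... \<longleftrightarrow> conjugate G (\<kappa> (W w)) (\<kappa> (W' w))" by (rule conj_crit[OF len', symmetric])
  finally show ?thesis .
 qed
 show thesis
 proof (rule that[OF PP])
  fix u v assume u: "u : words (length gs)" and v: "v : words (length gs)"
  have n1: "1 \<notin> set (encode u)" using set_encode[OF u] by auto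
  show "P (encode u @ 1 # encode v) \<longleftrightarrow> conjugate H (eval_word H gs u) (eval_word H gs v)"
   unfolding crit W_def W'_def subst_word_parts[OF n1] using ev u v by (simp add: k_def H)
 next
  fix u assume u: "u : words (length gs)"
  have n1: "1 \<notin> set (encode u)" using set_encode[OF u] by auto
  show "P (encode u) \<longleftrightarrow> conjugate H (eval_word H gs u) \<one>\<^bsub>H\<^esub>"
   unfolding crit W_def W'_def subst_word_parts[OF n1] using ev u by (simp add: k_def H one_code)
 qed
qed

end

section \<open>The family of groups\<close>

lemma halts_in_unique: "halts_in M w t c ==> halts_in M w t' c' ==> t <= t' ==> t = t' & c = c'"
proof -
 let ?R = "step_rel M"
 assume a: "halts_in M w t c" "halts_in M w t' c'" and le: "t <= t'"
 hence "(init_config M w, c') : ?R ^^ t O ?R ^^ (t' - t)" unfolding relpow_add[symmetric] by (simp add: halts_in_def)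
 then obtain d where d: "(init_config M w, d) : ?R ^^ t" "(d, c') : ?R ^^ (t' - t)" by blast
 have "single_valued (?R ^^ t)" by (rule single_valued_relpow) (auto simp: single_valued_def)
 hence dc: "d = c" using d(1) a(1) unfolding halts_in_def by (meson single_valuedD)
 have "t' - t = 0"
 proof (rule ccontr)
  assume "t' - t ~= 0"
  then obtain y where "t' - t = Suc y" by (cases "t' - t") auto
  then obtain z where "(d, z) : ?R" using relpow_Suc_D2 d(2) by metis
  thus False using a(1) dc by (simp add: halts_in_def)
 qed
 thus ?thesis using d(2) dc le by simp
qed

lemma tm_step_support:
 assumes "tm_step M c = Some c'" "snd c ~= []" "finite {i. hd (snd c) i ~= 0}"
 shows "snd c' ~= [] & finite {i. hd (snd c') i ~= 0} & card {i. hd (snd c') i ~= 0} <= Suc (card {i. hd (snd c) i ~= 0})"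
proof -
 obtain q acts q' where r: "find (applicable c) (rules M) = Some (q, acts, q')"
  and c': "c' = (q', map2 (%(_, b, m) t. shift_tape m (t(0 := b))) acts (snd c))"
  using assms(1) unfolding tm_step_def by (auto split: option.splits)
 hence "applicable c (q, acts, q')" by (auto simp: find_Some_iff)
 hence "map fst acts = map (%t. t 0) (snd c)" by (simp add: applicable_def)
 hence "length acts = length (snd c)" using map_eq_imp_length_eq by blast
 then obtain a b m as t ts where x: "acts = (a, b, m) # as" "snd c = t # ts"
  using assms(2) by (cases acts; cases "snd c") auto
 define s where "s = {i. t i ~= 0}"
 have s: "finite s" using assms(3) by (simp add: x s_def)
 have sub: "{i. shift_tape m (t(0 := b)) i ~= 0} <= (%i. i - shift_num m) ` insert 0 s"
 proof (rule subsetI)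
  fix i assume "i : {i. shift_tape m (t(0 := b)) i ~= 0}"
  moreover have "shift_tape m u i = u (i + shift_num m)" for u by (cases m) simp_all
  ultimately have "i + shift_num m : insert 0 s" by (auto simp: s_def split: if_splits)
  thus "i : (%i. i - shift_num m) ` insert 0 s" by (intro image_eqI[of _ _ "i + shift_num m"]) simp_all
 qed
 have fin: "finite (insert 0 s)" using s by simp
 have A: "finite {i. shift_tape m (t(0 := b)) i ~= 0}" "card {i. shift_tape m (t(0 := b)) i ~= 0} <= card (insert 0 s)"
  using finite_surj[OF fin sub] surj_card_le[OF fin sub] by blast+
 have B: "card (insert 0 s) <= Suc (card s)" by (rule card_insert_le_m1[of "Suc (card s)" s, simplified])
 have C: "hd (snd c') = shift_tape m (t(0 := b))" "hd (snd c) = t" by (simp_all add: c' x)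
 have "card {i. hd (snd c') i ~= 0} <= Suc (card {i. hd (snd c) i ~= 0})" using A(2) B unfolding C s_def by linarith
 moreover have "finite {i. hd (snd c') i ~= 0}" using A(1) unfolding C .
 moreover have "snd c' ~= []" by (simp add: c' x)
 ultimately show ?thesis by blast
qed

text \<open>The output has as many non-blank cells as it is long, and each step adds at most one to the \<open>n\<close> cells of the input.\<close>

lemma output_le: assumes "halts_in M (replicate n 1) t c" "hd (snd c) = word_tape (replicate y 1)" shows "y <= n + t"
proof -
 have sup: "{i. word_tape (replicate y 1) i ~= 0} = int ` {..<y}" for y
 proof -
  have "x : int ` {..<y}" if "0 <= x" "x < int y" for x using that by (intro image_eqI[of _ _ "nat x"]) auto
  thus ?thesis by (auto simp: word_tape_def split: if_splits)
 qed
 have "snd d ~= [] & finite {i. hd (snd d) i ~= 0} & card {i. hd (snd d) i ~= 0} <= n + s"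
  if "(init_config M (replicate n 1), d) : step_rel M ^^ s" for d s
  using that
 proof (induction s arbitrary: d)
  case 0
  hence d: "d = init_config M (replicate n 1)" by simp
  show ?case unfolding d init_config_def snd_conv list.sel sup by (simp add: card_image)
 next
  case (Suc s)
  then obtain d' where "(init_config M (replicate n 1), d') : step_rel M ^^ s" "tm_step M d' = Some d"
   by (elim relpow_Suc_E) simp
  thus ?case using Suc.IH[of d'] tm_step_support[of M d' d] by simp
 qed
 from this[of c t] have "card {i. hd (snd c) i ~= 0} <= n + t" using assms(1) by (simp add: halts_in_def)
 thus ?thesis unfolding assms(2) sup by (simp add: card_image)
qed

instance move :: countable by countable_datatype
instance tm :: countable by countable_datatype

lemma machine_digits_exists: "EX b. machine_digits M b"
proof -
 define B where "B = (\<Sum>r\<leftarrow>rules M. \<Sum>x\<leftarrow>fst (snd r). fst (snd x))"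
 have "fst (snd x) <= B" if "r : set (rules M)" "x : set (fst (snd r))" for r x
 proof -
  have "fst (snd x) <= (\<Sum>x\<leftarrow>fst (snd r). fst (snd x))" using that(2) by (intro member_le_sum_list) auto
  also have "... <= B" unfolding B_def using that(1) by (intro member_le_sum_list) auto
  finally show ?thesis .
 qed
 hence lt: "fst (snd x) < B + 2" if "r : set (rules M)" "x : set (fst (snd r))" for r x using that by fastforce
 have "machine_digits M (B + 2)" by unfold_locales (simp, rule lt)
 thus ?thesis ..
qed

lemma finite_gen_set_carrier: "finite_gen_set G S ==> S <= carrier G" by (simp add: finite_gen_set_def)

definition machine_group :: "tm => nat monoid" where
 "machine_group M = word_group (exponents.eqm (expo M) 0 0)"

context
 fixes M :: tm
 assumes total: "!!n. EX t c. halts_in M (replicate n 1) t c"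
begin

lemma expo_good: "good M r (expo M r)"
 unfolding expo_def using good_exists[OF total] by (rule LeastI_ex)

lemma exponents_expo: "exponents (expo M)"
 by unfold_locales (use expo_good in \<open>simp add: good_def\<close>)

lemma machine_group_poly_time: "poly_time_conjugacy (machine_group M)"
 unfolding poly_time_conjugacy_def
proof (intro allI impI)
 fix gs assume gs: "finite_gen_set (machine_group M) (set gs)"
 obtain b where b: "machine_digits M b" using machine_digits_exists by blast
 define K where "K = 2 * length gs + 1"
 interpret simulation K M b using b by (simp add: simulation_def)
 obtain P where P: "PTb (%w e. P w)"
  "!!u v. u : words (length gs) ==> v : words (length gs) ==> P (encode u @ 1 # encode v) \<longleftrightarrow>
   conjugate (machine_group M) (eval_word (machine_group M) gs u) (eval_word (machine_group M) gs v)"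
  unfolding machine_group_def
  by (rule conj_decidable[OF total finite_gen_set_carrier[OF gs[unfolded machine_group_def]]]) blast
 obtain N and p :: "nat poly" where N: "ALL w. set w <= {1..K} -->
  (EX t c. halts_in N w t c & t <= poly p (length w) & (accepting c \<longleftrightarrow> P w))" using PTb_decider[OF P(1)] by blast
 show "poly_time_conjugacy_wrt (machine_group M) gs" unfolding poly_time_conjugacy_wrt_def
 proof (rule exI[of _ N], rule exI[of _ "p \<circ>\<^sub>p [:1, 1:]"], intro ballI)
  fix u v assume u: "u : words (length gs)" and v: "v : words (length gs)"
  have "set (encode u @ 1 # encode v) <= {1..K}" using set_encode[OF u] set_encode[OF v] by (auto simp: K_def)
  then obtain t c where t: "halts_in N (encode u @ 1 # encode v) t c" "t <= poly p (length (encode u @ 1 # encode v))"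
   "accepting c \<longleftrightarrow> P (encode u @ 1 # encode v)" using N by blast
  have "length (encode u @ 1 # encode v) = 1 + (length u + length v)" by (simp add: encode_def)
  hence "t <= poly (p \<circ>\<^sub>p [:1, 1:]) (length u + length v)" using t(2) by (simp add: poly_pcompose)
  thus "EX t c. halts_in N (encode u @ [1] @ encode v) t c & t <= poly (p \<circ>\<^sub>p [:1, 1:]) (length u + length v) \<and>
   (accepting c \<longleftrightarrow> conjugate (machine_group M) (eval_word (machine_group M) gs u) (eval_word (machine_group M) gs v))"
   using t(1,3) P(2)[OF u v] by (intro exI[of _ t] exI[of _ c]) simp
 qed
qed

lemma machine_group_presented: "recursively_presented (machine_group M)"
proof -
 interpret exponents "expo M" by (rule exponents_expo)
 interpret grp: group G by (rule group)
 obtain b where b: "machine_digits M b" using machine_digits_exists by blast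
 define K :: nat where "K = 7"
 interpret simulation K M b using b by (simp add: simulation_def)
 have G: "machine_group M = G" by (simp add: machine_group_def)
 have len: "length std_gens = 3" by (simp add: std_gens_def)
 have gs: "set std_gens <= carrier (word_group (exponents.eqm (expo M) 0 0))" by (rule finite_gen_set_carrier[OF finite_gen_std])
 obtain P where P: "PTb (%w e. P w)" "!!u. u : words (length std_gens) ==> P (encode u) \<longleftrightarrow> conjugate G (eval_word G std_gens u) \<one>\<^bsub>G\<^esub>"
  by (rule conj_decidable[OF total gs]) blast
 have ev: "eval_word G std_gens u = \<kappa> u" if "u : words 3" for u
  using that
 proof (induction u)
  case (Cons x u)
  obtain i b where x: "x = (i, b)" by (cases x)
  have "\<kappa> (x # u) = \<kappa> [(i, b)] \<otimes>\<^bsub>G\<^esub> \<kappa> u" by (simp add: x)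
  thus ?case using Cons by (simp add: x eval_word_def code_letter)
 qed (simp add: eval_word_def one_code)
 have one: "conjugate G (\<kappa> u) \<one>\<^bsub>G\<^esub> \<longleftrightarrow> \<kappa> u = \<kappa> []" for u
 proof
  assume "conjugate G (\<kappa> u) \<one>\<^bsub>G\<^esub>"
  then obtain h where h: "h : carrier G" "h \<otimes>\<^bsub>G\<^esub> \<kappa> u \<otimes>\<^bsub>G\<^esub> inv\<^bsub>G\<^esub> h = \<one>\<^bsub>G\<^esub>" unfolding conjugate_def by blast
  hence "h \<otimes>\<^bsub>G\<^esub> \<kappa> u = \<one>\<^bsub>G\<^esub> \<otimes>\<^bsub>G\<^esub> h" using grp.inv_solve_right'[of "\<one>\<^bsub>G\<^esub>" "h \<otimes>\<^bsub>G\<^esub> \<kappa> u" h] by simp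
  hence "h \<otimes>\<^bsub>G\<^esub> \<kappa> u = h" using h(1) by simp
  thus "\<kappa> u = \<kappa> []" using h(1) by (simp add: one_code)
 next
  assume "\<kappa> u = \<kappa> []"
  thus "conjugate G (\<kappa> u) \<one>\<^bsub>G\<^esub>" unfolding conjugate_def one_code[symmetric] by (intro bexI[of _ "\<one>\<^bsub>G\<^esub>"]) simp_all
 qed
 obtain N where N: "ALL w. set w <= {1..K} --> (P w \<longleftrightarrow> (EX t c. halts_in N w t c))" using PTb_semidecider[OF P(1)] by blast
 have "w : relators \<longleftrightarrow> (EX t c. halts_in N (encode w) t c)" if w: "w : words 3" for w
 proof -
  have "set (encode w) <= {1..K}" using set_encode[OF w] by (auto simp: K_def)
  hence "(EX t c. halts_in N (encode w) t c) \<longleftrightarrow> P (encode w)" using N by blast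
  also have "... \<longleftrightarrow> \<kappa> w = \<kappa> []" using P(2)[of w] w ev[OF w] one by (simp add: len)
  finally show ?thesis using w by (simp add: relators_def)
 qed
 hence "recursively_enumerable 3 relators" unfolding recursively_enumerable_def by (auto simp: relators_def)
 thus ?thesis unfolding recursively_presented_def G using presentation by blast
qed

text \<open>For \<open>n < r!\<close> the output on input \<open>n\<close> is at most \<open>n\<close> plus the running time, hence at most \<open>2 x \<le> 2 ^ x\<close> for \<open>x = expo M
r\<close>.\<close>

lemma machine_group_Conj:
 assumes S: "finite_gen_set (machine_group M) S"
  and \<Phi>: "!!n. EX t c. halts_in M (replicate n 1) t c & hd (snd c) = word_tape (replicate (\<Phi> n) 1)"
 shows "(%n. real (\<Phi> n)) \<prec> (%n. real (Conj (machine_group M) S n))"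
 unfolding machine_group_def
proof (rule exponents.Conj_dominates[OF exponents_expo])
 show "finite_gen_set (word_group (exponents.eqm (expo M) 0 0)) S" using S by (simp add: machine_group_def)
 fix r n :: nat assume n: "n < fact r"
 define x where "x = expo M r"
 have x: "1 <= x" "fact r <= x" "\<exists>t\<le>x. EX c. halts_in M (replicate n 1) t c" using expo_good[of r] n by (auto simp: good_def x_def)
 obtain t c where t: "t <= x" "halts_in M (replicate n 1) t c" using x(3) by blast
 obtain t' c' where t': "halts_in M (replicate n 1) t' c'" "hd (snd c') = word_tape (replicate (\<Phi> n) 1)" using \<Phi> by blast
 have "t = t' & c = c'" using halts_in_unique[OF t(2) t'(1)] halts_in_unique[OF t'(1) t(2)] by (cases "t <= t'") auto
 hence "\<Phi> n <= n + t" using output_le[OF t(2)] t'(2) by simp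
 also have "... <= 2 * x" using t(1) n x(2) by simp
 also have "2 * x <= 2 ^ x"
 proof -
  have "y < 2 ^ y" for y :: nat by (rule less_exp)
  from this[of "x - 1"] have "x <= 2 ^ (x - 1)" by linarith
  hence "2 * x <= 2 * 2 ^ (x - 1)" by simp
  also have "... = 2 ^ x" using x(1) by (cases x) auto
  finally show ?thesis .
 qed
 finally show "\<Phi> n <= 2 ^ expo M r" by (simp add: x_def)
qed

end

theorem theorem2:
  shows "\<exists>(D :: nat set) (G :: nat \<Rightarrow> nat monoid).
    (\<forall>d\<in>D. group (G d) \<and> finitely_generated (G d) \<and> recursively_presented (G d) \<and>
       torsion_free (G d) \<and> has_derived_length (G d) 3 \<and> conjugacy_separable (G d)) \<and>
    (\<forall>d\<in>D. \<exists>\<delta>::int. \<forall>S. finite_gen_set (G d) S \<longrightarrow>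
       (\<lambda>n. real (Rf (G d) S n)) \<prec> (\<lambda>n. exp (real n powi \<delta>))) \<and>
    (\<forall>d\<in>D. \<forall>S. finite_gen_set (G d) S \<longrightarrow>
       polynomially_bounded (\<lambda>n. real (Cl (G d) S n))) \<and>
    (\<forall>d\<in>D. poly_time_conjugacy (G d)) \<and>
    (\<forall>\<Phi>. computable \<Phi> \<longrightarrow>
       (\<exists>d\<in>D. \<forall>S. finite_gen_set (G d) S \<longrightarrow>
          (\<lambda>n. real (\<Phi> n)) \<prec> (\<lambda>n. real (Conj (G d) S n))))"
proof -
 \<comment> \<open>Codes of the machines that halt on all unary inputs.\<close>
 define D :: "nat set" where "D = {d. ALL n. EX t c. halts_in (from_nat d) (replicate n 1) t c}"
 define G where "G d = machine_group (from_nat d)" for d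
 have tot: "EX t c. halts_in (from_nat d) (replicate n 1) t c" if "d : D" for d n using that by (simp add: D_def)
 have e: "exponents (expo (from_nat d))" if "d : D" for d by (rule exponents_expo[OF tot[OF that]])
 show ?thesis
 proof (rule exI[of _ D], rule exI[of _ G], intro conjI ballI allI impI)
  fix d assume d: "d : D"
  interpret exponents "expo (from_nat d)" by (rule e[OF d])
  show "group (G d)" unfolding G_def machine_group_def by (rule group)
  show "finitely_generated (G d)" unfolding G_def machine_group_def finitely_generated_def using finite_gen_std by blast
  show "recursively_presented (G d)" unfolding G_def by (rule machine_group_presented[OF tot[OF d]])
  show "torsion_free (G d)" unfolding G_def machine_group_def by (rule torsion_free)
  show "has_derived_length (G d) 3" unfolding G_def machine_group_def by (rule derived_length)
  show "conjugacy_separable (G d)" unfolding G_def machine_group_def by (rule conjugacy_separable)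
  show "EX \<delta>::int. ALL S. finite_gen_set (G d) S --> (%n. real (Rf (G d) S n)) \<prec> (%n. exp (real n powi \<delta>))"
   unfolding G_def machine_group_def by (intro exI[of _ 6] allI impI Rf_exponential)
  show "polynomially_bounded (%n. real (Cl (G d) S n))" if "finite_gen_set (G d) S" for S
   using that unfolding G_def machine_group_def by (rule Cl_polynomial)
  show "poly_time_conjugacy (G d)" unfolding G_def by (rule machine_group_poly_time[OF tot[OF d]])
 next
  fix \<Phi> assume "computable \<Phi>"
  then obtain M where M: "!!n. EX t c. halts_in M (replicate n 1) t c & hd (snd c) = word_tape (replicate (\<Phi> n) 1)"
   unfolding computable_def by blast
  have "EX t c. halts_in M (replicate n 1) t c" for n using M by blast
  hence "to_nat M : D" and "ALL S. finite_gen_set (G (to_nat M)) S --> (%n. real (\<Phi> n)) \<prec> (%n. real (Conj (G (to_nat M)) S n))"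
   using machine_group_Conj[of M, OF _ _ M] by (simp_all add: D_def G_def)
  thus "EX d:D. ALL S. finite_gen_set (G d) S --> (%n. real (\<Phi> n)) \<prec> (%n. real (Conj (G d) S n))" by blast
 qed
qed

end
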